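(* Fix $0<\delta<1/2$. There is a constant $\gamma(\delta)>0$, depending only on $\delta$, such that the following holds. Let $D=(d_1,\ldots,d_n)$ be a $\delta$-tame degree sequence with $d_1+\ldots+d_n\equiv 0 \pmod 2$, let $z=(\zeta_{\{j,k\}})$ be its maximum entropy matrix, and let $q,\mu,\nu$ be as in the context. Define the $n\times n$ symmetric matrix $Q=(\omega_{jk})$ by $$\omega_{jk}=\zeta_{\{j,k\}}(1-\zeta_{\{j,k\}})\ \ (j\neq k),\qquad \omega_{jj}=d_j-\sum_{k:\,k\neq j}\zeta_{\{j,k\}}^2 \ \ (j=1,\ldots,n).$$ Then $Q$ is positive definite, and the quantity $$\frac{2e^{H(z)}}{(2\pi)^{n/2}\sqrt{\det Q}}\exp\Big\{-\frac{\mu}{2}+\nu\Big\}$$ approximates the number $|G(D)|$ within a relative error which tends to $0$ as $n\to+\infty$. More precisely, for any $0<\epsilon\le 1/2$, this quantity approximates $|G(D)|$ within relative error $\epsilon$ provided $n\ge (1/\epsilon)^{\gamma(\delta)}$.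
   Context: For a vector $D=(d_1,\ldots,d_n)$ of positive integers, $G(D)$ is the set of graphs (undirected, no loops, no multiple edges) on the vertex set $\{1,\ldots,n\}$ in which vertex $k$ has degree $d_k$ for all $k$. Coordinates of $\mathbb{R}^{\binom n2}$ are indexed by unordered pairs $\{j,k\}$, $1\le j\neq k\le n$. The polytope $\mathcal{P}(D)\subset\mathbb{R}^{\binom n2}$ consists of $x=(\xi_{\{j,k\}})$ with $\sum_{j:\,j\ne k}\xi_{\{j,k\}}=d_k$ for $k=1,\ldots,n$ and $0\le\xi_{\{j,k\}}\le 1$. The entropy is $H(x)=\sum_{\{j,k\}}\big(\xi_{\{j,k\}}\ln\frac{1}{\xi_{\{j,k\}}}+(1-\xi_{\{j,k\}})\ln\frac{1}{1-\xi_{\{j,k\}}}\big)$. If $\mathcal{P}(D)\ne\emptyset$, the strictly concave $H$ attains its maximum on $\mathcal{P}(D)$ at a unique point $z=(\zeta_{\{j,k\}})$, the maximum entropy matrix of $D$. For $0<\delta\le 1/2$, $D$ is $\delta$-tame if $\mathcal{P}(D)\neq\emptyset$ and $\delta\le\zeta_{\{j,k\}}\le 1-\delta$ for all $j\neq k$. Define $q:\mathbb{R}^n\to\mathbb{R}$ by $q(t)=\frac12\sum_{\{j,k\}}(\zeta_{\{j,k\}}-\zeta_{\{j,k\}}^2)(\tau_j+\tau_k)^2$ for $t=(\tau_1,\ldots,\tau_n)$ (positive definite for $n>2$), and consider the Gaussian probability measure on $\mathbb{R}^n$ with density proportional to $e^{-q}$. Define $f(t)=\frac16\sum_{\{j,k\}}\zeta_{\{j,k\}}(1-\zeta_{\{j,k\}})(2\zeta_{\{j,k\}}-1)(\tau_j+\tau_k)^3$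 and $h(t)=\frac1{24}\sum_{\{j,k\}}\zeta_{\{j,k\}}(1-\zeta_{\{j,k\}})(6\zeta_{\{j,k\}}^2-6\zeta_{\{j,k\}}+1)(\tau_j+\tau_k)^4$, and $\mu=\mathbf{E} f^2$, $\nu=\mathbf{E} h$ with respect to this Gaussian measure. All sums are over unordered pairs $\{j,k\}$ with $1\le j\ne k\le n$. *)

theory Defs
  imports "HOL-Probability.Probability" "Jordan_Normal_Form.Determinant"
begin

text \<open>
  The vertices are \<open>0, \<dots>, n - 1\<close> instead of \<open>1, \<dots>, n\<close>.  A point of the space \<open>\<real>^(n choose 2)\<close>
  is a function \<open>x\<close> on the two-element sets of vertices, extensional outside of them, so that
  its coordinates are \<open>x {j, k}\<close> and distinct functions are distinct points.
\<close>

definition vertex_pairs :: "nat \<Rightarrow> nat set set" where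
  "vertex_pairs n = {e. e \<subseteq> {..<n} \<and> card e = 2}"

definition graphs_with_degrees :: "nat \<Rightarrow> (nat \<Rightarrow> nat) \<Rightarrow> nat set set set" where
  "graphs_with_degrees n D =
     {E. E \<subseteq> vertex_pairs n \<and> (\<forall>k<n. card {e \<in> E. k \<in> e} = D k)}"

definition degree_polytope :: "nat \<Rightarrow> (nat \<Rightarrow> nat) \<Rightarrow> (nat set \<Rightarrow> real) set" where
  "degree_polytope n D =
     {x \<in> vertex_pairs n \<rightarrow>\<^sub>E {0..1}. \<forall>k<n. (\<Sum>j\<in>{..<n} - {k}. x {j, k}) = real (D k)}"

text \<open>At \<open>\<xi> = 0\<close> and \<open>\<xi> = 1\<close> the factor \<open>0\<close> gives the usual convention \<open>0 ln (1/0) = 0\<close>.\<close>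

definition entropy_fun :: "nat \<Rightarrow> (nat set \<Rightarrow> real) \<Rightarrow> real" where
  "entropy_fun n x =
     (\<Sum>e\<in>vertex_pairs n. x e * ln (1 / x e) + (1 - x e) * ln (1 / (1 - x e)))"

text \<open>
  By compactness of the polytope and strict concavity of the entropy, a nonempty polytope has
  exactly one \<open>z\<close> with the following property; so in \<open>tame\<close> the quantifier over \<open>z\<close> ranges over
  exactly one point.
\<close>

definition is_max_entropy_matrix :: "nat \<Rightarrow> (nat \<Rightarrow> nat) \<Rightarrow> (nat set \<Rightarrow> real) \<Rightarrow> bool" where
  "is_max_entropy_matrix n D z \<longleftrightarrow>
     z \<in> degree_polytope n D \<and> (\<forall>x\<in>degree_polytope n D. entropy_fun n x \<le> entropy_fun n z)"

definition tame :: "real \<Rightarrow> nat \<Rightarrow> (nat \<Rightarrow> nat) \<Rightarrow> bool" where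
  "tame \<delta> n D \<longleftrightarrow> degree_polytope n D \<noteq> {} \<and>
     (\<forall>z. is_max_entropy_matrix n D z \<longrightarrow> (\<forall>e\<in>vertex_pairs n. \<delta> \<le> z e \<and> z e \<le> 1 - \<delta>))"

text \<open>For \<open>e = {j, k}\<close> the expression \<open>sum t e\<close> is \<open>\<tau>\<^sub>j + \<tau>\<^sub>k\<close>.\<close>

definition q_form :: "nat \<Rightarrow> (nat set \<Rightarrow> real) \<Rightarrow> (nat \<Rightarrow> real) \<Rightarrow> real" where
  "q_form n z t = 1/2 * (\<Sum>e\<in>vertex_pairs n. (z e - (z e)\<^sup>2) * (sum t e)\<^sup>2)"

definition f_form :: "nat \<Rightarrow> (nat set \<Rightarrow> real) \<Rightarrow> (nat \<Rightarrow> real) \<Rightarrow> real" where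
  "f_form n z t = 1/6 * (\<Sum>e\<in>vertex_pairs n. z e * (1 - z e) * (2 * z e - 1) * (sum t e) ^ 3)"

definition h_form :: "nat \<Rightarrow> (nat set \<Rightarrow> real) \<Rightarrow> (nat \<Rightarrow> real) \<Rightarrow> real" where
  "h_form n z t =
     1/24 * (\<Sum>e\<in>vertex_pairs n. z e * (1 - z e) * (6 * (z e)\<^sup>2 - 6 * z e + 1) * (sum t e) ^ 4)"

definition gaussian :: "nat \<Rightarrow> (nat set \<Rightarrow> real) \<Rightarrow> (nat \<Rightarrow> real) measure" where
  "gaussian n z =
     (let L = (\<Pi>\<^sub>M i\<in>{..<n}. lborel) in
      density L (\<lambda>t. ennreal (exp (- q_form n z t) / (LINT s|L. exp (- q_form n z s)))))"

definition mu :: "nat \<Rightarrow> (nat set \<Rightarrow> real) \<Rightarrow> real" where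
  "mu n z = (LINT t|gaussian n z. (f_form n z t)\<^sup>2)"

definition nu :: "nat \<Rightarrow> (nat set \<Rightarrow> real) \<Rightarrow> real" where
  "nu n z = (LINT t|gaussian n z. h_form n z t)"

definition Q_mat :: "nat \<Rightarrow> (nat \<Rightarrow> nat) \<Rightarrow> (nat set \<Rightarrow> real) \<Rightarrow> real mat" where
  "Q_mat n D z = Matrix.mat n n (\<lambda>(j, k).
     if j = k then real (D j) - (\<Sum>i\<in>{..<n} - {j}. (z {j, i})\<^sup>2)
     else z {j, k} * (1 - z {j, k}))"

definition positive_definite :: "real mat \<Rightarrow> bool" where
  "positive_definite A \<longleftrightarrow> square_mat A \<and> transpose_mat A = A \<and>
     (\<forall>v\<in>carrier_vec (dim_row A). v \<noteq> 0\<^sub>v (dim_row A) \<longrightarrow> 0 < scalar_prod v (A *\<^sub>v v))"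

definition asymptotic_formula :: "nat \<Rightarrow> (nat \<Rightarrow> nat) \<Rightarrow> (nat set \<Rightarrow> real) \<Rightarrow> real" where
  "asymptotic_formula n D z =
     2 * exp (entropy_fun n z) / ((2 * pi) powr (real n / 2) * sqrt (Determinant.det (Q_mat n D z)))
       * exp (- mu n z / 2 + nu n z)"

definition approximates_within :: "real \<Rightarrow> real \<Rightarrow> real \<Rightarrow> bool" where
  "approximates_within \<epsilon> a b \<longleftrightarrow> \<bar>a - b\<bar> \<le> \<epsilon> * \<bar>b\<bar>"

end

theory Submission
  imports Defs "HOL-Real_Asymp.Real_Asymp"
begin

text \<open>
  At the maximum entropy matrix \<open>z\<close> the derivative of the entropy vanishes in the direction of every graph
  with degrees \<open>D\<close>, so the random graph with independent edge probabilities \<open>z\<close> gives each such graph the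
  same probability \<open>exp (- H z)\<close>. Hence \<open>card (G D)\<close> is \<open>exp (H z)\<close> times the probability that this random
  graph has degrees \<open>D\<close>, which by Fourier inversion is an integral over \<open>[- \<pi>, \<pi>]\<^sup>n\<close>. Since the
  sum of the degrees is even, the integrand is invariant under adding \<open>\<pi>\<close> to all coordinates, so twice the
  integral over the part where \<open>\<Sum> cos t\<^sub>j\<close> is nonnegative suffices; this is the factor 2.

  On that part the modulus of the integrand is negligible outside a box of radius slightly above
  \<open>n powr (- 1/2)\<close>: where \<open>\<Sum> (1 - cos t\<^sub>j)\<close> exceeds a constant by a pointwise bound, elsewhere by
  integrating over one coordinate at a time. Inside the box the integrand is
  \<open>exp (- q + \<i> f + h)\<close> up to a factor close to 1, so the integral is the Gaussian constant times the
  expectation of \<open>exp (\<i> f + h)\<close>. By the Poincare inequality \<open>h\<close> is concentrated at its mean \<open>\<nu>\<close>. For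
  \<open>f\<close>, integrating by parts twice gives \<open>\<integral> f \<phi>(f) = \<integral> \<Gamma> \<phi>'(f)\<close> with an explicit \<open>\<Gamma>\<close> that is concentrated
  at its mean \<open>\<mu>\<close>, again by Poincare; so \<open>f\<close> is nearly Gaussian with variance \<open>\<mu>\<close> and contributes
  \<open>exp (- \<mu> / 2)\<close>.
\<close>

section \<open>The one-dimensional Gaussian measure\<close>

text \<open>Under the Gaussian measure the edge sums \<open>sum t e\<close> have size n^(-1/2), and
  there are about n^2 / 2 of them. So f and h are of order one and have to be evaluated, and the
  fifth order remainder is n^2 r^5 on a box of radius r, which keeps r between n^(-1/2) and
  n^(-2/5). Concentration without a loss in the dimension rests on one fact: in coordinates y in
  which q is half the squared length, the sum of w_e (sum t e)^2 is exactly |y|^2. The edge sums are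
  then linear forms with Bessel constant 1 / w0, and gradients of sums over edges are bounded
  uniformly. Outside the box, the pointwise bound loses a factor exponential in n against the
  Gaussian constant, since the variances w_e are only known to lie between w0 and 1/4. It wins only
  at distance \<open>K0\<close> or more from the origin. The region in between is compared with
  itself: moving one large coordinate back to 0 gains so much that the resulting inequality closes
  up to the far part.\<close>

definition std_normal :: "real measure" where
  "std_normal = density lborel (\<lambda>x. ennreal (std_normal_density x))"

lemma prob_space_std_normal: "prob_space std_normal"
  unfolding std_normal_def by (rule prob_space_normal_density) simp

lemma sets_std_normal [measurable_cong, simp]: "sets std_normal = sets borel"
  by (simp add: std_normal_def)

lemma space_std_normal [simp]: "space std_normal = UNIV"
  by (simp add: std_normal_def)

lemma integral_std_normal:
  fixes F :: "real \<Rightarrow> real"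
  assumes [measurable]: "F \<in> borel_measurable borel"
  shows "(\<integral>x. F x \<partial>std_normal) = (\<integral>x. std_normal_density x * F x \<partial>lborel)"
  unfolding std_normal_def by (subst integral_density) auto

lemma integrable_std_normal:
  fixes F :: "real \<Rightarrow> real"
  assumes [measurable]: "F \<in> borel_measurable borel"
  shows "integrable std_normal F \<longleftrightarrow> integrable lborel (\<lambda>x. std_normal_density x * F x)"
  unfolding std_normal_def by (subst integrable_density) auto

text \<open>Completing the square: an exponential tilt moves the mean to \<open>a\<close>, which
  gives all exponential moments at once.\<close>

lemma exp_times_std_normal_density:
  "std_normal_density x * exp (a * x) = exp (a\<^sup>2 / 2) * normal_density a 1 x"
proof -
  have "- x\<^sup>2 / 2 + a * x = a\<^sup>2 / 2 + - (x - a)\<^sup>2 / 2"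
    by (simp add: power2_eq_square field_simps)
  then have "exp (- x\<^sup>2 / 2) * exp (a * x) = exp (a\<^sup>2 / 2) * exp (- (x - a)\<^sup>2 / 2)"
    unfolding exp_add[symmetric] by (simp only:)
  then show ?thesis
    by (simp add: normal_density_def)
qed

lemma exp_std_normal:
  shows integrable_exp_std_normal: "integrable std_normal (\<lambda>x. exp (a * x))"
    and integral_exp_std_normal: "(\<integral>x. exp (a * x) \<partial>std_normal) = exp (a\<^sup>2 / 2)"
  by (simp_all add: integrable_std_normal integral_std_normal exp_times_std_normal_density)

lemma exp_abs_le: "exp (a * \<bar>x\<bar>) \<le> exp (a * x) + exp (- a * x :: real)"
  by (cases "x \<ge> 0") (auto simp: add_increasing add_increasing2)

lemma integrable_exp_abs_std_normal: "integrable std_normal (\<lambda>x. exp (a * \<bar>x\<bar>))"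
proof (rule Bochner_Integration.integrable_bound)
  show "integrable std_normal (\<lambda>x. exp (a * x) + exp (- a * x))"
    by (intro Bochner_Integration.integrable_add integrable_exp_std_normal)
  show "AE x in std_normal. norm (exp (a * \<bar>x\<bar>)) \<le> norm (exp (a * x) + exp (- a * x))"
    by (intro AE_I2) (use exp_abs_le[of a] in \<open>auto simp: add_nonneg_nonneg\<close>)
qed simp

lemma integrable_std_normal_growth:
  fixes G :: "real \<Rightarrow> real"
  assumes "G \<in> borel_measurable borel" "\<And>x. \<bar>G x\<bar> \<le> C * exp (a * \<bar>x\<bar>)"
  shows "integrable std_normal G"
proof (rule Bochner_Integration.integrable_bound)
  show "integrable std_normal (\<lambda>x. C * exp (a * \<bar>x\<bar>))"
    by (intro integrable_mult_right integrable_exp_abs_std_normal)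
  show "AE x in std_normal. norm (G x) \<le> norm (C * exp (a * \<bar>x\<bar>))"
    using assms(2) by (intro AE_I2) (auto intro: order_trans[OF _ abs_ge_self])
qed (use assms in simp)

lemma abs_le_exp_abs: "\<bar>x\<bar> \<le> exp (\<bar>x\<bar> :: real)"
  using exp_ge_add_one_self[of "\<bar>x\<bar>"] by linarith

section \<open>Gaussian integration by parts on an interval\<close>

lemma std_normal_density_deriv:
  "(std_normal_density has_real_derivative - x * std_normal_density x) (at x)"
  unfolding std_normal_density_def by (auto intro!: derivative_eq_intros simp: field_simps)

lemma normal_density_tendsto_0:
  "(normal_density a 1 \<longlongrightarrow> 0) at_top" "(normal_density a 1 \<longlongrightarrow> 0) at_bot"
proof -
  have *: "normal_density a 1 = (\<lambda>x. 1 / sqrt (2 * pi) * exp (- (x - a)\<^sup>2 / 2))"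
    by (auto simp: normal_density_def)
  have "((\<lambda>x::real. exp (- (x - a)\<^sup>2 / 2)) \<longlongrightarrow> 0) at_top" by real_asymp
  from tendsto_mult_right_zero[OF this] show "(normal_density a 1 \<longlongrightarrow> 0) at_top" unfolding * .
  have "((\<lambda>x::real. exp (- (x - a)\<^sup>2 / 2)) \<longlongrightarrow> 0) at_bot" by real_asymp
  from tendsto_mult_right_zero[OF this] show "(normal_density a 1 \<longlongrightarrow> 0) at_bot" unfolding * .
qed

text \<open>Removes the boundary terms at infinity: the growth factor is dominated by two tilts,
  each of which turns the density into a shifted normal density.\<close>

lemma std_normal_growth_tendsto_0:
  assumes F: "F = at_top \<or> F = at_bot"
  shows "((\<lambda>x. std_normal_density x * (C * exp (a * \<bar>x\<bar>))) \<longlongrightarrow> 0) F"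
proof (rule Lim_null_comparison)
  let ?g = "\<lambda>x. \<bar>C\<bar> * exp (a\<^sup>2 / 2) * (normal_density a 1 x + normal_density (- a) 1 x)"
  show "\<forall>\<^sub>F x in F. norm (std_normal_density x * (C * exp (a * \<bar>x\<bar>))) \<le> ?g x"
  proof (intro always_eventually allI)
    fix x
    have "norm (std_normal_density x * (C * exp (a * \<bar>x\<bar>))) = \<bar>C\<bar> * (std_normal_density x * exp (a * \<bar>x\<bar>))"
      by (simp add: abs_mult)
    also have "\<dots> \<le> \<bar>C\<bar> * (std_normal_density x * (exp (a * x) + exp (- a * x)))"
      by (intro mult_left_mono exp_abs_le) auto
    also have "\<dots> = ?g x"
      using exp_times_std_normal_density[of x a] exp_times_std_normal_density[of x "- a"]
      by (simp add: algebra_simps)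
    finally show "norm (std_normal_density x * (C * exp (a * \<bar>x\<bar>))) \<le> ?g x" .
  qed
  show "(?g \<longlongrightarrow> 0) F"
    using F by (intro tendsto_mult_right_zero tendsto_add_zero) (auto intro: normal_density_tendsto_0)
qed

text \<open>The integrand is the derivative of \<open>std_normal_density x * G x\<close>, so this is
  the fundamental theorem of calculus; \<open>gl\<close> and \<open>gu\<close> are the boundary
  values, 0 at infinite ends. Half-lines are included because the truncated first moments in the
  Poincare kernel need them.\<close>

lemma std_normal_ibp_from:
  fixes G G' :: "real \<Rightarrow> real" and l u :: ereal
  assumes lu: "l < u" "(l = -\<infinity> \<and> gl = 0) \<or> (\<exists>r. l = ereal r \<and> gl = std_normal_density r * G r)"
      "(u = \<infinity> \<and> gu = 0) \<or> (\<exists>r. u = ereal r \<and> gu = std_normal_density r * G r)"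
  assumes der: "\<And>x. (G has_real_derivative G' x) (at x)"
    and cont: "\<And>x. isCont G' x"
    and bd: "\<And>x. \<bar>G x\<bar> \<le> C * exp (a * \<bar>x\<bar>)" "\<And>x. \<bar>G' x\<bar> \<le> C * exp (a * \<bar>x\<bar>)"
  shows "(LBINT x=l..u. std_normal_density x * (G' x - x * G x)) = gu - gl"
proof (rule interval_integral_FTC_integrable[OF lu(1)])
  let ?F = "\<lambda>x. std_normal_density x * G x"
  have contG: "continuous_on UNIV G" "continuous_on UNIV G'"
    using der cont by (auto simp: continuous_on_eq_continuous_at intro: DERIV_isCont)
  then have [measurable]: "G \<in> borel_measurable borel" "G' \<in> borel_measurable borel"
    by (auto intro: borel_measurable_continuous_onI)
  have F: "(?F has_real_derivative std_normal_density x * (G' x - x * G x)) (at x)" for x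
    by (auto intro!: derivative_eq_intros der std_normal_density_deriv simp: algebra_simps)
  then show "(?F has_vector_derivative std_normal_density x * (G' x - x * G x)) (at x)" for x
    by (simp add: has_real_derivative_iff_has_vector_derivative)
  have "isCont std_normal_density x" for x
    using std_normal_density_deriv by (rule DERIV_isCont)
  then show "isCont (\<lambda>x. std_normal_density x * (G' x - x * G x)) x" for x
    using contG by (intro continuous_intros) (auto simp: continuous_on_eq_continuous_at)
  have "integrable std_normal (\<lambda>x. G' x - x * G x)"
  proof (rule integrable_std_normal_growth)
    show "\<bar>G' x - x * G x\<bar> \<le> (2 * \<bar>C\<bar>) * exp ((\<bar>a\<bar> + 1) * \<bar>x\<bar>)" for x
    proof -
      have e: "C * exp (a * \<bar>x\<bar>) \<le> \<bar>C\<bar> * exp (\<bar>a\<bar> * \<bar>x\<bar>)"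
        by (intro mult_mono) (auto intro!: mult_right_mono)
      have "\<bar>x * G x\<bar> \<le> exp \<bar>x\<bar> * (\<bar>C\<bar> * exp (\<bar>a\<bar> * \<bar>x\<bar>))"
        unfolding abs_mult using bd(1)[of x] e abs_le_exp_abs[of x] by (intro mult_mono) auto
      also have "\<dots> = \<bar>C\<bar> * exp ((\<bar>a\<bar> + 1) * \<bar>x\<bar>)"
        by (simp add: exp_add[symmetric] algebra_simps)
      finally have 1: "\<bar>x * G x\<bar> \<le> \<bar>C\<bar> * exp ((\<bar>a\<bar> + 1) * \<bar>x\<bar>)" .
      have "\<bar>G' x\<bar> \<le> \<bar>C\<bar> * exp (\<bar>a\<bar> * \<bar>x\<bar>)"
        using bd(2)[of x] e by linarith
      also have "\<dots> \<le> \<bar>C\<bar> * exp ((\<bar>a\<bar> + 1) * \<bar>x\<bar>)"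
        by (intro mult_left_mono) (auto simp: algebra_simps)
      finally show ?thesis using 1 by linarith
    qed
  qed measurable
  then have "integrable lborel (\<lambda>x. std_normal_density x * (G' x - x * G x))"
    by (subst (asm) integrable_std_normal) auto
  then show "set_integrable lborel (einterval l u) (\<lambda>x. std_normal_density x * (G' x - x * G x))"
    unfolding set_integrable_def by (rule integrable_mult_indicator[rotated]) auto
  have bF: "norm (?F x) \<le> std_normal_density x * (C * exp (a * \<bar>x\<bar>))" for x
    using bd(1)[of x] by (auto simp: abs_mult intro!: mult_left_mono)
  have top: "(?F \<longlongrightarrow> 0) at_top" "(?F \<longlongrightarrow> 0) at_bot"
    by (rule Lim_null_comparison[OF always_eventually std_normal_growth_tendsto_0]; use bF in blast)+
  have cF: "(?F \<longlongrightarrow> ?F r) (at r within A)" for r A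
    using DERIV_isCont[OF F, of r] by (auto simp: isCont_def intro: tendsto_within_subset)
  show "((?F \<circ> real_of_ereal) \<longlongrightarrow> gl) (at_right l)"
    using lu(2) top(2) cF by (auto simp: ereal_tendsto_simps ereal_tendsto_simps1)
  show "((?F \<circ> real_of_ereal) \<longlongrightarrow> gu) (at_left u)"
    using lu(3) top(1) cF by (auto simp: ereal_tendsto_simps ereal_tendsto_simps1)
qed

text \<open>Stein's identity: on the whole line both boundary terms vanish.\<close>

lemma std_normal_ibp:
  fixes G G' :: "real \<Rightarrow> real"
  assumes der: "\<And>x. (G has_real_derivative G' x) (at x)"
    and cont: "\<And>x. isCont G' x"
    and bd: "\<And>x. \<bar>G x\<bar> \<le> C * exp (a * \<bar>x\<bar>)" "\<And>x. \<bar>G' x\<bar> \<le> C * exp (a * \<bar>x\<bar>)"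
    and int: "integrable std_normal G'" "integrable std_normal (\<lambda>x. x * G x)"
  shows "(\<integral>x. x * G x \<partial>std_normal) = (\<integral>x. G' x \<partial>std_normal)"
proof -
  have contG: "continuous_on UNIV G" "continuous_on UNIV G'"
    using der cont by (auto simp: continuous_on_eq_continuous_at intro: DERIV_isCont)
  then have [measurable]: "G \<in> borel_measurable borel" "G' \<in> borel_measurable borel"
    by (auto intro: borel_measurable_continuous_onI)
  have "(LBINT x=-\<infinity>..\<infinity>. std_normal_density x * (G' x - x * G x)) = 0 - 0"
    by (rule std_normal_ibp_from[OF _ _ _ der cont bd]) auto
  then have "(\<integral>x. std_normal_density x * (G' x - x * G x) \<partial>lborel) = 0"
    by (simp add: interval_lebesgue_integral_def set_lebesgue_integral_def einterval_def)
  then have "(\<integral>x. G' x - x * G x \<partial>std_normal) = 0"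
    by (subst integral_std_normal) auto
  then show ?thesis
    using int by simp
qed

section \<open>The Poincare inequality on the line\<close>

lemma borel_measurable_indicator_Icc [measurable]:
  fixes f g h :: "'a \<Rightarrow> real"
  assumes [measurable]: "f \<in> borel_measurable M" "g \<in> borel_measurable M" "h \<in> borel_measurable M"
  shows "(\<lambda>x. indicator {f x..g x} (h x) :: ennreal) \<in> borel_measurable M"
  unfolding indicator_def atLeastAtMost_iff by measurable

text \<open>Only pairs y \<le> s \<le> x contribute. The first moments truncated to x \<ge> s and to
  x \<le> s are the density at s and its negative, so the inner integral is p x plus the density for
  x \<ge> s. Integrating over x gives p + p' = 1 times the density.\<close>

lemma std_normal_tail_kernel:
  "(\<integral>\<^sup>+x. \<integral>\<^sup>+y. ennreal (x - y) * indicator {y..x} s \<partial>std_normal \<partial>std_normal) = ennreal (std_normal_density s)"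
proof -
  interpret prob_space std_normal by (rule prob_space_std_normal)
  let ?phi = "std_normal_density s"
  define p where "p = (\<integral>x. indicator {..s} x \<partial>std_normal :: real)"
  define p' where "p' = (\<integral>x. indicator {s..} x \<partial>std_normal :: real)"
  have int: "integrable std_normal (\<lambda>x::real. x)"
    by (rule integrable_std_normal_growth[where C = 1 and a = 1]) (use abs_le_exp_abs in auto)
  have i1: "integrable std_normal (indicator {..s} :: real \<Rightarrow> real)" "integrable std_normal (indicator {s..} :: real \<Rightarrow> real)"
    by (auto intro!: integrable_real_indicator simp: emeasure_eq_measure)
  have i2: "integrable std_normal (\<lambda>x. x * indicator {..s} x :: real)" "integrable std_normal (\<lambda>x. x * indicator {s..} x :: real)"
    by (rule Bochner_Integration.integrable_bound[OF int]; auto simp: indicator_def)+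
  have null: "AE x in std_normal. x \<noteq> s"
    unfolding std_normal_def by (subst AE_density) (use AE_lborel_singleton[of s] in auto)
  have "p + p' = (\<integral>x. indicator {..s} x + indicator {s..} x \<partial>std_normal)"
    unfolding p_def p'_def using i1 by simp
  also have "\<dots> = (\<integral>x. 1 \<partial>std_normal)"
    by (rule integral_cong_AE) (use null in \<open>auto simp: indicator_def\<close>)
  finally have pp: "p + p' = 1" using prob_space by simp
  have p0: "p \<ge> 0" "p' \<ge> 0" unfolding p_def p'_def by auto
  have "(LBINT x=ereal s..\<infinity>. std_normal_density x * (0 - x * 1)) = 0 - ?phi"
    by (rule std_normal_ibp_from[where G = "\<lambda>_. 1" and C = 1 and a = 0]) auto
  also have "(LBINT x=ereal s..\<infinity>. std_normal_density x * (0 - x * 1))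
      = - (\<integral>x. std_normal_density x * (x * indicator {s..} x) \<partial>lborel)"
    unfolding interval_lebesgue_integral_def set_lebesgue_integral_def
    by (subst integral_minus[symmetric], simp, rule integral_cong_AE)
       (use AE_lborel_singleton[of s] in \<open>auto simp: einterval_def indicator_def\<close>)
  finally have a: "(\<integral>x. x * indicator {s..} x \<partial>std_normal) = ?phi"
    by (subst integral_std_normal) auto
  have "(LBINT x=-\<infinity>..ereal s. std_normal_density x * (0 - x * 1)) = ?phi - 0"
    by (rule std_normal_ibp_from[where G = "\<lambda>_. 1" and C = 1 and a = 0]) auto
  also have "(LBINT x=-\<infinity>..ereal s. std_normal_density x * (0 - x * 1))
      = - (\<integral>x. std_normal_density x * (x * indicator {..s} x) \<partial>lborel)"
    unfolding interval_lebesgue_integral_def set_lebesgue_integral_def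
    by (subst integral_minus[symmetric], simp, rule integral_cong_AE)
       (use AE_lborel_singleton[of s] in \<open>auto simp: einterval_def indicator_def\<close>)
  finally have b: "(\<integral>x. x * indicator {..s} x \<partial>std_normal) = - ?phi"
    by (subst integral_std_normal) auto
  have inner: "(\<integral>\<^sup>+y. ennreal (x - y) * indicator {y..x} s \<partial>std_normal)
      = ennreal (p * (x * indicator {s..} x) + ?phi * indicator {s..} x)" for x
  proof (cases "s \<le> x")
    case True
    have "(\<integral>\<^sup>+y. ennreal (x - y) * indicator {y..x} s \<partial>std_normal)
        = (\<integral>\<^sup>+y. ennreal (x * indicator {..s} y - y * indicator {..s} y) \<partial>std_normal)"
      by (rule nn_integral_cong) (use True in \<open>auto simp: indicator_def\<close>)
    also have "\<dots> = ennreal (\<integral>y. x * indicator {..s} y - y * indicator {..s} y \<partial>std_normal)"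
    proof (rule nn_integral_eq_integral)
      show "AE y in std_normal. 0 \<le> x * indicator {..s} y - y * indicator {..s} y"
        using True by (auto simp: indicator_def)
    qed (use i1 i2 in auto)
    also have "(\<integral>y. x * indicator {..s} y - y * indicator {..s} y \<partial>std_normal) = x * p - - ?phi"
      unfolding b[symmetric] p_def using i1 i2 by simp
    finally show ?thesis using True by (simp add: mult.commute)
  qed (auto simp: indicator_def)
  have ge: "0 \<le> p * (x * indicator {s..} x) + ?phi * indicator {s..} x" for x
  proof (cases "s \<le> x")
    case True
    have "0 \<le> (\<integral>y. x * indicator {..s} y - y * indicator {..s} y \<partial>std_normal)"
      by (rule integral_nonneg_AE) (use True in \<open>auto simp: indicator_def\<close>)
    also have "\<dots> = x * p - - ?phi"
      unfolding b[symmetric] p_def using i1 i2 by simp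
    finally show ?thesis using True by (simp add: mult.commute)
  qed auto
  have "(\<integral>\<^sup>+x. \<integral>\<^sup>+y. ennreal (x - y) * indicator {y..x} s \<partial>std_normal \<partial>std_normal)
      = (\<integral>\<^sup>+x. ennreal (p * (x * indicator {s..} x) + ?phi * indicator {s..} x) \<partial>std_normal)"
    unfolding inner ..
  also have "\<dots> = ennreal (\<integral>x. p * (x * indicator {s..} x) + ?phi * indicator {s..} x \<partial>std_normal)"
    by (rule nn_integral_eq_integral) (use i1 i2 ge in auto)
  also have "(\<integral>x. p * (x * indicator {s..} x) + ?phi * indicator {s..} x \<partial>std_normal) = p * ?phi + ?phi * p'"
    unfolding a[symmetric] p'_def using i1 i2 by simp
  also have "\<dots> = ?phi" using pp by (metis distrib_left mult.commute mult.right_neutral)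
  finally show ?thesis .
qed

text \<open>Cauchy-Schwarz written as nonnegativity of the integral of (G' - l)^2, where
  \<open>l\<close> is the mean slope on the segment. The length x - y stays inside the integral over
  s, as part of the kernel that is integrated over x and y afterwards.\<close>

lemma square_increment_le:
  fixes G G' :: "real \<Rightarrow> real"
  assumes der: "\<And>x. (G has_real_derivative G' x) (at x)" and cont: "\<And>x. isCont G' x" and "y \<le> x"
  shows "ennreal ((G x - G y)\<^sup>2) \<le> (\<integral>\<^sup>+s. ennreal ((G' s)\<^sup>2) * (ennreal (x - y) * indicator {y..x} s) \<partial>lborel)"
proof (cases "y = x")
  case False
  with assms have yx: "y < x" by simp
  define l where "l = (G x - G y) / (x - y)"
  have c: "continuous_on A G'" for A using cont by (simp add: continuous_at_imp_continuous_on)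
  have int: "integrable lborel (\<lambda>s. indicator {y..x} s *\<^sub>R f s)" if "continuous_on {y..x} f" for f :: "real \<Rightarrow> real"
    using borel_integrable_atLeastAtMost'[OF that] by (simp add: set_integrable_def)
  have I1: "(\<integral>s. indicator {y..x} s *\<^sub>R G' s \<partial>lborel) = G x - G y"
    by (rule integral_FTC_atLeastAtMost)
       (use yx c der in \<open>auto simp: has_real_derivative_iff_has_vector_derivative[symmetric] intro: has_field_derivative_at_within\<close>)
  have I0: "(\<integral>s. indicator {y..x} s *\<^sub>R (1::real) \<partial>lborel) = x - y"
    using yx by simp
  define I where "I = (\<integral>s. indicator {y..x} s *\<^sub>R (G' s)\<^sup>2 \<partial>lborel)"
  have i: "integrable lborel (\<lambda>s. indicator {y..x} s *\<^sub>R (G' s)\<^sup>2)" "integrable lborel (\<lambda>s. indicator {y..x} s *\<^sub>R G' s)"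
    by (rule int; intro continuous_intros c)+
  have "0 \<le> (\<integral>s. indicator {y..x} s *\<^sub>R (G' s - l)\<^sup>2 \<partial>lborel)"
    by (rule integral_nonneg_AE) auto
  also have "\<dots> = (\<integral>s. indicator {y..x} s *\<^sub>R (G' s)\<^sup>2 - 2 * l * (indicator {y..x} s *\<^sub>R G' s) + l\<^sup>2 * (indicator {y..x} s *\<^sub>R (1::real)) \<partial>lborel)"
    by (rule Bochner_Integration.integral_cong) (auto simp: power2_eq_square algebra_simps)
  also have "\<dots> = I - 2 * l * (G x - G y) + l\<^sup>2 * (x - y)"
  proof -
    have i0: "integrable lborel (\<lambda>s. indicator {y..x} s *\<^sub>R (1::real))"
      by (rule int) (rule continuous_on_const)
    show ?thesis
      unfolding I_def I1[symmetric] I0[symmetric]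
      using i(1) integrable_mult_right[OF i(2), of "2 * l"] integrable_mult_right[OF i0, of "l\<^sup>2"]
      by (simp only: Bochner_Integration.integral_add Bochner_Integration.integral_diff
          Bochner_Integration.integrable_diff integral_mult_right_zero)
  qed
  also have "\<dots> = I - (G x - G y)\<^sup>2 / (x - y)"
  proof -
    have "G x - G y = l * (x - y)" using yx by (simp add: l_def)
    then show ?thesis using yx by (simp add: power2_eq_square)
  qed
  finally have "(G x - G y)\<^sup>2 \<le> (x - y) * I"
    using yx by (simp add: field_simps)
  then have "ennreal ((G x - G y)\<^sup>2) \<le> ennreal ((x - y) * I)" by (rule ennreal_leI)
  also have "\<dots> = ennreal (x - y) * ennreal I" using yx by (simp add: ennreal_mult')
  also have "ennreal I = (\<integral>\<^sup>+s. ennreal (indicator {y..x} s *\<^sub>R (G' s)\<^sup>2) \<partial>lborel)"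
    unfolding I_def by (rule nn_integral_eq_integral[symmetric]) (use i in auto)
  also have "ennreal (x - y) * \<dots> = (\<integral>\<^sup>+s. ennreal (x - y) * ennreal (indicator {y..x} s *\<^sub>R (G' s)\<^sup>2) \<partial>lborel)"
    by (rule nn_integral_cmult[symmetric]) (use i in auto)
  also have "\<dots> = (\<integral>\<^sup>+s. ennreal ((G' s)\<^sup>2) * (ennreal (x - y) * indicator {y..x} s) \<partial>lborel)"
    by (rule nn_integral_cong) (auto simp: indicator_def mult.commute)
  finally show ?thesis .
qed simp

text \<open>Cauchy--Schwarz on the segment from \<open>y\<close> to \<open>x\<close>; the resulting kernel integrates to exactly the
  Gaussian density.\<close>

lemma std_normal_poincare:
  fixes G G' :: "real \<Rightarrow> real"
  assumes der: "\<And>x. (G has_real_derivative G' x) (at x)"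
    and cont: "\<And>x. isCont G' x"
    and int: "integrable std_normal G" "integrable std_normal (\<lambda>x. (G x)\<^sup>2)" "integrable std_normal (\<lambda>x. (G' x)\<^sup>2)"
  shows "(\<integral>x. (G x)\<^sup>2 \<partial>std_normal) - (\<integral>x. G x \<partial>std_normal)\<^sup>2 \<le> (\<integral>x. (G' x)\<^sup>2 \<partial>std_normal)"
proof -
  interpret N: prob_space std_normal by (rule prob_space_std_normal)
  interpret NN: pair_sigma_finite std_normal lborel ..
  have "continuous_on UNIV G" "continuous_on UNIV G'"
    using der cont by (auto simp: continuous_on_eq_continuous_at intro: DERIV_isCont)
  then have [measurable]: "G \<in> borel_measurable borel" "G' \<in> borel_measurable borel"
    by (auto intro: borel_measurable_continuous_onI)
  have prob1: "measure std_normal UNIV = 1" using N.prob_space by simp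
  let ?k = "\<lambda>x y s. ennreal (x - y) * indicator {y..x} s :: ennreal"
  let ?g = "\<lambda>s. ennreal ((G' s)\<^sup>2)"
  define m where "m = (\<integral>x. G x \<partial>std_normal)"
  define V where "V = (\<integral>x. (G x)\<^sup>2 \<partial>std_normal)"
  have inner: "(\<integral>\<^sup>+y. ennreal ((G x - G y)\<^sup>2) \<partial>std_normal) = ennreal ((G x)\<^sup>2 - 2 * G x * m + V)" for x
  proof -
    have "(\<integral>\<^sup>+y. ennreal ((G x - G y)\<^sup>2) \<partial>std_normal) = (\<integral>\<^sup>+y. ennreal ((G x)\<^sup>2 - 2 * G x * G y + (G y)\<^sup>2) \<partial>std_normal)"
      by (simp add: power2_diff algebra_simps)
    also have "\<dots> = ennreal (\<integral>y. (G x)\<^sup>2 - 2 * G x * G y + (G y)\<^sup>2 \<partial>std_normal)"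
    proof (rule nn_integral_eq_integral)
      show "AE y in std_normal. 0 \<le> (G x)\<^sup>2 - 2 * G x * G y + (G y)\<^sup>2"
        using zero_le_power2[of "G x - G _"] by (intro AE_I2) (simp add: power2_diff algebra_simps)
    qed (use int in auto)
    also have "(\<integral>y. (G x)\<^sup>2 - 2 * G x * G y + (G y)\<^sup>2 \<partial>std_normal) = (G x)\<^sup>2 - 2 * G x * m + V"
      using int unfolding m_def V_def by (simp add: prob1)
    finally show ?thesis .
  qed
  \<comment> \<open>Twice the variance is the mean square of G x - G y for independent x and
    y.\<close>
  have "ennreal (2 * (V - m\<^sup>2)) = ennreal (\<integral>x. (G x)\<^sup>2 - 2 * G x * m + V \<partial>std_normal)"
    using int unfolding m_def V_def by (simp add: prob1 power2_eq_square algebra_simps)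
  also have "\<dots> = (\<integral>\<^sup>+x. ennreal ((G x)\<^sup>2 - 2 * G x * m + V) \<partial>std_normal)"
  proof (rule nn_integral_eq_integral[symmetric])
    have "(G x)\<^sup>2 - 2 * G x * m + V \<ge> 0" for x
    proof -
      have "0 \<le> (\<integral>y. (G x - G y)\<^sup>2 \<partial>std_normal)" by simp
      also have "\<dots> = (G x)\<^sup>2 - 2 * G x * m + V"
        unfolding power2_diff using int unfolding m_def V_def by (simp add: prob1 algebra_simps)
      finally show ?thesis .
    qed
    then show "AE x in std_normal. 0 \<le> (G x)\<^sup>2 - 2 * G x * m + V" by simp
  qed (use int in auto)
  also have "\<dots> = (\<integral>\<^sup>+x. \<integral>\<^sup>+y. ennreal ((G x - G y)\<^sup>2) \<partial>std_normal \<partial>std_normal)"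
    unfolding inner ..
  also have "\<dots> \<le> (\<integral>\<^sup>+x. \<integral>\<^sup>+y. \<integral>\<^sup>+s. ?g s * ?k x y s + ?g s * ?k y x s \<partial>lborel \<partial>std_normal \<partial>std_normal)"
  proof (intro nn_integral_mono)
    fix x y
    show "ennreal ((G x - G y)\<^sup>2) \<le> (\<integral>\<^sup>+s. ?g s * ?k x y s + ?g s * ?k y x s \<partial>lborel)"
    proof (cases "y \<le> x")
      case True
      show ?thesis
        by (rule order_trans[OF square_increment_le[OF der cont True]]) (intro nn_integral_mono, auto)
    next
      case False
      then have "x \<le> y" by simp
      have "ennreal ((G x - G y)\<^sup>2) = ennreal ((G y - G x)\<^sup>2)" by (simp add: power2_commute)
      then show ?thesis
        by (simp only:) (rule order_trans[OF square_increment_le[OF der cont \<open>x \<le> y\<close>]], intro nn_integral_mono, auto)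
    qed
  qed
  \<comment> \<open>Tonelli brings s to the outside, so that the kernel and its mirror image can be
    integrated over x and y for fixed s.\<close>
  also have "\<dots> = (\<integral>\<^sup>+x. \<integral>\<^sup>+s. \<integral>\<^sup>+y. ?g s * ?k x y s + ?g s * ?k y x s \<partial>std_normal \<partial>lborel \<partial>std_normal)"
    by (intro nn_integral_cong NN.Fubini'[symmetric]) measurable
  also have "\<dots> = (\<integral>\<^sup>+s. \<integral>\<^sup>+x. \<integral>\<^sup>+y. ?g s * ?k x y s + ?g s * ?k y x s \<partial>std_normal \<partial>std_normal \<partial>lborel)"
    by (rule NN.Fubini'[symmetric]) measurable
  also have "\<dots> = (\<integral>\<^sup>+s. ?g s * (\<integral>\<^sup>+x. \<integral>\<^sup>+y. ?k x y s \<partial>std_normal \<partial>std_normal)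
      + ?g s * (\<integral>\<^sup>+y. \<integral>\<^sup>+x. ?k x y s \<partial>std_normal \<partial>std_normal) \<partial>lborel)"
    by (intro nn_integral_cong) (simp add: nn_integral_add nn_integral_cmult)
  also have "\<dots> = (\<integral>\<^sup>+s. ?g s * (\<integral>\<^sup>+x. \<integral>\<^sup>+y. ?k x y s \<partial>std_normal \<partial>std_normal)
      + ?g s * (\<integral>\<^sup>+x. \<integral>\<^sup>+y. ?k x y s \<partial>std_normal \<partial>std_normal) \<partial>lborel)"
  proof -
    interpret P: pair_sigma_finite std_normal std_normal ..
    have "(\<integral>\<^sup>+y. \<integral>\<^sup>+x. ?k x y s \<partial>std_normal \<partial>std_normal) = (\<integral>\<^sup>+x. \<integral>\<^sup>+y. ?k x y s \<partial>std_normal \<partial>std_normal)" for s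
      by (rule P.Fubini') measurable
    then show ?thesis by simp
  qed
  also have "\<dots> = (\<integral>\<^sup>+s. ennreal (2 * (std_normal_density s * (G' s)\<^sup>2)) \<partial>lborel)"
    unfolding std_normal_tail_kernel
    by (intro nn_integral_cong) (simp add: ennreal_mult'[symmetric] ennreal_plus[symmetric] mult.commute del: ennreal_plus)
  also have "\<dots> = ennreal (\<integral>s. 2 * (std_normal_density s * (G' s)\<^sup>2) \<partial>lborel)"
    by (rule nn_integral_eq_integral) (use int(3) in \<open>auto simp: integrable_std_normal\<close>)
  also have "(\<integral>s. 2 * (std_normal_density s * (G' s)\<^sup>2) \<partial>lborel) = 2 * (\<integral>s. (G' s)\<^sup>2 \<partial>std_normal)"
    by (subst integral_std_normal) auto
  finally have "2 * (V - m\<^sup>2) \<le> 2 * (\<integral>s. (G' s)\<^sup>2 \<partial>std_normal)"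
    by (subst (asm) ennreal_le_iff) auto
  then show ?thesis unfolding V_def m_def by simp
qed

section \<open>Gaussian measures and quadratic forms\<close>

definition std_gauss :: "'i set \<Rightarrow> ('i \<Rightarrow> real) measure" where
  "std_gauss I = (\<Pi>\<^sub>M i\<in>I. std_normal)"

abbreviation lebesgue_prod :: "'i set \<Rightarrow> ('i \<Rightarrow> real) measure" where
  "lebesgue_prod I \<equiv> (\<Pi>\<^sub>M i\<in>I. lborel)"

lemma product_sigma_finite_lborel: "product_sigma_finite (\<lambda>_. lborel)"
  by (simp add: product_sigma_finite_def sigma_finite_lborel)

lemma product_sigma_finite_std_normal: "product_sigma_finite (\<lambda>_. std_normal)"
  by (simp add: product_sigma_finite_def prob_space_imp_sigma_finite prob_space_std_normal)

lemma sets_std_gauss [measurable_cong, simp]: "sets (std_gauss I) = sets (lebesgue_prod I)"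
  unfolding std_gauss_def by (rule sets_PiM_cong) auto

lemma space_std_gauss: "space (std_gauss I) = PiE I (\<lambda>_. UNIV)"
  by (simp add: std_gauss_def space_PiM)

lemma prob_space_std_gauss: "prob_space (std_gauss I)"
  unfolding std_gauss_def by (rule prob_space_PiM) (rule prob_space_std_normal)

text \<open>Restricted to \<open>{..<n}\<close> because the points of the product space are
  extensional functions.\<close>

definition lin_map :: "nat \<Rightarrow> (nat \<Rightarrow> nat \<Rightarrow> real) \<Rightarrow> (nat \<Rightarrow> real) \<Rightarrow> nat \<Rightarrow> real" where
  "lin_map n M y = (\<lambda>j\<in>{..<n}. \<Sum>k<n. M j k * y k)"

lemma lin_map_measurable [measurable]: "lin_map n M \<in> measurable (lebesgue_prod {..<n}) (lebesgue_prod {..<n})"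
  unfolding lin_map_def by (intro measurable_restrict) measurable

definition quad_form :: "nat \<Rightarrow> (nat \<Rightarrow> nat \<Rightarrow> real) \<Rightarrow> (nat \<Rightarrow> real) \<Rightarrow> real" where
  "quad_form n a t = (\<Sum>i<n. \<Sum>j<n. a i j * t i * t j)"

lemma quad_form_measurable [measurable]: "quad_form n a \<in> borel_measurable (lebesgue_prod {..<n})"
  unfolding quad_form_def by measurable

lemma quad_form_cong: "(\<And>i. i < n \<Longrightarrow> s i = t i) \<Longrightarrow> quad_form n a s = quad_form n a t"
  unfolding quad_form_def by (intro sum.cong) auto

text \<open>The substitution x = y / sqrt c - b. It is applied to the last variable of a quadratic
  form, where \<open>c\<close> is the pivot and \<open>b\<close> a linear function of the other
  variables.\<close>

lemma nn_integral_std_normal_affine: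
  fixes f :: "real \<Rightarrow> ennreal"
  assumes [measurable]: "f \<in> borel_measurable borel" and c: "c > 0"
  shows "(\<integral>\<^sup>+x. f x * ennreal (exp (- (c * (x + b)\<^sup>2) / 2)) \<partial>lborel)
    = ennreal (sqrt (2 * pi) / sqrt c) * (\<integral>\<^sup>+y. f (y / sqrt c - b) \<partial>std_normal)"
proof -
  have sc: "sqrt c > 0" using c by simp
  have "(\<integral>\<^sup>+x. f x * ennreal (exp (- (c * (x + b)\<^sup>2) / 2)) \<partial>lborel)
      = ennreal \<bar>1 / sqrt c\<bar> * (\<integral>\<^sup>+y. f (- b + 1 / sqrt c * y) * ennreal (exp (- (c * (- b + 1 / sqrt c * y + b)\<^sup>2) / 2)) \<partial>lborel)"
    by (rule nn_integral_real_affine) (use sc in auto)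
  also have "(\<integral>\<^sup>+y. f (- b + 1 / sqrt c * y) * ennreal (exp (- (c * (- b + 1 / sqrt c * y + b)\<^sup>2) / 2)) \<partial>lborel)
      = (\<integral>\<^sup>+y. ennreal (sqrt (2 * pi)) * (ennreal (std_normal_density y) * f (y / sqrt c - b)) \<partial>lborel)"
  proof (rule nn_integral_cong)
    fix y
    have "c * (- b + 1 / sqrt c * y + b)\<^sup>2 = y\<^sup>2"
      using c by (simp add: power_divide)
    moreover have "ennreal (sqrt (2 * pi)) * ennreal (std_normal_density y) = ennreal (exp (- y\<^sup>2 / 2))"
      by (simp add: std_normal_density_def ennreal_mult'[symmetric])
    ultimately show "f (- b + 1 / sqrt c * y) * ennreal (exp (- (c * (- b + 1 / sqrt c * y + b)\<^sup>2) / 2))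
        = ennreal (sqrt (2 * pi)) * (ennreal (std_normal_density y) * f (y / sqrt c - b))"
      using \<open>ennreal (sqrt (2 * pi)) * ennreal (std_normal_density y) = ennreal (exp (- y\<^sup>2 / 2))\<close>
      by (simp add: mult.assoc[symmetric] mult.commute)
  qed
  also have "\<dots> = ennreal (sqrt (2 * pi)) * (\<integral>\<^sup>+y. f (y / sqrt c - b) \<partial>std_normal)"
    unfolding std_normal_def by (simp add: nn_integral_cmult nn_integral_density)
  finally show ?thesis
    using sc by (simp add: mult.assoc[symmetric] ennreal_mult'[symmetric])
qed

text \<open>Completing the square in the last variable: the remaining form is the Schur complement.\<close>

lemma gaussian_diagonalisation:
  assumes "\<And>i j. i < n \<Longrightarrow> j < n \<Longrightarrow> a i j = a j i"
    and "\<And>t. (\<exists>i<n. t i \<noteq> 0) \<Longrightarrow> 0 < quad_form n a t"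
  shows "\<exists>M. (\<forall>j<n. 0 < M j j) \<and> (\<forall>j k. j < k \<longrightarrow> M j k = 0) \<and>
    (\<forall>y. quad_form n a (lin_map n M y) = (\<Sum>k<n. (y k)\<^sup>2)) \<and>
    (\<forall>F \<in> borel_measurable (lebesgue_prod {..<n}).
      (\<integral>\<^sup>+t. F t * ennreal (exp (- quad_form n a t / 2)) \<partial>lebesgue_prod {..<n})
      = ennreal (sqrt (2 * pi) ^ n * (\<Prod>j<n. M j j)) * (\<integral>\<^sup>+y. F (lin_map n M y) \<partial>std_gauss {..<n}))"
  using assms
proof (induction n arbitrary: a)
  case 0
  interpret L: product_sigma_finite "\<lambda>_::nat. lborel :: real measure" by (rule product_sigma_finite_lborel)
  interpret N: product_sigma_finite "\<lambda>_::nat. std_normal" by (rule product_sigma_finite_std_normal)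
  show ?case
    using prob_space.emeasure_space_1[OF prob_space_std_gauss[of "{} :: nat set"], unfolded std_gauss_def]
    by (intro exI[of _ "\<lambda>_ _. 0"])
       (auto simp: quad_form_def std_gauss_def L.nn_integral_empty N.nn_integral_empty lin_map_def restrict_def)
next
  case (Suc n)
  interpret L: product_sigma_finite "\<lambda>_::nat. lborel :: real measure" by (rule product_sigma_finite_lborel)
  interpret N: product_sigma_finite "\<lambda>_::nat. std_normal" by (rule product_sigma_finite_std_normal)
  define c where "c = a n n"
  define b where "b i = a i n / c" for i
  define a' where "a' i j = a i j - a i n * a j n / c" for i j
  have sym: "a i j = a j i" if "i \<le> n" "j \<le> n" for i j using Suc.prems(1) that by auto
  have c: "c > 0"
  proof -
    have "0 < quad_form (Suc n) a (\<lambda>i. if i = n then 1 else 0)"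
      by (rule Suc.prems(2)) auto
    also have "\<dots> = c" unfolding quad_form_def c_def by (simp add: if_distrib cong: if_cong)
    finally show ?thesis .
  qed
  have split: "quad_form (Suc n) a t = c * (t n + (\<Sum>i<n. b i * t i))\<^sup>2 + quad_form n a' t" for t
  proof -
    have s: "(\<Sum>j<n. a n j * t n * t j) = (\<Sum>i<n. a i n * t i * t n)"
      by (intro sum.cong) (auto simp: sym)
    have "quad_form (Suc n) a t = (\<Sum>i<n. \<Sum>j<n. a i j * t i * t j) + 2 * t n * (\<Sum>i<n. a i n * t i) + c * (t n)\<^sup>2"
    proof -
      have "quad_form (Suc n) a t = (\<Sum>i<n. \<Sum>j<n. a i j * t i * t j) + (\<Sum>i<n. a i n * t i * t n)
          + ((\<Sum>j<n. a n j * t n * t j) + c * (t n)\<^sup>2)"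
        unfolding quad_form_def by (simp add: sum.distrib c_def power2_eq_square)
      moreover have "(\<Sum>i<n. a i n * t i * t n) = t n * (\<Sum>i<n. a i n * t i)"
        by (simp add: sum_distrib_left mult_ac)
      ultimately show ?thesis unfolding s by simp
    qed
    also have "(\<Sum>i<n. \<Sum>j<n. a i j * t i * t j) = quad_form n a' t + (\<Sum>i<n. a i n * t i)\<^sup>2 / c"
      unfolding quad_form_def a'_def power2_eq_square sum_product sum_divide_distrib sum.distrib[symmetric]
      by (intro sum.cong refl) (simp add: algebra_simps)
    also have "(\<Sum>i<n. a i n * t i) = c * (\<Sum>i<n. b i * t i)"
      unfolding sum_distrib_left b_def using c by (intro sum.cong) auto
    finally show ?thesis using c by (simp add: power2_eq_square field_simps)
  qed
  have "\<exists>M. (\<forall>j<n. 0 < M j j) \<and> (\<forall>j k. j < k \<longrightarrow> M j k = 0) \<and>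
    (\<forall>y. quad_form n a' (lin_map n M y) = (\<Sum>k<n. (y k)\<^sup>2)) \<and>
    (\<forall>F \<in> borel_measurable (lebesgue_prod {..<n}).
      (\<integral>\<^sup>+t. F t * ennreal (exp (- quad_form n a' t / 2)) \<partial>lebesgue_prod {..<n})
      = ennreal (sqrt (2 * pi) ^ n * (\<Prod>j<n. M j j)) * (\<integral>\<^sup>+y. F (lin_map n M y) \<partial>std_gauss {..<n}))"
  proof (rule Suc.IH)
    show "a' i j = a' j i" if "i < n" "j < n" for i j using that by (simp add: a'_def sym)
    fix t :: "nat \<Rightarrow> real" assume t: "\<exists>i<n. t i \<noteq> 0"
    \<comment> \<open>The last coordinate is chosen to annihilate the completed square, so the Schur
      complement inherits positivity.\<close>
    define t' where "t' = t(n := - (\<Sum>i<n. b i * t i))"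
    have "0 < quad_form (Suc n) a t'"
      by (rule Suc.prems(2)) (use t in \<open>auto simp: t'_def\<close>)
    also have "\<dots> = quad_form n a' t"
      unfolding split by (simp add: t'_def quad_form_cong[of n t' t, unfolded t'_def])
    finally show "0 < quad_form n a' t" .
  qed
  then obtain M' where M'pos: "\<And>j. j < n \<Longrightarrow> 0 < M' j j" and M'tri: "\<And>j k. j < k \<Longrightarrow> M' j k = 0"
    and M'q: "\<And>y. quad_form n a' (lin_map n M' y) = (\<Sum>k<n. (y k)\<^sup>2)"
    and M'int: "\<And>F. F \<in> borel_measurable (lebesgue_prod {..<n}) \<Longrightarrow>
      (\<integral>\<^sup>+t. F t * ennreal (exp (- quad_form n a' t / 2)) \<partial>lebesgue_prod {..<n})
      = ennreal (sqrt (2 * pi) ^ n * (\<Prod>j<n. M' j j)) * (\<integral>\<^sup>+y. F (lin_map n M' y) \<partial>std_gauss {..<n})"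
    by blast
  \<comment> \<open>The new last row undoes the shift by b after the old map has been applied. The
    matrix stays lower triangular, so its diagonal carries the Jacobian.\<close>
  define M where "M j k = (if j = n then if k = n then 1 / sqrt c else if k < n then - (\<Sum>i<n. b i * M' i k) else 0
     else if k < n then M' j k else 0)" for j k
  have lin: "lin_map (Suc n) M y = (lin_map n M' y)(n := y n / sqrt c - (\<Sum>i<n. b i * lin_map n M' y i))" for y
  proof
    fix j
    consider "j < n" | "j = n" | "j > n" by linarith
    then show "lin_map (Suc n) M y j = ((lin_map n M' y)(n := y n / sqrt c - (\<Sum>i<n. b i * lin_map n M' y i))) j"
    proof cases
      case 2
      have "(\<Sum>i<n. b i * lin_map n M' y i) = (\<Sum>i<n. \<Sum>k<n. b i * M' i k * y k)"
        by (simp add: lin_map_def sum_distrib_left mult.assoc)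
      also have "\<dots> = (\<Sum>k<n. (\<Sum>i<n. b i * M' i k) * y k)"
        by (subst sum.swap) (simp add: sum_distrib_right)
      finally show ?thesis using 2 by (simp add: lin_map_def M_def sum_negf)
    qed (auto simp: lin_map_def M_def)
  qed
  show ?case
  proof (intro exI[of _ M] conjI allI impI ballI)
    show "0 < M j j" if "j < Suc n" for j using that c M'pos by (auto simp: M_def less_Suc_eq)
    show "M j k = 0" if "j < k" for j k using that M'tri by (auto simp: M_def)
    fix y
    show "quad_form (Suc n) a (lin_map (Suc n) M y) = (\<Sum>k<Suc n. (y k)\<^sup>2)"
      unfolding split lin using c
      by (subst quad_form_cong[of n _ "lin_map n M' y"]) (auto simp: M'q power_divide)
  next
    fix F :: "(nat \<Rightarrow> real) \<Rightarrow> ennreal"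
    assume F: "F \<in> borel_measurable (lebesgue_prod {..<Suc n})"
    have ins: "{..<Suc n} = insert n {..<n}" by auto
    note F' [measurable] = F[unfolded ins]
    have q' [measurable]: "quad_form (Suc n) a \<in> borel_measurable (lebesgue_prod (insert n {..<n}))"
      using quad_form_measurable[of "Suc n" a] unfolding ins .
    let ?s = "\<lambda>x. \<Sum>i<n. b i * x i"
    let ?C = "sqrt (2 * pi) / sqrt c" let ?C' = "sqrt (2 * pi) ^ n * (\<Prod>j<n. M' j j)"
    have up [measurable]: "(\<lambda>y. F (x(n := y))) \<in> borel_measurable borel" if "x \<in> space (lebesgue_prod {..<n})" for x
      using measurable_compose[OF _ F', of "\<lambda>y. x(n := y)" borel] that
      by (auto intro!: measurable_fun_upd[where J = "{..<n}"] measurable_const)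
    have G [measurable]: "(\<lambda>x. \<integral>\<^sup>+y. F (x(n := y / sqrt c - ?s x)) \<partial>std_normal) \<in> borel_measurable (lebesgue_prod {..<n})"
    proof -
      have "(\<lambda>p. (fst p)(n := snd p / sqrt c - ?s (fst p))) \<in>
          measurable (lebesgue_prod {..<n} \<Otimes>\<^sub>M std_normal) (lebesgue_prod (insert n {..<n}))"
        by (rule measurable_fun_upd[where J = "{..<n}"]) auto
      from measurable_compose[OF this F'] show ?thesis
        by (intro sigma_finite_measure.borel_measurable_nn_integral)
           (auto simp: split_def prob_space_std_normal prob_space_imp_sigma_finite)
    qed
    have "(\<integral>\<^sup>+t. F t * ennreal (exp (- quad_form (Suc n) a t / 2)) \<partial>lebesgue_prod {..<Suc n})
      = (\<integral>\<^sup>+x. \<integral>\<^sup>+y. F (x(n := y)) * ennreal (exp (- quad_form (Suc n) a (x(n := y)) / 2)) \<partial>lborel \<partial>lebesgue_prod {..<n})"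
      unfolding ins by (rule L.product_nn_integral_insert) auto
    also have "\<dots> = (\<integral>\<^sup>+x. \<integral>\<^sup>+y. ennreal (exp (- quad_form n a' x / 2)) * (F (x(n := y)) * ennreal (exp (- (c * (y + ?s x)\<^sup>2) / 2)))
        \<partial>lborel \<partial>lebesgue_prod {..<n})"
    proof (intro nn_integral_cong)
      fix x y
      have "- quad_form (Suc n) a (x(n := y)) / 2 = - quad_form n a' x / 2 + - (c * (y + ?s x)\<^sup>2) / 2"
        unfolding split by (simp add: quad_form_cong[of n "x(n := y)" x])
      then show "F (x(n := y)) * ennreal (exp (- quad_form (Suc n) a (x(n := y)) / 2)) =
          ennreal (exp (- quad_form n a' x / 2)) * (F (x(n := y)) * ennreal (exp (- (c * (y + ?s x)\<^sup>2) / 2)))"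
        by (simp only: exp_add ennreal_mult' exp_ge_zero mult_ac)
    qed
    also have "\<dots> = (\<integral>\<^sup>+x. ennreal ?C * ((\<integral>\<^sup>+y. F (x(n := y / sqrt c - ?s x)) \<partial>std_normal) * ennreal (exp (- quad_form n a' x / 2)))
        \<partial>lebesgue_prod {..<n})"
    proof (intro nn_integral_cong)
      fix x assume x: "x \<in> space (lebesgue_prod {..<n})"
      have "(\<integral>\<^sup>+y. ennreal (exp (- quad_form n a' x / 2)) * (F (x(n := y)) * ennreal (exp (- (c * (y + ?s x)\<^sup>2) / 2))) \<partial>lborel)
        = ennreal (exp (- quad_form n a' x / 2)) * (\<integral>\<^sup>+y. F (x(n := y)) * ennreal (exp (- (c * (y + ?s x)\<^sup>2) / 2)) \<partial>lborel)"
        by (rule nn_integral_cmult) (use up[OF x] in auto)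
      then show "(\<integral>\<^sup>+y. ennreal (exp (- quad_form n a' x / 2)) * (F (x(n := y)) * ennreal (exp (- (c * (y + ?s x)\<^sup>2) / 2))) \<partial>lborel)
          = ennreal ?C * ((\<integral>\<^sup>+y. F (x(n := y / sqrt c - ?s x)) \<partial>std_normal) * ennreal (exp (- quad_form n a' x / 2)))"
        using nn_integral_std_normal_affine[OF up[OF x] c, of "?s x"] by (simp add: mult_ac)
    qed
    also have "\<dots> = ennreal ?C * (\<integral>\<^sup>+x. (\<integral>\<^sup>+y. F (x(n := y / sqrt c - ?s x)) \<partial>std_normal) * ennreal (exp (- quad_form n a' x / 2)) \<partial>lebesgue_prod {..<n})"
      by (rule nn_integral_cmult) auto
    also have "\<dots> = ennreal ?C * (ennreal ?C' * (\<integral>\<^sup>+z. \<integral>\<^sup>+y. F ((lin_map n M' z)(n := y / sqrt c - ?s (lin_map n M' z))) \<partial>std_normal \<partial>std_gauss {..<n}))"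
      by (subst M'int[OF G]) simp
    also have "\<dots> = ennreal (?C * ?C') * (\<integral>\<^sup>+z. \<integral>\<^sup>+y. F ((lin_map n M' z)(n := y / sqrt c - ?s (lin_map n M' z))) \<partial>std_normal \<partial>std_gauss {..<n})"
      using c by (subst ennreal_mult') (auto simp: mult.assoc)
    also have "?C * ?C' = sqrt (2 * pi) ^ Suc n * (\<Prod>j<Suc n. M j j)"
      by (simp add: M_def)
    also have "(\<integral>\<^sup>+z. \<integral>\<^sup>+y. F ((lin_map n M' z)(n := y / sqrt c - ?s (lin_map n M' z))) \<partial>std_normal \<partial>std_gauss {..<n})
        = (\<integral>\<^sup>+z. \<integral>\<^sup>+y. F (lin_map (Suc n) M (z(n := y))) \<partial>std_normal \<partial>std_gauss {..<n})"
    proof (intro nn_integral_cong arg_cong[of _ _ F])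
      fix z y
      have "lin_map n M' (z(n := y)) = lin_map n M' z" by (auto simp: lin_map_def fun_eq_iff)
      then show "(lin_map n M' z)(n := y / sqrt c - ?s (lin_map n M' z)) = lin_map (Suc n) M (z(n := y))"
        unfolding lin by simp
    qed
    also have "\<dots> = (\<integral>\<^sup>+y. F (lin_map (Suc n) M y) \<partial>std_gauss {..<Suc n})"
      unfolding std_gauss_def ins
    proof (rule N.product_nn_integral_insert[symmetric])
      have "(\<lambda>y. F (lin_map (Suc n) M y)) \<in> borel_measurable (std_gauss {..<Suc n})"
        using F by measurable
      then show "(\<lambda>y. F (lin_map (Suc n) M y)) \<in> borel_measurable (Pi\<^sub>M (insert n {..<n}) (\<lambda>_. std_normal))"
        unfolding std_gauss_def ins .
    qed auto
    finally show "(\<integral>\<^sup>+t. F t * ennreal (exp (- quad_form (Suc n) a t / 2)) \<partial>lebesgue_prod {..<Suc n})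
      = ennreal (sqrt (2 * pi) ^ Suc n * (\<Prod>j<Suc n. M j j)) * (\<integral>\<^sup>+y. F (lin_map (Suc n) M y) \<partial>std_gauss {..<Suc n})" .
  qed
qed

section \<open>Integration by parts and the Poincare inequality\<close>

text \<open>A class that contains polynomials in the coordinates and bounded measurable functions,
  is closed under sums, products, sections and partial Gaussian integrals, and consists of
  integrable functions. The bound is required at every function \<open>x\<close>, extensional or
  not, so that updates \<open>x(i := y)\<close> can be inserted freely.\<close>

definition subexp :: "'i set \<Rightarrow> (('i \<Rightarrow> real) \<Rightarrow> real) \<Rightarrow> bool" where
  "subexp I F \<longleftrightarrow> F \<in> borel_measurable (lebesgue_prod I) \<and>
     (\<exists>C\<ge>0. \<exists>a\<ge>0. \<forall>x. \<bar>F x\<bar> \<le> C * exp (a * (\<Sum>i\<in>I. \<bar>x i\<bar>)))"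

lemma subexpI:
  assumes "F \<in> borel_measurable (lebesgue_prod I)" "\<And>x. \<bar>F x\<bar> \<le> C * exp (a * (\<Sum>i\<in>I. \<bar>x i\<bar>))"
  shows "subexp I F"
proof -
  have "\<bar>F x\<bar> \<le> \<bar>C\<bar> * exp (\<bar>a\<bar> * (\<Sum>i\<in>I. \<bar>x i\<bar>))" for x
  proof -
    have "C * exp (a * (\<Sum>i\<in>I. \<bar>x i\<bar>)) \<le> \<bar>C\<bar> * exp (\<bar>a\<bar> * (\<Sum>i\<in>I. \<bar>x i\<bar>))"
      by (intro mult_mono) (auto intro!: mult_right_mono sum_nonneg)
    then show ?thesis using assms(2)[of x] by linarith
  qed
  then show ?thesis unfolding subexp_def using assms(1) by (intro conjI exI[of _ "\<bar>C\<bar>"] exI[of _ "\<bar>a\<bar>"]) auto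
qed

lemma subexp_measurable: "subexp I F \<Longrightarrow> F \<in> borel_measurable (lebesgue_prod I)"
  by (simp add: subexp_def)

lemma subexp_bounded:
  assumes "F \<in> borel_measurable (lebesgue_prod I)" "\<And>x. \<bar>F x\<bar> \<le> C"
  shows "subexp I F"
  by (rule subexpI[where C = C and a = 0]) (use assms in auto)

lemma subexp_const [intro]: "subexp I (\<lambda>_. c)"
  by (rule subexp_bounded[where C = "\<bar>c\<bar>"]) auto

lemma subexp_component [intro]:
  assumes "finite I" "i \<in> I"
  shows "subexp I (\<lambda>x. x i)"
proof (rule subexpI[where C = 1 and a = 1])
  show "\<bar>x i\<bar> \<le> 1 * exp (1 * (\<Sum>i\<in>I. \<bar>x i\<bar>))" for x :: "_ \<Rightarrow> real"
    using member_le_sum[OF assms(2), of "\<lambda>i. \<bar>x i\<bar>"] assms(1) exp_ge_add_one_self[of "\<Sum>i\<in>I. \<bar>x i\<bar>"]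
    by (simp del: exp_ge_add_one_self)
qed (use assms in measurable)

lemma subexp_mult [intro]:
  assumes "subexp I F" "subexp I G"
  shows "subexp I (\<lambda>x. F x * G x)"
proof -
  note [measurable] = assms[THEN subexp_measurable]
  obtain C a where C: "C \<ge> 0" "\<And>x. \<bar>F x\<bar> \<le> C * exp (a * (\<Sum>i\<in>I. \<bar>x i\<bar>))" using assms(1) unfolding subexp_def by blast
  obtain D b where D: "D \<ge> 0" "\<And>x. \<bar>G x\<bar> \<le> D * exp (b * (\<Sum>i\<in>I. \<bar>x i\<bar>))" using assms(2) unfolding subexp_def by blast
  have "\<bar>F x * G x\<bar> \<le> (C * D) * exp ((a + b) * (\<Sum>i\<in>I. \<bar>x i\<bar>))" for x
    using mult_mono[OF C(2)[of x] D(2)[of x]] C(1)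
    by (simp add: abs_mult distrib_right exp_add mult_ac)
  then show ?thesis by (rule subexpI[rotated]) measurable
qed

lemma subexp_add [intro]:
  assumes "subexp I F" "subexp I G"
  shows "subexp I (\<lambda>x. F x + G x)"
proof -
  note [measurable] = assms[THEN subexp_measurable]
  obtain C a where C: "C \<ge> 0" "a \<ge> 0" "\<And>x. \<bar>F x\<bar> \<le> C * exp (a * (\<Sum>i\<in>I. \<bar>x i\<bar>))" using assms(1) unfolding subexp_def by blast
  obtain D b where D: "D \<ge> 0" "b \<ge> 0" "\<And>x. \<bar>G x\<bar> \<le> D * exp (b * (\<Sum>i\<in>I. \<bar>x i\<bar>))" using assms(2) unfolding subexp_def by blast
  have "\<bar>F x + G x\<bar> \<le> (C + D) * exp ((a + b) * (\<Sum>i\<in>I. \<bar>x i\<bar>))" for x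
  proof -
    have s: "(\<Sum>i\<in>I. \<bar>x i\<bar>) \<ge> 0" by (rule sum_nonneg) simp
    have "C * exp (a * (\<Sum>i\<in>I. \<bar>x i\<bar>)) \<le> C * exp ((a + b) * (\<Sum>i\<in>I. \<bar>x i\<bar>))"
         "D * exp (b * (\<Sum>i\<in>I. \<bar>x i\<bar>)) \<le> D * exp ((a + b) * (\<Sum>i\<in>I. \<bar>x i\<bar>))"
      using C D s by (auto intro!: mult_left_mono mult_right_mono)
    then show ?thesis using C(3)[of x] D(3)[of x] by (simp add: distrib_right)
  qed
  then show ?thesis by (rule subexpI[rotated]) measurable
qed

lemma subexp_diff [intro]:
  assumes "subexp I F" "subexp I G" shows "subexp I (\<lambda>x. F x - G x)"
  using subexp_add[OF assms(1) subexp_mult[OF subexp_const[of I "-1"] assms(2)]] by simp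

lemma subexp_sum [intro]:
  "(\<And>j. j \<in> J \<Longrightarrow> subexp I (F j)) \<Longrightarrow> subexp I (\<lambda>x. \<Sum>j\<in>J. F j x)"
  by (induction J rule: infinite_finite_induct) auto

lemma subexp_power [intro]: "subexp I F \<Longrightarrow> subexp I (\<lambda>x. F x ^ p)"
  by (induction p) auto

lemma subexp_abs [intro]:
  assumes "subexp I F" shows "subexp I (\<lambda>x. \<bar>F x\<bar>)"
  using assms subexp_measurable[OF assms] unfolding subexp_def by auto

lemma integrable_exp_abs_std_gauss:
  assumes "finite I"
  shows "integrable (std_gauss I) (\<lambda>x. exp (a * (\<Sum>i\<in>I. \<bar>x i\<bar>)))"
proof -
  interpret N: product_sigma_finite "\<lambda>_. std_normal" by (rule product_sigma_finite_std_normal)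
  have "integrable (std_gauss I) (\<lambda>x. \<Prod>i\<in>I. exp (a * \<bar>x i\<bar>))"
    unfolding std_gauss_def using assms by (intro N.product_integrable_prod integrable_exp_abs_std_normal)
  then show ?thesis using assms by (simp add: sum_distrib_left exp_sum)
qed

lemma subexp_integrable:
  assumes "finite I" "subexp I F"
  shows "integrable (std_gauss I) F"
proof -
  obtain C a where C: "C \<ge> 0" "\<And>x. \<bar>F x\<bar> \<le> C * exp (a * (\<Sum>i\<in>I. \<bar>x i\<bar>))" using assms(2) unfolding subexp_def by blast
  show ?thesis
  proof (rule Bochner_Integration.integrable_bound)
    show "integrable (std_gauss I) (\<lambda>x. C * exp (a * (\<Sum>i\<in>I. \<bar>x i\<bar>)))"
      using assms by (intro integrable_mult_right integrable_exp_abs_std_gauss)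
    show "AE x in std_gauss I. norm (F x) \<le> norm (C * exp (a * (\<Sum>i\<in>I. \<bar>x i\<bar>)))"
      using C by (intro AE_I2) (auto intro: order_trans[OF _ abs_ge_self])
  qed (use assms(2) in \<open>auto dest: subexp_measurable\<close>)
qed

lemma abs_integral_le:
  fixes f g :: "'a \<Rightarrow> real"
  assumes "integrable M f" "integrable M g" "\<And>x. x \<in> space M \<Longrightarrow> \<bar>f x\<bar> \<le> g x"
  shows "\<bar>\<integral>x. f x \<partial>M\<bar> \<le> (\<integral>x. g x \<partial>M)"
  by (rule order_trans[OF integral_abs_bound integral_mono]) (use assms in auto)

section \<open>Integrating out one coordinate or all the others\<close>

lemma fun_upd_measurable_pair:
  "(\<lambda>p. (fst p)(i := snd p)) \<in> measurable (std_gauss I \<Otimes>\<^sub>M std_normal) (lebesgue_prod (insert i I))"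
  by (rule measurable_fun_upd[where J = I]) auto

context
  fixes I :: "'i set" and i :: 'i and F :: "('i \<Rightarrow> real) \<Rightarrow> real"
  assumes fin: "finite I" and iI: "i \<notin> I" and F: "subexp (insert i I) F"
begin

lemma subexp_section: "subexp I (\<lambda>x. F (x(i := y)))"
proof -
  obtain C a where C: "C \<ge> 0" "\<And>x. \<bar>F x\<bar> \<le> C * exp (a * (\<Sum>j\<in>insert i I. \<bar>x j\<bar>))" using F unfolding subexp_def by blast
  have s: "(\<Sum>j\<in>insert i I. \<bar>(x(i := y)) j\<bar>) = \<bar>y\<bar> + (\<Sum>j\<in>I. \<bar>x j\<bar>)" for x :: "'i \<Rightarrow> real"
    using fin iI by (auto intro!: sum.cong)
  have "\<bar>F (x(i := y))\<bar> \<le> (C * exp (a * \<bar>y\<bar>)) * exp (a * (\<Sum>j\<in>I. \<bar>x j\<bar>))" for x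
    using C(2)[of "x(i := y)"] unfolding s by (simp add: distrib_left exp_add mult_ac)
  moreover have "(\<lambda>x. F (x(i := y))) \<in> borel_measurable (lebesgue_prod I)"
    by (rule measurable_compose[OF _ subexp_measurable[OF F]]) (rule measurable_fun_upd[where J = I], auto)
  ultimately show ?thesis by (rule subexpI[rotated])
qed

lemma coordinate_section:
  "\<exists>C a. 0 \<le> C \<and> (\<forall>x y. \<bar>F (x(i := y))\<bar> \<le> C * exp (a * (\<Sum>j\<in>I. \<bar>x j\<bar>)) * exp (a * \<bar>y\<bar>))"
proof -
  obtain C a where C: "C \<ge> 0" "\<And>x. \<bar>F x\<bar> \<le> C * exp (a * (\<Sum>j\<in>insert i I. \<bar>x j\<bar>))" using F unfolding subexp_def by blast
  have s: "(\<Sum>j\<in>insert i I. \<bar>(x(i := y)) j\<bar>) = \<bar>y\<bar> + (\<Sum>j\<in>I. \<bar>x j\<bar>)" for x :: "'i \<Rightarrow> real" and y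
    using fin iI by (auto intro!: sum.cong)
  have "\<bar>F (x(i := y))\<bar> \<le> C * exp (a * (\<Sum>j\<in>I. \<bar>x j\<bar>)) * exp (a * \<bar>y\<bar>)" for x y
    using C(2)[of "x(i := y)"] unfolding s by (simp add: distrib_left exp_add mult_ac)
  then show ?thesis using C(1) by blast
qed

lemma coordinate_measurable: "x \<in> space (std_gauss I) \<Longrightarrow> (\<lambda>y. F (x(i := y))) \<in> borel_measurable borel"
  using measurable_compose[OF _ subexp_measurable[OF F], of "\<lambda>y. x(i := y)" borel]
  by (auto intro!: measurable_fun_upd[where J = I] measurable_const simp: space_std_gauss space_PiM)

lemma coordinate_integrable: "x \<in> space (std_gauss I) \<Longrightarrow> integrable std_normal (\<lambda>y. F (x(i := y)))"
  using coordinate_section by (blast intro: integrable_std_normal_growth[OF coordinate_measurable])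

lemma pair_measurable: "(\<lambda>(x, y). F (x(i := y))) \<in> borel_measurable (std_gauss I \<Otimes>\<^sub>M std_normal)"
  using measurable_compose[OF fun_upd_measurable_pair subexp_measurable[OF F]] by (simp add: split_def)

lemma subexp_coordinate_integral: "subexp I (\<lambda>x. \<integral>y. F (x(i := y)) \<partial>std_normal)"
proof -
  interpret N: prob_space std_normal by (rule prob_space_std_normal)
  obtain C a where C0: "C \<ge> 0" and C: "\<And>x y. \<bar>F (x(i := y))\<bar> \<le> C * exp (a * (\<Sum>j\<in>I. \<bar>x j\<bar>)) * exp (a * \<bar>y\<bar>)"
    using coordinate_section by blast
  define K where "K = (\<integral>y. exp (a * \<bar>y\<bar>) \<partial>std_normal)"
  have [measurable]: "(\<lambda>x. \<integral>y. F (x(i := y)) \<partial>std_normal) \<in> borel_measurable (std_gauss I)"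
    using N.borel_measurable_lebesgue_integral[OF pair_measurable] by simp
  show ?thesis
  proof (rule subexpI)
    have "0 \<le> (\<integral>y. exp (a * \<bar>y\<bar>) \<partial>std_normal)" by simp
    then show "\<bar>\<integral>y. F (x(i := y)) \<partial>std_normal\<bar> \<le> (C * K) * exp (a * (\<Sum>j\<in>I. \<bar>x j\<bar>))" for x
    proof -
      \<comment> \<open>The bound has to hold for every \<open>x\<close>. Where the section fails to
        be integrable, as may happen outside the space, its integral is 0 by convention and the
        bound is trivial.\<close>
      have "\<bar>\<integral>y. F (x(i := y)) \<partial>std_normal\<bar> \<le> (\<integral>y. C * exp (a * (\<Sum>j\<in>I. \<bar>x j\<bar>)) * exp (a * \<bar>y\<bar>) \<partial>std_normal)"
        using abs_integral_le[of std_normal "\<lambda>y. F (x(i := y))" "\<lambda>y. C * exp (a * (\<Sum>j\<in>I. \<bar>x j\<bar>)) * exp (a * \<bar>y\<bar>)"] C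
          integrable_exp_abs_std_normal[of a] C0 \<open>0 \<le> (\<integral>y. exp (a * \<bar>y\<bar>) \<partial>std_normal)\<close>
        by (cases "integrable std_normal (\<lambda>y. F (x(i := y)))") (auto simp: not_integrable_integral_eq)
      also have "\<dots> = (C * K) * exp (a * (\<Sum>j\<in>I. \<bar>x j\<bar>))" unfolding K_def by simp
      finally show ?thesis .
    qed
  qed measurable
qed

text \<open>The mean over all the other coordinates as a function of the remaining one; the
  tensorisation of the Poincare inequality compares it with the mean over that one
  coordinate.\<close>

lemma other_integral:
  shows other_integral_measurable: "(\<lambda>y. \<integral>x. F (x(i := y)) \<partial>std_gauss I) \<in> borel_measurable borel"
    and other_integral_bound: "\<exists>C a. \<forall>y. \<bar>\<integral>x. F (x(i := y)) \<partial>std_gauss I\<bar> \<le> C * exp (a * \<bar>y\<bar>)"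
proof -
  interpret P: prob_space "std_gauss I" by (rule prob_space_std_gauss)
  have "(\<lambda>(y, x). F (x(i := y))) \<in> borel_measurable (std_normal \<Otimes>\<^sub>M std_gauss I)"
    using measurable_compose[OF measurable_pair_swap' pair_measurable] by (simp add: split_def)
  from P.borel_measurable_lebesgue_integral[OF this]
  show "(\<lambda>y. \<integral>x. F (x(i := y)) \<partial>std_gauss I) \<in> borel_measurable borel"
    by (simp cong: measurable_cong_sets)
  obtain C a where C0: "C \<ge> 0" and C: "\<And>x y. \<bar>F (x(i := y))\<bar> \<le> C * exp (a * (\<Sum>j\<in>I. \<bar>x j\<bar>)) * exp (a * \<bar>y\<bar>)"
    using coordinate_section by blast
  define K where "K = (\<integral>x. exp (a * (\<Sum>j\<in>I. \<bar>x j\<bar>)) \<partial>std_gauss I)"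
  have "\<bar>\<integral>x. F (x(i := y)) \<partial>std_gauss I\<bar> \<le> (C * K) * exp (a * \<bar>y\<bar>)" for y
  proof -
    have "\<bar>\<integral>x. F (x(i := y)) \<partial>std_gauss I\<bar> \<le> (\<integral>x. C * exp (a * (\<Sum>j\<in>I. \<bar>x j\<bar>)) * exp (a * \<bar>y\<bar>) \<partial>std_gauss I)"
      using C integrable_exp_abs_std_gauss[OF fin, of a] subexp_integrable[OF fin subexp_section]
      by (intro abs_integral_le) auto
    also have "\<dots> = (C * K) * exp (a * \<bar>y\<bar>)" unfolding K_def by simp
    finally show ?thesis .
  qed
  then show "\<exists>C a. \<forall>y. \<bar>\<integral>x. F (x(i := y)) \<partial>std_gauss I\<bar> \<le> C * exp (a * \<bar>y\<bar>)" by blast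
qed

lemma std_gauss_insert:
  shows integral_std_gauss_insert:
      "(\<integral>x. F x \<partial>std_gauss (insert i I)) = (\<integral>x. \<integral>y. F (x(i := y)) \<partial>std_normal \<partial>std_gauss I)"
    and integral_std_gauss_insert_rev:
      "(\<integral>x. F x \<partial>std_gauss (insert i I)) = (\<integral>y. \<integral>x. F (x(i := y)) \<partial>std_gauss I \<partial>std_normal)"
proof -
  interpret N: product_sigma_finite "\<lambda>_. std_normal" by (rule product_sigma_finite_std_normal)
  have "integrable (std_gauss (insert i I)) F" using fin F by (intro subexp_integrable) auto
  then show 1: "(\<integral>x. F x \<partial>std_gauss (insert i I)) = (\<integral>x. \<integral>y. F (x(i := y)) \<partial>std_normal \<partial>std_gauss I)"
    unfolding std_gauss_def using fin iI by (intro N.product_integral_insert) auto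
  interpret P: pair_sigma_finite "std_gauss I" std_normal
    by (simp add: pair_sigma_finite_def prob_space_imp_sigma_finite prob_space_std_gauss prob_space_std_normal)
  have "integrable (std_gauss I \<Otimes>\<^sub>M std_normal) (\<lambda>(x, y). F (x(i := y)))"
  proof (rule P.Fubini_integrable[OF pair_measurable])
    obtain C a where C0: "C \<ge> 0" and C: "\<And>x y. \<bar>F (x(i := y))\<bar> \<le> C * exp (a * (\<Sum>j\<in>I. \<bar>x j\<bar>)) * exp (a * \<bar>y\<bar>)"
      using coordinate_section by blast
    define K where "K = (\<integral>y. exp (a * \<bar>y\<bar>) \<partial>std_normal)"
    have [measurable]: "(\<lambda>x. \<integral>y. norm (case (x, y) of (x, y) \<Rightarrow> F (x(i := y))) \<partial>std_normal) \<in> borel_measurable (std_gauss I)"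
    proof (rule sigma_finite_measure.borel_measurable_lebesgue_integral)
      show "(\<lambda>(x, y). norm (case (x, y) of (x, y) \<Rightarrow> F (x(i := y)))) \<in> borel_measurable (std_gauss I \<Otimes>\<^sub>M std_normal)"
        using measurable_compose[OF pair_measurable borel_measurable_norm] by (simp add: split_def)
    qed (rule prob_space_imp_sigma_finite[OF prob_space_std_normal])
    show "integrable (std_gauss I) (\<lambda>x. \<integral>y. norm (case (x, y) of (x, y) \<Rightarrow> F (x(i := y))) \<partial>std_normal)"
    proof (rule Bochner_Integration.integrable_bound)
      show "integrable (std_gauss I) (\<lambda>x. (C * K) * exp (a * (\<Sum>j\<in>I. \<bar>x j\<bar>)))"
        using fin by (intro integrable_mult_right integrable_exp_abs_std_gauss)
      show "AE x in std_gauss I. norm (\<integral>y. norm (case (x, y) of (x, y) \<Rightarrow> F (x(i := y))) \<partial>std_normal)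
          \<le> norm ((C * K) * exp (a * (\<Sum>j\<in>I. \<bar>x j\<bar>)))"
      proof (intro AE_I2)
        fix x assume x: "x \<in> space (std_gauss I)"
        have "(\<integral>y. \<bar>F (x(i := y))\<bar> \<partial>std_normal) \<le> (\<integral>y. C * exp (a * (\<Sum>j\<in>I. \<bar>x j\<bar>)) * exp (a * \<bar>y\<bar>) \<partial>std_normal)"
          using C coordinate_integrable[OF x] integrable_exp_abs_std_normal[of a] by (intro integral_mono) auto
        also have "\<dots> = (C * K) * exp (a * (\<Sum>j\<in>I. \<bar>x j\<bar>))" unfolding K_def by simp
        finally show "norm (\<integral>y. norm (case (x, y) of (x, y) \<Rightarrow> F (x(i := y))) \<partial>std_normal)
          \<le> norm ((C * K) * exp (a * (\<Sum>j\<in>I. \<bar>x j\<bar>)))" by simp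
      qed
    qed measurable
    show "AE x in std_gauss I. integrable std_normal (\<lambda>y. case (x, y) of (x, y) \<Rightarrow> F (x(i := y)))"
      using coordinate_integrable by (intro AE_I2) auto
  qed
  from P.Fubini_integral[OF this]
  show "(\<integral>x. F x \<partial>std_gauss (insert i I)) = (\<integral>y. \<integral>x. F (x(i := y)) \<partial>std_gauss I \<partial>std_normal)"
    unfolding 1 by simp
qed

end

text \<open>Partial derivatives, each continuous along its own coordinate line: exactly the
  regularity that the one-dimensional results consume when they are applied one coordinate at a
  time.\<close>

definition has_gradient :: "'i set \<Rightarrow> (('i \<Rightarrow> real) \<Rightarrow> real) \<Rightarrow> ('i \<Rightarrow> ('i \<Rightarrow> real) \<Rightarrow> real) \<Rightarrow> bool" where
  "has_gradient I F D \<longleftrightarrow> subexp I F \<and> (\<forall>k\<in>I. subexp I (D k) \<and>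
     (\<forall>x u. ((\<lambda>u. F (x(k := u))) has_real_derivative D k (x(k := u))) (at u) \<and> isCont (\<lambda>u. D k (x(k := u))) u))"

lemma has_gradient_section:
  assumes "finite I" "i \<notin> I" "has_gradient (insert i I) F D"
  shows "has_gradient I (\<lambda>x. F (x(i := y))) (\<lambda>k x. D k (x(i := y)))"
  unfolding has_gradient_def
proof (intro conjI ballI allI)
  show "subexp I (\<lambda>x. F (x(i := y)))"
    using assms by (intro subexp_section) (auto simp: has_gradient_def)
  fix k x u assume k: "k \<in> I"
  show "subexp I (\<lambda>x. D k (x(i := y)))"
    using assms k by (intro subexp_section) (auto simp: has_gradient_def)
  have ki: "k \<noteq> i" using assms k by auto
  show "((\<lambda>u. F (x(k := u, i := y))) has_real_derivative D k (x(k := u, i := y))) (at u)"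
    using assms(3) k unfolding has_gradient_def fun_upd_twist[OF ki] by blast
  show "isCont (\<lambda>u. D k (x(k := u, i := y))) u"
    using assms(3) k unfolding has_gradient_def fun_upd_twist[OF ki] by blast
qed

lemma std_gauss_ibp:
  assumes "finite I" "k \<in> I" "has_gradient I F D"
  shows "(\<integral>x. x k * F x \<partial>std_gauss I) = (\<integral>x. D k x \<partial>std_gauss I)"
proof -
  define J where "J = I - {k}"
  have J: "finite J" "k \<notin> J" "I = insert k J" using assms by (auto simp: J_def)
  have sF: "subexp (insert k J) F" "subexp (insert k J) (D k)" "subexp (insert k J) (\<lambda>x. x k * F x)"
    using assms J by (auto simp: has_gradient_def)
  have "(\<integral>y. y * F (x(k := y)) \<partial>std_normal) = (\<integral>y. D k (x(k := y)) \<partial>std_normal)" if x: "x \<in> space (std_gauss J)" for x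
  proof -
    obtain C a where C0: "C \<ge> 0" and C: "\<And>x y. \<bar>F (x(k := y))\<bar> \<le> C * exp (a * (\<Sum>j\<in>J. \<bar>x j\<bar>)) * exp (a * \<bar>y\<bar>)"
      using coordinate_section[OF J(1,2) sF(1)] by blast
    obtain C' a' where C': "\<And>x y. \<bar>D k (x(k := y))\<bar> \<le> C' * exp (a' * (\<Sum>j\<in>J. \<bar>x j\<bar>)) * exp (a' * \<bar>y\<bar>)"
      using coordinate_section[OF J(1,2) sF(2)] by blast
    define K where "K = \<bar>C * exp (a * (\<Sum>j\<in>J. \<bar>x j\<bar>))\<bar> + \<bar>C' * exp (a' * (\<Sum>j\<in>J. \<bar>x j\<bar>))\<bar>"
    have K: "c * exp (b * \<bar>y\<bar>) \<le> K * exp ((\<bar>a\<bar> + \<bar>a'\<bar>) * \<bar>y\<bar>)"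
      if "\<bar>c\<bar> \<le> K" "\<bar>b\<bar> \<le> \<bar>a\<bar> + \<bar>a'\<bar>" for b c y
      using that by (intro mult_mono) (auto intro!: mult_right_mono)
    show ?thesis
    proof (rule std_normal_ibp)
      show "((\<lambda>y. F (x(k := y))) has_real_derivative D k (x(k := y))) (at y)" "isCont (\<lambda>y. D k (x(k := y))) y" for y
        using assms by (auto simp: has_gradient_def)
      show "\<bar>F (x(k := y))\<bar> \<le> K * exp ((\<bar>a\<bar> + \<bar>a'\<bar>) * \<bar>y\<bar>)" for y
        by (rule order_trans[OF C]) (rule K, auto simp: K_def)
      show "\<bar>D k (x(k := y))\<bar> \<le> K * exp ((\<bar>a\<bar> + \<bar>a'\<bar>) * \<bar>y\<bar>)" for y
        by (rule order_trans[OF C']) (rule K, auto simp: K_def)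
      show "integrable std_normal (\<lambda>y. D k (x(k := y)))"
        using coordinate_integrable[OF J(1,2) sF(2) x] .
      show "integrable std_normal (\<lambda>y. y * F (x(k := y)))"
        using coordinate_integrable[OF J(1,2) sF(3) x] by simp
    qed
  qed
  then show ?thesis
    unfolding J(3) integral_std_gauss_insert[OF J(1,2) sF(3)] integral_std_gauss_insert[OF J(1,2) sF(2)]
    by (simp cong: Bochner_Integration.integral_cong)
qed

text \<open>Tensorisation of the variance. Let m be the mean over coordinate i and n the mean over
  the others. The one-dimensional inequality bounds the mean of F^2 - m^2, the induction hypothesis
  bounds that of F^2 - n^2, and the variance of m is at most the latter; the two bounds add
  up.\<close>

lemma std_gauss_poincare:
  assumes "finite I" "has_gradient I F D"
  shows "(\<integral>x. (F x)\<^sup>2 \<partial>std_gauss I) - (\<integral>x. F x \<partial>std_gauss I)\<^sup>2 \<le> (\<Sum>k\<in>I. \<integral>x. (D k x)\<^sup>2 \<partial>std_gauss I)"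
  using assms
proof (induction I arbitrary: F D rule: finite_induct)
  case empty
  interpret P: prob_space "std_gauss ({} :: 'a set)" by (rule prob_space_std_gauss)
  \<comment> \<open>The space over the empty index set has the single point
    \<open>\<lambda>_. undefined\<close>, so the variance is 0.\<close>
  have c: "(\<integral>x. G x \<partial>std_gauss ({} :: 'a set)) = G (\<lambda>_. undefined)" for G :: "_ \<Rightarrow> real"
  proof -
    have "(\<integral>x. G x \<partial>std_gauss ({} :: 'a set)) = (\<integral>x. G (\<lambda>_. undefined) \<partial>std_gauss ({} :: 'a set))"
      by (rule Bochner_Integration.integral_cong) (auto simp: space_std_gauss)
    then show ?thesis by (simp add: P.prob_space)
  qed
  show ?case by (simp only: c) simp
next
  case (insert i I)
  let ?P = "std_gauss I" and ?N = std_normal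
  interpret P: prob_space ?P by (rule prob_space_std_gauss)
  interpret N: prob_space ?N by (rule prob_space_std_normal)
  note fin = insert.hyps(1,2)
  have sF: "subexp (insert i I) F" and sD: "\<And>k. k \<in> insert i I \<Longrightarrow> subexp (insert i I) (D k)"
    using insert.prems by (auto simp: has_gradient_def)
  have sF2: "subexp (insert i I) (\<lambda>x. (F x)\<^sup>2)" and sD2: "\<And>k. k \<in> insert i I \<Longrightarrow> subexp (insert i I) (\<lambda>x. (D k x)\<^sup>2)"
    using sF sD by auto
  define m where "m x = (\<integral>y. F (x(i := y)) \<partial>?N)" for x
  define n where "n y = (\<integral>x. F (x(i := y)) \<partial>?P)" for y
  define A where "A = (\<integral>x. (F x)\<^sup>2 \<partial>std_gauss (insert i I))"
  define e where "e = (\<integral>x. F x \<partial>std_gauss (insert i I))"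
  have sm: "subexp I m" unfolding m_def by (rule subexp_coordinate_integral[OF fin sF])
  have nm [measurable]: "n \<in> borel_measurable borel" unfolding n_def by (rule other_integral_measurable[OF fin sF])
  obtain Cn an where nb: "\<And>y. \<bar>n y\<bar> \<le> Cn * exp (an * \<bar>y\<bar>)"
    using other_integral_bound[OF fin sF] unfolding n_def by blast
  have sn: "subexp (insert i I) (\<lambda>x. n (x i))"
  proof (rule subexpI)
    show "\<bar>n (x i)\<bar> \<le> \<bar>Cn\<bar> * exp (\<bar>an\<bar> * (\<Sum>j\<in>insert i I. \<bar>x j\<bar>))" for x :: "_ \<Rightarrow> real"
    proof (rule order_trans[OF nb])
      have "\<bar>x i\<bar> \<le> (\<Sum>j\<in>insert i I. \<bar>x j\<bar>)" using fin by (intro member_le_sum) auto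
      then show "Cn * exp (an * \<bar>x i\<bar>) \<le> \<bar>Cn\<bar> * exp (\<bar>an\<bar> * (\<Sum>j\<in>insert i I. \<bar>x j\<bar>))"
        by (intro mult_mono) (auto intro!: mult_mono)
    qed
  qed measurable
  have in2: "integrable ?N (\<lambda>y. (n y)\<^sup>2)"
  proof (rule integrable_std_normal_growth)
    show "\<bar>(n y)\<^sup>2\<bar> \<le> Cn\<^sup>2 * exp ((2 * an) * \<bar>y\<bar>)" for y
      using power_mono[OF nb[of y] abs_ge_zero, of 2] by (simp add: power_mult_distrib exp_double[symmetric] mult_ac)
  qed measurable
  have e1: "e = (\<integral>x. m x \<partial>?P)" unfolding e_def m_def by (rule integral_std_gauss_insert[OF fin sF])
  have e2: "e = (\<integral>y. n y \<partial>?N)" unfolding e_def n_def by (rule integral_std_gauss_insert_rev[OF fin sF])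
  have int: "integrable ?N (\<lambda>y. \<integral>x. H (x(i := y)) \<partial>?P)" if "subexp (insert i I) H" for H
  proof -
    obtain C a where "\<And>y. \<bar>\<integral>x. H (x(i := y)) \<partial>?P\<bar> \<le> C * exp (a * \<bar>y\<bar>)"
      using other_integral_bound[OF fin \<open>subexp (insert i I) H\<close>] by blast
    then show ?thesis by (rule integrable_std_normal_growth[OF other_integral_measurable[OF fin \<open>subexp (insert i I) H\<close>]])
  qed
  have 1: "A - (\<integral>x. (m x)\<^sup>2 \<partial>?P) \<le> (\<integral>x. (D i x)\<^sup>2 \<partial>std_gauss (insert i I))"
  proof -
    have "(\<integral>y. (F (x(i := y)))\<^sup>2 \<partial>?N) - (m x)\<^sup>2 \<le> (\<integral>y. (D i (x(i := y)))\<^sup>2 \<partial>?N)" if x: "x \<in> space ?P" for x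
      unfolding m_def
    proof (rule std_normal_poincare)
      show "((\<lambda>y. F (x(i := y))) has_real_derivative D i (x(i := y))) (at y)" "isCont (\<lambda>y. D i (x(i := y))) y" for y
        using insert.prems by (auto simp: has_gradient_def)
    qed (use coordinate_integrable[OF fin _ x] sF sF2 sD2[of i] in auto)
    then have "(\<integral>x. (\<integral>y. (F (x(i := y)))\<^sup>2 \<partial>?N) - (m x)\<^sup>2 \<partial>?P) \<le> (\<integral>x. (\<integral>y. (D i (x(i := y)))\<^sup>2 \<partial>?N) \<partial>?P)"
      using sF2 sD2[of i] sm fin
      by (intro integral_mono) (auto intro!: Bochner_Integration.integrable_diff subexp_integrable subexp_coordinate_integral)
    then show ?thesis
      unfolding A_def integral_std_gauss_insert[OF fin sF2] integral_std_gauss_insert[OF fin sD2[of i, simplified]]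
      using subexp_integrable[OF fin(1) subexp_coordinate_integral[OF fin sF2]] subexp_integrable[OF fin(1) subexp_power[OF sm, of 2]]
      by simp
  qed
  have 2: "A - (\<integral>y. (n y)\<^sup>2 \<partial>?N) \<le> (\<Sum>k\<in>I. \<integral>x. (D k x)\<^sup>2 \<partial>std_gauss (insert i I))"
  proof -
    have "(\<integral>x. (F (x(i := y)))\<^sup>2 \<partial>?P) - (n y)\<^sup>2 \<le> (\<Sum>k\<in>I. \<integral>x. (D k (x(i := y)))\<^sup>2 \<partial>?P)" for y
      unfolding n_def by (rule insert.IH[OF has_gradient_section[OF fin insert.prems]])
    then have "(\<integral>y. (\<integral>x. (F (x(i := y)))\<^sup>2 \<partial>?P) - (n y)\<^sup>2 \<partial>?N) \<le> (\<integral>y. (\<Sum>k\<in>I. \<integral>x. (D k (x(i := y)))\<^sup>2 \<partial>?P) \<partial>?N)"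
      using int[OF sF2] int[OF sD2] in2 by (intro integral_mono) auto
    also have "\<dots> = (\<Sum>k\<in>I. \<integral>x. (D k x)\<^sup>2 \<partial>std_gauss (insert i I))"
      using int[OF sD2] by (subst Bochner_Integration.integral_sum)
        (auto intro!: sum.cong simp: integral_std_gauss_insert_rev[OF fin sD2])
    finally show ?thesis
      unfolding A_def integral_std_gauss_insert_rev[OF fin sF2] using int[OF sF2] in2 by simp
  qed
  \<comment> \<open>As e is the mean of n, the number m x - e is the mean of F - n over coordinate
    i. Jensen bounds its square, and exchanging the integrals turns the result into the conditional
    variance of F given coordinate i.\<close>
  have 3: "(\<integral>x. (m x)\<^sup>2 \<partial>?P) - e\<^sup>2 \<le> A - (\<integral>y. (n y)\<^sup>2 \<partial>?N)"
  proof -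
    let ?H = "\<lambda>x. (F x - n (x i))\<^sup>2"
    have sH: "subexp (insert i I) ?H" "subexp (insert i I) (\<lambda>x. F x - n (x i))" using sF sn by auto
    have "(m x - e)\<^sup>2 \<le> (\<integral>y. (F (x(i := y)) - n y)\<^sup>2 \<partial>?N)" if x: "x \<in> space ?P" for x
    proof -
      have i: "integrable ?N (\<lambda>y. F (x(i := y)))" "integrable ?N (\<lambda>y. F (x(i := y)) - n y)"
        "integrable ?N (\<lambda>y. (F (x(i := y)) - n y)\<^sup>2)"
        using coordinate_integrable[OF fin sF x] coordinate_integrable[OF fin sH(2) x] coordinate_integrable[OF fin sH(1) x] by auto
      have "integrable ?N n" using Bochner_Integration.integrable_diff[OF i(1,2)] by simp
      then have "m x - e = (\<integral>y. F (x(i := y)) - n y \<partial>?N)" unfolding m_def e2 using i(1) by simp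
      also have "\<dots>\<^sup>2 \<le> (\<integral>y. (F (x(i := y)) - n y)\<^sup>2 \<partial>?N)"
        using N.variance_positive[of "\<lambda>y. F (x(i := y)) - n y"] N.variance_eq[OF i(2,3)] by simp
      finally show ?thesis .
    qed
    then have "(\<integral>x. (m x - e)\<^sup>2 \<partial>?P) \<le> (\<integral>x. \<integral>y. (F (x(i := y)) - n y)\<^sup>2 \<partial>?N \<partial>?P)"
      using sm subexp_power[OF subexp_diff[OF sm subexp_const], of e 2] subexp_coordinate_integral[OF fin sH(1)] fin
      by (intro integral_mono subexp_integrable) auto
    also have "\<dots> = (\<integral>x. ?H x \<partial>std_gauss (insert i I))"
      using integral_std_gauss_insert[OF fin sH(1)] by simp
    also have "\<dots> = (\<integral>y. \<integral>x. (F (x(i := y)) - n y)\<^sup>2 \<partial>?P \<partial>?N)"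
      using integral_std_gauss_insert_rev[OF fin sH(1)] by simp
    also have "\<dots> = (\<integral>y. (\<integral>x. (F (x(i := y)))\<^sup>2 \<partial>?P) - (n y)\<^sup>2 \<partial>?N)"
    proof (intro Bochner_Integration.integral_cong refl)
      fix y
      have i: "integrable ?P (\<lambda>x. F (x(i := y)))" "integrable ?P (\<lambda>x. (F (x(i := y)))\<^sup>2)"
        using subexp_integrable[OF fin(1) subexp_section[OF fin sF]] subexp_integrable[OF fin(1) subexp_section[OF fin sF2]] by auto
      show "(\<integral>x. (F (x(i := y)) - n y)\<^sup>2 \<partial>?P) = (\<integral>x. (F (x(i := y)))\<^sup>2 \<partial>?P) - (n y)\<^sup>2"
        unfolding n_def using P.variance_eq[OF i] .
    qed
    also have "\<dots> = A - (\<integral>y. (n y)\<^sup>2 \<partial>?N)"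
      unfolding A_def integral_std_gauss_insert_rev[OF fin sF2] using int[OF sF2] in2 by simp
    finally have "(\<integral>x. (m x - e)\<^sup>2 \<partial>?P) \<le> A - (\<integral>y. (n y)\<^sup>2 \<partial>?N)" .
    moreover have "(\<integral>x. (m x - e)\<^sup>2 \<partial>?P) = (\<integral>x. (m x)\<^sup>2 \<partial>?P) - e\<^sup>2"
      unfolding e1 using sm fin by (intro P.variance_eq subexp_integrable) auto
    ultimately show ?thesis by simp
  qed
  have "(\<Sum>k\<in>insert i I. \<integral>x. (D k x)\<^sup>2 \<partial>std_gauss (insert i I)) =
    (\<integral>x. (D i x)\<^sup>2 \<partial>std_gauss (insert i I)) + (\<Sum>k\<in>I. \<integral>x. (D k x)\<^sup>2 \<partial>std_gauss (insert i I))"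
    using fin by simp
  then show ?case using 1 2 3 unfolding A_def e_def by linarith
qed

section \<open>Concentration of exponentials and moments of linear forms\<close>

lemma exp_le_1_plus_2x: "0 \<le> x \<Longrightarrow> x \<le> 1 \<Longrightarrow> exp x \<le> 1 + 2 * (x::real)"
  using exp_bound[of x] mult_left_le[of x x] unfolding power2_eq_square by linarith

text \<open>Both \<open>H\<close> and \<open>exp (H / 2)\<close> are within \<open>2 a\<close> (relatively, for the latter) of their means at a common
  point; this is how the exponential moment gets compared with the exponential of the mean.\<close>

lemma (in prob_space) exp_concentration:
  fixes H :: "'a \<Rightarrow> real"
  assumes [measurable]: "random_variable borel H"
    and bd: "\<And>x. \<bar>H x\<bar> \<le> B"
    and a: "0 < a" "a \<le> 1 / 10"
    and h: "h = expectation H"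
    and V1: "expectation (\<lambda>x. (H x)\<^sup>2) - h\<^sup>2 \<le> a ^ 4"
    and V2: "expectation (\<lambda>x. exp (H x)) - (expectation (\<lambda>x. exp (H x / 2)))\<^sup>2 \<le> a ^ 4 * expectation (\<lambda>x. exp (H x))"
  shows "expectation (\<lambda>x. \<bar>exp (H x) - exp h\<bar>) \<le> 30 * a * exp h"
proof -
  have eb: "exp (H x) \<le> exp B" "exp (H x / 2) \<le> exp (B / 2)" for x
    using bd[of x] by auto
  define Y where "Y x = exp (H x / 2)" for x
  define A where "A = expectation Y"
  have [measurable]: "random_variable borel Y" unfolding Y_def by measurable
  have Y2: "(Y x)\<^sup>2 = exp (H x)" for x by (simp add: Y_def exp_double[symmetric])
  have iH: "integrable M H" "integrable M (\<lambda>x. (H x)\<^sup>2)"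
    by (rule integrable_const_bound[where B = B], use bd in simp, simp)
      (rule integrable_const_bound[where B = "B\<^sup>2"], use power_mono[OF bd abs_ge_zero, where n = 2] in simp, simp)
  have iY: "integrable M Y" "integrable M (\<lambda>x. (Y x)\<^sup>2)"
    by (rule integrable_const_bound[where B = "exp (B / 2)"], use eb in \<open>simp add: Y_def\<close>, simp)
      (rule integrable_const_bound[where B = "exp B"], use eb in \<open>simp add: Y2\<close>, simp)
  have "exp (- B / 2) \<le> A"
  proof -
    have "exp (- B / 2) \<le> Y x" for x using bd[of x] by (simp add: abs_le_iff Y_def)
    then show ?thesis unfolding A_def using iY(1) by (intro integral_ge_const AE_I2) auto
  qed
  then have A: "A > 0" by (meson exp_gt_zero order_less_le_trans)
  define E2 where "E2 = expectation (\<lambda>x. (Y x)\<^sup>2)"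
  have a4: "a ^ 4 \<le> 1 / 2" and a2: "a\<^sup>2 \<le> a" "a ^ 4 \<le> a\<^sup>2"
    using a power_mono[of a "1/10" 4] power_decreasing[of 1 2 a] power_decreasing[of 2 4 a] by (auto simp: power_divide)
  have E2nn: "E2 \<ge> 0" unfolding E2_def by simp
  have "E2 - A\<^sup>2 \<le> a ^ 4 * E2" using V2 unfolding E2_def A_def Y_def by (simp add: exp_double[symmetric])
  also have "\<dots> \<le> 1 / 2 * E2" using a4 E2nn by (rule mult_right_mono)
  finally have E2: "E2 \<le> 2 * A\<^sup>2" by simp
  have VY: "expectation (\<lambda>x. (Y x - A)\<^sup>2) \<le> 2 * a ^ 4 * A\<^sup>2"
  proof -
    have "expectation (\<lambda>x. (Y x - A)\<^sup>2) = E2 - A\<^sup>2" unfolding A_def E2_def using iY by (rule variance_eq)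
    also have "\<dots> \<le> a ^ 4 * E2" by fact
    also have "\<dots> \<le> a ^ 4 * (2 * A\<^sup>2)" using E2 by (intro mult_left_mono) auto
    finally show ?thesis by simp
  qed
  have VH: "expectation (\<lambda>x. (H x - h)\<^sup>2) \<le> a ^ 4" unfolding h using variance_eq[OF iH] V1 h by simp
  have iYA: "integrable M (\<lambda>x. (Y x - A)\<^sup>2)" "integrable M (\<lambda>x. (H x - h)\<^sup>2)"
    unfolding power2_diff using iH iY by auto
  \<comment> \<open>The mean of this sum is below 1, so one point satisfies both deviation bounds
    simultaneously.\<close>
  obtain w where w: "(Y w - A)\<^sup>2 / (4 * a\<^sup>2 * A\<^sup>2) + (H w - h)\<^sup>2 / (4 * a\<^sup>2) < 1"
  proof (rule ccontr)
    assume "\<not> thesis"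
    then have "1 \<le> (Y w - A)\<^sup>2 / (4 * a\<^sup>2 * A\<^sup>2) + (H w - h)\<^sup>2 / (4 * a\<^sup>2)" for w
      using that by (meson not_less)
    then have "1 \<le> expectation (\<lambda>w. (Y w - A)\<^sup>2 / (4 * a\<^sup>2 * A\<^sup>2) + (H w - h)\<^sup>2 / (4 * a\<^sup>2))"
      using iYA by (intro integral_ge_const) auto
    also have "\<dots> = expectation (\<lambda>x. (Y x - A)\<^sup>2) / (4 * a\<^sup>2 * A\<^sup>2) + expectation (\<lambda>x. (H x - h)\<^sup>2) / (4 * a\<^sup>2)"
      using iYA by simp
    also have "\<dots> \<le> (2 * a ^ 4 * A\<^sup>2) / (4 * a\<^sup>2 * A\<^sup>2) + a ^ 4 / (4 * a\<^sup>2)"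
      using VY VH a A by (intro add_mono divide_right_mono) auto
    also have "\<dots> = 3 / 4 * a\<^sup>2"
      using a A by (simp add: field_simps power2_eq_square power4_eq_xxxx)
    also have "\<dots> < 1" using a a2 by linarith
    finally show False by simp
  qed
  have "(Y w - A)\<^sup>2 / (4 * a\<^sup>2 * A\<^sup>2) < 1" "(H w - h)\<^sup>2 / (4 * a\<^sup>2) < 1"
    using w by (smt (verit) zero_le_power2 divide_nonneg_nonneg mult_nonneg_nonneg)+
  then have "(Y w - A)\<^sup>2 < (2 * a * A)\<^sup>2" "(H w - h)\<^sup>2 < (2 * a)\<^sup>2"
    using a A by (auto simp: power_mult_distrib field_simps)
  then have Yw: "\<bar>Y w - A\<bar> < 2 * a * A" and Hw: "\<bar>H w - h\<bar> < 2 * a"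
    using a A by (auto intro: power2_less_imp_less simp: power2_less_imp_less[of "\<bar>_\<bar>"])
  define u where "u = Y w / A - 1"
  have "u = (Y w - A) / A" using A by (simp add: u_def field_simps)
  then have u: "\<bar>u\<bar> \<le> 2 * a" using Yw A by (simp add: abs_divide divide_le_eq)
  have lnu: "\<bar>ln (1 + u)\<bar> \<le> 4 * a"
  proof -
    have "\<bar>ln (1 + u) - u\<bar> \<le> 2 * u\<^sup>2" using u a by (intro abs_ln_one_plus_x_minus_x_bound) auto
    moreover have "2 * u\<^sup>2 \<le> \<bar>u\<bar>"
      using u a mult_left_mono[of "\<bar>u\<bar>" "1/2" "\<bar>u\<bar>"] by (simp add: power2_eq_square abs_mult_self_eq flip: abs_mult)
    ultimately show ?thesis using u by linarith
  qed
  have "ln (Y w) = ln A + ln (1 + u)"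
    using A by (subst ln_mult_pos[symmetric]) (auto simp: u_def Y_def)
  \<comment> \<open>Since 2 ln (Y w) = H w, the difference is H w - h - 2 ln (1 + u), at most 2 a +
    2 * 4 a in modulus. This is what ties the mean of exp (H / 2) to the exponential of the mean of
    H.\<close>
  then have d: "\<bar>2 * ln A - h\<bar> \<le> 10 * a"
    using lnu Hw unfolding Y_def by simp
  define d where "d = 2 * ln A - h"
  have A2: "A\<^sup>2 = exp h * exp d"
    using A by (simp add: d_def exp_add[symmetric] exp_double)
  have d1: "\<bar>d\<bar> \<le> 1" "\<bar>d\<bar> \<le> 10 * a" using d a by (auto simp: d_def)
  have ed: "\<bar>exp d - 1\<bar> \<le> 2 * \<bar>d\<bar>"
  proof (cases "d \<ge> 0")
    case True then show ?thesis using exp_le_1_plus_2x[of d] d1 exp_ge_add_one_self[of d] by simp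
  next
    case False
    then have "exp d \<le> 1" by simp
    then show ?thesis using exp_ge_add_one_self[of d] False by linarith
  qed
  have AA: "\<bar>A\<^sup>2 - exp h\<bar> \<le> 20 * a * exp h"
  proof -
    have "A\<^sup>2 - exp h = exp h * (exp d - 1)" unfolding A2 by (simp add: right_diff_distrib)
    then have "\<bar>A\<^sup>2 - exp h\<bar> = exp h * \<bar>exp d - 1\<bar>" by (simp add: abs_mult)
    also have "\<dots> \<le> exp h * (20 * a)" using ed d1 by (intro mult_left_mono) auto
    finally show ?thesis by (simp add: mult.commute)
  qed
  moreover have "20 * a * exp h \<le> 2 * exp h" using a by (intro mult_right_mono) auto
  ultimately have A3: "A\<^sup>2 \<le> 3 * exp h" by linarith
  have sq: "\<bar>p\<^sup>2 + 2 * u * v\<bar> \<le> p\<^sup>2 + (u\<^sup>2 + v\<^sup>2)" for p u v :: real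
    using sum_squares_bound[of u v] sum_squares_bound[of "- u" v] zero_le_power2[of p]
    unfolding abs_le_iff by (simp, linarith)
  have "expectation (\<lambda>x. \<bar>exp (H x) - exp h\<bar>) \<le>
      expectation (\<lambda>x. (Y x - A)\<^sup>2 + ((Y x - A)\<^sup>2 / a\<^sup>2 + a\<^sup>2 * A\<^sup>2) + 20 * a * exp h)"
  proof (rule integral_mono)
    show "integrable M (\<lambda>x. \<bar>exp (H x) - exp h\<bar>)" using iY(2) unfolding Y2 by auto
    show "integrable M (\<lambda>x. (Y x - A)\<^sup>2 + ((Y x - A)\<^sup>2 / a\<^sup>2 + a\<^sup>2 * A\<^sup>2) + 20 * a * exp h)" using iYA by auto
    fix x
    have "\<bar>exp (H x) - exp h\<bar> \<le> \<bar>(Y x)\<^sup>2 - A\<^sup>2\<bar> + \<bar>A\<^sup>2 - exp h\<bar>" unfolding Y2 by simp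
    also have "(Y x)\<^sup>2 - A\<^sup>2 = (Y x - A)\<^sup>2 + 2 * (Y x - A) * A"
      by (simp add: power2_eq_square algebra_simps)
    \<comment> \<open>The weights 1 / a and a balance the two squares: the variance of Y is of order
      a^4 A^2, so both become of order a^2 A^2.\<close>
    also have "2 * (Y x - A) * A = 2 * ((Y x - A) / a) * (a * A)"
      using a by simp
    also have "\<bar>(Y x - A)\<^sup>2 + 2 * ((Y x - A) / a) * (a * A)\<bar> \<le> (Y x - A)\<^sup>2 + (((Y x - A) / a)\<^sup>2 + (a * A)\<^sup>2)"
      by (rule sq)
    finally show "\<bar>exp (H x) - exp h\<bar> \<le> (Y x - A)\<^sup>2 + ((Y x - A)\<^sup>2 / a\<^sup>2 + a\<^sup>2 * A\<^sup>2) + 20 * a * exp h"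
      using AA by (simp add: power_divide power_mult_distrib)
  qed
  also have "\<dots> = expectation (\<lambda>x. (Y x - A)\<^sup>2) + expectation (\<lambda>x. (Y x - A)\<^sup>2) / a\<^sup>2 + a\<^sup>2 * A\<^sup>2 + 20 * a * exp h"
    using iYA by (simp add: prob_space)
  also have "\<dots> \<le> 2 * a ^ 4 * A\<^sup>2 + 2 * a ^ 4 * A\<^sup>2 / a\<^sup>2 + a\<^sup>2 * A\<^sup>2 + 20 * a * exp h"
    using VY by (intro add_mono divide_right_mono) auto
  also have "\<dots> = (2 * a ^ 4 + 3 * a\<^sup>2) * A\<^sup>2 + 20 * a * exp h"
    using a by (simp add: field_simps power2_eq_square power4_eq_xxxx)
  also have "\<dots> \<le> (5 * a\<^sup>2) * (3 * exp h) + 20 * a * exp h"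
    using A3 a2 a by (intro add_mono mult_mono) auto
  also have "\<dots> \<le> (10 * a) * exp h + 20 * a * exp h"
  proof -
    have "15 * a\<^sup>2 \<le> 10 * a" using a mult_left_mono[of a "1/10" a] by (simp add: power2_eq_square)
    from mult_right_mono[OF this, of "exp h"] show ?thesis by simp
  qed
  finally show ?thesis by simp
qed

section \<open>Exponential moments, moments and tails of linear forms\<close>

definition lin_form :: "'i set \<Rightarrow> ('i \<Rightarrow> real) \<Rightarrow> ('i \<Rightarrow> real) \<Rightarrow> real" where
  "lin_form I m y = (\<Sum>k\<in>I. m k * y k)"

lemma subexp_lin_form [intro]: "finite I \<Longrightarrow> subexp I (lin_form I m)"
  unfolding lin_form_def [abs_def] by (intro subexp_sum subexp_mult subexp_const subexp_component) auto

lemma lin_form_deriv [derivative_intros]: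
  assumes "finite I" "k \<in> I"
  shows "((\<lambda>u. lin_form I m (x(k := u))) has_real_derivative m k) (at u)"
proof -
  have "lin_form I m (x(k := u)) = m k * u + (\<Sum>j\<in>I - {k}. m j * x j)" for u
    unfolding lin_form_def using assms by (subst sum.remove[of _ k]) (auto intro!: sum.cong)
  then show ?thesis by (auto intro!: derivative_eq_intros)
qed

lemma exp_lin_form:
  assumes "finite I"
  shows integrable_exp_lin_form: "integrable (std_gauss I) (\<lambda>y. exp (c * lin_form I m y))"
    and integral_exp_lin_form: "(\<integral>y. exp (c * lin_form I m y) \<partial>std_gauss I) = exp (c\<^sup>2 * (\<Sum>k\<in>I. (m k)\<^sup>2) / 2)"
proof -
  interpret N: product_sigma_finite "\<lambda>_. std_normal" by (rule product_sigma_finite_std_normal)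
  have e: "exp (c * lin_form I m y) = (\<Prod>k\<in>I. exp ((c * m k) * y k))" for y
    using assms by (simp add: lin_form_def sum_distrib_left exp_sum mult.assoc)
  show "integrable (std_gauss I) (\<lambda>y. exp (c * lin_form I m y))"
    unfolding e std_gauss_def using assms by (intro N.product_integrable_prod integrable_exp_std_normal)
  have "(\<integral>y. exp (c * lin_form I m y) \<partial>std_gauss I) = (\<Prod>k\<in>I. \<integral>x. exp ((c * m k) * x) \<partial>std_normal)"
    unfolding e std_gauss_def using assms by (intro N.product_integral_prod integrable_exp_std_normal)
  also have "\<dots> = exp (\<Sum>k\<in>I. (c * m k)\<^sup>2 / 2)"
    using assms by (simp only: integral_exp_std_normal exp_sum)
  also have "(\<Sum>k\<in>I. (c * m k)\<^sup>2 / 2) = c\<^sup>2 * (\<Sum>k\<in>I. (m k)\<^sup>2) / 2"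
    by (simp add: sum_divide_distrib sum_distrib_left power_mult_distrib)
  finally show "(\<integral>y. exp (c * lin_form I m y) \<partial>std_gauss I) = exp (c\<^sup>2 * (\<Sum>k\<in>I. (m k)\<^sup>2) / 2)" .
qed

text \<open>One exponential moment at the scale \<open>s\<close> controls all even moments and the
  tail. The constant comes from 2 exp (1/2) \<le> 4.\<close>

lemma exp_abs_lin_form:
  assumes "finite I" "s > 0" "(\<Sum>k\<in>I. (m k)\<^sup>2) \<le> s\<^sup>2"
  shows "integrable (std_gauss I) (\<lambda>y. exp (\<bar>lin_form I m y\<bar> / s))"
    and "(\<integral>y. exp (\<bar>lin_form I m y\<bar> / s) \<partial>std_gauss I) \<le> 4"
proof -
  note [measurable] = subexp_measurable[OF subexp_lin_form[OF assms(1), of m]]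
  let ?b = "\<lambda>y. exp (1 / s * lin_form I m y) + exp (- 1 / s * lin_form I m y)"
  have b: "exp (\<bar>lin_form I m y\<bar> / s) \<le> ?b y" for y
    using exp_abs_le[of "1 / s" "lin_form I m y"] by simp
  have i: "integrable (std_gauss I) ?b"
    using assms by (intro Bochner_Integration.integrable_add integrable_exp_lin_form)
  show 1: "integrable (std_gauss I) (\<lambda>y. exp (\<bar>lin_form I m y\<bar> / s))"
    by (rule Bochner_Integration.integrable_bound[OF i]) (use b in \<open>auto simp: add_nonneg_nonneg intro!: AE_I2\<close>)
  have "(\<integral>y. exp (\<bar>lin_form I m y\<bar> / s) \<partial>std_gauss I) \<le> (\<integral>y. ?b y \<partial>std_gauss I)"
    by (rule integral_mono[OF 1 i b])
  also have "\<dots> = 2 * exp ((1 / s)\<^sup>2 * (\<Sum>k\<in>I. (m k)\<^sup>2) / 2)"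
    using assms integrable_exp_lin_form[OF assms(1), of "1 / s" m] integrable_exp_lin_form[OF assms(1), of "- 1 / s" m]
    by (subst Bochner_Integration.integral_add) (auto simp only: integral_exp_lin_form, auto)
  also have "\<dots> \<le> 2 * exp (1 / 2)"
    using assms by (auto simp: power_divide field_simps)
  also have "\<dots> \<le> 4" using exp_le_1_plus_2x[of "1/2"] by simp
  finally show "(\<integral>y. exp (\<bar>lin_form I m y\<bar> / s) \<partial>std_gauss I) \<le> 4" .
qed

lemma power_le_fact_exp: "0 \<le> x \<Longrightarrow> x ^ p \<le> fact p * exp (x::real)"
proof -
  assume x: "0 \<le> x"
  have "(\<Sum>k\<in>{p}. inverse (fact k) *\<^sub>R x ^ k) \<le> exp x"
    unfolding exp_def using x by (intro sum_le_suminf summable_exp_generic) auto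
  then show ?thesis by (simp add: field_simps)
qed

lemma lin_form_moment:
  assumes "finite I" "s > 0" "(\<Sum>k\<in>I. (m k)\<^sup>2) \<le> s\<^sup>2"
  shows "(\<integral>y. lin_form I m y ^ (2 * p) \<partial>std_gauss I) \<le> 4 * fact (2 * p) * s ^ (2 * p)"
proof -
  note e = exp_abs_lin_form[OF assms]
  have "(\<integral>y. lin_form I m y ^ (2 * p) \<partial>std_gauss I) \<le> (\<integral>y. s ^ (2 * p) * (fact (2 * p) * exp (\<bar>lin_form I m y\<bar> / s)) \<partial>std_gauss I)"
  proof (rule integral_mono)
    show "integrable (std_gauss I) (\<lambda>y. lin_form I m y ^ (2 * p))"
      using assms by (intro subexp_integrable subexp_power subexp_lin_form)
    fix y
    have "lin_form I m y ^ (2 * p) = s ^ (2 * p) * (\<bar>lin_form I m y\<bar> / s) ^ (2 * p)"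
      using assms by (simp add: power_divide power_mult)
    also have "\<dots> \<le> s ^ (2 * p) * (fact (2 * p) * exp (\<bar>lin_form I m y\<bar> / s))"
      using assms by (intro mult_left_mono power_le_fact_exp) auto
    finally show "lin_form I m y ^ (2 * p) \<le> s ^ (2 * p) * (fact (2 * p) * exp (\<bar>lin_form I m y\<bar> / s))" .
  qed (use e in auto)
  also have "\<dots> = s ^ (2 * p) * (fact (2 * p) * (\<integral>y. exp (\<bar>lin_form I m y\<bar> / s) \<partial>std_gauss I))" by simp
  also have "\<dots> \<le> s ^ (2 * p) * (fact (2 * p) * 4)"
    using e assms by (intro mult_left_mono) auto
  finally show ?thesis by (simp add: mult_ac)
qed

text \<open>Markov's inequality for exp (|X| / s). The decay is exponential in r / s instead of
  Gaussian, but this ratio will be a positive power of n.\<close>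

lemma lin_form_tail:
  assumes "finite I" "s > 0" "(\<Sum>k\<in>I. (m k)\<^sup>2) \<le> s\<^sup>2"
  shows "measure (std_gauss I) {y \<in> space (std_gauss I). r < \<bar>lin_form I m y\<bar>} \<le> 4 * exp (- r / s)"
proof -
  interpret prob_space "std_gauss I" by (rule prob_space_std_gauss)
  note [measurable] = subexp_measurable[OF subexp_lin_form[OF assms(1), of m]]
  note e = exp_abs_lin_form[OF assms]
  have ms: "{y \<in> space (std_gauss I). r < \<bar>lin_form I m y\<bar>} \<in> sets (std_gauss I)" by measurable
  have "measure (std_gauss I) {y \<in> space (std_gauss I). r < \<bar>lin_form I m y\<bar>}
      = (\<integral>y. indicator {y \<in> space (std_gauss I). r < \<bar>lin_form I m y\<bar>} y \<partial>std_gauss I)"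
    by (auto intro!: arg_cong[where f = prob])
  also have "\<dots> \<le> (\<integral>y. exp (- r / s) * exp (\<bar>lin_form I m y\<bar> / s) \<partial>std_gauss I)"
  proof (rule integral_mono)
    fix y
    show "indicator {y \<in> space (std_gauss I). r < \<bar>lin_form I m y\<bar>} y \<le> exp (- r / s) * exp (\<bar>lin_form I m y\<bar> / s)"
      using assms by (auto simp: indicator_def exp_add[symmetric] diff_divide_distrib[symmetric])
  qed (use e ms in \<open>auto simp: emeasure_eq_measure intro!: integrable_real_indicator\<close>)
  also have "\<dots> \<le> exp (- r / s) * 4" using e(2) by simp
  finally show ?thesis by (simp add: mult.commute)
qed

section \<open>Quartic forms\<close>

lemmas subexp_intros = subexp_const subexp_component subexp_add subexp_diff subexp_mult subexp_power subexp_sum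
  subexp_abs

section \<open>Calculus of gradients\<close>

lemma has_gradientI:
  assumes "subexp I F" "\<And>k. k \<in> I \<Longrightarrow> subexp I (D k)"
    "\<And>k x u. k \<in> I \<Longrightarrow> ((\<lambda>u. F (x(k := u))) has_real_derivative D k (x(k := u))) (at u)"
    "\<And>k x u. k \<in> I \<Longrightarrow> isCont (\<lambda>u. D k (x(k := u))) u"
  shows "has_gradient I F D"
  using assms unfolding has_gradient_def by blast

lemma has_gradient_subexp: "has_gradient I F D \<Longrightarrow> subexp I F" "has_gradient I F D \<Longrightarrow> k \<in> I \<Longrightarrow> subexp I (D k)"
  and has_gradient_deriv: "has_gradient I F D \<Longrightarrow> k \<in> I \<Longrightarrow> ((\<lambda>u. F (x(k := u))) has_real_derivative D k (x(k := u))) (at u)"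
  and has_gradient_deriv_isCont: "has_gradient I F D \<Longrightarrow> k \<in> I \<Longrightarrow> isCont (\<lambda>u. D k (x(k := u))) u"
  by (auto simp: has_gradient_def)

lemma has_gradient_isCont: "has_gradient I F D \<Longrightarrow> k \<in> I \<Longrightarrow> isCont (\<lambda>u. F (x(k := u))) u"
  by (rule DERIV_isCont[OF has_gradient_deriv])

lemma has_gradient_lin_form [intro]:
  "finite I \<Longrightarrow> has_gradient I (lin_form I m) (\<lambda>k _. m k)"
  by (rule has_gradientI) (auto intro: lin_form_deriv)

lemma has_gradient_const [intro]: "has_gradient I (\<lambda>_. c) (\<lambda>_ _. 0)"
  by (rule has_gradientI) auto

lemma has_gradient_mult [intro]:
  assumes F: "has_gradient I F D" and G: "has_gradient I G D'"
  shows "has_gradient I (\<lambda>x. F x * G x) (\<lambda>k x. D k x * G x + D' k x * F x)"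
proof (rule has_gradientI)
  fix k x u assume k: "k \<in> I"
  show "subexp I (\<lambda>x. D k x * G x + D' k x * F x)"
    by (intro subexp_add subexp_mult has_gradient_subexp(1)[OF F] has_gradient_subexp(1)[OF G]
        has_gradient_subexp(2)[OF F k] has_gradient_subexp(2)[OF G k])
  show "((\<lambda>u. F (x(k := u)) * G (x(k := u))) has_real_derivative
      D k (x(k := u)) * G (x(k := u)) + D' k (x(k := u)) * F (x(k := u))) (at u)"
    by (rule DERIV_mult[OF has_gradient_deriv[OF F k] has_gradient_deriv[OF G k]])
  show "isCont (\<lambda>u. D k (x(k := u)) * G (x(k := u)) + D' k (x(k := u)) * F (x(k := u))) u"
    by (rule isCont_add[OF isCont_mult[OF has_gradient_deriv_isCont[OF F k] has_gradient_isCont[OF G k]]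
          isCont_mult[OF has_gradient_deriv_isCont[OF G k] has_gradient_isCont[OF F k]]])
qed (intro subexp_mult has_gradient_subexp(1)[OF F] has_gradient_subexp(1)[OF G])

lemma has_gradient_add [intro]:
  assumes F: "has_gradient I F D" and G: "has_gradient I G D'"
  shows "has_gradient I (\<lambda>x. F x + G x) (\<lambda>k x. D k x + D' k x)"
proof (rule has_gradientI)
  fix k x u assume k: "k \<in> I"
  show "subexp I (\<lambda>x. D k x + D' k x)"
    by (intro subexp_add has_gradient_subexp(2)[OF F k] has_gradient_subexp(2)[OF G k])
  show "((\<lambda>u. F (x(k := u)) + G (x(k := u))) has_real_derivative D k (x(k := u)) + D' k (x(k := u))) (at u)"
    by (rule DERIV_add[OF has_gradient_deriv[OF F k] has_gradient_deriv[OF G k]])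
  show "isCont (\<lambda>u. D k (x(k := u)) + D' k (x(k := u))) u"
    by (rule isCont_add[OF has_gradient_deriv_isCont[OF F k] has_gradient_deriv_isCont[OF G k]])
qed (intro subexp_add has_gradient_subexp(1)[OF F] has_gradient_subexp(1)[OF G])

lemma has_gradient_cmult [intro]:
  assumes F: "has_gradient I F D"
  shows "has_gradient I (\<lambda>x. c * F x) (\<lambda>k x. c * D k x)"
  using has_gradient_mult[OF has_gradient_const[of I c] F] by (simp add: mult.commute)

lemma has_gradient_sum [intro]:
  "(\<And>j. j \<in> J \<Longrightarrow> has_gradient I (F j) (D j)) \<Longrightarrow> has_gradient I (\<lambda>x. \<Sum>j\<in>J. F j x) (\<lambda>k x. \<Sum>j\<in>J. D j k x)"
proof (induction J rule: infinite_finite_induct)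
  case (insert j J)
  then have "has_gradient I (\<lambda>x. F j x + (\<Sum>j\<in>J. F j x)) (\<lambda>k x. D j k x + (\<Sum>j\<in>J. D j k x))" by auto
  then show ?case using insert by simp
qed auto

lemma has_gradient_compose:
  assumes F: "has_gradient I F D" and p: "\<And>x. (p has_real_derivative p' x) (at x)" "\<And>x. isCont p' x"
    and s: "subexp I (\<lambda>x. p (F x))" "subexp I (\<lambda>x. p' (F x))"
  shows "has_gradient I (\<lambda>x. p (F x)) (\<lambda>k x. p' (F x) * D k x)"
proof (rule has_gradientI)
  fix k x u assume k: "k \<in> I"
  show "((\<lambda>u. p (F (x(k := u)))) has_real_derivative p' (F (x(k := u))) * D k (x(k := u))) (at u)"
    by (rule DERIV_chain2[OF p(1) has_gradient_deriv[OF F k]])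
  show "isCont (\<lambda>u. p' (F (x(k := u))) * D k (x(k := u))) u"
    by (intro continuous_intros isCont_o2[OF has_gradient_isCont[OF F k] p(2)] has_gradient_deriv_isCont[OF F k])
qed (use s has_gradient_subexp[OF F] in auto)

lemma has_gradient_power:
  assumes F: "has_gradient I F D"
  shows "has_gradient I (\<lambda>x. F x ^ p) (\<lambda>k x. real p * F x ^ (p - 1) * D k x)"
proof (rule has_gradient_compose[OF F, where p = "\<lambda>x. x ^ p" and p' = "\<lambda>x. real p * x ^ (p - 1)"])
  show "((\<lambda>x. x ^ p) has_real_derivative real p * x ^ (p - 1)) (at x)" for x :: real
    using DERIV_pow[of p x] by simp
  show "isCont (\<lambda>x. real p * x ^ (p - 1)) x" for x :: real by (intro continuous_intros)
qed (intro subexp_mult subexp_const subexp_power has_gradient_subexp(1)[OF F])+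

lemma bounded_subexp:
  assumes "subexp I F" "continuous_on UNIV p" "\<And>x. \<bar>p x\<bar> \<le> B"
  shows "subexp I (\<lambda>x. p (F x))"
  by (rule subexp_bounded[where C = B])
     (use assms in \<open>auto intro: borel_measurable_continuous_on subexp_measurable\<close>)

text \<open>Differentiation under the integral sign. The pointwise error of the linear approximation
  is at most h^2 (f x)^2, so a finite second moment V makes the difference quotient converge with
  error |h| V.\<close>

lemma integral_cos_deriv:
  fixes M :: "'a measure" and f :: "'a \<Rightarrow> real"
  assumes P: "prob_space M" and [measurable]: "f \<in> borel_measurable M"
    and i: "integrable M f" "integrable M (\<lambda>x. (f x)\<^sup>2)"
  shows "((\<lambda>s. \<integral>x. cos (s * f x + c) \<partial>M) has_real_derivative - (\<integral>x. f x * sin (s * f x + c) \<partial>M)) (at s)"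
proof -
  interpret prob_space M by fact
  define V where "V = (\<integral>x. (f x)\<^sup>2 \<partial>M)"
  have ic: "integrable M (\<lambda>x. cos (s * f x + c))" for s
    by (rule integrable_const_bound[where B = 1]) auto
  have isn: "integrable M (\<lambda>x. f x * sin (s * f x + c))" for s
    by (rule Bochner_Integration.integrable_bound[OF i(1)]) (auto simp: abs_mult intro!: AE_I2 mult_left_le)
  have pt: "\<bar>cos (b + h) - cos b + h * sin b\<bar> \<le> h\<^sup>2" for b h :: real
  proof -
    have "\<bar>cos h - 1\<bar> \<le> h\<^sup>2 / 2" "\<bar>sin h - h\<bar> \<le> h\<^sup>2 / 2"
    proof -
      let ?z = "iexp h - (1 + \<i> * h)"
      have "cmod ?z \<le> h\<^sup>2 / 2"
        using iexp_approx1[of h 1] by (simp add: power2_eq_square)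
      moreover have "Re ?z = cos h - 1" "Im ?z = sin h - h" by (simp_all add: Re_exp Im_exp)
      ultimately show "\<bar>cos h - 1\<bar> \<le> h\<^sup>2 / 2" "\<bar>sin h - h\<bar> \<le> h\<^sup>2 / 2"
        using abs_Re_le_cmod[of ?z] abs_Im_le_cmod[of ?z] by linarith+
    qed
    moreover have "\<bar>cos b * (cos h - 1)\<bar> \<le> \<bar>cos h - 1\<bar>" "\<bar>sin b * (sin h - h)\<bar> \<le> \<bar>sin h - h\<bar>"
      by (auto simp: abs_mult intro!: mult_left_le_one_le)
    moreover have "cos (b + h) - cos b + h * sin b = cos b * (cos h - 1) - sin b * (sin h - h)"
      by (simp add: cos_add algebra_simps)
    ultimately show ?thesis by linarith
  qed
  have "((\<lambda>h. ((\<integral>x. cos ((s + h) * f x + c) \<partial>M) - (\<integral>x. cos (s * f x + c) \<partial>M)) / h) \<longlongrightarrow> - (\<integral>x. f x * sin (s * f x + c) \<partial>M)) (at 0)"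
  proof (subst Lim_null, rule Lim_null_comparison)
    show "\<forall>\<^sub>F h in at 0. norm (((\<integral>x. cos ((s + h) * f x + c) \<partial>M) - (\<integral>x. cos (s * f x + c) \<partial>M)) / h - - (\<integral>x. f x * sin (s * f x + c) \<partial>M))
        \<le> \<bar>h\<bar> * V"
    proof (rule eventually_at_topological[THEN iffD2], intro exI[of _ UNIV] conjI ballI impI)
      fix h :: real assume h: "h \<noteq> 0"
      define Q where "Q = (\<integral>x. cos ((s + h) * f x + c) - cos (s * f x + c) + h * (f x * sin (s * f x + c)) \<partial>M)"
      define L where "L = ((\<integral>x. cos ((s + h) * f x + c) \<partial>M) - (\<integral>x. cos (s * f x + c) \<partial>M)) / h - - (\<integral>x. f x * sin (s * f x + c) \<partial>M)"
      have "L = Q / h"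
      proof -
        have "(\<integral>x. cos ((s + h) * f x + c) - cos (s * f x + c) + h * (f x * sin (s * f x + c)) \<partial>M)
            = (\<integral>x. cos ((s + h) * f x + c) - cos (s * f x + c) \<partial>M) + (\<integral>x. h * (f x * sin (s * f x + c)) \<partial>M)"
          by (rule Bochner_Integration.integral_add[OF Bochner_Integration.integrable_diff[OF ic ic] integrable_mult_right[OF isn]])
        also have "(\<integral>x. cos ((s + h) * f x + c) - cos (s * f x + c) \<partial>M)
            = (\<integral>x. cos ((s + h) * f x + c) \<partial>M) - (\<integral>x. cos (s * f x + c) \<partial>M)"
          by (rule Bochner_Integration.integral_diff[OF ic ic])
        also have "(\<integral>x. h * (f x * sin (s * f x + c)) \<partial>M) = h * (\<integral>x. f x * sin (s * f x + c) \<partial>M)"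
          by (rule integral_mult_right_zero)
        finally have eq: "(\<integral>x. cos ((s + h) * f x + c) - cos (s * f x + c) + h * (f x * sin (s * f x + c)) \<partial>M)
            = (\<integral>x. cos ((s + h) * f x + c) \<partial>M) - (\<integral>x. cos (s * f x + c) \<partial>M) + h * (\<integral>x. f x * sin (s * f x + c) \<partial>M)" .
        have "(p - q) / h - - d = (p - q + h * d) / h" for p q d :: real
          using h by (simp add: field_simps)
        then show ?thesis unfolding L_def Q_def eq .
      qed
      then have "\<bar>L\<bar> = \<bar>Q\<bar> / \<bar>h\<bar>" by simp
      also have "\<dots> \<le> (\<integral>x. h\<^sup>2 * (f x)\<^sup>2 \<partial>M) / \<bar>h\<bar>"
        unfolding Q_def
      proof (rule divide_right_mono[OF abs_integral_le])
        show "integrable M (\<lambda>x. cos ((s + h) * f x + c) - cos (s * f x + c) + h * (f x * sin (s * f x + c)))"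
          by (rule Bochner_Integration.integrable_add[OF Bochner_Integration.integrable_diff[OF ic ic] integrable_mult_right[OF isn]])
        show "integrable M (\<lambda>x. h\<^sup>2 * (f x)\<^sup>2)" by (rule integrable_mult_right[OF i(2)])
        fix x
        show "\<bar>cos ((s + h) * f x + c) - cos (s * f x + c) + h * (f x * sin (s * f x + c))\<bar> \<le> h\<^sup>2 * (f x)\<^sup>2"
        proof -
          have e: "s * f x + c + h * f x = (s + h) * f x + c" by (simp add: algebra_simps)
          show ?thesis
            using pt[of "s * f x + c" "h * f x"] unfolding e power_mult_distrib mult.assoc .
        qed
      qed simp
      also have "\<dots> = \<bar>h\<bar> * V" using h by (simp add: V_def power2_eq_square abs_if)
      finally show "norm (((\<integral>x. cos ((s + h) * f x + c) \<partial>M) - (\<integral>x. cos (s * f x + c) \<partial>M)) / h - - (\<integral>x. f x * sin (s * f x + c) \<partial>M))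
        \<le> \<bar>h\<bar> * V" unfolding L_def real_norm_def .
    qed auto
    show "((\<lambda>h. \<bar>h\<bar> * V) \<longlongrightarrow> 0) (at 0)"
      by (rule tendsto_mult_left_zero) (simp add: tendsto_rabs_zero_iff)
  qed
  then show ?thesis by (simp add: DERIV_def)
qed

text \<open>The forms \<open>lin_form I (m e)\<close> have variance at most s^2 each, and
  \<open>analysis\<close> is a Bessel bound for the family as a whole. The latter keeps gradients of
  sums over E free of a second factor card E. In the application E is the set of edges, s is of
  order n^(-1/2), N = n^2, and \<kappa> does not depend on n.\<close>

locale gaussian_frame =
  fixes I :: "'i set" and E :: "'e set" and m :: "'e \<Rightarrow> 'i \<Rightarrow> real" and s \<kappa> N :: real
  assumes fin: "finite I" "finite E" and s: "0 < s" and kap: "1 \<le> \<kappa>" and card: "real (card E) \<le> N"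
    and short: "\<And>e. e \<in> E \<Longrightarrow> (\<Sum>k\<in>I. (m e k)\<^sup>2) \<le> s\<^sup>2"
    and analysis: "\<And>v. (\<Sum>e\<in>E. (lin_form I (m e) v)\<^sup>2) \<le> \<kappa> * (\<Sum>k\<in>I. (v k)\<^sup>2)"
begin

abbreviation X :: "'e \<Rightarrow> ('i \<Rightarrow> real) \<Rightarrow> real" where "X e \<equiv> lin_form I (m e)"
abbreviation \<gamma> :: "('i \<Rightarrow> real) measure" where "\<gamma> \<equiv> std_gauss I"

lemma prob_gauss: "prob_space \<gamma>" by (rule prob_space_std_gauss)

lemma N_nonneg: "0 \<le> N" using card by linarith

text \<open>The adjoint of the analysis operator has the same norm.\<close>

lemma synthesis: "(\<Sum>k\<in>I. (\<Sum>e\<in>E. c e * m e k)\<^sup>2) \<le> \<kappa> * (\<Sum>e\<in>E. (c e)\<^sup>2)"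
proof -
  define v where "v k = (\<Sum>e\<in>E. c e * m e k)" for k
  define S where "S = (\<Sum>k\<in>I. (v k)\<^sup>2)"
  have "S = (\<Sum>k\<in>I. \<Sum>e\<in>E. c e * m e k * v k)"
    unfolding S_def power2_eq_square by (intro sum.cong refl, subst v_def) (simp add: sum_distrib_right)
  also have "\<dots> = (\<Sum>e\<in>E. c e * X e v)"
    by (subst sum.swap) (simp add: lin_form_def sum_distrib_left mult_ac)
  finally have "S\<^sup>2 \<le> (\<Sum>e\<in>E. (c e)\<^sup>2) * (\<Sum>e\<in>E. (X e v)\<^sup>2)"
    using Cauchy_Schwarz_ineq_sum[of c "\<lambda>e. X e v" E] by simp
  also have "\<dots> \<le> (\<Sum>e\<in>E. (c e)\<^sup>2) * (\<kappa> * S)"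
    unfolding S_def by (intro mult_left_mono analysis sum_nonneg) auto
  finally have *: "S * S \<le> (\<kappa> * (\<Sum>e\<in>E. (c e)\<^sup>2)) * S" by (simp add: power2_eq_square mult_ac)
  have "S \<ge> 0" unfolding S_def by (rule sum_nonneg) auto
  then have "S \<le> \<kappa> * (\<Sum>e\<in>E. (c e)\<^sup>2)"
  proof (cases "S = 0")
    case True
    then show ?thesis using kap by (auto intro!: mult_nonneg_nonneg sum_nonneg)
  qed (use * in auto)
  then show ?thesis unfolding S_def v_def .
qed

lemma subexp_X [intro]: "subexp I (X e)" using fin by auto

lemma moment_sum:
  shows subexp_moment_sum: "subexp I (\<lambda>y. \<Sum>e\<in>E. X e y ^ (2 * p))"
    and moment_sum_nonneg: "0 \<le> (\<integral>y. (\<Sum>e\<in>E. X e y ^ (2 * p)) \<partial>\<gamma>)"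
    and moment_sum_le: "(\<integral>y. (\<Sum>e\<in>E. X e y ^ (2 * p)) \<partial>\<gamma>) \<le> N * (4 * fact (2 * p) * s ^ (2 * p))"
proof -
  show "subexp I (\<lambda>y. \<Sum>e\<in>E. X e y ^ (2 * p))" by (intro subexp_intros subexp_X)
  show "0 \<le> (\<integral>y. (\<Sum>e\<in>E. X e y ^ (2 * p)) \<partial>\<gamma>)"
    by (intro integral_nonneg_AE AE_I2 sum_nonneg) (simp add: power_mult)
  have "(\<integral>y. (\<Sum>e\<in>E. X e y ^ (2 * p)) \<partial>\<gamma>) = (\<Sum>e\<in>E. \<integral>y. X e y ^ (2 * p) \<partial>\<gamma>)"
    using fin by (intro Bochner_Integration.integral_sum subexp_integrable) auto
  also have "\<dots> \<le> (\<Sum>e\<in>E. 4 * fact (2 * p) * s ^ (2 * p))"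
    using fin s short by (intro sum_mono lin_form_moment)
  also have "\<dots> = real (card E) * (4 * fact (2 * p) * s ^ (2 * p))" by simp
  also have "\<dots> \<le> N * (4 * fact (2 * p) * s ^ (2 * p))"
    using card s by (intro mult_right_mono) auto
  finally show "(\<integral>y. (\<Sum>e\<in>E. X e y ^ (2 * p)) \<partial>\<gamma>) \<le> N * (4 * fact (2 * p) * s ^ (2 * p))" .
qed

text \<open>The sine replaces \<open>x ^ 4\<close> by the Lipschitz function \<open>\<rho> ^ 4 sin (x / \<rho>) ^ 4\<close>: exponentials of a quartic
  form itself need not be integrable.\<close>

definition quartic :: "('e \<Rightarrow> real) \<Rightarrow> real \<Rightarrow> ('i \<Rightarrow> real) \<Rightarrow> real" where
  "quartic b \<rho> y = (\<Sum>e\<in>E. b e * (\<rho> ^ 4 * sin (X e y / \<rho>) ^ 4))"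

text \<open>The gradient is synthesised from coefficients of modulus at most 4 \<rho>^3, so its
  squared length is at most 16 \<kappa> N \<rho>^6 everywhere. A pointwise bound makes the Poincare
  inequality work for exp (H / 2) as well as for H, and these are the two variance conditions of
  \<open>exp_concentration\<close>.\<close>

lemma quartic_concentration:
  assumes b: "\<And>e. e \<in> E \<Longrightarrow> \<bar>b e\<bar> \<le> 1" and r: "\<rho> > 0"
    and a: "0 < a" "a \<le> 1 / 10" "16 * \<kappa> * N * \<rho> ^ 6 \<le> a ^ 4"
  defines "h \<equiv> \<integral>y. quartic b \<rho> y \<partial>\<gamma>"
  shows "(\<integral>y. \<bar>exp (quartic b \<rho> y) - exp h\<bar> \<partial>\<gamma>) \<le> 30 * a * exp h"
proof -
  interpret P: prob_space \<gamma> by (rule prob_gauss)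
  let ?H = "quartic b \<rho>"
  define p where "p x = \<rho> ^ 4 * sin (x / \<rho>) ^ 4" for x
  define p' where "p' x = 4 * \<rho> ^ 3 * sin (x / \<rho>) ^ 3 * cos (x / \<rho>)" for x
  define D where "D k y = (\<Sum>e\<in>E. b e * (p' (X e y) * m e k))" for k y
  have pb: "\<bar>p x\<bar> \<le> \<rho> ^ 4" "\<bar>p' x\<bar> \<le> 4 * \<rho> ^ 3" for x
  proof -
    have si: "\<bar>sin (x / \<rho>)\<bar> ^ k \<le> 1" for k by (rule power_le_one) auto
    then show "\<bar>p x\<bar> \<le> \<rho> ^ 4" "\<bar>p' x\<bar> \<le> 4 * \<rho> ^ 3"
      using r si[of 4] by (auto simp: p_def p'_def abs_mult power_abs intro!: mult_left_le mult_le_one)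
  qed
  have pd: "(p has_real_derivative p' x) (at x)" "isCont p' x" for x
    unfolding p_def [abs_def] p'_def [abs_def] using r
    by (auto intro!: derivative_eq_intros continuous_intros simp: field_simps power_numeral_reduce)
  have pc: "continuous_on UNIV p" "continuous_on UNIV p'"
    using pd by (auto simp: continuous_on_eq_continuous_at intro: DERIV_isCont)
  have g: "has_gradient I ?H D"
    unfolding quartic_def [abs_def] D_def [abs_def] p_def[symmetric] using fin
    by (intro has_gradient_sum has_gradient_cmult has_gradient_compose[OF has_gradient_lin_form pd]
        bounded_subexp[OF subexp_X pc(1) pb(1)] bounded_subexp[OF subexp_X pc(2) pb(2)])
  have Dsum: "(\<Sum>k\<in>I. (D k y)\<^sup>2) \<le> a ^ 4" for y
  proof -
    have "(\<Sum>k\<in>I. (D k y)\<^sup>2) = (\<Sum>k\<in>I. (\<Sum>e\<in>E. (b e * p' (X e y)) * m e k)\<^sup>2)"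
      by (simp add: D_def mult.assoc)
    also have "\<dots> \<le> \<kappa> * (\<Sum>e\<in>E. (b e * p' (X e y))\<^sup>2)" by (rule synthesis)
    also have "\<dots> \<le> \<kappa> * (\<Sum>e\<in>E. (4 * \<rho> ^ 3)\<^sup>2)"
    proof (intro mult_left_mono sum_mono)
      fix e assume e: "e \<in> E"
      have "\<bar>b e * p' (X e y)\<bar> \<le> 1 * (4 * \<rho> ^ 3)"
        unfolding abs_mult using b[OF e] pb by (intro mult_mono) auto
      then show "(b e * p' (X e y))\<^sup>2 \<le> (4 * \<rho> ^ 3)\<^sup>2"
        using r by (intro abs_le_square_iff[THEN iffD1]) auto
    qed (use kap in auto)
    also have "\<dots> = (\<kappa> * 16 * \<rho> ^ 6) * real (card E)" by (simp add: power_mult_distrib power_mult[symmetric])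
    also have "\<dots> \<le> (\<kappa> * 16 * \<rho> ^ 6) * N" using kap r card by (intro mult_left_mono) auto
    finally show ?thesis using a(3) by (simp add: mult_ac)
  qed
  have Hb: "\<bar>?H y\<bar> \<le> N * \<rho> ^ 4" for y
  proof -
    have "\<bar>?H y\<bar> \<le> (\<Sum>e\<in>E. \<rho> ^ 4)"
      unfolding quartic_def p_def[symmetric]
    proof (rule order_trans[OF sum_abs sum_mono])
      fix e assume "e \<in> E"
      then have "\<bar>b e * p (X e y)\<bar> \<le> 1 * \<rho> ^ 4" unfolding abs_mult using b pb by (intro mult_mono) auto
      then show "\<bar>b e * p (X e y)\<bar> \<le> \<rho> ^ 4" by simp
    qed
    also have "\<dots> \<le> N * \<rho> ^ 4" using card r by (auto intro: mult_right_mono)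
    finally show ?thesis .
  qed
  have sH: "subexp I ?H" using has_gradient_subexp(1)[OF g] .
  note [measurable] = subexp_measurable[OF sH]
  have sE: "subexp I (\<lambda>y. exp (?H y))" "subexp I (\<lambda>y. exp (?H y / 2))"
  proof -
    show "subexp I (\<lambda>y. exp (?H y))"
      by (rule subexp_bounded[where C = "exp (N * \<rho> ^ 4)"], measurable) (use Hb in \<open>auto simp: abs_le_iff\<close>)
    show "subexp I (\<lambda>y. exp (?H y / 2))"
      by (rule subexp_bounded[where C = "exp (N * \<rho> ^ 4 / 2)"], measurable) (use Hb in \<open>auto simp: abs_le_iff\<close>)
  qed
  have sD: "subexp I (D k)" if "k \<in> I" for k using has_gradient_subexp(2)[OF g that] .
  show ?thesis
  proof (rule P.exp_concentration[OF _ Hb a(1,2)])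
    show "h = P.expectation ?H" by (simp add: h_def)
    have "P.expectation (\<lambda>y. (?H y)\<^sup>2) - h\<^sup>2 \<le> (\<Sum>k\<in>I. P.expectation (\<lambda>y. (D k y)\<^sup>2))"
      unfolding h_def by (rule std_gauss_poincare[OF fin(1) g])
    also have "\<dots> = P.expectation (\<lambda>y. \<Sum>k\<in>I. (D k y)\<^sup>2)"
      using sD fin by (intro Bochner_Integration.integral_sum[symmetric] subexp_integrable subexp_power) auto
    also have "\<dots> \<le> P.expectation (\<lambda>y. a ^ 4)"
      using sD fin Dsum by (intro integral_mono subexp_integrable subexp_intros) auto
    finally show "P.expectation (\<lambda>y. (?H y)\<^sup>2) - h\<^sup>2 \<le> a ^ 4" by (simp add: P.prob_space)
    have gE: "has_gradient I (\<lambda>y. exp (?H y / 2)) (\<lambda>k y. (exp (?H y / 2) / 2) * D k y)"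
      by (rule has_gradient_compose[OF g, where p = "\<lambda>x. exp (x / 2)"])
         (use sE in \<open>auto intro!: derivative_eq_intros continuous_intros subexp_mult[OF _ subexp_const, of _ _ "1/2", simplified]\<close>)
    have "P.expectation (\<lambda>y. (exp (?H y / 2))\<^sup>2) - (P.expectation (\<lambda>y. exp (?H y / 2)))\<^sup>2
        \<le> (\<Sum>k\<in>I. P.expectation (\<lambda>y. ((exp (?H y / 2) / 2) * D k y)\<^sup>2))"
      by (rule std_gauss_poincare[OF fin(1) gE])
    also have "\<dots> = P.expectation (\<lambda>y. \<Sum>k\<in>I. ((exp (?H y / 2) / 2) * D k y)\<^sup>2)"
      using has_gradient_subexp(2)[OF gE] fin
      by (intro Bochner_Integration.integral_sum[symmetric] subexp_integrable subexp_power) auto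
    also have "\<dots> \<le> P.expectation (\<lambda>y. a ^ 4 * exp (?H y))"
    proof (intro integral_mono)
      show "integrable \<gamma> (\<lambda>y. \<Sum>k\<in>I. ((exp (?H y / 2) / 2) * D k y)\<^sup>2)"
        using has_gradient_subexp(2)[OF gE] fin by (intro subexp_integrable subexp_sum subexp_power) auto
      show "integrable \<gamma> (\<lambda>y. a ^ 4 * exp (?H y))" using sE fin by (intro subexp_integrable) auto
      fix y
      have "(\<Sum>k\<in>I. ((exp (?H y / 2) / 2) * D k y)\<^sup>2) = exp (?H y) / 4 * (\<Sum>k\<in>I. (D k y)\<^sup>2)"
        by (simp add: power_mult_distrib power_divide exp_double[symmetric] sum_distrib_left)
      also have "\<dots> \<le> exp (?H y) / 4 * a ^ 4" using Dsum by (intro mult_left_mono) auto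
      also have "\<dots> \<le> a ^ 4 * exp (?H y)" by simp
      finally show "(\<Sum>k\<in>I. ((exp (?H y / 2) / 2) * D k y)\<^sup>2) \<le> a ^ 4 * exp (?H y)" .
    qed
    finally show "P.expectation (\<lambda>y. exp (?H y)) - (P.expectation (\<lambda>y. exp (?H y / 2)))\<^sup>2 \<le> a ^ 4 * P.expectation (\<lambda>y. exp (?H y))"
      by (simp add: exp_double[symmetric])
  qed measurable
qed

text \<open>A difference of squares: u^2 - (sin u)^2 \<le> u^4 / 2 by the expansion of cos (2 u),
  and the other factor is at most 2 u^2.\<close>

lemma sin_pow4_approx: "\<bar>u ^ 4 - sin u ^ 4\<bar> \<le> u ^ 6" for u :: real
proof -
  have 1: "(sin u)\<^sup>2 \<le> u\<^sup>2" using abs_sin_x_le_abs_x[of u] by (simp add: abs_le_square_iff)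
  have 2: "u\<^sup>2 - (sin u)\<^sup>2 \<le> u ^ 4 / 2"
  proof -
    have "cos (2 * u) \<le> 1 - (2 * u)\<^sup>2 / 2 + (2 * u) ^ 4 / 24"
    proof -
      obtain t where t: "cos (2 * u) = (\<Sum>k<4. cos_coeff k * (2 * u) ^ k) + cos (t + 1 / 2 * real 4 * pi) / fact 4 * (2 * u) ^ 4"
        using Maclaurin_cos_expansion[of "2 * u" 4] by blast
      have "(\<Sum>k<4. cos_coeff k * (2 * u) ^ k) = 1 - (2 * u)\<^sup>2 / 2"
        by (simp add: cos_coeff_def lessThan_nat_numeral fact_numeral)
      moreover have "cos (t + 1 / 2 * real 4 * pi) / fact 4 * (2 * u) ^ 4 \<le> 1 / fact 4 * (2 * u) ^ 4"
        by (intro mult_right_mono divide_right_mono cos_le_one) auto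
      ultimately show ?thesis unfolding t by (simp add: fact_numeral)
    qed
    then have "1 - cos (2 * u) \<ge> 2 * u\<^sup>2 - 2 / 3 * u ^ 4" by (simp add: power_mult_distrib)
    moreover have "1 - cos (2 * u) = 2 * (sin u)\<^sup>2" by (simp add: cos_double_sin)
    moreover have "0 \<le> u ^ 4" by simp
    ultimately show ?thesis by linarith
  qed
  have "u ^ 4 - sin u ^ 4 = (u\<^sup>2 - (sin u)\<^sup>2) * (u\<^sup>2 + (sin u)\<^sup>2)" by (simp add: algebra_simps power2_eq_square power4_eq_xxxx)
  moreover have "(u\<^sup>2 - (sin u)\<^sup>2) * (u\<^sup>2 + (sin u)\<^sup>2) \<le> (u ^ 4 / 2) * (2 * u\<^sup>2)"
    using 1 2 by (intro mult_mono) auto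
  moreover have "(u\<^sup>2 - (sin u)\<^sup>2) * (u\<^sup>2 + (sin u)\<^sup>2) \<ge> 0" using 1 by (intro mult_nonneg_nonneg) auto
  ultimately show ?thesis by (simp add: power_add[symmetric])
qed

lemma quartic_approx:
  assumes b: "\<And>e. e \<in> E \<Longrightarrow> \<bar>b e\<bar> \<le> 1" and r: "\<rho> > 0"
  shows "\<bar>(\<Sum>e\<in>E. b e * X e y ^ 4) - quartic b \<rho> y\<bar> \<le> (\<Sum>e\<in>E. X e y ^ 6) / \<rho>\<^sup>2"
proof -
  have "(\<Sum>e\<in>E. b e * X e y ^ 4) - quartic b \<rho> y = (\<Sum>e\<in>E. b e * (\<rho> ^ 4 * ((X e y / \<rho>) ^ 4 - sin (X e y / \<rho>) ^ 4)))"
    using r by (simp add: quartic_def sum_subtractf[symmetric] right_diff_distrib power_divide)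
  also have "\<bar>\<dots>\<bar> \<le> (\<Sum>e\<in>E. X e y ^ 6 / \<rho>\<^sup>2)"
  proof (rule order_trans[OF sum_abs sum_mono])
    fix e assume e: "e \<in> E"
    have "\<bar>b e * (\<rho> ^ 4 * ((X e y / \<rho>) ^ 4 - sin (X e y / \<rho>) ^ 4))\<bar> \<le> 1 * (\<rho> ^ 4 * (X e y / \<rho>) ^ 6)"
      unfolding abs_mult using b[OF e] r sin_pow4_approx[of "X e y / \<rho>"] by (intro mult_mono) auto
    also have "\<dots> = X e y ^ 6 / \<rho>\<^sup>2" using r by (simp add: power_divide field_simps power_add[symmetric])
    finally show "\<bar>b e * (\<rho> ^ 4 * ((X e y / \<rho>) ^ 4 - sin (X e y / \<rho>) ^ 4))\<bar> \<le> X e y ^ 6 / \<rho>\<^sup>2" .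
  qed
  finally show ?thesis by (simp add: sum_divide_distrib)
qed

text \<open>The constants are those of the moment bound, 96 = 4 * 4! and 2880 = 4 * 6!; the sixth
  moment enters through \<open>quartic_approx\<close>.\<close>

lemma quartic_mean:
  assumes b: "\<And>e. e \<in> E \<Longrightarrow> \<bar>b e\<bar> \<le> 1" and r: "\<rho> > 0"
  shows "\<bar>(\<integral>y. (\<Sum>e\<in>E. b e * X e y ^ 4) \<partial>\<gamma>)\<bar> \<le> 96 * N * s ^ 4"
    and "\<bar>(\<integral>y. (\<Sum>e\<in>E. b e * X e y ^ 4) \<partial>\<gamma>) - (\<integral>y. quartic b \<rho> y \<partial>\<gamma>)\<bar> \<le> 2880 * N * s ^ 6 / \<rho>\<^sup>2"
proof -
  have s4: "subexp I (\<lambda>y. (\<Sum>e\<in>E. b e * X e y ^ 4))" by (intro subexp_intros subexp_X)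
  have s1: "sin x ^ 4 \<le> 1" for x :: real using power_le_one[of "\<bar>sin x\<bar>" 4] by simp
  have sq: "subexp I (quartic b \<rho>)"
  proof (rule subexp_bounded)
    show "quartic b \<rho> \<in> borel_measurable (lebesgue_prod I)"
      unfolding quartic_def [abs_def] using subexp_measurable[OF subexp_X] by measurable
    show "\<bar>quartic b \<rho> y\<bar> \<le> (\<Sum>e\<in>E. \<bar>b e\<bar> * (\<rho> ^ 4 * 1))" for y
      unfolding quartic_def using r
      by (intro order_trans[OF sum_abs sum_mono]) (auto simp: abs_mult power_abs s1 intro!: mult_left_mono mult_left_le)
  qed
  have "\<bar>(\<integral>y. (\<Sum>e\<in>E. b e * X e y ^ 4) \<partial>\<gamma>)\<bar> \<le> (\<integral>y. (\<Sum>e\<in>E. X e y ^ (2 * 2)) \<partial>\<gamma>)"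
  proof (rule abs_integral_le)
    fix y
    show "\<bar>\<Sum>e\<in>E. b e * X e y ^ 4\<bar> \<le> (\<Sum>e\<in>E. X e y ^ (2 * 2))"
      using b by (intro order_trans[OF sum_abs sum_mono]) (auto simp: abs_mult intro!: mult_left_le_one_le)
  qed (use subexp_integrable[OF fin(1) s4] subexp_integrable[OF fin(1) subexp_moment_sum[of 2]] in auto)
  also note moment_sum_le[of 2]
  finally show "\<bar>(\<integral>y. (\<Sum>e\<in>E. b e * X e y ^ 4) \<partial>\<gamma>)\<bar> \<le> 96 * N * s ^ 4"
    by (simp add: fact_numeral)
  have "\<bar>(\<integral>y. (\<Sum>e\<in>E. b e * X e y ^ 4) \<partial>\<gamma>) - (\<integral>y. quartic b \<rho> y \<partial>\<gamma>)\<bar>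
      = \<bar>(\<integral>y. (\<Sum>e\<in>E. b e * X e y ^ 4) - quartic b \<rho> y \<partial>\<gamma>)\<bar>"
    using subexp_integrable[OF fin(1) s4] subexp_integrable[OF fin(1) sq] by simp
  also have "\<dots> \<le> (\<integral>y. (\<Sum>e\<in>E. X e y ^ (2 * 3)) / \<rho>\<^sup>2 \<partial>\<gamma>)"
    using subexp_integrable[OF fin(1) s4] subexp_integrable[OF fin(1) sq] subexp_integrable[OF fin(1) subexp_moment_sum[of 3]]
      quartic_approx[OF b r] by (intro abs_integral_le) auto
  also have "\<dots> = (\<integral>y. (\<Sum>e\<in>E. X e y ^ (2 * 3)) \<partial>\<gamma>) / \<rho>\<^sup>2" by simp
  also have "\<dots> \<le> N * (4 * fact (2 * 3) * s ^ (2 * 3)) / \<rho>\<^sup>2"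
    by (intro divide_right_mono moment_sum_le) auto
  finally show "\<bar>(\<integral>y. (\<Sum>e\<in>E. b e * X e y ^ 4) \<partial>\<gamma>) - (\<integral>y. quartic b \<rho> y \<partial>\<gamma>)\<bar> \<le> 2880 * N * s ^ 6 / \<rho>\<^sup>2"
    by (simp add: fact_numeral mult_ac)
qed

end

section \<open>Cubic forms\<close>

lemma integral_double_sum:
  fixes F :: "'a \<Rightarrow> 'b \<Rightarrow> 'c \<Rightarrow> real"
  assumes "\<And>e k. e \<in> A \<Longrightarrow> k \<in> B \<Longrightarrow> integrable M (F e k)"
  shows "(\<integral>y. (\<Sum>e\<in>A. \<Sum>k\<in>B. c e k * F e k y) \<partial>M) = (\<Sum>e\<in>A. \<Sum>k\<in>B. c e k * (\<integral>y. F e k y \<partial>M))"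
  using assms by (simp add: Bochner_Integration.integral_sum)

context gaussian_frame
begin

text \<open>\<open>Gam\<close> is the function \<open>\<Gamma>\<close> with \<open>\<integral> f \<phi>(f) = \<integral> \<Gamma> \<phi>'(f)\<close> for the cubic form \<open>f\<close>; the vector
  \<open>lap_grad\<close> is the gradient of the Laplacian of \<open>f\<close>, which is a linear form.\<close>

context
  fixes a :: "'e \<Rightarrow> real"
  assumes a: "\<And>e. e \<in> E \<Longrightarrow> \<bar>a e\<bar> \<le> 1"
begin

definition cubic :: "('i \<Rightarrow> real) \<Rightarrow> real" where
  "cubic y = 1/6 * (\<Sum>e\<in>E. a e * X e y ^ 3)"

definition cubic_grad :: "'i \<Rightarrow> ('i \<Rightarrow> real) \<Rightarrow> real" where
  "cubic_grad k y = (\<Sum>e\<in>E. a e / 2 * (X e y)\<^sup>2 * m e k)"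

definition lap_grad :: "'i \<Rightarrow> real" where
  "lap_grad k = (\<Sum>e\<in>E. a e * (\<Sum>j\<in>I. (m e j)\<^sup>2) * m e k)"

definition Gam :: "('i \<Rightarrow> real) \<Rightarrow> real" where
  "Gam y = 1/3 * (\<Sum>k\<in>I. (cubic_grad k y + lap_grad k) * cubic_grad k y)"

lemma has_gradient_cubic: "has_gradient I cubic cubic_grad"
proof -
  have "has_gradient I cubic (\<lambda>k y. 1/6 * (\<Sum>e\<in>E. a e * (real 3 * X e y ^ (3 - 1) * m e k)))"
    unfolding cubic_def [abs_def] using fin
    by (intro has_gradient_cmult has_gradient_sum has_gradient_power has_gradient_lin_form)
  also have "(\<lambda>k y. 1/6 * (\<Sum>e\<in>E. a e * (real 3 * X e y ^ (3 - 1) * m e k))) = cubic_grad"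
    by (auto simp: cubic_grad_def fun_eq_iff sum_distrib_left intro!: sum.cong)
  finally show ?thesis .
qed

lemma has_gradient_cubic_grad:
  "has_gradient I (cubic_grad k) (\<lambda>l y. \<Sum>e\<in>E. a e * X e y * m e l * m e k)"
proof -
  have "has_gradient I (\<lambda>y. \<Sum>e\<in>E. (a e / 2 * m e k) * (X e y)\<^sup>2)
      (\<lambda>l y. \<Sum>e\<in>E. (a e / 2 * m e k) * (real 2 * X e y ^ (2 - 1) * m e l))"
    using fin by (intro has_gradient_cmult has_gradient_sum has_gradient_power has_gradient_lin_form)
  moreover have "(\<lambda>y. \<Sum>e\<in>E. (a e / 2 * m e k) * (X e y)\<^sup>2) = cubic_grad k"
    by (auto simp: cubic_grad_def fun_eq_iff mult_ac)
  moreover have "(\<lambda>l y. \<Sum>e\<in>E. (a e / 2 * m e k) * (real 2 * X e y ^ (2 - 1) * m e l)) = (\<lambda>l y. \<Sum>e\<in>E. a e * X e y * m e l * m e k)"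
    by (auto simp: fun_eq_iff mult_ac)
  ultimately show ?thesis by simp
qed

lemma subexp_cubic: "subexp I cubic" and subexp_cubic_grad: "subexp I (cubic_grad k)" and subexp_Gam: "subexp I Gam"
proof -
  show 1: "subexp I cubic" by (rule has_gradient_subexp(1)[OF has_gradient_cubic])
  show 2: "subexp I (cubic_grad k)" for k by (rule has_gradient_subexp(1)[OF has_gradient_cubic_grad])
  show "subexp I Gam" unfolding Gam_def [abs_def] by (intro subexp_intros 2)
qed

text \<open>Euler's identity 3 f = sum of y_k D_k f. Integrating by parts in y_k leaves the
  Laplacian of f times p(f) and the squared gradient times p'(f). The Laplacian is linear in y with
  coefficients \<open>lap_grad\<close>, so a second integration by parts turns the first term into
  the derivative form too.\<close>

lemma cubic_ibp:
  assumes p: "\<And>x. (p has_real_derivative p' x) (at x)" "\<And>x. isCont p' x"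
    and sp: "subexp I (\<lambda>y. p (cubic y))" "subexp I (\<lambda>y. p' (cubic y))"
  shows "(\<integral>y. cubic y * p (cubic y) \<partial>\<gamma>) = (\<integral>y. Gam y * p' (cubic y) \<partial>\<gamma>)"
proof -
  let ?p = "\<lambda>y. p (cubic y)" and ?p' = "\<lambda>y. p' (cubic y)"
  have gp: "has_gradient I ?p (\<lambda>k y. ?p' y * cubic_grad k y)"
    by (rule has_gradient_compose[OF has_gradient_cubic p sp])
  have gX: "has_gradient I (\<lambda>y. (X e y)\<^sup>2 * ?p y) (\<lambda>k y. (real 2 * X e y ^ (2 - 1) * m e k) * ?p y + (?p' y * cubic_grad k y) * (X e y)\<^sup>2)" for e
    using fin by (intro has_gradient_mult gp has_gradient_power has_gradient_lin_form)
  have int: "integrable \<gamma> F" if "subexp I F" for F by (rule subexp_integrable[OF fin(1) that])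
  note ss = subexp_intros subexp_X sp subexp_cubic_grad subexp_cubic
  have "(\<integral>y. cubic y * p (cubic y) \<partial>\<gamma>) = (\<integral>y. (\<Sum>e\<in>E. \<Sum>k\<in>I. (a e / 6 * m e k) * (y k * ((X e y)\<^sup>2 * ?p y))) \<partial>\<gamma>)"
  proof (intro Bochner_Integration.integral_cong refl)
    fix y
    have "X e y ^ 3 = (\<Sum>k\<in>I. m e k * y k) * (X e y)\<^sup>2" for e
      by (simp add: lin_form_def power3_eq_cube power2_eq_square)
    then show "cubic y * ?p y = (\<Sum>e\<in>E. \<Sum>k\<in>I. (a e / 6 * m e k) * (y k * ((X e y)\<^sup>2 * ?p y)))"
      unfolding cubic_def by (simp add: sum_distrib_left sum_distrib_right mult_ac)
  qed
  also have "\<dots> = (\<Sum>e\<in>E. \<Sum>k\<in>I. (a e / 6 * m e k) * (\<integral>y. y k * ((X e y)\<^sup>2 * ?p y) \<partial>\<gamma>))"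
  proof -
    have i: "integrable \<gamma> (\<lambda>y. y k * ((X e y)\<^sup>2 * ?p y))" if "k \<in> I" for e k
      using that fin by (intro int subexp_mult[OF subexp_component] subexp_mult[OF subexp_power[OF subexp_X] sp(1)])
    show ?thesis by (rule integral_double_sum) (rule i)
  qed
  also have "\<dots> = (\<Sum>e\<in>E. \<Sum>k\<in>I. (a e / 6 * m e k) * (\<integral>y. (real 2 * X e y ^ (2 - 1) * m e k) * ?p y + (?p' y * cubic_grad k y) * (X e y)\<^sup>2 \<partial>\<gamma>))"
    by (intro sum.cong refl arg_cong2[where f = "(*)"] std_gauss_ibp[OF fin(1) _ gX])
  also have "\<dots> = (\<integral>y. (\<Sum>e\<in>E. \<Sum>k\<in>I. (a e / 6 * m e k) * ((real 2 * X e y ^ (2 - 1) * m e k) * ?p y + (?p' y * cubic_grad k y) * (X e y)\<^sup>2)) \<partial>\<gamma>)"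
  proof -
    have i: "integrable \<gamma> (\<lambda>y. (real 2 * X e y ^ (2 - 1) * m e k) * ?p y + (?p' y * cubic_grad k y) * (X e y)\<^sup>2)" if "k \<in> I" for e k
      using has_gradient_subexp(2)[OF gX that] by (rule int)
    show ?thesis by (rule integral_double_sum[symmetric]) (rule i)
  qed
  also have "\<dots> = (\<integral>y. 1/3 * (\<Sum>k\<in>I. lap_grad k * (y k * ?p y)) + 1/3 * (\<Sum>k\<in>I. cubic_grad k y * cubic_grad k y * ?p' y) \<partial>\<gamma>)"
  proof (intro Bochner_Integration.integral_cong refl)
    fix y
    have 1: "(\<Sum>k\<in>I. cubic_grad k y * cubic_grad k y * ?p' y) = (\<Sum>e\<in>E. \<Sum>k\<in>I. (a e / 2 * m e k) * ((?p' y * cubic_grad k y) * (X e y)\<^sup>2))"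
      by (subst sum.swap, intro sum.cong refl, subst (2) cubic_grad_def)
         (simp add: sum_distrib_left sum_distrib_right mult_ac)
    have "(\<Sum>k\<in>I. lap_grad k * (y k * ?p y)) = (\<Sum>e\<in>E. a e * (\<Sum>j\<in>I. (m e j)\<^sup>2) * X e y * ?p y)"
    proof -
      define c where "c e = (\<Sum>j\<in>I. (m e j)\<^sup>2)" for e
      show ?thesis
        unfolding lap_grad_def c_def[symmetric]
        by (simp add: sum_distrib_right, subst sum.swap) (simp add: lin_form_def sum_distrib_left sum_distrib_right mult_ac)
    qed
    also have "\<dots> = (\<Sum>e\<in>E. \<Sum>k\<in>I. (a e * m e k) * (X e y * m e k * ?p y))"
      by (intro sum.cong refl) (simp add: sum_distrib_left sum_distrib_right power2_eq_square mult_ac)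
    finally have 2: "(\<Sum>k\<in>I. lap_grad k * (y k * ?p y)) = (\<Sum>e\<in>E. \<Sum>k\<in>I. (a e * m e k) * (X e y * m e k * ?p y))" .
    show "(\<Sum>e\<in>E. \<Sum>k\<in>I. (a e / 6 * m e k) * ((real 2 * X e y ^ (2 - 1) * m e k) * ?p y + (?p' y * cubic_grad k y) * (X e y)\<^sup>2))
      = 1/3 * (\<Sum>k\<in>I. lap_grad k * (y k * ?p y)) + 1/3 * (\<Sum>k\<in>I. cubic_grad k y * cubic_grad k y * ?p' y)"
      unfolding 1 2 sum_distrib_left sum.distrib[symmetric] by (intro sum.cong refl) (simp add: algebra_simps)
  qed
  also have "\<dots> = 1/3 * (\<Sum>k\<in>I. lap_grad k * (\<integral>y. y k * ?p y \<partial>\<gamma>)) + 1/3 * (\<Sum>k\<in>I. \<integral>y. cubic_grad k y * cubic_grad k y * ?p' y \<partial>\<gamma>)"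
  proof -
    have i: "integrable \<gamma> (\<lambda>y. y k * ?p y)" if "k \<in> I" for k
      by (rule int[OF subexp_mult[OF subexp_component[OF fin(1) that] sp(1)]])
    have i': "integrable \<gamma> (\<lambda>y. cubic_grad k y * cubic_grad k y * ?p' y)" for k
      by (rule int[OF subexp_mult[OF subexp_mult[OF subexp_cubic_grad subexp_cubic_grad] sp(2)]])
    have "(\<integral>y. 1/3 * (\<Sum>k\<in>I. lap_grad k * (y k * ?p y)) + 1/3 * (\<Sum>k\<in>I. cubic_grad k y * cubic_grad k y * ?p' y) \<partial>\<gamma>)
        = 1/3 * (\<integral>y. (\<Sum>k\<in>I. lap_grad k * (y k * ?p y)) \<partial>\<gamma>) + 1/3 * (\<integral>y. (\<Sum>k\<in>I. cubic_grad k y * cubic_grad k y * ?p' y) \<partial>\<gamma>)"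
      using i i' by (subst Bochner_Integration.integral_add) (auto intro!: Bochner_Integration.integrable_sum)
    then show ?thesis
      using i i' by (simp add: Bochner_Integration.integral_sum)
  qed
  also have "\<dots> = 1/3 * (\<Sum>k\<in>I. lap_grad k * (\<integral>y. ?p' y * cubic_grad k y \<partial>\<gamma>)) + 1/3 * (\<Sum>k\<in>I. \<integral>y. cubic_grad k y * cubic_grad k y * ?p' y \<partial>\<gamma>)"
    using std_gauss_ibp[OF fin(1) _ gp] by simp
  also have "\<dots> = (\<integral>y. Gam y * ?p' y \<partial>\<gamma>)"
  proof -
    have i: "integrable \<gamma> (\<lambda>y. ?p' y * cubic_grad k y)" "integrable \<gamma> (\<lambda>y. cubic_grad k y * cubic_grad k y * ?p' y)" for k
      by (intro int subexp_mult sp subexp_cubic_grad)+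
    have "(\<integral>y. Gam y * ?p' y \<partial>\<gamma>) = (\<integral>y. 1/3 * (\<Sum>k\<in>I. lap_grad k * (?p' y * cubic_grad k y)) + 1/3 * (\<Sum>k\<in>I. cubic_grad k y * cubic_grad k y * ?p' y) \<partial>\<gamma>)"
      unfolding Gam_def
      by (intro Bochner_Integration.integral_cong refl)
         (simp add: sum_distrib_left sum_distrib_right sum.distrib[symmetric] algebra_simps)
    also have "\<dots> = 1/3 * (\<integral>y. (\<Sum>k\<in>I. lap_grad k * (?p' y * cubic_grad k y)) \<partial>\<gamma>) + 1/3 * (\<integral>y. (\<Sum>k\<in>I. cubic_grad k y * cubic_grad k y * ?p' y) \<partial>\<gamma>)"
      using i by (subst Bochner_Integration.integral_add) (auto intro!: Bochner_Integration.integrable_sum)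
    finally show ?thesis
      using i by (simp add: Bochner_Integration.integral_sum)
  qed
  finally show ?thesis .
qed

definition cubic_var :: real where "cubic_var = (\<integral>y. (cubic y)\<^sup>2 \<partial>\<gamma>)"

text \<open>The case of the identity function in \<open>cubic_ibp\<close>.\<close>

lemma cubic_var_eq: "cubic_var = (\<integral>y. Gam y \<partial>\<gamma>)"
  using cubic_ibp[of "\<lambda>x. x" "\<lambda>_. 1"] subexp_cubic by (auto simp: cubic_var_def power2_eq_square)

lemma grad_sums:
  shows grad_sum: "(\<Sum>k\<in>I. (cubic_grad k y)\<^sup>2) \<le> \<kappa> * (\<Sum>e\<in>E. X e y ^ 4)"
    and lap_sum: "(\<Sum>k\<in>I. (lap_grad k)\<^sup>2) \<le> \<kappa> * N * s ^ 4"
proof -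
  have a2: "(a e)\<^sup>2 \<le> 1" if "e \<in> E" for e using a[OF that] by (simp add: abs_square_le_1)
  have "(\<Sum>k\<in>I. (cubic_grad k y)\<^sup>2) \<le> \<kappa> * (\<Sum>e\<in>E. (a e / 2 * (X e y)\<^sup>2)\<^sup>2)"
    unfolding cubic_grad_def by (rule synthesis)
  also have "\<dots> \<le> \<kappa> * (\<Sum>e\<in>E. X e y ^ 4)"
  proof (intro mult_left_mono sum_mono)
    fix e assume e: "e \<in> E"
    have "(a e / 2 * (X e y)\<^sup>2)\<^sup>2 = ((a e)\<^sup>2 / 4) * X e y ^ 4" by (simp add: power_mult_distrib power_divide flip: power_mult)
    also have "\<dots> \<le> 1 * X e y ^ 4" using a2[OF e] by (intro mult_right_mono) auto
    finally show "(a e / 2 * (X e y)\<^sup>2)\<^sup>2 \<le> X e y ^ 4" by simp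
  qed (use kap in auto)
  finally show "(\<Sum>k\<in>I. (cubic_grad k y)\<^sup>2) \<le> \<kappa> * (\<Sum>e\<in>E. X e y ^ 4)" .
  have "(\<Sum>k\<in>I. (lap_grad k)\<^sup>2) \<le> \<kappa> * (\<Sum>e\<in>E. (a e * (\<Sum>j\<in>I. (m e j)\<^sup>2))\<^sup>2)"
    unfolding lap_grad_def by (rule synthesis)
  also have "\<dots> \<le> \<kappa> * (\<Sum>e\<in>E. s ^ 4)"
  proof (intro mult_left_mono sum_mono)
    fix e assume e: "e \<in> E"
    have "(a e * (\<Sum>j\<in>I. (m e j)\<^sup>2))\<^sup>2 = (a e)\<^sup>2 * (\<Sum>j\<in>I. (m e j)\<^sup>2)\<^sup>2" by (simp add: power_mult_distrib)
    also have "\<dots> \<le> 1 * (s\<^sup>2)\<^sup>2" using a2[OF e] short[OF e]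
      by (intro mult_mono power_mono sum_nonneg) (auto intro: sum_nonneg)
    finally show "(a e * (\<Sum>j\<in>I. (m e j)\<^sup>2))\<^sup>2 \<le> s ^ 4" by (simp flip: power_mult)
  qed (use kap in auto)
  also have "\<dots> = \<kappa> * s ^ 4 * real (card E)" by simp
  also have "\<dots> \<le> \<kappa> * s ^ 4 * N" using kap card by (intro mult_left_mono) auto
  finally show "(\<Sum>k\<in>I. (lap_grad k)\<^sup>2) \<le> \<kappa> * N * s ^ 4" by (simp add: mult_ac)
qed

text \<open>Three times \<open>Gam\<close> is at most twice the squared gradient plus the squared
  length of \<open>lap_grad\<close>; in the mean this gives 4 * 4! + 1 = 97, rounded to 100. The
  order is N s^4, hence a constant in the application.\<close>

lemma cubic_var_le: "cubic_var \<le> 100 * \<kappa> * N * s ^ 4"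
proof -
  interpret P: prob_space \<gamma> by (rule prob_gauss)
  have "Gam y \<le> \<kappa> * (\<Sum>e\<in>E. X e y ^ (2 * 2)) + \<kappa> * N * s ^ 4" for y
  proof -
    have "(\<Sum>k\<in>I. (cubic_grad k y + lap_grad k) * cubic_grad k y) \<le> (\<Sum>k\<in>I. 2 * (cubic_grad k y)\<^sup>2 + (lap_grad k)\<^sup>2)"
    proof (rule sum_mono)
      fix k
      show "(cubic_grad k y + lap_grad k) * cubic_grad k y \<le> 2 * (cubic_grad k y)\<^sup>2 + (lap_grad k)\<^sup>2"
      proof -
        have "(cubic_grad k y + lap_grad k) * cubic_grad k y = (cubic_grad k y)\<^sup>2 + lap_grad k * cubic_grad k y"
          "(cubic_grad k y / 2 - lap_grad k)\<^sup>2 = (cubic_grad k y)\<^sup>2 / 4 - lap_grad k * cubic_grad k y + (lap_grad k)\<^sup>2"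
          by (simp_all add: power2_eq_square field_simps)
        then show ?thesis
          using zero_le_power2[of "cubic_grad k y / 2 - lap_grad k"] zero_le_power2[of "cubic_grad k y"] by linarith
      qed
    qed
    also have "\<dots> = 2 * (\<Sum>k\<in>I. (cubic_grad k y)\<^sup>2) + (\<Sum>k\<in>I. (lap_grad k)\<^sup>2)" by (simp add: sum.distrib sum_distrib_left)
    finally have "3 * Gam y \<le> 2 * (\<Sum>k\<in>I. (cubic_grad k y)\<^sup>2) + (\<Sum>k\<in>I. (lap_grad k)\<^sup>2)" unfolding Gam_def by simp
    moreover have "0 \<le> (\<Sum>k\<in>I. (cubic_grad k y)\<^sup>2)" "0 \<le> (\<Sum>k\<in>I. (lap_grad k)\<^sup>2)" by (auto intro: sum_nonneg)
    ultimately show ?thesis using grad_sum[of y] lap_sum by simp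
  qed
  then have "cubic_var \<le> (\<integral>y. \<kappa> * (\<Sum>e\<in>E. X e y ^ (2 * 2)) + \<kappa> * N * s ^ 4 \<partial>\<gamma>)"
    unfolding cubic_var_eq using fin
    by (intro integral_mono subexp_integrable subexp_Gam subexp_add subexp_mult subexp_const subexp_moment_sum)
  also have "\<dots> = \<kappa> * (\<integral>y. (\<Sum>e\<in>E. X e y ^ (2 * 2)) \<partial>\<gamma>) + \<kappa> * N * s ^ 4"
    using subexp_integrable[OF fin(1) subexp_moment_sum[of 2]] by (simp add: P.prob_space)
  also have "\<dots> \<le> \<kappa> * (N * (4 * fact (2 * 2) * s ^ (2 * 2))) + \<kappa> * N * s ^ 4"
    using kap N_nonneg by (intro add_mono mult_left_mono moment_sum_le) auto
  also have "\<dots> = 97 * (\<kappa> * N * s ^ 4)" by (simp add: fact_numeral)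
  also have "\<dots> \<le> 100 * (\<kappa> * N * s ^ 4)" using kap N_nonneg by (intro mult_right_mono) auto
  finally show ?thesis by simp
qed

text \<open>The elementary bound \<open>x\<^sup>2 \<le> t + x ^ 8 / t ^ 3\<close> replaces the maximum of the \<open>X\<^sub>e\<^sup>2\<close> by a polynomial.\<close>

lemma Gam_variance:
  assumes t: "t > 0"
  shows "(\<integral>y. (Gam y)\<^sup>2 \<partial>\<gamma>) - cubic_var\<^sup>2
    \<le> 10 ^ 11 * \<kappa> ^ 3 * (t * N * s ^ 4 + N\<^sup>2 * s ^ 12 / t ^ 3)"
proof -
  \<comment> \<open>The gradient of \<open>Gam\<close> is one third of the Hessian of f applied to
    \<open>u\<close>. The Hessian is analysis, multiplication by \<open>a e * X e y\<close>, then
    synthesis, so the two frame bounds leave only the maximum of the \<open>X e y\<close> squared to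
    control.\<close>
  define u where "u k y = 2 * cubic_grad k y + lap_grad k" for k y
  define U where "U y = (\<Sum>k\<in>I. (u k y)\<^sup>2)" for y
  define D where "D l y = (\<Sum>e\<in>E. (a e / 3 * X e y * lin_form I (m e) (\<lambda>k. u k y)) * m e l)" for l y
  let ?S = "\<lambda>p y. \<Sum>e\<in>E. X e y ^ (2 * p)"
  have gG: "has_gradient I Gam D"
  proof -
    have "has_gradient I (\<lambda>y. cubic_grad k y + lap_grad k) (\<lambda>l y. (\<Sum>e\<in>E. a e * X e y * m e l * m e k) + 0)" for k
      by (intro has_gradient_add has_gradient_cubic_grad has_gradient_const)
    then have "has_gradient I Gam (\<lambda>l y. 1/3 * (\<Sum>k\<in>I. ((\<Sum>e\<in>E. a e * X e y * m e l * m e k) + 0) * cubic_grad k y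
        + (\<Sum>e\<in>E. a e * X e y * m e l * m e k) * (cubic_grad k y + lap_grad k)))"
      unfolding Gam_def [abs_def]
      by (intro has_gradient_cmult has_gradient_sum has_gradient_mult has_gradient_cubic_grad)
    also have "(\<lambda>l y. 1/3 * (\<Sum>k\<in>I. ((\<Sum>e\<in>E. a e * X e y * m e l * m e k) + 0) * cubic_grad k y
        + (\<Sum>e\<in>E. a e * X e y * m e l * m e k) * (cubic_grad k y + lap_grad k))) = D"
    proof (intro ext)
      fix l y
      have "D l y = (\<Sum>e\<in>E. \<Sum>k\<in>I. 1/3 * (a e * X e y * m e l * m e k * u k y))"
      proof -
        have "lin_form I (m e) (\<lambda>k. u k y) = (\<Sum>k\<in>I. m e k * u k y)" for e by (simp add: lin_form_def)
        then show ?thesis unfolding D_def by (simp add: sum_distrib_left sum_distrib_right sum_divide_distrib mult_ac)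
      qed
      also have "\<dots> = 1/3 * (\<Sum>k\<in>I. (\<Sum>e\<in>E. a e * X e y * m e l * m e k) * u k y)"
        by (subst sum.swap) (simp add: sum_distrib_left sum_distrib_right)
      finally show "1/3 * (\<Sum>k\<in>I. ((\<Sum>e\<in>E. a e * X e y * m e l * m e k) + 0) * cubic_grad k y
          + (\<Sum>e\<in>E. a e * X e y * m e l * m e k) * (cubic_grad k y + lap_grad k)) = D l y"
        by (simp add: u_def algebra_simps)
    qed
    finally show ?thesis .
  qed
  have Unn: "U y \<ge> 0" for y unfolding U_def by (intro sum_nonneg) auto
  have Snn: "?S p y \<ge> 0" for p y by (intro sum_nonneg) (simp add: power_mult)
  have Ub: "U y \<le> 8 * \<kappa> * ?S 2 y + 2 * \<kappa> * N * s ^ 4" for y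
  proof -
    have "U y \<le> (\<Sum>k\<in>I. 8 * (cubic_grad k y)\<^sup>2 + 2 * (lap_grad k)\<^sup>2)"
      unfolding U_def u_def
    proof (rule sum_mono)
      fix k
      have "8 * (cubic_grad k y)\<^sup>2 + 2 * (lap_grad k)\<^sup>2 - (2 * cubic_grad k y + lap_grad k)\<^sup>2 = (2 * cubic_grad k y - lap_grad k)\<^sup>2"
        by (simp add: power2_eq_square algebra_simps)
      then show "(2 * cubic_grad k y + lap_grad k)\<^sup>2 \<le> 8 * (cubic_grad k y)\<^sup>2 + 2 * (lap_grad k)\<^sup>2"
        using zero_le_power2[of "2 * cubic_grad k y - lap_grad k"] by linarith
    qed
    also have "\<dots> = 8 * (\<Sum>k\<in>I. (cubic_grad k y)\<^sup>2) + 2 * (\<Sum>k\<in>I. (lap_grad k)\<^sup>2)"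
      by (simp add: sum.distrib sum_distrib_left)
    finally show ?thesis using grad_sum[of y] lap_sum by simp
  qed
  define R where "R y = (\<kappa>\<^sup>2 / 9) * ((t + ?S 4 y / t ^ 3) * (8 * \<kappa> * ?S 2 y + 2 * \<kappa> * N * s ^ 4))" for y
  have Db: "(\<Sum>l\<in>I. (D l y)\<^sup>2) \<le> R y" for y
  proof -
    let ?L = "\<lambda>e. lin_form I (m e) (\<lambda>k. u k y)"
    have "(\<Sum>l\<in>I. (D l y)\<^sup>2) \<le> \<kappa> * (\<Sum>e\<in>E. (a e / 3 * X e y * ?L e)\<^sup>2)"
      unfolding D_def by (rule synthesis)
    also have "\<dots> \<le> \<kappa> * (\<Sum>e\<in>E. 1/9 * (t + ?S 4 y / t ^ 3) * (?L e)\<^sup>2)"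
    proof (intro mult_left_mono sum_mono)
      fix e assume e: "e \<in> E"
      have "(X e y)\<^sup>2 \<le> t + X e y ^ 8 / t ^ 3"
      proof (cases "(X e y)\<^sup>2 \<le> t")
        case True then show ?thesis using t by (simp add: add_increasing2)
      next
        case False
        then have "t ^ 3 \<le> ((X e y)\<^sup>2) ^ 3" using t by (intro power_mono) auto
        then have "(X e y)\<^sup>2 * t ^ 3 \<le> (X e y)\<^sup>2 * ((X e y)\<^sup>2) ^ 3" by (intro mult_left_mono) auto
        also have "\<dots> = X e y ^ 8" by (simp flip: power_mult power_add)
        finally have "(X e y)\<^sup>2 \<le> X e y ^ 8 / t ^ 3" using t by (simp add: field_simps)
        then show ?thesis using t by simp
      qed
      also have "X e y ^ 8 \<le> ?S 4 y"
        using member_le_sum[OF e, of "\<lambda>e. X e y ^ 8"] fin by simp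
      finally have X2: "(X e y)\<^sup>2 \<le> t + ?S 4 y / t ^ 3" using t by (simp add: divide_right_mono)
      have "(a e / 3 * X e y * ?L e)\<^sup>2 = (a e)\<^sup>2 * (1/9 * (X e y)\<^sup>2 * (?L e)\<^sup>2)"
        by (simp add: power_mult_distrib power_divide)
      also have "\<dots> \<le> 1 * (1/9 * (t + ?S 4 y / t ^ 3) * (?L e)\<^sup>2)"
        using X2 a[OF e] by (intro mult_mono mult_right_mono mult_left_mono) (auto simp: abs_square_le_1)
      finally show "(a e / 3 * X e y * ?L e)\<^sup>2 \<le> 1/9 * (t + ?S 4 y / t ^ 3) * (?L e)\<^sup>2" by simp
    qed (use kap in auto)
    also have "\<dots> = \<kappa> / 9 * (t + ?S 4 y / t ^ 3) * (\<Sum>e\<in>E. (?L e)\<^sup>2)"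
      unfolding sum_distrib_left[symmetric] by simp
    also have "\<dots> \<le> \<kappa> / 9 * (t + ?S 4 y / t ^ 3) * (\<kappa> * U y)"
      unfolding U_def using kap t Snn[where p = 4] by (intro mult_left_mono analysis mult_nonneg_nonneg add_nonneg_nonneg) auto
    also have "\<dots> \<le> \<kappa> / 9 * (t + ?S 4 y / t ^ 3) * (\<kappa> * (8 * \<kappa> * ?S 2 y + 2 * \<kappa> * N * s ^ 4))"
      using kap t Ub Snn[where p = 4] by (intro mult_left_mono mult_nonneg_nonneg add_nonneg_nonneg) auto
    finally show ?thesis unfolding R_def by (simp add: power2_eq_square mult_ac)
  qed
  \<comment> \<open>The product of an eighth and a fourth power is at most the larger twelfth power.
    This reduces the product of two power sums to a single one whose mean is known.\<close>
  have S42: "?S 4 y * ?S 2 y \<le> 2 * N * ?S 6 y" for y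
  proof -
    have "?S 4 y * ?S 2 y = (\<Sum>e\<in>E. \<Sum>e'\<in>E. X e y ^ 8 * X e' y ^ 4)" by (simp add: sum_product)
    also have "\<dots> \<le> (\<Sum>e\<in>E. \<Sum>e'\<in>E. X e y ^ 12 + X e' y ^ 12)"
    proof (intro sum_mono)
      fix e e'
      have "p ^ 8 * r ^ 4 \<le> p ^ 12 + r ^ 12" for p r :: real
      proof (cases "\<bar>r\<bar> \<le> \<bar>p\<bar>")
        case True
        then have "p ^ 8 * r ^ 4 \<le> p ^ 8 * p ^ 4" using power_mono[OF True abs_ge_zero, of 4] by (intro mult_left_mono) auto
        also have "\<dots> = p ^ 12" by (simp flip: power_add)
        finally show ?thesis by (simp add: add_increasing2)
      next
        case False
        then have "\<bar>p\<bar> \<le> \<bar>r\<bar>" by simp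
        from power_mono[OF this abs_ge_zero, of 8] have "p ^ 8 * r ^ 4 \<le> r ^ 8 * r ^ 4" by (intro mult_right_mono) auto
        also have "\<dots> = r ^ 12" by (simp flip: power_add)
        finally show ?thesis by (simp add: add_increasing)
      qed
      then show "X e y ^ 8 * X e' y ^ 4 \<le> X e y ^ 12 + X e' y ^ 12" .
    qed
    also have "\<dots> = 2 * real (card E) * ?S 6 y" by (simp add: sum.distrib sum_distrib_left mult_ac)
    also have "\<dots> \<le> 2 * N * ?S 6 y" using card Snn[where p = 6] by (intro mult_right_mono) auto
    finally show ?thesis .
  qed
  define R' where "R' y = (\<kappa>\<^sup>2 / 9) * (8 * \<kappa> * t * ?S 2 y + 2 * \<kappa> * N * s ^ 4 * t
      + (16 * \<kappa> * N / t ^ 3) * ?S 6 y + (2 * \<kappa> * N * s ^ 4 / t ^ 3) * ?S 4 y)" for y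
  have RR: "R y \<le> R' y" for y
  proof -
    have "(t + ?S 4 y / t ^ 3) * (8 * \<kappa> * ?S 2 y + 2 * \<kappa> * N * s ^ 4)
      = 8 * \<kappa> * t * ?S 2 y + 2 * \<kappa> * N * s ^ 4 * t + (8 * \<kappa> / t ^ 3) * (?S 4 y * ?S 2 y) + (2 * \<kappa> * N * s ^ 4 / t ^ 3) * ?S 4 y"
      by (simp add: algebra_simps)
    also have "(8 * \<kappa> / t ^ 3) * (?S 4 y * ?S 2 y) \<le> (8 * \<kappa> / t ^ 3) * (2 * N * ?S 6 y)"
      using kap t S42 by (intro mult_left_mono) auto
    finally show ?thesis unfolding R_def R'_def by (intro mult_left_mono) (auto simp: algebra_simps)
  qed
  have int: "integrable \<gamma> F" if "subexp I F" for F by (rule subexp_integrable[OF fin(1) that])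
  have iS: "integrable \<gamma> (?S p)" for p by (intro int subexp_moment_sum)
  have sD: "subexp I (\<lambda>y. (D l y)\<^sup>2)" if "l \<in> I" for l using has_gradient_subexp(2)[OF gG that] by (intro subexp_power)
  have "(\<integral>y. (Gam y)\<^sup>2 \<partial>\<gamma>) - cubic_var\<^sup>2 \<le> (\<Sum>l\<in>I. \<integral>y. (D l y)\<^sup>2 \<partial>\<gamma>)"
    unfolding cubic_var_eq by (rule std_gauss_poincare[OF fin(1) gG])
  also have "\<dots> = (\<integral>y. (\<Sum>l\<in>I. (D l y)\<^sup>2) \<partial>\<gamma>)"
    by (rule Bochner_Integration.integral_sum[symmetric]) (intro int sD)
  also have "\<dots> \<le> (\<integral>y. R' y \<partial>\<gamma>)"
  proof (rule integral_mono)
    show "integrable \<gamma> R'" unfolding R'_def using iS[of 2] iS[of 6] iS[of 4] prob_gauss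
      by (intro integrable_mult_right Bochner_Integration.integrable_add finite_measure.integrable_const prob_space.finite_measure)
    show "integrable \<gamma> (\<lambda>y. \<Sum>l\<in>I. (D l y)\<^sup>2)" by (intro int subexp_sum sD)
    show "(\<Sum>l\<in>I. (D l y)\<^sup>2) \<le> R' y" for y by (rule order_trans[OF Db RR])
  qed
  also have "\<dots> = (\<kappa>\<^sup>2 / 9) * (8 * \<kappa> * t * (\<integral>y. ?S 2 y \<partial>\<gamma>) + 2 * \<kappa> * N * s ^ 4 * t
      + (16 * \<kappa> * N / t ^ 3) * (\<integral>y. ?S 6 y \<partial>\<gamma>) + (2 * \<kappa> * N * s ^ 4 / t ^ 3) * (\<integral>y. ?S 4 y \<partial>\<gamma>))"
  proof -
    have ic: "integrable \<gamma> (\<lambda>y. c)" for c :: real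
      using prob_gauss by (intro finite_measure.integrable_const prob_space.finite_measure)
    show ?thesis
      unfolding R'_def using iS[of 2] iS[of 6] iS[of 4] prob_space.prob_space[OF prob_gauss]
      by (simp only: integral_mult_right_zero Bochner_Integration.integral_add Bochner_Integration.integrable_add
          integrable_mult_right ic lebesgue_integral_const scaleR_one)
  qed
  also have "\<dots> \<le> (\<kappa>\<^sup>2 / 9) * (8 * \<kappa> * t * (N * (4 * fact (2 * 2) * s ^ (2 * 2))) + 2 * \<kappa> * N * s ^ 4 * t
      + (16 * \<kappa> * N / t ^ 3) * (N * (4 * fact (2 * 6) * s ^ (2 * 6))) + (2 * \<kappa> * N * s ^ 4 / t ^ 3) * (N * (4 * fact (2 * 4) * s ^ (2 * 4))))"
    using kap t N_nonneg s by (intro mult_left_mono add_mono moment_sum_le) auto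
  \<comment> \<open>770 = 8 * 4 * 4! + 2 and 30656424960 = 16 * 4 * 12! + 2 * 4 * 8!; after division
    by 9 both are below 10^11.\<close>
  also have "\<dots> = (\<kappa> ^ 3 / 9) * (770 * (t * N * s ^ 4) + 30656424960 * (N\<^sup>2 * s ^ 12 / t ^ 3))"
    by (simp add: fact_numeral power2_eq_square power3_eq_cube algebra_simps flip: power_add)
  also have "\<dots> \<le> \<kappa> ^ 3 * (10 ^ 11 * (t * N * s ^ 4) + 10 ^ 11 * (N\<^sup>2 * s ^ 12 / t ^ 3))"
  proof -
    have 0: "0 \<le> t * N * s ^ 4" "0 \<le> N\<^sup>2 * s ^ 12 / t ^ 3" using t N_nonneg s by auto
    have "1 / 9 * (770 * (t * N * s ^ 4) + 30656424960 * (N\<^sup>2 * s ^ 12 / t ^ 3))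
        \<le> 10 ^ 11 * (t * N * s ^ 4) + 10 ^ 11 * (N\<^sup>2 * s ^ 12 / t ^ 3)"
    proof -
      have "1 / 9 * (770 * p + 30656424960 * q) \<le> 10 ^ 11 * p + 10 ^ 11 * q" if "0 \<le> p" "0 \<le> q" for p q :: real
        using that by simp
      from this[OF 0] show ?thesis .
    qed
    from mult_left_mono[OF this, of "\<kappa> ^ 3"] kap show ?thesis by simp
  qed
  finally show ?thesis by (simp add: algebra_simps)
qed

text \<open>\<open>u(r) = \<integral> cos (r f + c)\<close> satisfies \<open>u' = - r \<integral> \<Gamma> cos (r f + c)\<close>, which is close to \<open>- r \<mu> u\<close>.\<close>

lemma cubic_char_fun:
  assumes v: "v > 0" "(\<integral>y. (Gam y)\<^sup>2 \<partial>\<gamma>) - cubic_var\<^sup>2 \<le> v\<^sup>2"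
  shows "\<bar>(\<integral>y. cos (cubic y + c) \<partial>\<gamma>) - cos c * exp (- cubic_var / 2)\<bar> \<le> v"
proof -
  interpret P: prob_space \<gamma> by (rule prob_gauss)
  define \<mu> where "\<mu> = cubic_var"
  have mu0: "\<mu> \<ge> 0" unfolding \<mu>_def cubic_var_def by simp
  have int: "integrable \<gamma> F" if "subexp I F" for F by (rule subexp_integrable[OF fin(1) that])
  have sc: "subexp I (\<lambda>y. cos (r * cubic y + c))" "subexp I (\<lambda>y. sin (r * cubic y + c))" for r
    by (rule bounded_subexp[OF subexp_cubic, where p = "\<lambda>x. cos (r * x + c)" and B = 1]
          bounded_subexp[OF subexp_cubic, where p = "\<lambda>x. sin (r * x + c)" and B = 1];
        auto intro!: continuous_intros)+
  \<comment> \<open>From the variance to the mean deviation by |x| \<le> x^2 / (2 v) + v / 2, each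
    term contributing v / 2.\<close>
  have V: "(\<integral>y. \<bar>Gam y - \<mu>\<bar> \<partial>\<gamma>) \<le> v"
  proof -
    have iG: "integrable \<gamma> Gam" "integrable \<gamma> (\<lambda>y. (Gam y)\<^sup>2)" by (intro int subexp_Gam subexp_power)+
    have iZ: "integrable \<gamma> (\<lambda>y. (Gam y - \<mu>)\<^sup>2)" "integrable \<gamma> (\<lambda>y. \<bar>Gam y - \<mu>\<bar>)"
      by (rule int[OF subexp_power[OF subexp_diff[OF subexp_Gam subexp_const]]])
        (rule int[OF subexp_abs[OF subexp_diff[OF subexp_Gam subexp_const]]])
    have iB: "integrable \<gamma> (\<lambda>y. 1 / (2 * v) * (Gam y - \<mu>)\<^sup>2)" by (rule integrable_mult_right[OF iZ(1)])
    have "(\<integral>y. \<bar>Gam y - \<mu>\<bar> \<partial>\<gamma>) \<le> (\<integral>y. 1 / (2 * v) * (Gam y - \<mu>)\<^sup>2 + v / 2 \<partial>\<gamma>)"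
    proof (rule integral_mono[OF iZ(2) Bochner_Integration.integrable_add[OF iB P.integrable_const]])
      fix y
      have "0 \<le> (\<bar>Gam y - \<mu>\<bar> - v)\<^sup>2" by simp
      then have "2 * v * \<bar>Gam y - \<mu>\<bar> \<le> (Gam y - \<mu>)\<^sup>2 + v\<^sup>2"
        unfolding power2_diff[of "\<bar>Gam y - \<mu>\<bar>"] power2_abs by (simp only: mult_ac)
      then have "1 / (2 * v) * (2 * v * \<bar>Gam y - \<mu>\<bar>) \<le> 1 / (2 * v) * ((Gam y - \<mu>)\<^sup>2 + v\<^sup>2)"
        using v(1) by (intro mult_left_mono) auto
      then show "\<bar>Gam y - \<mu>\<bar> \<le> 1 / (2 * v) * (Gam y - \<mu>)\<^sup>2 + v / 2"
        using v(1) by (simp add: distrib_left power2_eq_square)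
    qed
    also have "\<dots> = (\<integral>y. (Gam y - \<mu>)\<^sup>2 \<partial>\<gamma>) / (2 * v) + v / 2"
      unfolding Bochner_Integration.integral_add[OF iB P.integrable_const] by (simp add: P.prob_space)
    also have "(\<integral>y. (Gam y - \<mu>)\<^sup>2 \<partial>\<gamma>) = (\<integral>y. (Gam y)\<^sup>2 \<partial>\<gamma>) - \<mu>\<^sup>2"
      unfolding \<mu>_def cubic_var_eq by (rule P.variance_eq[OF iG])
    also have "((\<integral>y. (Gam y)\<^sup>2 \<partial>\<gamma>) - \<mu>\<^sup>2) / (2 * v) + v / 2 \<le> v\<^sup>2 / (2 * v) + v / 2"
      using v unfolding \<mu>_def by (intro add_mono divide_right_mono) auto
    also have "\<dots> = v" using v(1) by (simp add: power2_eq_square)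
    finally show ?thesis .
  qed
  define u where "u r = (\<integral>y. cos (r * cubic y + c) \<partial>\<gamma>)" for r
  have du: "(u has_real_derivative - (r * (\<integral>y. Gam y * cos (r * cubic y + c) \<partial>\<gamma>))) (at r)" for r
  proof -
    have "(u has_real_derivative - (\<integral>y. cubic y * sin (r * cubic y + c) \<partial>\<gamma>)) (at r)"
      unfolding u_def using subexp_measurable[OF subexp_cubic]
      by (intro integral_cos_deriv prob_gauss int subexp_cubic subexp_power) auto
    also have "(\<integral>y. cubic y * sin (r * cubic y + c) \<partial>\<gamma>) = (\<integral>y. Gam y * (r * cos (r * cubic y + c)) \<partial>\<gamma>)"
      by (rule cubic_ibp[where p = "\<lambda>x. sin (r * x + c)" and p' = "\<lambda>x. r * cos (r * x + c)"])
         (auto intro!: derivative_eq_intros continuous_intros sc subexp_mult)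
    also have "\<dots> = r * (\<integral>y. Gam y * cos (r * cubic y + c) \<partial>\<gamma>)"
      by (simp add: mult_ac flip: integral_mult_right_zero)
    finally show ?thesis .
  qed
  \<comment> \<open>The integrating factor cancels the main term - r \<mu> u, so the derivative of W
    contains only the deviation of \<open>Gam\<close> from its mean. On [0, 1] the factor is at most
    exp (\<mu> / 2), which is exactly what is divided out at r = 1.\<close>
  define W where "W r = exp (\<mu> * r\<^sup>2 / 2) * u r" for r
  have dW: "(W has_real_derivative - (r * exp (\<mu> * r\<^sup>2 / 2) * (\<integral>y. (Gam y - \<mu>) * cos (r * cubic y + c) \<partial>\<gamma>))) (at r)" for r
  proof -
    define A where "A = (\<integral>y. Gam y * cos (r * cubic y + c) \<partial>\<gamma>)"
    define B where "B = (\<integral>y. (Gam y - \<mu>) * cos (r * cubic y + c) \<partial>\<gamma>)"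
    have AB: "B = A - \<mu> * u r"
      unfolding u_def A_def B_def left_diff_distrib
      using int[OF subexp_mult[OF subexp_Gam sc(1)[of r]]] int[OF sc(1)[of r]] by simp
    have "((\<lambda>r. exp (\<mu> * r\<^sup>2 / 2)) has_real_derivative exp (\<mu> * r\<^sup>2 / 2) * (\<mu> * r)) (at r)"
      by (auto intro!: derivative_eq_intros)
    from DERIV_mult[OF this du[of r]]
    have "(W has_real_derivative exp (\<mu> * r\<^sup>2 / 2) * (\<mu> * r) * u r + - (r * A) * exp (\<mu> * r\<^sup>2 / 2)) (at r)"
      unfolding W_def A_def .
    also have "exp (\<mu> * r\<^sup>2 / 2) * (\<mu> * r) * u r + - (r * A) * exp (\<mu> * r\<^sup>2 / 2) = - (r * exp (\<mu> * r\<^sup>2 / 2) * B)"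
      unfolding AB by (simp add: algebra_simps)
    finally show ?thesis unfolding B_def .
  qed
  have "norm (W 1 - W 0) \<le> (exp (\<mu> / 2) * v) * norm (1 - (0::real))"
  proof (rule field_differentiable_bound[where S = "{0..1}" and f' = "\<lambda>r. - (r * exp (\<mu> * r\<^sup>2 / 2) * (\<integral>y. (Gam y - \<mu>) * cos (r * cubic y + c) \<partial>\<gamma>))"])
    fix r :: real assume r: "r \<in> {0..1}"
    have "\<bar>\<integral>y. (Gam y - \<mu>) * cos (r * cubic y + c) \<partial>\<gamma>\<bar> \<le> (\<integral>y. \<bar>Gam y - \<mu>\<bar> \<partial>\<gamma>)"
    proof (rule abs_integral_le)
      show "integrable \<gamma> (\<lambda>y. (Gam y - \<mu>) * cos (r * cubic y + c))" "integrable \<gamma> (\<lambda>y. \<bar>Gam y - \<mu>\<bar>)"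
        by (intro int subexp_intros subexp_Gam sc)+
    qed (auto simp: abs_mult intro!: mult_left_le)
    moreover have "exp (\<mu> * r\<^sup>2 / 2) \<le> exp (\<mu> / 2)" using r mu0 by (auto intro!: mult_left_le power_le_one)
    ultimately have "\<bar>r * exp (\<mu> * r\<^sup>2 / 2)\<bar> * \<bar>\<integral>y. (Gam y - \<mu>) * cos (r * cubic y + c) \<partial>\<gamma>\<bar> \<le> (1 * exp (\<mu> / 2)) * v"
      using r V v(1) unfolding abs_mult by (intro mult_mono) auto
    then show "norm (- (r * exp (\<mu> * r\<^sup>2 / 2) * (\<integral>y. (Gam y - \<mu>) * cos (r * cubic y + c) \<partial>\<gamma>))) \<le> exp (\<mu> / 2) * v"
      by (simp add: abs_mult)
  qed (use dW in \<open>auto intro: has_field_derivative_at_within\<close>)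
  moreover have "W 0 = cos c" by (simp add: W_def u_def P.prob_space)
  moreover have "W 1 - cos c = exp (\<mu> / 2) * (u 1 - cos c * exp (- \<mu> / 2))"
    by (simp add: W_def right_diff_distrib exp_minus field_simps)
  ultimately have "exp (\<mu> / 2) * \<bar>u 1 - cos c * exp (- \<mu> / 2)\<bar> \<le> exp (\<mu> / 2) * v"
    by (simp add: abs_mult)
  then show ?thesis by (simp add: u_def \<mu>_def)
qed

end

end

section \<open>Characteristic functions of Bernoulli variables\<close>

text \<open>The mean value inequality on the segment from 0 to x. Iterated, it raises a Taylor
  remainder by one degree at a time with an unchanged constant.\<close>

lemma norm_le_power_Suc_of_deriv:
  fixes F :: "real \<Rightarrow> complex"
  assumes d: "\<And>t. \<bar>t\<bar> \<le> r \<Longrightarrow> (F has_vector_derivative F' t) (at t within {-r..r})"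
    and b: "\<And>t. \<bar>t\<bar> \<le> r \<Longrightarrow> cmod (F' t) \<le> C * \<bar>t\<bar> ^ k"
    and 0: "F 0 = 0" and x: "\<bar>x\<bar> \<le> r" and C: "C \<ge> 0"
  shows "cmod (F x) \<le> C * \<bar>x\<bar> ^ Suc k"
proof -
  let ?S = "closed_segment 0 x"
  have S: "\<bar>t\<bar> \<le> \<bar>x\<bar>" if "t \<in> ?S" for t using that by (auto simp: closed_segment_eq_real_ivl split: if_splits)
  then have sub: "?S \<subseteq> {-r..r}" using x by (fastforce simp: abs_le_iff)
  have "norm (F x - F 0) \<le> (C * \<bar>x\<bar> ^ k) * norm (x - 0)"
  proof (rule differentiable_bound[where S = ?S and f' = "\<lambda>t u. u *\<^sub>R F' t"])
    fix t assume t: "t \<in> ?S"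
    then have tr: "\<bar>t\<bar> \<le> r" using S[OF t] x by linarith
    show "(F has_derivative (\<lambda>u. u *\<^sub>R F' t)) (at t within ?S)"
      using has_vector_derivative_within_subset[OF d[OF tr] sub] by (simp add: has_vector_derivative_def)
    have "onorm (\<lambda>u. u *\<^sub>R F' t) \<le> cmod (F' t)" by (rule onorm_le) (auto simp: mult.commute)
    also have "\<dots> \<le> C * \<bar>x\<bar> ^ k"
      by (rule order_trans[OF b[OF tr]]) (use S[OF t] C in \<open>auto intro!: mult_left_mono power_mono\<close>)
    finally show "onorm (\<lambda>u. u *\<^sub>R F' t) \<le> C * \<bar>x\<bar> ^ k" .
  qed auto
  then show ?thesis using 0 by (simp add: mult_ac)
qed

lemma one_minus_cos_le: "1 - cos x \<le> x\<^sup>2 / 2" for x :: real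
proof -
  have "1 - cos x = 2 * (sin (x / 2))\<^sup>2" using cos_double_sin[of "x / 2"] by simp
  also have "\<dots> \<le> 2 * (x / 2)\<^sup>2"
    using abs_sin_x_le_abs_x[of "x / 2"] unfolding abs_le_square_iff by simp
  finally show ?thesis by (simp add: power_divide)
qed

lemma norm_prod_minus_one_le:
  fixes r :: "'a \<Rightarrow> complex"
  shows "norm ((\<Prod>e\<in>A. 1 + r e) - 1) \<le> exp (\<Sum>e\<in>A. norm (r e)) - 1"
proof (induction A rule: infinite_finite_induct)
  case (insert a A)
  let ?P = "\<Prod>e\<in>A. 1 + r e" and ?S = "\<Sum>e\<in>A. norm (r e)"
  have n: "norm ?P \<le> exp ?S"
    using norm_triangle_ineq[of "?P - 1" 1] insert.IH by simp
  have "norm ((\<Prod>e\<in>insert a A. 1 + r e) - 1) = norm ((?P - 1) + r a * ?P)"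
    using insert.hyps by (simp add: algebra_simps)
  also have "\<dots> \<le> (exp ?S - 1) + norm (r a) * exp ?S"
    using insert.IH n by (intro order_trans[OF norm_triangle_ineq] add_mono) (auto simp: norm_mult intro!: mult_left_mono)
  also have "\<dots> = (1 + norm (r a)) * exp ?S - 1" by (simp add: algebra_simps)
  also have "\<dots> \<le> exp (norm (r a)) * exp ?S - 1" by (intro diff_right_mono mult_right_mono exp_ge_add_one_self) auto
  finally show ?case using insert.hyps by (simp add: exp_add)
qed auto

context
  fixes \<zeta> :: real
  assumes z: "0 \<le> \<zeta>" "\<zeta> \<le> 1"
begin

definition bern :: "real \<Rightarrow> complex" where "bern x = 1 - of_real \<zeta> + of_real \<zeta> * cis x"
text \<open>\<i> times \<open>tilt\<close> is the logarithmic derivative of \<open>bern\<close>, the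
  characteristic function of a Bernoulli variable. Its own derivative is \<i> tilt (1 - tilt), so
  all higher derivatives are polynomials in \<open>tilt\<close>.\<close>

definition tilt :: "real \<Rightarrow> complex" where "tilt x = of_real \<zeta> * cis x / bern x"

lemma variance_bounds: "0 \<le> \<zeta> * (1 - \<zeta>)" "\<zeta> * (1 - \<zeta>) \<le> 1 / 4"
proof -
  show "0 \<le> \<zeta> * (1 - \<zeta>)" using z by simp
  have "0 \<le> (\<zeta> - 1/2)\<^sup>2" by simp
  then show "\<zeta> * (1 - \<zeta>) \<le> 1 / 4" by (simp add: power2_eq_square algebra_simps)
qed

lemma norm_bern: "(cmod (bern x))\<^sup>2 = 1 - 2 * (\<zeta> * (1 - \<zeta>)) * (1 - cos x)"
proof -
  have "(cmod (bern x))\<^sup>2 = (1 - \<zeta> + \<zeta> * cos x)\<^sup>2 + (\<zeta> * sin x)\<^sup>2"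
    by (simp add: bern_def cmod_power2)
  also have "\<dots> = (1 - \<zeta>)\<^sup>2 + 2 * (1 - \<zeta>) * \<zeta> * cos x + \<zeta>\<^sup>2 * ((sin x)\<^sup>2 + (cos x)\<^sup>2)"
    by (simp only: power2_eq_square) (simp only: algebra_simps)
  finally show ?thesis by (simp add: power2_eq_square algebra_simps)
qed

lemma norm_bern_le: "cmod (bern x) \<le> exp (- (\<zeta> * (1 - \<zeta>)) * (1 - cos x))"
proof -
  have "(cmod (bern x))\<^sup>2 \<le> exp (- 2 * (\<zeta> * (1 - \<zeta>)) * (1 - cos x))"
    unfolding norm_bern using exp_ge_add_one_self[of "- 2 * (\<zeta> * (1 - \<zeta>)) * (1 - cos x)"] by simp
  also have "\<dots> = (exp (- (\<zeta> * (1 - \<zeta>)) * (1 - cos x)))\<^sup>2"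
    by (simp add: exp_double[symmetric] mult.assoc)
  finally show ?thesis by (rule power2_le_imp_le) simp
qed

lemma bern_lower: assumes "\<bar>x\<bar> \<le> 1" shows "1 / 2 \<le> cmod (bern x)"
proof -
  have "1 - cos x \<le> 1 / 2"
    using one_minus_cos_le[of x] assms abs_le_square_iff[of x 1] by simp
  then have "(\<zeta> * (1 - \<zeta>)) * (1 - cos x) \<le> 1 / 4 * (1 / 2)"
    using variance_bounds by (intro mult_mono) auto
  then have "(1 / 2)\<^sup>2 \<le> (cmod (bern x))\<^sup>2" unfolding norm_bern by (simp add: power2_eq_square)
  then show ?thesis by (rule power2_le_imp_le) simp
qed

lemma tilt_bounds: assumes "\<bar>x\<bar> \<le> 1" shows "cmod (tilt x) \<le> 2" "cmod (1 - tilt x) \<le> 2"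
proof -
  have b: "bern x \<noteq> 0" "1 / 2 \<le> cmod (bern x)" using bern_lower[OF assms] by auto
  have "cmod (tilt x) \<le> 1 / (1 / 2)"
    unfolding tilt_def norm_divide using b z by (intro frac_le) (auto simp: norm_mult)
  then show "cmod (tilt x) \<le> 2" by simp
  have "1 - tilt x = (1 - of_real \<zeta>) / bern x" using b by (simp add: tilt_def bern_def field_simps)
  moreover have "cmod ((1 - of_real \<zeta>) / bern x) \<le> 1 / (1 / 2)"
  proof -
    have "cmod (1 - of_real \<zeta>) = 1 - \<zeta>" using norm_of_real[of "1 - \<zeta>", where 'a = complex] z by simp
    then show ?thesis unfolding norm_divide using b z by (intro frac_le) auto
  qed
  ultimately show "cmod (1 - tilt x) \<le> 2" by simp
qed

lemma bern_deriv: "(bern has_vector_derivative of_real \<zeta> * (\<i> * cis x)) (at x within A)"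
proof -
  have "((\<lambda>z. 1 - of_real \<zeta> + of_real \<zeta> * exp (\<i> * z)) has_field_derivative of_real \<zeta> * (\<i> * exp (\<i> * of_real x))) (at (of_real x))"
    by (auto intro!: derivative_eq_intros)
  from has_vector_derivative_real_field[OF this]
  have "((\<lambda>x. 1 - of_real \<zeta> + of_real \<zeta> * exp (\<i> * of_real x)) has_vector_derivative of_real \<zeta> * (\<i> * exp (\<i> * of_real x))) (at x)" .
  then show ?thesis unfolding bern_def [abs_def] cis_conv_exp by (rule has_vector_derivative_at_within)
qed

lemma tilt_deriv:
  assumes "\<bar>x\<bar> \<le> 1"
  shows "(tilt has_vector_derivative \<i> * tilt x * (1 - tilt x)) (at x within A)"
proof -
  have b: "bern x \<noteq> 0" using bern_lower[OF assms] by auto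
  let ?b = "\<lambda>z. 1 - of_real \<zeta> + of_real \<zeta> * exp (\<i> * z)"
  have bx: "?b (of_real x) = bern x" by (simp add: bern_def cis_conv_exp)
  have "((\<lambda>z. of_real \<zeta> * exp (\<i> * z) / ?b z) has_field_derivative
      ((of_real \<zeta> * (\<i> * exp (\<i> * of_real x))) * ?b (of_real x) - (of_real \<zeta> * exp (\<i> * of_real x)) * (of_real \<zeta> * (\<i> * exp (\<i> * of_real x))))
       / (?b (of_real x) * ?b (of_real x))) (at (of_real x))"
    using b bx by (intro DERIV_divide) (auto intro!: derivative_eq_intros)
  from has_vector_derivative_real_field[OF this]
  have "((\<lambda>x. of_real \<zeta> * exp (\<i> * of_real x) / ?b (of_real x)) has_vector_derivative
      ((of_real \<zeta> * (\<i> * exp (\<i> * of_real x))) * ?b (of_real x) - (of_real \<zeta> * exp (\<i> * of_real x)) * (of_real \<zeta> * (\<i> * exp (\<i> * of_real x))))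
       / (?b (of_real x) * ?b (of_real x))) (at x)" .
  moreover have "(\<lambda>x. of_real \<zeta> * exp (\<i> * of_real x) / ?b (of_real x)) = tilt"
    by (auto simp: tilt_def bern_def cis_conv_exp)
  moreover have "((of_real \<zeta> * (\<i> * exp (\<i> * of_real x))) * ?b (of_real x) - (of_real \<zeta> * exp (\<i> * of_real x)) * (of_real \<zeta> * (\<i> * exp (\<i> * of_real x))))
       / (?b (of_real x) * ?b (of_real x)) = \<i> * tilt x * (1 - tilt x)"
    unfolding bx tilt_def cis_conv_exp using b by (simp add: field_simps)
  ultimately show ?thesis by (auto intro: has_vector_derivative_at_within)
qed

text \<open>A fourth order expansion of log \<open>bern\<close> that takes no complex logarithm: let
  E be \<open>bern\<close> times the exponential of minus the Taylor polynomial of its logarithm.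
  Then E' = \<i> E r0, where r0 is the third order Taylor remainder of \<open>tilt\<close>, and E 0
  = 1. The numbers \<zeta>, w, a and b are the first four cumulants.\<close>

lemma bern_expansion:
  assumes x: "\<bar>x\<bar> \<le> 1"
  defines "w \<equiv> \<zeta> * (1 - \<zeta>)"
  defines "a \<equiv> w * (2 * \<zeta> - 1)" and "b \<equiv> w * (6 * \<zeta>\<^sup>2 - 6 * \<zeta> + 1)"
  shows "cmod (bern x * exp (- \<i> * of_real (\<zeta> * x) + of_real (w * x\<^sup>2 / 2) - \<i> * of_real (a * x ^ 3 / 6) - of_real (b * x ^ 4 / 24)) - 1)
    \<le> 3000 * \<bar>x\<bar> ^ 5"
proof -
  let ?p = tilt
  let ?I = "{-1..1::real}"
  let ?z = "of_real \<zeta> :: complex"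
  define p1 where "p1 t = \<i> * ?p t * (1 - ?p t)" for t
  define p2 where "p2 t = - ?p t * (1 - ?p t) * (1 - 2 * ?p t)" for t
  define p3 where "p3 t = - \<i> * ?p t * (1 - ?p t) * (1 - 6 * ?p t + 6 * (?p t)\<^sup>2)" for t
  define p4 where "p4 t = ?p t * (1 - ?p t) * (1 - 2 * ?p t) * (1 - 12 * ?p t + 12 * (?p t)\<^sup>2)" for t
  have p0: "?p 0 = ?z" by (simp add: tilt_def bern_def)
  have q: "p1 0 = \<i> * of_real w" "p2 0 = of_real a" "p3 0 = - \<i> * of_real b"
    by (simp_all add: p1_def p2_def p3_def p0 w_def a_def b_def algebra_simps)
  have d0: "(?p has_vector_derivative p1 t) (at t within ?I)" if "\<bar>t\<bar> \<le> 1" for t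
    unfolding p1_def by (rule tilt_deriv[OF that])
  have poly: "((\<lambda>t. poly P (?p t)) has_vector_derivative p1 t * poly (pderiv P) (?p t)) (at t within ?I)" if "\<bar>t\<bar> \<le> 1" for t P
    using field_vector_diff_chain_within[OF d0[OF that] has_field_derivative_at_within[OF poly_DERIV[of P]]]
    by (simp only: o_def)
  have d1: "(p1 has_vector_derivative p2 t) (at t within ?I)" if t: "\<bar>t\<bar> \<le> 1" for t
  proof -
    have "(\<lambda>t. poly [:0, \<i>, -\<i>:] (?p t)) = p1" by (auto simp: p1_def algebra_simps)
    moreover have "p1 t * poly (pderiv [:0, \<i>, -\<i>:]) (?p t) = p2 t"
      by (simp add: p1_def p2_def pderiv_pCons algebra_simps)
    ultimately show ?thesis using poly[OF t, of "[:0, \<i>, -\<i>:]"] by simp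
  qed
  have d2: "(p2 has_vector_derivative p3 t) (at t within ?I)" if t: "\<bar>t\<bar> \<le> 1" for t
  proof -
    have "(\<lambda>t. poly [:0, -1, 3, -2:] (?p t)) = p2" by (auto simp: p2_def algebra_simps)
    moreover have "p1 t * poly (pderiv [:0, -1, 3, -2:]) (?p t) = p3 t"
      by (simp add: p1_def p3_def pderiv_pCons algebra_simps power2_eq_square)
    ultimately show ?thesis using poly[OF t, of "[:0, -1, 3, -2:]"] by simp
  qed
  have d3: "(p3 has_vector_derivative p4 t) (at t within ?I)" if t: "\<bar>t\<bar> \<le> 1" for t
  proof -
    have "(\<lambda>t. poly [:0, -\<i>, 7*\<i>, -12*\<i>, 6*\<i>:] (?p t)) = p3" by (auto simp: p3_def algebra_simps power2_eq_square)
    moreover have "p1 t * poly (pderiv [:0, -\<i>, 7*\<i>, -12*\<i>, 6*\<i>:]) (?p t) = p4 t"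
      by (simp add: p1_def p4_def pderiv_pCons algebra_simps power2_eq_square)
    ultimately show ?thesis using poly[OF t, of "[:0, -\<i>, 7*\<i>, -12*\<i>, 6*\<i>:]"] by simp
  qed
  \<comment> \<open>2 * 2 * 5 * 73 = 1460, from |tilt| \<le> 2 and |1 - tilt| \<le> 2.\<close>
  have b4: "cmod (p4 t) \<le> 1460" if t: "\<bar>t\<bar> \<le> 1" for t
  proof -
    note pb = tilt_bounds[OF t]
    have "cmod (1 - 2 * ?p t) \<le> 1 + 2 * 2"
      using pb by (intro order_trans[OF norm_triangle_ineq4]) (auto simp: norm_mult)
    moreover have "cmod (1 - 12 * ?p t + 12 * (?p t)\<^sup>2) \<le> (1 + 12 * 2) + 12 * 2\<^sup>2"
      using pb
      by (intro order_trans[OF norm_triangle_ineq] add_mono order_trans[OF norm_triangle_ineq4])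
         (auto simp: norm_mult norm_power power_mono[of _ 2 2, simplified])
    ultimately have "cmod (p4 t) \<le> 2 * 2 * (1 + 2 * 2) * ((1 + 12 * 2) + 12 * 2\<^sup>2)"
      unfolding p4_def norm_mult using pb by (intro mult_mono) auto
    then show ?thesis by simp
  qed
  \<comment> \<open>Taylor remainders at 0 of \<open>p3\<close>, \<open>p2\<close>,
    \<open>p1\<close> and \<open>tilt\<close>. The derivative of each of \<open>r2\<close>,
    \<open>r1\<close>, \<open>r0\<close> is the one before it, so the bound climbs from |t| to the
    fourth power.\<close>
  define r3 where "r3 t = p3 t - p3 0" for t
  define r2 where "r2 t = p2 t - p2 0 - p3 0 * of_real t" for t
  define r1 where "r1 t = p1 t - p1 0 - p2 0 * of_real t - p3 0 * of_real (t\<^sup>2 / 2)" for t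
  define r0 where "r0 t = ?p t - ?p 0 - p1 0 * of_real t - p2 0 * of_real (t\<^sup>2 / 2) - p3 0 * of_real (t ^ 3 / 6)" for t
  have mon: "((\<lambda>t. c * of_real (t ^ Suc k / real m)) has_vector_derivative c * of_real (real (Suc k) * t ^ k / real m)) (at t within ?I)"
    for c :: complex and t :: real and k m :: nat
  proof -
    have "((\<lambda>t. t ^ Suc k / real m) has_real_derivative real (Suc k) * t ^ k / real m) (at t within ?I)"
      using DERIV_cdivide[OF DERIV_pow[of "Suc k" t ?I], of "real m"] by simp
    then have "((\<lambda>t. t ^ Suc k / real m) has_vector_derivative real (Suc k) * t ^ k / real m) (at t within ?I)"
      by (simp add: has_real_derivative_iff_has_vector_derivative)
    from bounded_linear.has_vector_derivative[OF bounded_linear_compose[OF bounded_linear_mult_right[of c] bounded_linear_of_real] this]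
    show ?thesis .
  qed
  have B3: "cmod (r3 t) \<le> 1460 * \<bar>t\<bar> ^ Suc 0" if "\<bar>t\<bar> \<le> 1" for t
  proof (rule norm_le_power_Suc_of_deriv[where r = 1 and F' = p4])
    show "(r3 has_vector_derivative p4 t) (at t within ?I)" if "\<bar>t\<bar> \<le> 1" for t
      unfolding r3_def [abs_def] using has_vector_derivative_diff[OF d3[OF that] has_vector_derivative_const] by simp
  qed (use that b4 in \<open>auto simp: r3_def\<close>)
  have B2: "cmod (r2 t) \<le> 1460 * \<bar>t\<bar> ^ Suc (Suc 0)" if "\<bar>t\<bar> \<le> 1" for t
  proof (rule norm_le_power_Suc_of_deriv[where r = 1 and F' = r3, OF _ B3])
    show "(r2 has_vector_derivative r3 t) (at t within ?I)" if "\<bar>t\<bar> \<le> 1" for t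
      unfolding r3_def r2_def [abs_def]
      using has_vector_derivative_diff[OF has_vector_derivative_diff[OF d2[OF that] has_vector_derivative_const] mon[of "p3 0" 0 1 t]]
      by simp
  qed (use that in \<open>auto simp: r2_def\<close>)
  have B1: "cmod (r1 t) \<le> 1460 * \<bar>t\<bar> ^ Suc (Suc (Suc 0))" if "\<bar>t\<bar> \<le> 1" for t
  proof (rule norm_le_power_Suc_of_deriv[where r = 1 and F' = r2, OF _ B2])
    show "(r1 has_vector_derivative r2 t) (at t within ?I)" if "\<bar>t\<bar> \<le> 1" for t
      unfolding r2_def r1_def [abs_def]
      using has_vector_derivative_diff[OF has_vector_derivative_diff[OF has_vector_derivative_diff[OF d1[OF that] has_vector_derivative_const]
          mon[of "p2 0" 0 1 t]] mon[of "p3 0" 1 2 t]]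
      by (simp add: numeral_2_eq_2)
  qed (use that in \<open>auto simp: r1_def\<close>)
  have B0: "cmod (r0 t) \<le> 1460 * \<bar>t\<bar> ^ Suc (Suc (Suc (Suc 0)))" if "\<bar>t\<bar> \<le> 1" for t
  proof (rule norm_le_power_Suc_of_deriv[where r = 1 and F' = r1, OF _ B1])
    show "(r0 has_vector_derivative r1 t) (at t within ?I)" if "\<bar>t\<bar> \<le> 1" for t
      unfolding r1_def r0_def [abs_def]
      using has_vector_derivative_diff[OF has_vector_derivative_diff[OF has_vector_derivative_diff[OF has_vector_derivative_diff[OF d0[OF that] has_vector_derivative_const]
          mon[of "p1 0" 0 1 t]] mon[of "p2 0" 1 2 t]] mon[of "p3 0" 2 6 t]]
      by (simp add: numeral_2_eq_2 numeral_3_eq_3)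
  qed (use that in \<open>auto simp: r0_def\<close>)
  define g where "g t = - \<i> * (?z * t) + of_real w * t\<^sup>2 / 2 - \<i> * (of_real a * t ^ 3 / 6) - of_real b * t ^ 4 / 24" for t
  define E where "E t = bern t * exp (g (of_real t))" for t
  have dE: "(E has_vector_derivative \<i> * E t * r0 t) (at t within ?I)" if t: "\<bar>t\<bar> \<le> 1" for t
  proof -
    have bt: "bern t \<noteq> 0" using bern_lower[OF t] by auto
    have "((\<lambda>z. exp (g z)) has_field_derivative exp (g z) *
        (- \<i> * ?z + of_real w * z - \<i> * (of_real a * z\<^sup>2 / 2) - of_real b * z ^ 3 / 6)) (at z)" for z
      unfolding g_def by (auto intro!: derivative_eq_intros simp: algebra_simps power2_eq_square power3_eq_cube)
    from has_vector_derivative_real_field[OF this]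
    have "((\<lambda>t. exp (g (of_real t))) has_vector_derivative exp (g (of_real t)) *
        (- \<i> * ?z + of_real w * of_real t - \<i> * (of_real a * (of_real t)\<^sup>2 / 2) - of_real b * (of_real t) ^ 3 / 6)) (at t within ?I)"
      by (rule has_vector_derivative_at_within)
    from has_vector_derivative_mult[OF bern_deriv this]
    have "(E has_vector_derivative bern t * (exp (g (of_real t)) *
        (- \<i> * ?z + of_real w * of_real t - \<i> * (of_real a * (of_real t)\<^sup>2 / 2) - of_real b * (of_real t) ^ 3 / 6))
        + ?z * (\<i> * cis t) * exp (g (of_real t))) (at t within ?I)"
      unfolding E_def [abs_def] .
    also have "?z * (\<i> * cis t) = \<i> * ?p t * bern t" using bt by (simp add: tilt_def)
    finally show ?thesis
      by (rule has_vector_derivative_eq_rhs) (simp add: E_def r0_def q p0 algebra_simps)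
  qed
  have bE: "cmod (E t) \<le> 2" if t: "\<bar>t\<bar> \<le> 1" for t
  proof -
    have "\<bar>6 * \<zeta>\<^sup>2 - 6 * \<zeta> + 1\<bar> \<le> 1"
      using variance_bounds by (auto simp: abs_le_iff power2_eq_square algebra_simps)
    then have "\<bar>b\<bar> \<le> 1 / 4 * 1"
      unfolding b_def w_def abs_mult using variance_bounds by (intro mult_mono) auto
    then have "\<bar>b * t ^ 4\<bar> \<le> 1 / 4 * 1"
      unfolding abs_mult using power_le_one[of "\<bar>t\<bar>" 4] t by (intro mult_mono) (auto simp: power_abs)
    moreover have "\<bar>w * t\<^sup>2\<bar> \<le> 1 / 4 * 1"
      unfolding abs_mult w_def using power_le_one[of "\<bar>t\<bar>" 2] t variance_bounds by (intro mult_mono) (auto simp: power_abs)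
    ultimately have "Re (g (of_real t)) \<le> 1 / 2" by (simp add: g_def flip: of_real_power of_real_mult)
    then have "exp (Re (g (of_real t))) \<le> exp (1 / 2)" by simp
    also have "\<dots> \<le> 2" using exp_bound[of "1/2"] by (simp add: power2_eq_square)
    finally have e: "exp (Re (g (of_real t))) \<le> 2" .
    have "cmod (bern t) \<le> exp 0" using norm_bern_le[of t] variance_bounds by (auto intro!: order_trans[OF norm_bern_le] simp: mult_nonneg_nonneg)
    then have "cmod (E t) \<le> 1 * 2" unfolding E_def norm_mult using e by (intro mult_mono) auto
    then show ?thesis by simp
  qed
  \<comment> \<open>With |E| \<le> 2 the derivative of E is at most 2 * 1460 times the fourth power
    of |t|; 2920 is then rounded up to 3000.\<close>
  have "cmod (E x - 1) \<le> (2 * 1460) * \<bar>x\<bar> ^ Suc (Suc (Suc (Suc (Suc 0))))"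
  proof (rule norm_le_power_Suc_of_deriv[where r = 1 and F' = "\<lambda>t. \<i> * E t * r0 t" and F = "\<lambda>t. E t - 1"])
    show "((\<lambda>t. E t - 1) has_vector_derivative \<i> * E t * r0 t) (at t within ?I)" if "\<bar>t\<bar> \<le> 1" for t
      using has_vector_derivative_diff[OF dE[OF that] has_vector_derivative_const[of 1]] by simp
    show "cmod (\<i> * E t * r0 t) \<le> 2 * 1460 * \<bar>t\<bar> ^ Suc (Suc (Suc (Suc 0)))" if "\<bar>t\<bar> \<le> 1" for t
      unfolding norm_mult using mult_mono[OF bE[OF that] B0[OF that]] by (simp add: mult.assoc)
  qed (use x in \<open>auto simp: E_def g_def bern_def\<close>)
  also have "\<dots> \<le> 3000 * \<bar>x\<bar> ^ 5" by (simp add: numeral_eq_Suc mult_right_mono)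
  finally show ?thesis by (simp add: E_def g_def)
qed

end

section \<open>The quadratic form of a weighted complete graph\<close>

lemma finite_vertex_pairs [simp, intro]: "finite (vertex_pairs n)"
  unfolding vertex_pairs_def by (rule finite_subset[of _ "Pow {..<n}"]) auto

lemma vertex_pairsD: "e \<in> vertex_pairs n \<Longrightarrow> finite e \<and> card e = 2 \<and> e \<subseteq> {..<n}"
  unfolding vertex_pairs_def by (auto intro: finite_subset)

lemma doubleton_in_vertex_pairs: "j < n \<Longrightarrow> k < n \<Longrightarrow> j \<noteq> k \<Longrightarrow> {j, k} \<in> vertex_pairs n"
  unfolding vertex_pairs_def by auto

lemma bij_betw_vertex_pairs:
  assumes "j < n"
  shows "bij_betw (\<lambda>k. {j, k}) ({..<n} - {j}) {e \<in> vertex_pairs n. j \<in> e}"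
proof (rule bij_betw_imageI)
  show "inj_on (\<lambda>k. {j, k}) ({..<n} - {j})" by (auto simp: inj_on_def doubleton_eq_iff)
  have "\<exists>k. k < n \<and> k \<noteq> j \<and> e = {j, k}" if e: "e \<in> vertex_pairs n" and j: "j \<in> e" for e
  proof -
    obtain x y where xy: "e = {x, y}" "x \<noteq> y"
      using vertex_pairsD[OF e] by (auto simp: card_2_iff)
    then show ?thesis using j vertex_pairsD[OF e] by (auto simp: insert_commute)
  qed
  then show "(\<lambda>k. {j, k}) ` ({..<n} - {j}) = {e \<in> vertex_pairs n. j \<in> e}"
    using assms doubleton_in_vertex_pairs by (auto simp: image_iff)
qed

lemma sum_vertex_pairs_incident:
  "j < n \<Longrightarrow> (\<Sum>e | e \<in> vertex_pairs n \<and> j \<in> e. g e) = (\<Sum>k\<in>{..<n} - {j}. g {j, k})"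
  by (rule sum.reindex_bij_betw[OF bij_betw_vertex_pairs, symmetric])

lemma sum_vertex_pairs:
  "(\<Sum>e\<in>vertex_pairs n. \<Sum>j\<in>e. g e j) = (\<Sum>j<n. \<Sum>k\<in>{..<n} - {j}. (g {j, k} j :: 'a :: comm_monoid_add))"
proof -
  have "(\<Sum>e\<in>vertex_pairs n. \<Sum>j\<in>e. g e j) = (\<Sum>e\<in>vertex_pairs n. \<Sum>j | j \<in> {..<n} \<and> j \<in> e. g e j)"
    by (intro sum.cong refl) (auto dest: vertex_pairsD)
  also have "\<dots> = (\<Sum>j<n. \<Sum>e | e \<in> vertex_pairs n \<and> j \<in> e. g e j)"
    by (rule sum.swap_restrict) auto
  also have "\<dots> = (\<Sum>j<n. \<Sum>k\<in>{..<n} - {j}. g {j, k} j)"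
    by (intro sum.cong refl) (simp add: sum_vertex_pairs_incident)
  finally show ?thesis .
qed

text \<open>The passage to ordered pairs: full double sums factor into sums over single vertices,
  and the diagonal is subtracted afterwards.\<close>

lemma sum_vertex_pairs_half:
  fixes g :: "nat set \<Rightarrow> real"
  shows "2 * (\<Sum>e\<in>vertex_pairs n. g e) = (\<Sum>j<n. \<Sum>k\<in>{..<n} - {j}. g {j, k})"
proof -
  have "2 * (\<Sum>e\<in>vertex_pairs n. g e) = (\<Sum>e\<in>vertex_pairs n. \<Sum>j\<in>e. g e)"
    unfolding sum_distrib_left by (intro sum.cong refl) (auto dest: vertex_pairsD)
  then show ?thesis unfolding sum_vertex_pairs .
qed

lemma sum_remove_diagonal:
  fixes g :: "nat \<Rightarrow> nat \<Rightarrow> real"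
  shows "(\<Sum>j<n. \<Sum>k\<in>{..<n} - {j}. g j k) = (\<Sum>j<n. \<Sum>k<n. g j k) - (\<Sum>j<n. g j j)"
  by (simp add: sum_diff1 sum_subtractf)

lemma card_vertex_pairs: "real (card (vertex_pairs n)) \<le> (real n)\<^sup>2"
proof -
  have "2 * real (card (vertex_pairs n)) = (\<Sum>j<n. \<Sum>k\<in>{..<n} - {j}. 1)"
    using sum_vertex_pairs_half[where g = "\<lambda>_. 1" and n = n] by simp
  also have "\<dots> \<le> (\<Sum>j<n. \<Sum>k<n. 1)" by (intro sum_mono sum_mono2) auto
  finally show ?thesis by (simp add: power2_eq_square)
qed

lemma sum_edge_square_le:
  assumes "e \<in> vertex_pairs n"
  shows "(sum t e)\<^sup>2 \<le> 2 * (\<Sum>j\<in>e. (t j :: real)\<^sup>2)"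
proof -
  obtain j k where "e = {j, k}" "j \<noteq> k" using vertex_pairsD[OF assms] by (auto simp: card_2_iff)
  moreover have "(t j + t k)\<^sup>2 \<le> 2 * ((t j)\<^sup>2 + (t k)\<^sup>2)"
    using sum_squares_bound[of "t j" "t k"] by (simp add: power2_sum)
  ultimately show ?thesis by simp
qed

text \<open>The left-hand side is half the sum over all ordered pairs, up to the diagonal; that sum is
  \<open>n\<^sup>2 - (\<Sum> cos)\<^sup>2 + (\<Sum> sin)\<^sup>2\<close>.\<close>

lemma sum_one_minus_cos_pairs_ge:
  fixes t :: "nat \<Rightarrow> real"
  assumes "0 \<le> (\<Sum>j<n. cos (t j))"
  shows "(real n - 4) / 2 * (\<Sum>j<n. 1 - cos (t j)) \<le> (\<Sum>e\<in>vertex_pairs n. 1 - cos (sum t e))"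
proof -
  define A where "A = (\<Sum>j<n. cos (t j))"
  define B where "B = (\<Sum>j<n. sin (t j))"
  define V where "V = (\<Sum>j<n. 1 - cos (t j))"
  have V: "V = real n - A" by (simp add: V_def A_def sum_subtractf)
  have V0: "V \<ge> 0" unfolding V_def by (intro sum_nonneg) simp
  have "2 * (\<Sum>e\<in>vertex_pairs n. 1 - cos (sum t e)) = (\<Sum>j<n. \<Sum>k\<in>{..<n} - {j}. 1 - cos (t j + t k))"
    unfolding sum_vertex_pairs_half by (intro sum.cong refl) auto
  also have "\<dots> = (\<Sum>j<n. \<Sum>k<n. 1 - cos (t j + t k)) - (\<Sum>j<n. 1 - cos (t j + t j))"
    by (rule sum_remove_diagonal)
  also have "(\<Sum>j<n. \<Sum>k<n. 1 - cos (t j + t k)) = (real n)\<^sup>2 - A\<^sup>2 + B\<^sup>2"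
    by (simp add: A_def B_def cos_add sum_subtractf sum_product power2_eq_square)
  finally have eq: "2 * (\<Sum>e\<in>vertex_pairs n. 1 - cos (sum t e)) = (real n)\<^sup>2 - A\<^sup>2 + B\<^sup>2 - (\<Sum>j<n. 1 - cos (t j + t j))" .
  have "(\<Sum>j<n. 1 - cos (t j + t j)) \<le> (\<Sum>j<n. 4 * (1 - cos (t j)))"
  proof (rule sum_mono)
    fix j
    have "1 - cos (t j + t j) = 2 * (1 - cos (t j)) * (1 + cos (t j))"
      using cos_double_cos[of "t j"] by (simp add: power2_eq_square algebra_simps)
    also have "\<dots> \<le> 2 * (1 - cos (t j)) * 2" by (intro mult_left_mono) auto
    finally show "1 - cos (t j + t j) \<le> 4 * (1 - cos (t j))" by simp
  qed
  also have "(\<Sum>j<n. 4 * (1 - cos (t j))) = 4 * V" by (simp add: V_def sum_distrib_left)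
  finally have "(real n)\<^sup>2 - A\<^sup>2 + B\<^sup>2 - 4 * V \<le> 2 * (\<Sum>e\<in>vertex_pairs n. 1 - cos (sum t e))" unfolding eq by simp
  \<comment> \<open>The sign of the cosine sum enters here. At t = (\<pi>, ..., \<pi>), where that
    sum is -n, the left-hand side of the claim is positive for n > 4 while the right-hand side
    vanishes.\<close>
  moreover have "real n * V \<le> (real n)\<^sup>2 - A\<^sup>2"
  proof -
    have "(real n)\<^sup>2 - A\<^sup>2 = V * (real n + A)" unfolding V by (simp add: power2_eq_square algebra_simps)
    also have "\<dots> \<ge> V * real n" using V0 assms by (intro mult_left_mono) (auto simp: A_def)
    finally show ?thesis by (simp add: mult.commute)
  qed
  moreover have "0 \<le> B\<^sup>2" by simp
  ultimately have "(real n - 4) * V \<le> 2 * (\<Sum>e\<in>vertex_pairs n. 1 - cos (sum t e))"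
    unfolding left_diff_distrib by linarith
  then show ?thesis unfolding V_def[symmetric] by simp
qed

text \<open>With y = |x| / 2 the claim follows from sin y \<ge> y / 2, and y^3 / 6 \<le> y / 2 on
  [0, 8/5], an interval that contains \<pi> / 2.\<close>

lemma one_minus_cos_ge: "\<bar>x\<bar> \<le> pi \<Longrightarrow> x\<^sup>2 / 8 \<le> 1 - cos (x::real)"
proof -
  assume x: "\<bar>x\<bar> \<le> pi"
  define y where "y = \<bar>x\<bar> / 2"
  have y: "0 \<le> y" "y \<le> 8 / 5" using x pi_less_4 by (auto simp: y_def) (use x pi_approx in auto)
  have "\<bar>sin y - y\<bar> \<le> y ^ 3 / 6"
  proof -
    have "cmod (iexp y - (\<Sum>k\<le>2. (\<i> * y) ^ k / fact k)) \<le> \<bar>y\<bar> ^ Suc 2 / fact (Suc 2)" by (rule iexp_approx1)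
    moreover have "Im (iexp y - (\<Sum>k\<le>2. (\<i> * y) ^ k / fact k)) = sin y - y"
      by (simp add: Im_exp eval_nat_numeral power2_eq_square)
    ultimately show ?thesis
      using abs_Im_le_cmod[of "iexp y - (\<Sum>k\<le>2. (\<i> * y) ^ k / fact k)"] y by (simp add: eval_nat_numeral)
  qed
  moreover have "y ^ 3 / 6 \<le> y / 2"
  proof -
    have "y\<^sup>2 \<le> (8 / 5)\<^sup>2" using y by (intro power_mono) auto
    then have "y * y\<^sup>2 \<le> y * 3" using y by (intro mult_left_mono) (auto simp: power2_eq_square)
    then show ?thesis by (simp add: power3_eq_cube power2_eq_square)
  qed
  ultimately have "y / 2 \<le> sin y" by linarith
  then have "(y / 2)\<^sup>2 \<le> (sin y)\<^sup>2" using y by (intro power_mono) auto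
  moreover have "1 - cos x = 2 * (sin y)\<^sup>2"
    using cos_double_sin[of y] by (simp add: y_def)
  ultimately show ?thesis by (simp add: y_def power_divide)
qed

lemma one_minus_cos_ge_quartic: "x\<^sup>2 / 2 - x ^ 4 / 24 \<le> 1 - cos (x::real)"
proof -
  obtain t where t: "cos x = (\<Sum>k<4. cos_coeff k * x ^ k) + cos (t + 1 / 2 * real 4 * pi) / fact 4 * x ^ 4"
    using Maclaurin_cos_expansion[of x 4] by blast
  have "(\<Sum>k<4. cos_coeff k * x ^ k) = 1 - x\<^sup>2 / 2"
    by (simp add: cos_coeff_def lessThan_nat_numeral fact_numeral)
  moreover have "cos (t + 1 / 2 * real 4 * pi) / fact 4 * x ^ 4 \<le> 1 / fact 4 * x ^ 4"
    by (intro mult_right_mono divide_right_mono cos_le_one) auto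
  ultimately show ?thesis unfolding t by (simp add: fact_numeral)
qed

text \<open>This is the triangle inequality for the chords \<open>|1 - exp (i x)|\<close>, whose squares are \<open>2 (1 - cos x)\<close>.\<close>

lemma one_minus_cos_add_le: "1 - cos (x + y) \<le> 2 * (1 - cos x) + 2 * (1 - cos (y::real))"
proof -
  have "sin ((x + y) / 2) = sin (x / 2) * cos (y / 2) + cos (x / 2) * sin (y / 2)"
    by (simp add: sin_add add_divide_distrib)
  then have "\<bar>sin ((x + y) / 2)\<bar> \<le> \<bar>sin (x / 2)\<bar> * \<bar>cos (y / 2)\<bar> + \<bar>cos (x / 2)\<bar> * \<bar>sin (y / 2)\<bar>"
    by (metis abs_mult abs_triangle_ineq)
  also have "\<dots> \<le> \<bar>sin (x / 2)\<bar> * 1 + 1 * \<bar>sin (y / 2)\<bar>"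
    by (intro add_mono mult_mono) auto
  finally have "(sin ((x + y) / 2))\<^sup>2 \<le> (\<bar>sin (x / 2)\<bar> + \<bar>sin (y / 2)\<bar>)\<^sup>2"
    by (intro abs_le_square_iff[THEN iffD1]) simp
  also have "\<dots> \<le> 2 * (sin (x / 2))\<^sup>2 + 2 * (sin (y / 2))\<^sup>2"
    using sum_squares_bound[of "\<bar>sin (x / 2)\<bar>" "\<bar>sin (y / 2)\<bar>"] by (simp add: power2_sum)
  finally have "2 * (sin ((x + y) / 2))\<^sup>2 \<le> 2 * (2 * (sin (x / 2))\<^sup>2) + 2 * (2 * (sin (y / 2))\<^sup>2)" by simp
  moreover have "1 - cos u = 2 * (sin (u / 2))\<^sup>2" for u :: real using cos_double_sin[of "u / 2"] by simp
  ultimately show ?thesis by simp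
qed

locale graph_weights =
  fixes n :: nat and z :: "nat set \<Rightarrow> real" and w0 :: real
  assumes n3: "3 \<le> n" and w0: "0 < w0"
    and z: "\<And>e. e \<in> vertex_pairs n \<Longrightarrow> 0 \<le> z e" "\<And>e. e \<in> vertex_pairs n \<Longrightarrow> z e \<le> 1"
    and w0_le: "\<And>e. e \<in> vertex_pairs n \<Longrightarrow> w0 \<le> z e * (1 - z e)"
begin

abbreviation L :: "(nat \<Rightarrow> real) measure" where "L \<equiv> lebesgue_prod {..<n}"

definition w :: "nat set \<Rightarrow> real" where "w e = z e * (1 - z e)"

lemma w_bounds: "e \<in> vertex_pairs n \<Longrightarrow> 0 \<le> w e" "e \<in> vertex_pairs n \<Longrightarrow> w e \<le> 1 / 4"
  "e \<in> vertex_pairs n \<Longrightarrow> w0 \<le> w e"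
  unfolding w_def using variance_bounds[OF z] w0_le by auto

lemma w0_small: "w0 \<le> 1 / 4"
  using w_bounds[OF doubleton_in_vertex_pairs[of 0 n 1]] n3 by linarith

text \<open>The Hessian of \<open>q_form\<close>: the signless Laplacian of the complete graph with
  edge weights \<open>w\<close>. The degree equations identify it with \<open>Q_mat\<close>.\<close>

definition hess :: "nat \<Rightarrow> nat \<Rightarrow> real" where
  "hess i j = (if i = j then \<Sum>k\<in>{..<n} - {i}. w {i, k} else w {i, j})"

lemma quad_form_hess: "quad_form n hess t = (\<Sum>e\<in>vertex_pairs n. w e * (sum t e)\<^sup>2)"
proof -
  have "2 * (\<Sum>e\<in>vertex_pairs n. w e * (sum t e)\<^sup>2) = (\<Sum>j<n. \<Sum>k\<in>{..<n} - {j}. w {j, k} * (t j + t k)\<^sup>2)"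
    unfolding sum_vertex_pairs_half by (intro sum.cong refl) auto
  also have "\<dots> = (\<Sum>j<n. \<Sum>k\<in>{..<n} - {j}. w {j, k} * (t j)\<^sup>2 + w {j, k} * (t k)\<^sup>2 + 2 * (w {j, k} * t j * t k))"
    by (intro sum.cong refl) (simp add: power2_sum algebra_simps)
  also have "\<dots> = (\<Sum>j<n. \<Sum>k\<in>{..<n} - {j}. w {j, k} * (t j)\<^sup>2) + (\<Sum>j<n. \<Sum>k\<in>{..<n} - {j}. w {j, k} * (t k)\<^sup>2)
      + 2 * (\<Sum>j<n. \<Sum>k\<in>{..<n} - {j}. w {j, k} * t j * t k)"
    by (simp add: sum.distrib sum_distrib_left)
  also have "(\<Sum>j<n. \<Sum>k\<in>{..<n} - {j}. w {j, k} * (t k)\<^sup>2) = (\<Sum>k<n. \<Sum>j\<in>{..<n} - {k}. w {j, k} * (t k)\<^sup>2)"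
    unfolding sum_remove_diagonal by (subst sum.swap) simp
  also have "\<dots> = (\<Sum>j<n. \<Sum>k\<in>{..<n} - {j}. w {j, k} * (t j)\<^sup>2)"
    by (simp add: insert_commute)
  finally have 1: "(\<Sum>e\<in>vertex_pairs n. w e * (sum t e)\<^sup>2) = (\<Sum>j<n. \<Sum>k\<in>{..<n} - {j}. w {j, k} * (t j)\<^sup>2)
      + (\<Sum>j<n. \<Sum>k\<in>{..<n} - {j}. w {j, k} * t j * t k)" by simp
  have "quad_form n hess t = (\<Sum>j<n. hess j j * t j * t j + (\<Sum>k\<in>{..<n} - {j}. hess j k * t j * t k))"
    unfolding quad_form_def by (intro sum.cong refl) (subst sum.remove, auto)
  also have "\<dots> = (\<Sum>j<n. (\<Sum>k\<in>{..<n} - {j}. w {j, k} * (t j)\<^sup>2) + (\<Sum>k\<in>{..<n} - {j}. w {j, k} * t j * t k))"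
  proof (intro sum.cong refl arg_cong2[where f = "(+)"])
    fix j
    show "hess j j * t j * t j = (\<Sum>k\<in>{..<n} - {j}. w {j, k} * (t j)\<^sup>2)"
      by (simp add: hess_def sum_distrib_right power2_eq_square mult.assoc)
  qed (auto simp: hess_def)
  finally show ?thesis unfolding 1 by (simp add: sum.distrib)
qed

lemma q_form_eq: "q_form n z t = quad_form n hess t / 2"
  unfolding q_form_def quad_form_hess w_def by (simp add: power2_eq_square algebra_simps)

text \<open>With all weights equal to 1 the form is (n - 2) times the sum of the squares plus the
  square of the sum; the form is monotone in the weights, and n \<ge> 3 makes the bound
  positive.\<close>

lemma quad_form_hess_lower: "w0 * (real n - 2) * (\<Sum>j<n. (t j)\<^sup>2) \<le> quad_form n hess t"
proof -
  have "w0 * (real n - 2) * (\<Sum>j<n. (t j)\<^sup>2) \<le> w0 * ((real n - 2) * (\<Sum>j<n. (t j)\<^sup>2) + (\<Sum>j<n. t j)\<^sup>2)"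
    using w0 by (simp add: mult.assoc)
  also have "(real n - 2) * (\<Sum>j<n. (t j)\<^sup>2) + (\<Sum>j<n. t j)\<^sup>2 = (\<Sum>e\<in>vertex_pairs n. (sum t e)\<^sup>2)"
  proof -
    have "2 * (\<Sum>e\<in>vertex_pairs n. (sum t e)\<^sup>2) = (\<Sum>j<n. \<Sum>k\<in>{..<n} - {j}. (t j + t k)\<^sup>2)"
      unfolding sum_vertex_pairs_half by (intro sum.cong refl) auto
    also have "\<dots> = (\<Sum>j<n. \<Sum>k<n. (t j + t k)\<^sup>2) - (\<Sum>j<n. (t j + t j)\<^sup>2)"
      by (rule sum_remove_diagonal)
    also have "(\<Sum>j<n. \<Sum>k<n. (t j + t k)\<^sup>2) = 2 * real n * (\<Sum>j<n. (t j)\<^sup>2) + 2 * (\<Sum>j<n. t j)\<^sup>2"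
    proof -
      have "(\<Sum>j<n. \<Sum>k<n. (t j + t k)\<^sup>2) = (\<Sum>j<n. \<Sum>k<n. (t j)\<^sup>2) + (\<Sum>j<n. \<Sum>k<n. (t k)\<^sup>2) + 2 * (\<Sum>j<n. \<Sum>k<n. t j * t k)"
        by (simp add: power2_sum sum.distrib sum_distrib_left mult.assoc)
      moreover have "(\<Sum>j<n. \<Sum>k<n. t j * t k) = (\<Sum>j<n. t j)\<^sup>2"
        by (simp add: power2_eq_square sum_product)
      ultimately show ?thesis by (simp add: sum_distrib_left mult.assoc)
    qed
    also have "(\<Sum>j<n. (t j + t j)\<^sup>2) = 4 * (\<Sum>j<n. (t j)\<^sup>2)"
      by (simp add: sum_distrib_left power2_eq_square)
    finally show ?thesis by (simp add: algebra_simps)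
  qed
  also have "w0 * (\<Sum>e\<in>vertex_pairs n. (sum t e)\<^sup>2) \<le> quad_form n hess t"
    unfolding quad_form_hess sum_distrib_left by (intro sum_mono mult_right_mono w_bounds) auto
  finally show ?thesis by simp
qed

lemma quad_form_hess_upper: "quad_form n hess t \<le> real n / 2 * (\<Sum>j<n. (t j)\<^sup>2)"
proof -
  have "quad_form n hess t \<le> (\<Sum>e\<in>vertex_pairs n. 1 / 4 * (2 * (\<Sum>j\<in>e. (t j)\<^sup>2)))"
    unfolding quad_form_hess by (intro sum_mono mult_mono w_bounds sum_edge_square_le) auto
  also have "\<dots> = (\<Sum>e\<in>vertex_pairs n. \<Sum>j\<in>e. (t j)\<^sup>2 / 2)" by (simp add: sum_divide_distrib)
  also have "\<dots> = (\<Sum>j<n. (real n - 1) * ((t j)\<^sup>2 / 2))"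
    unfolding sum_vertex_pairs by (intro sum.cong refl) (auto simp: of_nat_diff)
  also have "\<dots> \<le> (\<Sum>j<n. real n * ((t j)\<^sup>2 / 2))" by (intro sum_mono mult_right_mono) auto
  finally show ?thesis by (simp add: sum_distrib_left)
qed

lemma quad_form_hess_pos: "\<exists>i<n. t i \<noteq> 0 \<Longrightarrow> 0 < quad_form n hess t"
proof -
  assume "\<exists>i<n. t i \<noteq> 0"
  then obtain i where i: "i < n" "t i \<noteq> 0" by blast
  then have "0 < (t i)\<^sup>2" by simp
  also have "\<dots> \<le> (\<Sum>j<n. (t j)\<^sup>2)" using i by (intro member_le_sum) auto
  finally have "0 < w0 * (real n - 2) * (\<Sum>j<n. (t j)\<^sup>2)" using w0 n3 by simp
  then show ?thesis using quad_form_hess_lower[of t] by linarith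
qed

lemma hess_sym: "hess i j = hess j i"
  by (simp add: hess_def insert_commute)

text \<open>Not a factor of \<open>hess\<close> but the inverse direction: a lower triangular M
  whose transpose, multiplied by \<open>hess\<close> and M, gives the identity. It maps a standard
  Gaussian vector to one with density proportional to exp (- q).\<close>

definition chol :: "nat \<Rightarrow> nat \<Rightarrow> real" where
  "chol = (SOME M. (\<forall>j<n. 0 < M j j) \<and> (\<forall>j k. j < k \<longrightarrow> M j k = 0) \<and>
    (\<forall>y. quad_form n hess (lin_map n M y) = (\<Sum>k<n. (y k)\<^sup>2)) \<and>
    (\<forall>F \<in> borel_measurable L.
      (\<integral>\<^sup>+t. F t * ennreal (exp (- quad_form n hess t / 2)) \<partial>L)
      = ennreal (sqrt (2 * pi) ^ n * (\<Prod>j<n. M j j)) * (\<integral>\<^sup>+y. F (lin_map n M y) \<partial>std_gauss {..<n})))"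

definition gauss_const :: real where "gauss_const = sqrt (2 * pi) ^ n * (\<Prod>j<n. chol j j)"

lemma chol:
  shows chol_pos: "j < n \<Longrightarrow> 0 < chol j j" and chol_lower: "j < k \<Longrightarrow> chol j k = 0"
    and chol_quad: "quad_form n hess (lin_map n chol y) = (\<Sum>k<n. (y k)\<^sup>2)"
    and chol_nn_integral: "F \<in> borel_measurable L \<Longrightarrow> (\<integral>\<^sup>+t. F t * ennreal (exp (- q_form n z t)) \<partial>L)
      = ennreal gauss_const * (\<integral>\<^sup>+y. F (lin_map n chol y) \<partial>std_gauss {..<n})"
  using someI_ex[OF gaussian_diagonalisation[of n hess, OF hess_sym quad_form_hess_pos]]
  unfolding chol_def[symmetric] gauss_const_def q_form_eq by simp_all

lemma gauss_const_pos: "0 < gauss_const"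
  unfolding gauss_const_def using chol_pos by (intro mult_pos_pos prod_pos) auto

lemma q_form_measurable [measurable]: "q_form n z \<in> borel_measurable L"
  unfolding q_form_eq [abs_def] by measurable

lemma nn_integral_exp_q: "(\<integral>\<^sup>+t. ennreal (exp (- q_form n z t)) \<partial>L) = ennreal gauss_const"
  using chol_nn_integral[of "\<lambda>_. 1"] prob_space.emeasure_space_1[OF prob_space_std_gauss[of "{..<n}"]] by simp

section \<open>Comparison with product Gaussians\<close>

lemma nn_integral_gauss_1d: "c > 0 \<Longrightarrow> (\<integral>\<^sup>+x. ennreal (exp (- (c * x\<^sup>2) / 2)) \<partial>lborel) = ennreal (sqrt (2 * pi) / sqrt c)"
  using nn_integral_std_normal_affine[of "\<lambda>_. 1" c 0] prob_space.emeasure_space_1[OF prob_space_std_normal] by simp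

lemma nn_integral_gauss_prod:
  assumes "c > 0"
  shows "(\<integral>\<^sup>+t. ennreal (exp (- (c * (\<Sum>j<n. (t j)\<^sup>2)) / 2)) \<partial>L) = ennreal ((sqrt (2 * pi) / sqrt c) ^ n)"
proof -
  interpret P: product_sigma_finite "\<lambda>_::nat. lborel :: real measure" by (rule product_sigma_finite_lborel)
  have "(\<integral>\<^sup>+t. ennreal (exp (- (c * (\<Sum>j<n. (t j)\<^sup>2)) / 2)) \<partial>L) = (\<integral>\<^sup>+t. (\<Prod>j<n. ennreal (exp (- (c * (t j)\<^sup>2) / 2))) \<partial>L)"
    by (simp add: prod_ennreal exp_sum[symmetric] sum_distrib_left sum_divide_distrib sum_negf)
  also have "\<dots> = (\<Prod>j<n. \<integral>\<^sup>+x. ennreal (exp (- (c * x\<^sup>2) / 2)) \<partial>lborel)"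
    by (rule P.product_nn_integral_prod) auto
  also have "\<dots> = ennreal ((sqrt (2 * pi) / sqrt c) ^ n)"
    using assms by (simp only: nn_integral_gauss_1d[OF assms] prod_constant card_lessThan) (simp add: ennreal_power)
  finally show ?thesis .
qed

text \<open>As the weights are at most 1/4, q is at most n/4 times the sum of the squares. The
  resulting bound (4 \<pi> / n)^(n/2) is the yardstick for the far region.\<close>

lemma gauss_const_ge: "(sqrt (2 * pi) / sqrt (real n / 2)) ^ n \<le> gauss_const"
proof -
  have "ennreal ((sqrt (2 * pi) / sqrt (real n / 2)) ^ n) = (\<integral>\<^sup>+t. ennreal (exp (- (real n / 2 * (\<Sum>j<n. (t j)\<^sup>2)) / 2)) \<partial>L)"
    using n3 by (subst nn_integral_gauss_prod) auto
  also have "\<dots> \<le> (\<integral>\<^sup>+t. ennreal (exp (- q_form n z t)) \<partial>L)"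
    using quad_form_hess_upper by (intro nn_integral_mono) (auto simp: q_form_eq mult.commute)
  also have "\<dots> = ennreal gauss_const" by (rule nn_integral_exp_q)
  finally show ?thesis using gauss_const_pos by (simp add: ennreal_le_iff)
qed

end

section \<open>The integrand away from the origin\<close>

lemma nn_integral_exp_square_std_normal:
  assumes "0 \<le> a" "a \<le> 1 / 2"
  shows "(\<integral>\<^sup>+y. ennreal (exp (a * y\<^sup>2 / 2)) \<partial>std_normal) \<le> ennreal (exp a)"
proof -
  have "(\<integral>\<^sup>+y. ennreal (exp (a * y\<^sup>2 / 2)) \<partial>std_normal)
      = (\<integral>\<^sup>+y. ennreal (1 / sqrt (2 * pi)) * ennreal (exp (- ((1 - a) * y\<^sup>2) / 2)) \<partial>lborel)"
    unfolding std_normal_def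
    by (subst nn_integral_density, simp, simp, intro nn_integral_cong)
       (simp add: std_normal_density_def ennreal_mult'[symmetric] exp_add[symmetric] algebra_simps diff_divide_distrib)
  also have "\<dots> = ennreal (1 / sqrt (2 * pi)) * ennreal (sqrt (2 * pi) / sqrt (1 - a))"
    using assms nn_integral_std_normal_affine[of "\<lambda>_. 1" "1 - a" 0] prob_space.emeasure_space_1[OF prob_space_std_normal]
    by (subst nn_integral_cmult) auto
  also have "\<dots> = ennreal (1 / sqrt (1 - a))"
    using assms by (simp add: ennreal_mult'[symmetric])
  also have "\<dots> \<le> ennreal (exp a)"
  proof (rule ennreal_leI)
    \<comment> \<open>The product is 1 + a (1 - 2 a), which is where a \<le> 1/2 is used.\<close>
    have "1 \<le> (1 - a) * (1 + 2 * a)" using assms mult_left_mono[of a "1/2" a] by (simp add: algebra_simps)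
    also have "\<dots> \<le> (1 - a) * exp (2 * a)" using assms exp_ge_add_one_self[of "2 * a"] by (intro mult_left_mono) auto
    finally have "sqrt 1 \<le> sqrt ((1 - a) * exp (2 * a))" by (rule real_sqrt_le_mono)
    also have "\<dots> = sqrt (1 - a) * exp a"
      by (simp add: real_sqrt_mult exp_double)
    finally show "1 / sqrt (1 - a) \<le> exp a" using assms by (simp add: field_simps)
  qed
  finally show ?thesis .
qed

context graph_weights
begin

text \<open>A majorant for the modulus of the counting integrand (\<open>norm_char_prod_le\<close>);
  the degrees D contribute only a phase and do not appear.\<close>

definition damp :: "(nat \<Rightarrow> real) \<Rightarrow> real" where
  "damp t = exp (- (\<Sum>e\<in>vertex_pairs n. w e * (1 - cos (sum t e))))"

definition V :: "(nat \<Rightarrow> real) \<Rightarrow> real" where "V t = (\<Sum>j<n. 1 - cos (t j))"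

definition cube :: "(nat \<Rightarrow> real) set" where
  "cube = {t \<in> space L. \<forall>j<n. \<bar>t j\<bar> \<le> pi}"

definition box :: "real \<Rightarrow> (nat \<Rightarrow> real) set" where
  "box r = {t \<in> space L. \<forall>j<n. \<bar>t j\<bar> \<le> r}"

lemma edge_sum_measurable: "e \<in> vertex_pairs n \<Longrightarrow> (\<lambda>t. sum t e) \<in> borel_measurable L"
proof (rule borel_measurable_sum)
  fix i assume "e \<in> vertex_pairs n" "i \<in> e"
  then have "i \<in> {..<n}" by (auto dest: vertex_pairsD)
  from measurable_component_singleton[OF this, of "\<lambda>_. lborel :: real measure"]
  show "(\<lambda>t. t i) \<in> borel_measurable L" by simp
qed

lemma damp_measurable [measurable]: "damp \<in> borel_measurable L"
proof -
  have "(\<lambda>t. \<Sum>e\<in>vertex_pairs n. w e * (1 - cos (sum t e))) \<in> borel_measurable L"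
  proof (rule borel_measurable_sum)
    fix e assume "e \<in> vertex_pairs n"
    note [measurable] = edge_sum_measurable[OF this]
    show "(\<lambda>t. w e * (1 - cos (sum t e))) \<in> borel_measurable L" by measurable
  qed
  then show ?thesis unfolding damp_def [abs_def] by measurable
qed

lemma V_measurable [measurable]: "V \<in> borel_measurable L"
  unfolding V_def [abs_def] by measurable

lemma cube_sets [measurable]: "cube \<in> sets L" unfolding cube_def by measurable
lemma cube_Collect_sets [measurable]:
  assumes "Measurable.pred L P" shows "{t \<in> cube. P t} \<in> sets L"
proof -
  have "{t \<in> cube. P t} = cube \<inter> {t \<in> space L. P t}" by (auto simp: cube_def)
  then show ?thesis using cube_sets assms by (auto simp: pred_def)
qed

lemma box_sets [measurable]: "box r \<in> sets L" unfolding box_def by measurable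

lemma damp_nonneg [simp]: "0 \<le> damp t" by (simp add: damp_def)

lemma V_nonneg: "0 \<le> V t" unfolding V_def by (intro sum_nonneg) simp

lemma sum_cos_eq: "(\<Sum>j<n. cos (t j)) = real n - V t"
  unfolding V_def by (simp add: sum_subtractf)

section \<open>The far region\<close>

lemma damp_le_far:
  assumes "0 \<le> (\<Sum>j<n. cos (t j))" "8 \<le> n"
  shows "damp t \<le> exp (- (w0 * real n / 4) * V t)"
proof -
  have "w0 * real n / 4 * V t = w0 * (real n / 4 * V t)" by simp
  \<comment> \<open>n \<ge> 8 gives n / 4 \<le> (n - 4) / 2.\<close>
  also have "\<dots> \<le> w0 * ((real n - 4) / 2 * V t)"
    using w0 V_nonneg[of t] assms by (intro mult_left_mono mult_right_mono) auto
  also have "\<dots> \<le> w0 * (\<Sum>e\<in>vertex_pairs n. 1 - cos (sum t e))"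
    using w0 sum_one_minus_cos_pairs_ge[OF assms(1)] unfolding V_def by (intro mult_left_mono) auto
  also have "\<dots> \<le> (\<Sum>e\<in>vertex_pairs n. w e * (1 - cos (sum t e)))"
    unfolding sum_distrib_left by (intro sum_mono mult_right_mono w_bounds) auto
  finally show ?thesis by (simp add: damp_def)
qed

text \<open>Chosen so that exp (- w0 n K0 / 8) is exp (- n) divided by (4 / sqrt w0)^n. The divisor
  repays the ratio between the Gaussian integral with precision w0 n / 32 and the lower bound for
  \<open>gauss_const\<close>; exp (- n) remains as the gain.\<close>

definition K0 :: real where "K0 = 8 / w0 * (1 + ln (4 / sqrt w0))"

lemma K0_pos: "0 < K0"
proof -
  have "sqrt w0 \<le> 1" using w0_small by simp
  then have "sqrt w0 \<le> 4" by linarith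
  then have "1 \<le> 4 / sqrt w0" using w0 by (simp add: le_divide_eq)
  then show ?thesis unfolding K0_def using w0 by (intro mult_pos_pos divide_pos_pos add_pos_nonneg) auto
qed

text \<open>The exponent w0 n V / 4 is split into equal halves. One is bounded by V \<ge> K0, the
  other by V \<ge> (sum of the squares) / 8 and integrated as a product Gaussian.\<close>

lemma far_integral:
  assumes n8: "8 \<le> n"
  shows "(\<integral>\<^sup>+t. ennreal (damp t) * indicator {t \<in> cube. 0 \<le> (\<Sum>j<n. cos (t j)) \<and> K0 \<le> V t} t \<partial>L)
    \<le> ennreal (exp (- real n) * gauss_const)"
proof -
  let ?c = "w0 * real n / 32"
  have c: "?c > 0" using w0 n3 by simp
  have "(\<integral>\<^sup>+t. ennreal (damp t) * indicator {t \<in> cube. 0 \<le> (\<Sum>j<n. cos (t j)) \<and> K0 \<le> V t} t \<partial>L)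
    \<le> (\<integral>\<^sup>+t. ennreal (exp (- (w0 * real n * K0 / 8))) * ennreal (exp (- (?c * (\<Sum>j<n. (t j)\<^sup>2)) / 2)) \<partial>L)"
  proof (intro nn_integral_mono)
    fix t assume "t \<in> space L"
    show "ennreal (damp t) * indicator {t \<in> cube. 0 \<le> (\<Sum>j<n. cos (t j)) \<and> K0 \<le> V t} t
        \<le> ennreal (exp (- (w0 * real n * K0 / 8))) * ennreal (exp (- (?c * (\<Sum>j<n. (t j)\<^sup>2)) / 2))"
    proof (cases "t \<in> cube \<and> 0 \<le> (\<Sum>j<n. cos (t j)) \<and> K0 \<le> V t")
      case True
      have "(\<Sum>j<n. (t j)\<^sup>2 / 8) \<le> V t"
        unfolding V_def using True by (intro sum_mono one_minus_cos_ge) (auto simp: cube_def)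
      then have "(\<Sum>j<n. (t j)\<^sup>2) / 8 \<le> V t" by (simp add: sum_divide_distrib)
      then have "w0 * real n / 8 * ((\<Sum>j<n. (t j)\<^sup>2) / 8) \<le> w0 * real n / 8 * V t"
        using w0 by (intro mult_left_mono) auto
      moreover have "w0 * real n / 8 * K0 \<le> w0 * real n / 8 * V t"
        using w0 True by (intro mult_left_mono) auto
      ultimately have "- (w0 * real n / 4) * V t \<le> - (w0 * real n * K0 / 8) + - (?c * (\<Sum>j<n. (t j)\<^sup>2)) / 2"
        by simp
      then have "damp t \<le> exp (- (w0 * real n * K0 / 8) + - (?c * (\<Sum>j<n. (t j)\<^sup>2)) / 2)"
        using damp_le_far[of t] True n8 by (meson exp_le_cancel_iff order_trans)
      then show ?thesis using True unfolding exp_add by (simp add: ennreal_mult'[symmetric])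
    qed auto
  qed
  also have "\<dots> = ennreal (exp (- (w0 * real n * K0 / 8))) * ennreal ((sqrt (2 * pi) / sqrt ?c) ^ n)"
    using nn_integral_gauss_prod[OF c] by (subst nn_integral_cmult) auto
  also have "\<dots> = ennreal (exp (- (w0 * real n * K0 / 8)) * (sqrt (2 * pi) / sqrt ?c) ^ n)"
    by (simp add: ennreal_mult'[symmetric])
  also have "\<dots> \<le> ennreal (exp (- real n) * gauss_const)"
  proof (rule ennreal_leI)
    have s: "sqrt (2 * pi) / sqrt ?c = 4 / sqrt w0 * (sqrt (2 * pi) / sqrt (real n / 2))"
    proof -
      have "sqrt (real n / 2) = 4 / sqrt w0 * sqrt ?c"
      proof -
        have "4 / sqrt w0 * sqrt ?c = sqrt (16 / w0) * sqrt ?c" by (simp add: real_sqrt_divide)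
        also have "\<dots> = sqrt (real n / 2)" using w0 by (simp add: real_sqrt_mult[symmetric])
        finally show ?thesis by simp
      qed
      then show ?thesis using w0 n3 by (simp add: field_simps)
    qed
    have "exp (- (w0 * real n * K0 / 8)) = exp (- real n) * exp (- (real n * ln (4 / sqrt w0)))"
      using w0 by (simp add: K0_def exp_add[symmetric] algebra_simps)
    also have "exp (- (real n * ln (4 / sqrt w0))) = inverse ((4 / sqrt w0) ^ n)"
      using w0 by (simp add: exp_minus exp_of_nat_mult)
    finally have "exp (- (w0 * real n * K0 / 8)) * (sqrt (2 * pi) / sqrt ?c) ^ n = exp (- real n) * (sqrt (2 * pi) / sqrt (real n / 2)) ^ n"
      unfolding s power_mult_distrib using w0 by simp
    then show "exp (- (w0 * real n * K0 / 8)) * (sqrt (2 * pi) / sqrt ?c) ^ n \<le> exp (- real n) * gauss_const"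
      using gauss_const_ge by simp
  qed
  finally show ?thesis .
qed

section \<open>The intermediate region\<close>

definition shell_mass :: "real \<Rightarrow> ennreal" where
  "shell_mass K = (\<integral>\<^sup>+t. ennreal (damp t) * indicator {t \<in> cube. V t \<le> K} t \<partial>L)"

text \<open>Edge sums in the box are at most 2 r, so the quartic term of the cosine costs a fraction
  a = r^2 / 3 of the quadratic one and \<open>damp\<close> is at most exp (- q + a q). In diagonal
  coordinates the mean of exp (a q) is a product of n one-dimensional integrals, each at most exp
  a.\<close>

lemma box_mass:
  assumes r: "0 \<le> r" "r \<le> 1"
  shows "(\<integral>\<^sup>+t. ennreal (damp t) * indicator (box r) t \<partial>L) \<le> ennreal (exp (real n * r\<^sup>2) * gauss_const)"
proof -
  interpret P: product_sigma_finite "\<lambda>_::nat. std_normal" by (rule product_sigma_finite_std_normal)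
  define a where "a = r\<^sup>2 / 3"
  have r2: "r\<^sup>2 \<le> 1" using power_le_one[OF r, of 2] .
  then have a: "0 \<le> a" "a \<le> 1 / 2" by (auto simp: a_def)
  have "(\<integral>\<^sup>+t. ennreal (damp t) * indicator (box r) t \<partial>L)
      \<le> (\<integral>\<^sup>+t. ennreal (exp (a * q_form n z t)) * ennreal (exp (- q_form n z t)) \<partial>L)"
  proof (intro nn_integral_mono)
    fix t
    show "ennreal (damp t) * indicator (box r) t \<le> ennreal (exp (a * q_form n z t)) * ennreal (exp (- q_form n z t))"
    proof (cases "t \<in> box r")
      case True
      have "(1 - a) * q_form n z t = (\<Sum>e\<in>vertex_pairs n. w e * ((1 - a) * ((sum t e)\<^sup>2 / 2)))"
        unfolding q_form_eq quad_form_hess by (simp add: sum_distrib_left sum_divide_distrib mult_ac)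
      also have "\<dots> \<le> (\<Sum>e\<in>vertex_pairs n. w e * (1 - cos (sum t e)))"
      proof (intro sum_mono mult_left_mono w_bounds)
        fix e assume e: "e \<in> vertex_pairs n"
        define x where "x = sum t e"
        obtain j k where jk: "e = {j, k}" "j \<noteq> k" using vertex_pairsD[OF e] by (auto simp: card_2_iff)
        have "\<bar>t j\<bar> \<le> r" "\<bar>t k\<bar> \<le> r" using True jk vertex_pairsD[OF e] by (auto simp: box_def)
        then have "\<bar>x\<bar> \<le> 2 * r" using jk by (auto simp: x_def)
        then have "x\<^sup>2 \<le> (2 * r)\<^sup>2" using r by (subst abs_le_square_iff[symmetric]) auto
        then have x2: "x\<^sup>2 * x\<^sup>2 \<le> x\<^sup>2 * (4 * r\<^sup>2)" by (intro mult_left_mono) (auto simp: power_mult_distrib)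
        have "x ^ 4 / 24 = x\<^sup>2 * x\<^sup>2 / 24" by (simp add: power4_eq_xxxx power2_eq_square)
        also have "\<dots> \<le> x\<^sup>2 * (4 * r\<^sup>2) / 24" using x2 by (rule divide_right_mono) simp
        also have "\<dots> = a * (x\<^sup>2 / 2)" by (simp add: a_def)
        finally have "x ^ 4 / 24 \<le> a * (x\<^sup>2 / 2)" .
        then show "(1 - a) * ((sum t e)\<^sup>2 / 2) \<le> 1 - cos (sum t e)"
          using one_minus_cos_ge_quartic[of x] unfolding x_def[symmetric] left_diff_distrib by linarith
      qed
      finally have "damp t \<le> exp (a * q_form n z t + - q_form n z t)"
        unfolding damp_def by (simp add: algebra_simps)
      then show ?thesis using True unfolding exp_add by (simp add: ennreal_mult'[symmetric])
    qed auto
  qed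
  also have "\<dots> = ennreal gauss_const * (\<integral>\<^sup>+y. ennreal (exp (a * q_form n z (lin_map n chol y))) \<partial>std_gauss {..<n})"
    by (rule chol_nn_integral) measurable
  also have "(\<integral>\<^sup>+y. ennreal (exp (a * q_form n z (lin_map n chol y))) \<partial>std_gauss {..<n})
      = (\<integral>\<^sup>+y. (\<Prod>k<n. ennreal (exp (a * (y k)\<^sup>2 / 2))) \<partial>std_gauss {..<n})"
    unfolding q_form_eq chol_quad
    by (simp add: prod_ennreal exp_sum[symmetric] sum_distrib_left sum_divide_distrib)
  also have "\<dots> = (\<Prod>k<n. \<integral>\<^sup>+y. ennreal (exp (a * y\<^sup>2 / 2)) \<partial>std_normal)"
    unfolding std_gauss_def by (rule P.product_nn_integral_prod) auto
  also have "\<dots> \<le> (\<Prod>k<n. ennreal (exp a))"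
  proof -
    have "p ^ m \<le> q ^ m" if "p \<le> q" for p q :: ennreal and m
      using that by (induction m) (auto intro: mult_mono)
    then show ?thesis using nn_integral_exp_square_std_normal[OF a] by simp
  qed
  also have "\<dots> = ennreal (exp (real n * a))"
    by (simp add: ennreal_power exp_of_nat_mult)
  also have "ennreal gauss_const * ennreal (exp (real n * a)) = ennreal (exp (real n * a) * gauss_const)"
    using gauss_const_pos by (simp add: ennreal_mult'[symmetric] mult.commute)
  also have "\<dots> \<le> ennreal (exp (real n * r\<^sup>2) * gauss_const)"
    using gauss_const_pos by (intro ennreal_leI mult_right_mono) (auto simp: a_def)
  finally show ?thesis by (simp add: mult_left_mono)
qed

text \<open>The factor pi * sqrt n is the ratio of the full period 2 \<pi> to the length 2 / sqrt n
  of the interval around 0 on which the density of one coordinate is bounded below.\<close>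

definition escape :: "real \<Rightarrow> real \<Rightarrow> real" where
  "escape K r = pi * sqrt (real n) * exp (K + 1 - w0 * real n * r\<^sup>2 / 32)"

text \<open>Given the other coordinates, the density of one coordinate is \<open>exp (- \<Sum>\<^sub>k w\<^bsub>jk\<^esub> (1 - cos (x + t\<^sub>k)))\<close>,
  whose exponent differs from a multiple of \<open>n (1 - cos x)\<close> by \<open>O (K)\<close> at most.\<close>

lemma one_coordinate_escape:
  assumes j: "j < n" and K: "0 \<le> K" and r: "0 \<le> r"
  shows "(\<integral>\<^sup>+t. ennreal (damp t) * indicator {t \<in> cube. V t \<le> K \<and> r < \<bar>t j\<bar>} t \<partial>L)
    \<le> ennreal (escape K r) * shell_mass (K + 1)"
proof -
  interpret P: product_sigma_finite "\<lambda>_::nat. lborel :: real measure" by (rule product_sigma_finite_lborel)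
  define I where "I = {..<n} - {j}"
  have I: "finite I" "j \<notin> I" "{..<n} = insert j I" using j by (auto simp: I_def)
  have cI: "real (card I) = real n - 1" using j by (simp add: I_def of_nat_diff)
  define g where "g x y = (\<Sum>k\<in>I. w {j, k} * (1 - cos (y + x k)))" for x :: "nat \<Rightarrow> real" and y
  define S where "S x = (\<Sum>e | e \<in> vertex_pairs n \<and> j \<notin> e. w e * (1 - cos (sum x e)))" for x :: "nat \<Rightarrow> real"
  define VI where "VI x = (\<Sum>k\<in>I. 1 - cos (x k))" for x :: "nat \<Rightarrow> real"
  define Q where "Q x \<longleftrightarrow> (\<forall>k\<in>I. \<bar>x k\<bar> \<le> pi) \<and> VI x \<le> K" for x :: "nat \<Rightarrow> real"
  \<comment> \<open>Up to the common factor exp (- S x), \<open>M1\<close> bounds the integrand from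
    above where |y| > r, and \<open>M2\<close> bounds it from below where |y| \<le> 1 / sqrt
    n.\<close>
  define M1 where "M1 = exp (- (w0 * ((real n - 1) * r\<^sup>2 / 16 - K)))"
  define M2 where "M2 = exp (- (1 / 4 + K / 2))"
  let ?s = "1 / sqrt (real n)"
  have s: "0 < ?s" "?s \<le> 1" "?s\<^sup>2 = 1 / real n" using n3 by (auto simp: power_divide)
  have wI: "w0 \<le> w {j, k}" "w {j, k} \<le> 1 / 4" "0 \<le> w {j, k}" if "k \<in> I" for k
    using that j w_bounds[OF doubleton_in_vertex_pairs[of j n k]] by (auto simp: I_def)
  have split: "damp (x(j := y)) = exp (- S x) * exp (- g x y)" for x y
  proof -
    have "(\<Sum>e\<in>vertex_pairs n. w e * (1 - cos (sum (x(j := y)) e)))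
        = (\<Sum>e | e \<in> vertex_pairs n \<and> j \<notin> e. w e * (1 - cos (sum (x(j := y)) e)))
          + (\<Sum>e | e \<in> vertex_pairs n \<and> j \<in> e. w e * (1 - cos (sum (x(j := y)) e)))"
      by (subst sum.union_disjoint[symmetric]) (auto intro!: sum.cong)
    also have "(\<Sum>e | e \<in> vertex_pairs n \<and> j \<notin> e. w e * (1 - cos (sum (x(j := y)) e))) = S x"
      unfolding S_def by (intro sum.cong refl arg_cong2[where f = "(*)"] arg_cong2[where f = "(-)"] arg_cong[where f = cos]) auto
    also have "(\<Sum>e | e \<in> vertex_pairs n \<and> j \<in> e. w e * (1 - cos (sum (x(j := y)) e))) = g x y"
      unfolding sum_vertex_pairs_incident[OF j] g_def I_def by (intro sum.cong refl) auto
    finally show ?thesis by (simp add: damp_def exp_add[symmetric])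
  qed
  have Vs: "V (x(j := y)) = VI x + (1 - cos y)" for x y
  proof -
    have "(\<Sum>k\<in>I. 1 - cos ((x(j := y)) k)) = VI x" unfolding VI_def by (intro sum.cong refl) (use I in auto)
    then show ?thesis by (simp only: V_def I(3) sum.insert[OF I(1,2)] fun_upd_same)
  qed
  have VI0: "0 \<le> VI x" for x unfolding VI_def by (intro sum_nonneg) auto
  \<comment> \<open>The chord inequality with y = (y + x k) - x k: each neighbour loses at most 1 -
    cos (x k), and these losses add up to at most K.\<close>
  have glow: "w0 * ((real n - 1) / 2 * (1 - cos y) - K) \<le> g x y" if "Q x" for x y
  proof -
    have "(real n - 1) / 2 * (1 - cos y) - VI x = (\<Sum>k\<in>I. (1 - cos y) / 2 - (1 - cos (x k)))"
      by (simp add: VI_def sum_subtractf cI)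
    also have "\<dots> \<le> (\<Sum>k\<in>I. 1 - cos (y + x k))"
    proof (rule sum_mono)
      fix k
      show "(1 - cos y) / 2 - (1 - cos (x k)) \<le> 1 - cos (y + x k)"
      proof -
        have "1 - cos y \<le> 2 * (1 - cos (y + x k)) + 2 * (1 - cos (x k))"
          using one_minus_cos_add_le[of "y + x k" "- x k"] by simp
        moreover have "p / 2 - q \<le> r" if "p \<le> 2 * r + 2 * q" for p q r :: real using that by simp
        ultimately show ?thesis by blast
      qed
    qed
    finally have "(real n - 1) / 2 * (1 - cos y) - K \<le> (\<Sum>k\<in>I. 1 - cos (y + x k))"
      using that by (simp add: Q_def)
    then have "w0 * ((real n - 1) / 2 * (1 - cos y) - K) \<le> w0 * (\<Sum>k\<in>I. 1 - cos (y + x k))"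
      using w0 by (intro mult_left_mono) auto
    also have "\<dots> \<le> g x y" unfolding g_def sum_distrib_left using wI by (intro sum_mono mult_right_mono) auto
    finally show ?thesis .
  qed
  have gup: "g x y \<le> 1 / 4 + K / 2" if "Q x" "\<bar>y\<bar> \<le> ?s" for x y
  proof -
    have "g x y \<le> (\<Sum>k\<in>I. 1 / 4 * (2 * (1 - cos y) + 2 * (1 - cos (x k))))"
      unfolding g_def using wI one_minus_cos_add_le by (intro sum_mono mult_mono) auto
    also have "\<dots> = (\<Sum>k\<in>I. (1 - cos y) / 2 + (1 - cos (x k)) / 2)"
      by (intro sum.cong refl) (simp add: add_divide_distrib diff_divide_distrib)
    also have "\<dots> = (\<Sum>k\<in>I. (1 - cos y) / 2) + VI x / 2" unfolding VI_def sum_divide_distrib by (rule sum.distrib)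
    also have "(\<Sum>k\<in>I. (1 - cos y) / 2) = (real n - 1) * (1 - cos y) / 2" unfolding cI[symmetric] by simp
    also have "(real n - 1) * (1 - cos y) / 2 + VI x / 2 \<le> real n * (y\<^sup>2 / 2) / 2 + K / 2"
      using one_minus_cos_le[of y] that n3 by (intro add_mono divide_right_mono mult_mono) (auto simp: Q_def)
    finally have g1: "g x y \<le> real n * (y\<^sup>2 / 2) / 2 + K / 2" .
    have "y\<^sup>2 \<le> 1 / real n" unfolding s(3)[symmetric] using that s by (subst abs_le_square_iff[symmetric]) auto
    then have "real n * (y\<^sup>2 / 2) / 2 + K / 2 \<le> 1 / 4 + K / 2" using n3 by (simp add: field_simps)
    then show ?thesis using g1 by linarith
  qed
  have esc: "M1 * (2 * pi) \<le> escape K r * (M2 * (2 * ?s))"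
  proof -
    have "- (w0 * ((real n - 1) * r\<^sup>2 / 16 - K)) \<le> (K + 1 - w0 * real n * r\<^sup>2 / 32) + - (1 / 4 + K / 2)"
    proof -
      have "w0 * real n * r\<^sup>2 / 32 \<le> w0 * ((real n - 1) * r\<^sup>2 / 16)"
        using w0 n3 mult_right_mono[of "real n / 2" "real n - 1" "r\<^sup>2"] by simp
      moreover have "w0 * K \<le> 1 / 4 * K" using w0_small K by (intro mult_right_mono) auto
      ultimately show ?thesis using K by (simp add: right_diff_distrib)
    qed
    then have "M1 \<le> exp (K + 1 - w0 * real n * r\<^sup>2 / 32) * M2"
      unfolding M1_def M2_def exp_add[symmetric] by simp
    then have "M1 * (2 * pi) \<le> (exp (K + 1 - w0 * real n * r\<^sup>2 / 32) * M2) * (2 * pi)"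
      by (intro mult_right_mono) auto
    also have "\<dots> = escape K r * (M2 * (2 * ?s))" using n3 by (simp add: escape_def)
    finally show ?thesis .
  qed
  let ?A = "{t \<in> cube. V t \<le> K \<and> r < \<bar>t j\<bar>}" and ?B = "{t \<in> cube. V t \<le> K + 1}"
  have [measurable]: "(\<lambda>t. t j) \<in> borel_measurable L"
    using measurable_component_singleton[of j "{..<n}" "\<lambda>_. lborel :: real measure"] j by simp
  have [measurable]: "?A \<in> sets L" "?B \<in> sets L"
    by (rule cube_Collect_sets, measurable)+
  have memc: "x(j := y) \<in> cube \<longleftrightarrow> (\<forall>k\<in>I. \<bar>x k\<bar> \<le> pi) \<and> \<bar>y\<bar> \<le> pi" if "x \<in> space (lebesgue_prod I)" for x y
  proof -
    have sp: "x(j := y) \<in> space L"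
      using that unfolding I(3) space_PiM by (intro PiE_fun_upd) auto
    have all: "(\<forall>k<n. P k) \<longleftrightarrow> P j \<and> (\<forall>k\<in>I. P k)" for P
    proof -
      have "(\<forall>k<n. P k) \<longleftrightarrow> (\<forall>k\<in>{..<n}. P k)" by auto
      then show ?thesis unfolding I(3) by simp
    qed
    have "(\<forall>k\<in>I. \<bar>(x(j := y)) k\<bar> \<le> pi) \<longleftrightarrow> (\<forall>k\<in>I. \<bar>x k\<bar> \<le> pi)"
      by (intro ball_cong refl) (use I(2) in auto)
    then show ?thesis unfolding cube_def mem_Collect_eq all using sp by simp blast
  qed
  have inner: "(\<integral>\<^sup>+y. ennreal (damp (x(j := y))) * indicator ?A (x(j := y)) \<partial>lborel)
      \<le> ennreal (escape K r) * (\<integral>\<^sup>+y. ennreal (damp (x(j := y))) * indicator ?B (x(j := y)) \<partial>lborel)"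
    if x: "x \<in> space (lebesgue_prod I)" for x
  proof (cases "Q x")
    case True
    have "(\<integral>\<^sup>+y. ennreal (damp (x(j := y))) * indicator ?A (x(j := y)) \<partial>lborel)
        \<le> (\<integral>\<^sup>+y. ennreal (exp (- S x) * M1) * indicator {-pi..pi} y \<partial>lborel)"
    proof (intro nn_integral_mono)
      fix y
      show "ennreal (damp (x(j := y))) * indicator ?A (x(j := y)) \<le> ennreal (exp (- S x) * M1) * indicator {-pi..pi} y"
      proof (cases "x(j := y) \<in> ?A")
        case A: True
        then have y: "\<bar>y\<bar> \<le> pi" "r < \<bar>y\<bar>" using memc[OF x] by auto
        have "r\<^sup>2 / 8 \<le> y\<^sup>2 / 8" using y r by (auto simp: abs_le_square_iff[symmetric])
        also have "\<dots> \<le> 1 - cos y" by (rule one_minus_cos_ge[OF y(1)])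
        finally have "(real n - 1) / 2 * (r\<^sup>2 / 8) \<le> (real n - 1) / 2 * (1 - cos y)"
          using n3 by (intro mult_left_mono) auto
        then have "w0 * ((real n - 1) * r\<^sup>2 / 16 - K) \<le> w0 * ((real n - 1) / 2 * (1 - cos y) - K)"
          using w0 by (intro mult_left_mono) auto
        then have "exp (- g x y) \<le> M1" using glow[OF True, of y] unfolding M1_def by simp
        then show ?thesis using y unfolding split by (auto simp: indicator_def abs_le_iff intro!: ennreal_leI mult_left_mono)
      qed auto
    qed
    also have "\<dots> = ennreal (exp (- S x) * M1) * ennreal (2 * pi)"
      by (subst nn_integral_cmult_indicator) auto
    also have "\<dots> = ennreal (exp (- S x) * (M1 * (2 * pi)))" by (simp add: ennreal_mult'[symmetric] M1_def mult_ac)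
    also have "\<dots> \<le> ennreal (exp (- S x) * (escape K r * (M2 * (2 * ?s))))"
      using esc by (intro ennreal_leI mult_left_mono) auto
    also have "\<dots> = ennreal (escape K r) * (ennreal (exp (- S x) * M2) * ennreal (2 * ?s))"
      using s by (simp add: ennreal_mult'[symmetric] M2_def escape_def mult_ac)
    also have "ennreal (exp (- S x) * M2) * ennreal (2 * ?s) = (\<integral>\<^sup>+y. ennreal (exp (- S x) * M2) * indicator {-?s..?s} y \<partial>lborel)"
      using s by (subst nn_integral_cmult_indicator) auto
    also have "ennreal (escape K r) * (\<integral>\<^sup>+y. ennreal (exp (- S x) * M2) * indicator {-?s..?s} y \<partial>lborel)
        \<le> ennreal (escape K r) * (\<integral>\<^sup>+y. ennreal (damp (x(j := y))) * indicator ?B (x(j := y)) \<partial>lborel)"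
    proof (intro mult_left_mono nn_integral_mono)
      fix y
      show "ennreal (exp (- S x) * M2) * indicator {-?s..?s} y \<le> ennreal (damp (x(j := y))) * indicator ?B (x(j := y))"
      proof (cases "y \<in> {-?s..?s}")
        case y: True
        then have ys: "\<bar>y\<bar> \<le> ?s" by (auto simp: abs_le_iff)
        then have "\<bar>y\<bar> \<le> pi" using s(2) pi_gt3 by linarith
        \<comment> \<open>Putting coordinate j back near 0 adds at most 1 to the sum over the other
          coordinates; this is why K + 1 appears on the right-hand side.\<close>
        moreover have "V (x(j := y)) \<le> K + 1"
        proof -
          have "y\<^sup>2 \<le> 1" using order_trans[OF ys s(2)] by (simp add: abs_square_le_1)
          then have "1 - cos y \<le> 1" using one_minus_cos_le[of y] by linarith
          then show ?thesis using True unfolding Vs Q_def by linarith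
        qed
        ultimately have "x(j := y) \<in> ?B" using True memc[OF x] by (auto simp: Q_def)
        moreover have "M2 \<le> exp (- g x y)" unfolding M2_def using gup[OF True ys] by simp
        ultimately show ?thesis using y unfolding split by (auto intro!: ennreal_leI mult_left_mono)
      qed auto
    qed auto
    finally show ?thesis .
  next
    case False
    have "indicator ?A (x(j := y)) = (0::ennreal)" for y
    proof -
      have "VI x \<le> V (x(j := y))" unfolding Vs by simp
      then show ?thesis using False memc[OF x] unfolding Q_def by (auto simp: indicator_def)
    qed
    then show ?thesis by simp
  qed
  have "(\<integral>\<^sup>+t. ennreal (damp t) * indicator ?A t \<partial>L)
      = (\<integral>\<^sup>+x. \<integral>\<^sup>+y. ennreal (damp (x(j := y))) * indicator ?A (x(j := y)) \<partial>lborel \<partial>lebesgue_prod I)"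
    unfolding I(3) using I by (intro P.product_nn_integral_insert) (auto simp: I(3)[symmetric])
  also have "\<dots> \<le> (\<integral>\<^sup>+x. ennreal (escape K r) * (\<integral>\<^sup>+y. ennreal (damp (x(j := y))) * indicator ?B (x(j := y)) \<partial>lborel) \<partial>lebesgue_prod I)"
    by (intro nn_integral_mono inner)
  also have "\<dots> = ennreal (escape K r) * (\<integral>\<^sup>+x. \<integral>\<^sup>+y. ennreal (damp (x(j := y))) * indicator ?B (x(j := y)) \<partial>lborel \<partial>lebesgue_prod I)"
  proof (rule nn_integral_cmult)
    have m: "(\<lambda>p. (fst p)(j := snd p)) \<in> measurable (lebesgue_prod I \<Otimes>\<^sub>M lborel) L"
      unfolding I(3) by (rule measurable_fun_upd[where J = I]) auto
    have "(\<lambda>t. ennreal (damp t) * indicator ?B t) \<in> borel_measurable L" by measurable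
    from measurable_compose[OF m this]
    show "(\<lambda>x. \<integral>\<^sup>+y. ennreal (damp (x(j := y))) * indicator ?B (x(j := y)) \<partial>lborel) \<in> borel_measurable (lebesgue_prod I)"
      by (intro sigma_finite_measure.borel_measurable_nn_integral) (auto simp: split_def sigma_finite_lborel)
  qed
  also have "(\<integral>\<^sup>+x. \<integral>\<^sup>+y. ennreal (damp (x(j := y))) * indicator ?B (x(j := y)) \<partial>lborel \<partial>lebesgue_prod I) = shell_mass (K + 1)"
    unfolding shell_mass_def I(3) using I by (intro P.product_nn_integral_insert[symmetric]) (auto simp: I(3)[symmetric])
  finally show ?thesis .
qed

lemma escape_nonneg: "0 \<le> escape K r" by (simp add: escape_def)

lemma box_escape:
  assumes K: "0 \<le> K" and r: "0 \<le> r"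
  shows "(\<integral>\<^sup>+t. ennreal (damp t) * indicator ({t \<in> cube. V t \<le> K} - box r) t \<partial>L)
    \<le> ennreal (real n * escape K r) * shell_mass (K + 1)"
proof -
  have "(\<integral>\<^sup>+t. ennreal (damp t) * indicator ({t \<in> cube. V t \<le> K} - box r) t \<partial>L)
      \<le> (\<integral>\<^sup>+t. (\<Sum>j<n. ennreal (damp t) * indicator {t \<in> cube. V t \<le> K \<and> r < \<bar>t j\<bar>} t) \<partial>L)"
  proof (intro nn_integral_mono)
    fix t
    show "ennreal (damp t) * indicator ({t \<in> cube. V t \<le> K} - box r) t
        \<le> (\<Sum>j<n. ennreal (damp t) * indicator {t \<in> cube. V t \<le> K \<and> r < \<bar>t j\<bar>} t)"
    proof (cases "t \<in> {t \<in> cube. V t \<le> K} - box r")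
      case True
      then obtain j where j: "j < n" "r < \<bar>t j\<bar>" by (auto simp: box_def cube_def not_le)
      have "ennreal (damp t) * indicator {t \<in> cube. V t \<le> K \<and> r < \<bar>t j\<bar>} t
          \<le> (\<Sum>j<n. ennreal (damp t) * indicator {t \<in> cube. V t \<le> K \<and> r < \<bar>t j\<bar>} t)"
        using j by (intro member_le_sum) auto
      then show ?thesis using True j by (auto simp: indicator_def)
    qed auto
  qed
  also have "\<dots> = (\<Sum>j<n. \<integral>\<^sup>+t. ennreal (damp t) * indicator {t \<in> cube. V t \<le> K \<and> r < \<bar>t j\<bar>} t \<partial>L)"
    by (rule nn_integral_sum) (use V_measurable in measurable)
  also have "\<dots> \<le> (\<Sum>j<n. ennreal (escape K r) * shell_mass (K + 1))"
    using K r by (intro sum_mono one_coordinate_escape) auto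
  also have "\<dots> = ennreal (real n * escape K r) * shell_mass (K + 1)"
    using escape_nonneg by (simp add: ennreal_mult' ennreal_of_nat_eq_real_of_nat mult.assoc)
  finally show ?thesis .
qed

text \<open>Write T for the mass of V \<le> K0 + 1. It is at most the mass of the box plus half the
  mass of V \<le> K0 + 2, and the latter is at most T plus the far mass. The cube has finite volume,
  so T is finite and T / 2 can be absorbed; box twice and far once give the factor 3.\<close>

lemma shell_mass_bound:
  assumes n8: "8 \<le> n" and nK: "K0 + 2 \<le> real n" and r: "0 \<le> r" "r \<le> 1"
    and half: "real n * escape (K0 + 1) r \<le> 1 / 2"
  shows "shell_mass (K0 + 1) \<le> ennreal (3 * exp (real n * r\<^sup>2) * gauss_const)"
proof -
  let ?K = "K0 + 1"
  have fin: "shell_mass K < \<infinity>" for K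
  proof -
    have "shell_mass K \<le> (\<integral>\<^sup>+t. indicator cube t \<partial>L)"
      unfolding shell_mass_def
    proof (intro nn_integral_mono)
      fix t
      have "damp t \<le> 1" unfolding damp_def using w_bounds by (auto intro!: sum_nonneg mult_nonneg_nonneg)
      then show "ennreal (damp t) * indicator {t \<in> cube. V t \<le> K} t \<le> indicator cube t"
        by (auto simp: indicator_def)
    qed
    also have "\<dots> = emeasure L cube" by simp
    also have "cube = (\<Pi>\<^sub>E j\<in>{..<n}. {-pi..pi})"
      unfolding cube_def space_PiM by (auto simp: PiE_def abs_le_iff Pi_def)
    also have "emeasure L \<dots> = (\<Prod>j<n. emeasure lborel {-pi..pi})"
      by (rule product_sigma_finite.emeasure_PiM[OF product_sigma_finite_lborel]) auto
    also have "\<dots> < \<infinity>" by (simp add: ennreal_power flip: ennreal_mult)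
    finally show ?thesis .
  qed
  define far where "far = (\<integral>\<^sup>+t. ennreal (damp t) * indicator {t \<in> cube. 0 \<le> (\<Sum>j<n. cos (t j)) \<and> K0 \<le> V t} t \<partial>L)"
  define inn where "inn = (\<integral>\<^sup>+t. ennreal (damp t) * indicator (box r) t \<partial>L)"
  have 1: "shell_mass (?K + 1) \<le> shell_mass ?K + far"
  proof -
    have "shell_mass (?K + 1) \<le> (\<integral>\<^sup>+t. ennreal (damp t) * indicator {t \<in> cube. V t \<le> ?K} t
        + ennreal (damp t) * indicator {t \<in> cube. 0 \<le> (\<Sum>j<n. cos (t j)) \<and> K0 \<le> V t} t \<partial>L)"
      unfolding shell_mass_def sum_cos_eq
    proof (intro nn_integral_mono)
      fix t
      \<comment> \<open>On V \<le> K0 + 2 \<le> n the cosine sum n - V is nonnegative, so the far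
        bound applies to what exceeds K0 + 1.\<close>
      show "ennreal (damp t) * indicator {t \<in> cube. V t \<le> ?K + 1} t \<le> ennreal (damp t) * indicator {t \<in> cube. V t \<le> ?K} t
        + ennreal (damp t) * indicator {t \<in> cube. 0 \<le> real n - V t \<and> K0 \<le> V t} t"
        using nK by (auto simp: indicator_def)
    qed
    also have "\<dots> = shell_mass ?K + far" unfolding shell_mass_def far_def by (rule nn_integral_add) measurable
    finally show ?thesis .
  qed
  have 2: "shell_mass ?K \<le> inn + ennreal (real n * escape ?K r) * shell_mass (?K + 1)"
  proof -
    have "shell_mass ?K \<le> (\<integral>\<^sup>+t. ennreal (damp t) * indicator (box r) t
        + ennreal (damp t) * indicator ({t \<in> cube. V t \<le> ?K} - box r) t \<partial>L)"
      unfolding shell_mass_def by (intro nn_integral_mono) (auto simp: indicator_def)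
    also have "\<dots> = inn + (\<integral>\<^sup>+t. ennreal (damp t) * indicator ({t \<in> cube. V t \<le> ?K} - box r) t \<partial>L)"
      unfolding inn_def by (rule nn_integral_add) measurable
    finally show ?thesis
      using box_escape[of ?K r] K0_pos r by (auto intro: order_trans add_left_mono)
  qed
  obtain T where T: "shell_mass ?K = ennreal T" "0 \<le> T" using fin[of ?K] by (cases "shell_mass ?K") auto
  obtain T' where T': "shell_mass (?K + 1) = ennreal T'" "0 \<le> T'" using fin[of "?K + 1"] by (cases "shell_mass (?K + 1)") auto
  have "far \<le> ennreal (exp (- real n) * gauss_const)" unfolding far_def by (rule far_integral[OF n8])
  with 1 have "ennreal T' \<le> ennreal T + ennreal (exp (- real n) * gauss_const)"
    unfolding T T' by (meson add_left_mono order_trans)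
  then have a: "T' \<le> T + exp (- real n) * gauss_const"
    using T gauss_const_pos by (simp flip: ennreal_plus)
  have "inn \<le> ennreal (exp (real n * r\<^sup>2) * gauss_const)" unfolding inn_def by (rule box_mass[OF r])
  with 2 have "ennreal T \<le> ennreal (exp (real n * r\<^sup>2) * gauss_const) + ennreal (real n * escape ?K r) * ennreal T'"
    unfolding T T' by (meson add_right_mono order_trans)
  then have "T \<le> exp (real n * r\<^sup>2) * gauss_const + real n * escape ?K r * T'"
    using T' gauss_const_pos escape_nonneg[of ?K r] by (simp flip: ennreal_plus ennreal_mult)
  also have "\<dots> \<le> exp (real n * r\<^sup>2) * gauss_const + 1 / 2 * T'"
    using half T' by (intro add_left_mono mult_right_mono) auto
  finally have b: "T \<le> exp (real n * r\<^sup>2) * gauss_const + 1 / 2 * T'" .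
  have "exp (- real n) * gauss_const \<le> exp (real n * r\<^sup>2) * gauss_const"
    using gauss_const_pos by (intro mult_right_mono) (auto simp: order_trans[of _ 0])
  then have "T \<le> 3 * exp (real n * r\<^sup>2) * gauss_const" using a b by linarith
  then show ?thesis unfolding T by (rule ennreal_leI)
qed

text \<open>Two radii: \<open>r\<close> serves only to bound the total mass of the intermediate
  region, at the price exp (n r^2), while \<open>r'\<close> is the radius of the actual box. Taking
  r' larger by a power of n lets the escape factor beat that price.\<close>

lemma tail_bound:
  assumes n8: "8 \<le> n" and nK: "K0 + 2 \<le> real n" and r: "0 \<le> r" "r \<le> 1" and r': "0 \<le> r'"
    and half: "real n * escape (K0 + 1) r \<le> 1 / 2"
  shows "(\<integral>\<^sup>+t. ennreal (damp t) * indicator ({t \<in> cube. 0 \<le> (\<Sum>j<n. cos (t j))} - box r') t \<partial>L)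
    \<le> ennreal ((exp (- real n) + 3 * real n * escape K0 r' * exp (real n * r\<^sup>2)) * gauss_const)"
proof -
  let ?far = "{t \<in> cube. 0 \<le> (\<Sum>j<n. cos (t j)) \<and> K0 \<le> V t}"
  have "(\<integral>\<^sup>+t. ennreal (damp t) * indicator ({t \<in> cube. 0 \<le> (\<Sum>j<n. cos (t j))} - box r') t \<partial>L)
      \<le> (\<integral>\<^sup>+t. ennreal (damp t) * indicator ?far t + ennreal (damp t) * indicator ({t \<in> cube. V t \<le> K0} - box r') t \<partial>L)"
    by (intro nn_integral_mono) (auto simp: indicator_def)
  also have "\<dots> = (\<integral>\<^sup>+t. ennreal (damp t) * indicator ?far t \<partial>L)
      + (\<integral>\<^sup>+t. ennreal (damp t) * indicator ({t \<in> cube. V t \<le> K0} - box r') t \<partial>L)"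
    by (rule nn_integral_add) measurable
  also have "\<dots> \<le> ennreal (exp (- real n) * gauss_const) + ennreal (real n * escape K0 r') * ennreal (3 * exp (real n * r\<^sup>2) * gauss_const)"
    using K0_pos r' by (intro add_mono far_integral[OF n8] order_trans[OF box_escape mult_left_mono[OF shell_mass_bound[OF n8 nK r half]]]) auto
  also have "\<dots> = ennreal ((exp (- real n) + 3 * real n * escape K0 r' * exp (real n * r\<^sup>2)) * gauss_const)"
    using gauss_const_pos escape_nonneg by (simp add: ennreal_mult'[symmetric] ennreal_plus[symmetric] algebra_simps del: ennreal_plus)
  finally show ?thesis .
qed

end

section \<open>The counting integral\<close>

lemma sum_incident_degrees:
  assumes "E \<subseteq> vertex_pairs n"
  shows "(\<Sum>e\<in>E. sum t e) = (\<Sum>k<n. real (card {e \<in> E. k \<in> e}) * (t k :: real))"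
proof -
  have fE: "finite E" using assms finite_subset by auto
  have "(\<Sum>e\<in>E. sum t e) = (\<Sum>e\<in>E. \<Sum>j | j \<in> {..<n} \<and> j \<in> e. t j)"
    by (intro sum.cong refl) (use assms vertex_pairsD in blast)
  also have "\<dots> = (\<Sum>j<n. \<Sum>e | e \<in> E \<and> j \<in> e. t j)"
    using fE by (intro sum.swap_restrict) auto
  finally show ?thesis by simp
qed

definition bernoulli_entropy :: "real \<Rightarrow> real" where
  "bernoulli_entropy p = p * ln (1 / p) + (1 - p) * ln (1 / (1 - p))"

lemma bernoulli_entropy_deriv:
  assumes "0 < p" "p < 1"
  shows "(bernoulli_entropy has_real_derivative ln (1 - p) - ln p) (at p)"
proof -
  have "((\<lambda>p. - p * ln p - (1 - p) * ln (1 - p)) has_real_derivative ln (1 - p) - ln p) (at p)"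
    using assms by (auto intro!: derivative_eq_intros)
  moreover have "\<forall>\<^sub>F x in nhds p. bernoulli_entropy x = - x * ln x - (1 - x) * ln (1 - x)"
  proof -
    have "\<forall>\<^sub>F x in nhds p. x \<in> {0<..<1}" using assms by (intro eventually_nhds_in_open) auto
    then show ?thesis by eventually_elim (auto simp: bernoulli_entropy_def ln_div)
  qed
  ultimately show ?thesis by (subst DERIV_cong_ev[OF refl _ refl]) auto
qed

text \<open>The derivative of the entropy at its maximum vanishes in the direction of every graph with the given
  degrees, so all these graphs have the same weight; no Lagrange multipliers are needed.\<close>

lemma graph_weight:
  assumes max: "is_max_entropy_matrix n D z" and d: "0 < \<delta>"
    and zd: "\<And>e. e \<in> vertex_pairs n \<Longrightarrow> \<delta> \<le> z e \<and> z e \<le> 1 - \<delta>"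
    and E: "E \<in> graphs_with_degrees n D"
  shows "(\<Prod>e\<in>E. z e) * (\<Prod>e\<in>vertex_pairs n - E. 1 - z e) = exp (- entropy_fun n z)"
proof -
  let ?P = "vertex_pairs n"
  define x where "x e = (if e \<in> E then 1 else 0 :: real)" for e
  define y where "y s = (\<lambda>e\<in>?P. z e + s * (x e - z e))" for s
  have EP: "E \<subseteq> ?P" and deg: "\<And>k. k < n \<Longrightarrow> card {e \<in> E. k \<in> e} = D k"
    using E by (auto simp: graphs_with_degrees_def)
  have zP: "z \<in> ?P \<rightarrow>\<^sub>E {0..1}" and zdeg: "\<And>k. k < n \<Longrightarrow> (\<Sum>j\<in>{..<n} - {k}. z {j, k}) = real (D k)"
    using max by (auto simp: is_max_entropy_matrix_def degree_polytope_def)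
  have xdeg: "(\<Sum>j\<in>{..<n} - {k}. x {j, k}) = real (D k)" if k: "k < n" for k
  proof -
    have "(\<Sum>j\<in>{..<n} - {k}. x {j, k}) = (\<Sum>e | e \<in> ?P \<and> k \<in> e. x e)"
      unfolding sum_vertex_pairs_incident[OF k] by (simp add: insert_commute)
    also have "\<dots> = (\<Sum>e | e \<in> E \<and> k \<in> e. 1)"
      unfolding x_def using EP by (intro sum.mono_neutral_cong_right) auto
    finally show ?thesis using deg[OF k] by simp
  qed
  \<comment> \<open>Tameness leaves room \<delta> on both sides of each coordinate, so the segment
    from z towards the graph extends backwards beyond z. Hence the derivative at z is 0 and not
    merely nonpositive.\<close>
  have in_poly: "y s \<in> degree_polytope n D" if s: "\<bar>s\<bar> \<le> \<delta>" for s
    unfolding degree_polytope_def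
  proof (intro CollectI conjI allI impI PiE_I)
    fix e assume e: "e \<in> ?P"
    have "\<bar>x e - z e\<bar> \<le> 1" using zd[OF e] d by (auto simp: x_def)
    then have "\<bar>s * (x e - z e)\<bar> \<le> \<delta> * 1" unfolding abs_mult using s by (intro mult_mono) auto
    then show "y s e \<in> {0..1}" using zd[OF e] e by (auto simp: y_def abs_le_iff)
  next
    fix e assume "e \<notin> ?P" then show "y s e = undefined" by (simp add: y_def)
  next
    fix k assume k: "k < n"
    have "(\<Sum>j\<in>{..<n} - {k}. y s {j, k}) = (\<Sum>j\<in>{..<n} - {k}. z {j, k} + s * (x {j, k} - z {j, k}))"
      by (intro sum.cong refl) (use k doubleton_in_vertex_pairs in \<open>auto simp: y_def\<close>)
    also have "\<dots> = real (D k)"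
      using xdeg[OF k] zdeg[OF k] by (simp add: sum.distrib sum_distrib_left[symmetric] sum_subtractf)
    finally show "(\<Sum>j\<in>{..<n} - {k}. y s {j, k}) = real (D k)" .
  qed
  have Hy: "entropy_fun n (y s) = (\<Sum>e\<in>?P. bernoulli_entropy (z e + s * (x e - z e)))" for s
    unfolding entropy_fun_def bernoulli_entropy_def by (intro sum.cong refl) (auto simp: y_def)
  have Hz: "entropy_fun n z = (\<Sum>e\<in>?P. bernoulli_entropy (z e))"
    unfolding entropy_fun_def bernoulli_entropy_def ..
  define l where "l = (\<Sum>e\<in>?P. (ln (1 - z e) - ln (z e)) * (x e - z e))"
  have "((\<lambda>s. \<Sum>e\<in>?P. bernoulli_entropy (z e + s * (x e - z e))) has_real_derivative l) (at 0)"
    unfolding l_def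
  proof (rule DERIV_sum)
    fix e assume e: "e \<in> ?P"
    have "(bernoulli_entropy has_real_derivative ln (1 - z e) - ln (z e)) (at (z e + 0 * (x e - z e)))"
      using bernoulli_entropy_deriv[of "z e"] zd[OF e] d by simp
    moreover have "((\<lambda>s. z e + s * (x e - z e)) has_real_derivative (x e - z e)) (at 0)"
      by (auto intro!: derivative_eq_intros)
    ultimately show "((\<lambda>s. bernoulli_entropy (z e + s * (x e - z e))) has_real_derivative (ln (1 - z e) - ln (z e)) * (x e - z e)) (at 0)"
      by (rule DERIV_chain2[where f = bernoulli_entropy and g = "\<lambda>s. z e + s * (x e - z e)"])
  qed
  then have "l = 0"
  proof (rule DERIV_local_max[OF _ d], intro allI impI)
    fix s assume "\<bar>0 - s\<bar> < \<delta>"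
    then have "entropy_fun n (y s) \<le> entropy_fun n z"
      using in_poly[of s] max by (auto simp: is_max_entropy_matrix_def)
    then show "(\<Sum>e\<in>?P. bernoulli_entropy (z e + s * (x e - z e))) \<le> (\<Sum>e\<in>?P. bernoulli_entropy (z e + 0 * (x e - z e)))"
      unfolding Hy Hz by simp
  qed
  have pos: "0 < z e" "0 < 1 - z e" if "e \<in> ?P" for e using zd[OF that] d by auto
  have "(\<Prod>e\<in>E. z e) * (\<Prod>e\<in>?P - E. 1 - z e) = (\<Prod>e\<in>?P. if e \<in> E then z e else 1 - z e)"
    using EP by (subst prod.If_cases) (auto simp: Int_absorb1 Int_commute Diff_eq intro!: arg_cong2[where f = "(*)"] prod.cong)
  also have "\<dots> = (\<Prod>e\<in>?P. exp (x e * ln (z e) + (1 - x e) * ln (1 - z e)))"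
    by (intro prod.cong refl) (use pos in \<open>auto simp: x_def\<close>)
  also have "\<dots> = exp (\<Sum>e\<in>?P. x e * ln (z e) + (1 - x e) * ln (1 - z e))" by (simp add: exp_sum)
  \<comment> \<open>The log-weight is affine in x: at x = z it is minus the entropy, and its
    increment from there to x is - l.\<close>
  also have "(\<Sum>e\<in>?P. x e * ln (z e) + (1 - x e) * ln (1 - z e)) = - entropy_fun n z - l"
    unfolding Hz l_def sum_negf[symmetric] sum_subtractf[symmetric]
    by (intro sum.cong refl) (use pos in \<open>simp add: bernoulli_entropy_def ln_div algebra_simps\<close>)
  finally show ?thesis using \<open>l = 0\<close> by simp
qed

text \<open>The characteristic function at t of the degree sequence minus D, for the random graph
  with independent edge probabilities z.\<close>

definition char_prod :: "nat \<Rightarrow> (nat \<Rightarrow> nat) \<Rightarrow> (nat set \<Rightarrow> real) \<Rightarrow> (nat \<Rightarrow> real) \<Rightarrow> complex" where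
  "char_prod n D z t = (\<Prod>e\<in>vertex_pairs n. bern (z e) (sum t e)) * cis (- (\<Sum>k<n. real (D k) * t k))"

section \<open>Fourier inversion on the torus\<close>

lemma cis_sum: "finite A \<Longrightarrow> cis (sum f A) = (\<Prod>a\<in>A. cis (f a))"
  by (induction A rule: finite_induct) (auto simp: cis_mult[symmetric])

lemma char_prod_expand:
  assumes z: "\<And>e. e \<in> vertex_pairs n \<Longrightarrow> 0 \<le> z e \<and> z e \<le> 1"
  shows "char_prod n D z t = (\<Sum>E\<in>Pow (vertex_pairs n).
    of_real ((\<Prod>e\<in>E. z e) * (\<Prod>e\<in>vertex_pairs n - E. 1 - z e)) *
    (\<Prod>k<n. cis (real_of_int (int (card {e \<in> E. k \<in> e}) - int (D k)) * t k)))"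
proof -
  let ?P = "vertex_pairs n"
  have b: "bern (z e) x = of_real (z e) * cis x + of_real (1 - z e)" if "e \<in> ?P" for e x
    using bern_def[of "z e" x] z[OF that] by simp
  have "(\<Prod>e\<in>?P. bern (z e) (sum t e)) = (\<Prod>e\<in>?P. of_real (z e) * cis (sum t e) + of_real (1 - z e))"
    by (intro prod.cong refl b)
  also have "\<dots> = (\<Sum>E\<in>Pow ?P. (\<Prod>e\<in>E. of_real (z e) * cis (sum t e)) * (\<Prod>e\<in>?P - E. of_real (1 - z e)))"
    by (rule prod_add) simp
  finally have "char_prod n D z t = (\<Sum>E\<in>Pow ?P. (\<Prod>e\<in>E. of_real (z e) * cis (sum t e)) * (\<Prod>e\<in>?P - E. of_real (1 - z e))
      * cis (- (\<Sum>k<n. real (D k) * t k)))"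
    unfolding char_prod_def by (simp only: sum_distrib_right)
  also have "\<dots> = (\<Sum>E\<in>Pow ?P. of_real ((\<Prod>e\<in>E. z e) * (\<Prod>e\<in>?P - E. 1 - z e)) *
    (\<Prod>k<n. cis (real_of_int (int (card {e \<in> E. k \<in> e}) - int (D k)) * t k)))"
  proof (intro sum.cong refl)
    fix E assume "E \<in> Pow ?P"
    then have E: "E \<subseteq> ?P" "finite E" using finite_subset by auto
    have "(\<Prod>e\<in>E. cis (sum t e)) * cis (- (\<Sum>k<n. real (D k) * t k)) = cis ((\<Sum>e\<in>E. sum t e) - (\<Sum>k<n. real (D k) * t k))"
      using E by (simp add: cis_sum[symmetric] cis_mult)
    also have "(\<Sum>e\<in>E. sum t e) - (\<Sum>k<n. real (D k) * t k) = (\<Sum>k<n. real_of_int (int (card {e \<in> E. k \<in> e}) - int (D k)) * t k)"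
      unfolding sum_incident_degrees[OF E(1)] by (simp add: sum_subtractf[symmetric] left_diff_distrib)
    also have "cis \<dots> = (\<Prod>k<n. cis (real_of_int (int (card {e \<in> E. k \<in> e}) - int (D k)) * t k))"
      by (rule cis_sum) simp
    finally show "(\<Prod>e\<in>E. of_real (z e) * cis (sum t e)) * (\<Prod>e\<in>?P - E. of_real (1 - z e)) * cis (- (\<Sum>k<n. real (D k) * t k))
      = of_real ((\<Prod>e\<in>E. z e) * (\<Prod>e\<in>?P - E. 1 - z e)) * (\<Prod>k<n. cis (real_of_int (int (card {e \<in> E. k \<in> e}) - int (D k)) * t k))"
      by (simp add: prod.distrib mult_ac)
  qed
  finally show ?thesis .
qed

lemma cis_integral:
  fixes m :: int
  shows "integrable lborel (\<lambda>x. indicator {-pi..pi} x *\<^sub>R cis (real_of_int m * x))"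
    and "(\<integral>x. indicator {-pi..pi} x *\<^sub>R cis (real_of_int m * x) \<partial>lborel) = (if m = 0 then 2 * of_real pi else 0)"
proof -
  have c: "continuous_on A (\<lambda>x. cis (real_of_int m * x))" for A by (intro continuous_intros)
  show "integrable lborel (\<lambda>x. indicator {-pi..pi} x *\<^sub>R cis (real_of_int m * x))"
    using borel_integrable_atLeastAtMost'[OF c, of "- pi" pi] by (simp add: set_integrable_def)
  show "(\<integral>x. indicator {-pi..pi} x *\<^sub>R cis (real_of_int m * x) \<partial>lborel) = (if m = 0 then 2 * of_real pi else 0)"
  proof (cases "m = 0")
    case False
    let ?F = "\<lambda>x. exp (\<i> * of_int m * of_real x) / (\<i> * of_int m)"
    have d: "(?F has_vector_derivative cis (real_of_int m * x)) (at x within {-pi..pi})" for x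
    proof -
      have "((\<lambda>z. exp (\<i> * of_int m * z) / (\<i> * of_int m)) has_field_derivative exp (\<i> * of_int m * of_real x)) (at (of_real x))"
        using False by (auto intro!: derivative_eq_intros)
      from has_vector_derivative_real_field[OF this] show ?thesis
        by (simp add: cis_conv_exp mult.assoc has_vector_derivative_at_within)
    qed
    have "(\<integral>x. indicator {-pi..pi} x *\<^sub>R cis (real_of_int m * x) \<partial>lborel) = ?F pi - ?F (- pi)"
      by (rule integral_FTC_atLeastAtMost[OF _ d c]) simp
    also have "exp (\<i> * of_int m * of_real pi) = exp (\<i> * of_int m * of_real (- pi))"
      unfolding exp_eq by (rule exI[of _ m]) (simp add: algebra_simps)
    finally show ?thesis using False by simp
  qed (simp add: scaleR_conv_of_real)
qed

text \<open>Lebesgue measure on the cube, with its density written as a product so that integrals of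
  products of characters factor.\<close>

definition torus :: "nat \<Rightarrow> (nat \<Rightarrow> real) measure" where
  "torus n = density (lebesgue_prod {..<n}) (\<lambda>t. \<Prod>k<n. indicator {-pi..pi} (t k))"

lemma sets_torus [measurable_cong, simp]: "sets (torus n) = sets (lebesgue_prod {..<n})"
  by (simp add: torus_def)

lemma indicator_prod_measurable [measurable]:
  "(\<lambda>t. (\<Prod>k<n. indicator {-pi..pi} (t k)) :: ennreal) \<in> borel_measurable (lebesgue_prod {..<n})"
  by measurable

lemma emeasure_torus_PiE:
  assumes "\<And>k. k < n \<Longrightarrow> A k \<in> sets borel"
  shows "emeasure (torus n) (\<Pi>\<^sub>E k\<in>{..<n}. A k) = (\<Prod>k<n. \<integral>\<^sup>+x. indicator {-pi..pi} x * indicator (A k) x \<partial>lborel)"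
proof -
  interpret P: product_sigma_finite "\<lambda>_::nat. lborel :: real measure" by (rule product_sigma_finite_lborel)
  have A: "(\<Pi>\<^sub>E k\<in>{..<n}. A k) \<in> sets (lebesgue_prod {..<n})" using assms by (intro sets_PiM_I_finite) auto
  have "emeasure (torus n) (\<Pi>\<^sub>E k\<in>{..<n}. A k) = (\<integral>\<^sup>+t. (\<Prod>k<n. indicator {-pi..pi} (t k)) * indicator (\<Pi>\<^sub>E k\<in>{..<n}. A k) t \<partial>lebesgue_prod {..<n})"
    unfolding torus_def by (rule emeasure_density[OF indicator_prod_measurable A])
  also have "\<dots> = (\<integral>\<^sup>+t. (\<Prod>k<n. indicator {-pi..pi} (t k) * indicator (A k) (t k)) \<partial>lebesgue_prod {..<n})"
  proof (intro nn_integral_cong)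
    fix t assume "t \<in> space (lebesgue_prod {..<n})"
    then have "indicator (\<Pi>\<^sub>E k\<in>{..<n}. A k) t = (\<Prod>k<n. indicator (A k) (t k) :: ennreal)"
      by (auto simp: indicator_def space_PiM PiE_def Pi_def prod_zero_iff)
    then show "(\<Prod>k<n. indicator {-pi..pi} (t k)) * indicator (\<Pi>\<^sub>E k\<in>{..<n}. A k) t
        = (\<Prod>k<n. indicator {-pi..pi} (t k) * indicator (A k) (t k) :: ennreal)"
      by (simp add: prod.distrib)
  qed
  also have "\<dots> = (\<Prod>k<n. \<integral>\<^sup>+x. indicator {-pi..pi} x * indicator (A k) x \<partial>lborel)"
    using assms by (intro P.product_nn_integral_prod) auto
  finally show ?thesis .
qed

text \<open>Addition of \<pi> modulo 2 \<pi>, with values again in [-\<pi>, \<pi>] for arguments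
  there.\<close>

definition half_turn :: "real \<Rightarrow> real" where "half_turn x = (if x \<le> 0 then x + pi else x - pi)"

lemma half_turn_measurable [measurable]: "half_turn \<in> borel_measurable borel"
  unfolding half_turn_def by measurable

lemma half_turn_invariant:
  assumes [measurable]: "A \<in> sets borel"
  shows "(\<integral>\<^sup>+x. indicator {-pi..pi} x * indicator A (half_turn x) \<partial>lborel) = (\<integral>\<^sup>+x. indicator {-pi..pi} x * indicator A x \<partial>lborel)"
proof -
  have "(\<integral>\<^sup>+x. indicator {-pi..pi} x * indicator A (half_turn x) \<partial>lborel)
      = (\<integral>\<^sup>+x. indicator {0..pi} (pi + 1 * x) * indicator A (pi + 1 * x) + indicator {-pi<..0} (- pi + 1 * x) * indicator A (- pi + 1 * x) \<partial>lborel)"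
    by (intro nn_integral_cong) (auto simp: indicator_def half_turn_def add.commute)
  also have "\<dots> = (\<integral>\<^sup>+x. indicator {0..pi} (pi + 1 * x) * indicator A (pi + 1 * x) \<partial>lborel)
      + (\<integral>\<^sup>+x. indicator {-pi<..0} (- pi + 1 * x) * indicator A (- pi + 1 * x) \<partial>lborel)"
    by (rule nn_integral_add) measurable
  also have "\<dots> = (\<integral>\<^sup>+x. indicator {0..pi} x * indicator A x \<partial>lborel) + (\<integral>\<^sup>+x. indicator {-pi<..0} x * indicator A x \<partial>lborel)"
    using nn_integral_real_affine[of "\<lambda>x. indicator {0..pi} x * indicator A x" 1 pi]
      nn_integral_real_affine[of "\<lambda>x. indicator {-pi<..0} x * indicator A x" 1 "- pi"] by simp
  also have "\<dots> = (\<integral>\<^sup>+x. indicator {0..pi} x * indicator A x + indicator {-pi<..0} x * indicator A x \<partial>lborel)"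
    by (rule nn_integral_add[symmetric]) measurable
  also have "\<dots> = (\<integral>\<^sup>+x. indicator {-pi..pi} x * indicator A x \<partial>lborel)"
  proof (rule nn_integral_cong_AE)
    show "AE x in lborel. indicator {0..pi} x * indicator A x + indicator {-pi<..0} x * indicator A x = indicator {-pi..pi} x * (indicator A x :: ennreal)"
      using AE_lborel_singleton[of "0 :: real"] AE_lborel_singleton[of "- pi"]
      by eventually_elim (use pi_gt_zero in \<open>auto simp: indicator_def\<close>)
  qed
  finally show ?thesis .
qed

definition half_turns :: "nat \<Rightarrow> (nat \<Rightarrow> real) \<Rightarrow> nat \<Rightarrow> real" where
  "half_turns n t = (\<lambda>k\<in>{..<n}. half_turn (t k))"

lemma half_turns_measurable [measurable]: "half_turns n \<in> measurable (lebesgue_prod {..<n}) (lebesgue_prod {..<n})"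
  unfolding half_turns_def by (intro measurable_restrict) measurable

lemma distr_torus_half_turns: "distr (torus n) (lebesgue_prod {..<n}) (half_turns n) = torus n"
proof -
  define U where "U = density lborel (indicator {-pi..pi} :: real \<Rightarrow> ennreal)"
  have eU: "emeasure U A = (\<integral>\<^sup>+x. indicator {-pi..pi} x * indicator A x \<partial>lborel)" if "A \<in> sets borel" for A
    unfolding U_def using that by (subst emeasure_density) auto
  have sU: "sets U = sets borel" by (simp add: U_def)
  have "finite_measure U" by (rule finite_measureI) (simp add: U_def emeasure_density)
  then interpret P: product_sigma_finite "\<lambda>_::nat. U"
    by (simp add: product_sigma_finite_def finite_measure.axioms(1) finite_measure_def)
  have sP: "sets (Pi\<^sub>M {..<n} (\<lambda>_. U)) = sets (lebesgue_prod {..<n})" by (rule sets_PiM_cong) (auto simp: sU)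
  have 1: "torus n = Pi\<^sub>M {..<n} (\<lambda>_. U)"
  proof (rule P.PiM_eqI)
    fix A :: "nat \<Rightarrow> real set" assume A: "\<And>i. i \<in> {..<n} \<Longrightarrow> A i \<in> sets U"
    show "emeasure (torus n) (Pi\<^sub>E {..<n} A) = (\<Prod>i<n. emeasure U (A i))"
      using A eU sU by (subst emeasure_torus_PiE) auto
  qed (auto simp: sP)
  have 2: "distr (torus n) (lebesgue_prod {..<n}) (half_turns n) = Pi\<^sub>M {..<n} (\<lambda>_. U)"
  proof (rule P.PiM_eqI)
    fix A :: "nat \<Rightarrow> real set" assume "\<And>i. i \<in> {..<n} \<Longrightarrow> A i \<in> sets U"
    then have A: "A i \<in> sets borel" if "i < n" for i using that sU by auto
    have "emeasure (distr (torus n) (lebesgue_prod {..<n}) (half_turns n)) (Pi\<^sub>E {..<n} A)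
        = emeasure (torus n) (half_turns n -` (Pi\<^sub>E {..<n} A) \<inter> space (torus n))"
      using A by (intro emeasure_distr) (auto intro!: sets_PiM_I_finite)
    also have "half_turns n -` (Pi\<^sub>E {..<n} A) \<inter> space (torus n) = (\<Pi>\<^sub>E k\<in>{..<n}. half_turn -` A k)"
      by (auto simp: torus_def space_PiM half_turns_def PiE_def Pi_def)
    also have "emeasure (torus n) \<dots> = (\<Prod>k<n. \<integral>\<^sup>+x. indicator {-pi..pi} x * indicator (half_turn -` A k) x \<partial>lborel)"
      using A measurable_sets[OF half_turn_measurable] by (intro emeasure_torus_PiE) auto
    also have "\<dots> = (\<Prod>k<n. emeasure U (A k))"
    proof (intro prod.cong refl)
      fix k assume "k \<in> {..<n}"
      then have Ak: "A k \<in> sets borel" using A by auto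
      show "(\<integral>\<^sup>+x. indicator {-pi..pi} x * indicator (half_turn -` A k) x \<partial>lborel) = emeasure U (A k)"
        unfolding eU[OF Ak] half_turn_invariant[OF Ak, symmetric] by (intro nn_integral_cong) (auto simp: indicator_def)
    qed
    finally show "emeasure (distr (torus n) (lebesgue_prod {..<n}) (half_turns n)) (Pi\<^sub>E {..<n} A) = (\<Prod>i<n. emeasure U (A i))" .
  qed (auto simp: sP)
  show ?thesis using 1 2 by simp
qed

lemma torus_eq_density: "torus n = density (lebesgue_prod {..<n}) (\<lambda>t. ennreal (\<Prod>k<n. indicator {-pi..pi} (t k)))"
proof -
  have "ennreal (\<Prod>k<n. indicator {-pi..pi} (t k)) = (\<Prod>k<n. indicator {-pi..pi} (t k))" for t :: "nat \<Rightarrow> real"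
    by (subst prod_ennreal[symmetric]) (auto simp: ennreal_indicator)
  then show ?thesis unfolding torus_def by simp
qed

lemma integral_torus:
  fixes f :: "(nat \<Rightarrow> real) \<Rightarrow> complex"
  assumes "f \<in> borel_measurable (lebesgue_prod {..<n})"
  shows "(\<integral>t. f t \<partial>torus n) = (\<integral>t. (\<Prod>k<n. indicator {-pi..pi} (t k)) *\<^sub>R f t \<partial>lebesgue_prod {..<n})"
    and "integrable (torus n) f \<longleftrightarrow> integrable (lebesgue_prod {..<n}) (\<lambda>t. (\<Prod>k<n. indicator {-pi..pi} (t k)) *\<^sub>R f t)"
  unfolding torus_eq_density using assms
  by (intro integral_density integrable_density; auto intro!: prod_nonneg)+

lemma torus_monomial_integral:
  fixes m :: "nat \<Rightarrow> int"
  shows "integrable (torus n) (\<lambda>t. \<Prod>k<n. cis (real_of_int (m k) * t k))"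
    and "(\<integral>t. (\<Prod>k<n. cis (real_of_int (m k) * t k)) \<partial>torus n) = (if \<forall>k<n. m k = 0 then (2 * of_real pi) ^ n else 0)"
proof -
  interpret P: product_sigma_finite "\<lambda>_::nat. lborel :: real measure" by (rule product_sigma_finite_lborel)
  have meas: "(\<lambda>t. \<Prod>k<n. cis (real_of_int (m k) * t k)) \<in> borel_measurable (lebesgue_prod {..<n})"
  proof (rule borel_measurable_prod)
    fix k assume "k \<in> {..<n}"
    from measurable_component_singleton[OF this, of "\<lambda>_. lborel :: real measure"]
    show "(\<lambda>t. cis (real_of_int (m k) * t k)) \<in> borel_measurable (lebesgue_prod {..<n})"
      by (intro measurable_compose[OF _ borel_measurable_continuous_onI[of "\<lambda>x. cis (real_of_int (m k) * x)"]])
         (auto intro!: continuous_intros)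
  qed
  have e: "(\<Prod>k<n. indicator {-pi..pi} (t k)) *\<^sub>R (\<Prod>k<n. cis (real_of_int (m k) * t k))
      = (\<Prod>k<n. indicator {-pi..pi} (t k) *\<^sub>R cis (real_of_int (m k) * t k))" for t :: "nat \<Rightarrow> real"
    by (simp add: scaleR_conv_of_real prod.distrib)
  show "integrable (torus n) (\<lambda>t. \<Prod>k<n. cis (real_of_int (m k) * t k))"
    unfolding integral_torus(2)[OF meas] e by (intro P.product_integrable_prod cis_integral) auto
  have "(\<integral>t. (\<Prod>k<n. cis (real_of_int (m k) * t k)) \<partial>torus n) = (\<Prod>k<n. \<integral>x. indicator {-pi..pi} x *\<^sub>R cis (real_of_int (m k) * x) \<partial>lborel)"
    unfolding integral_torus(1)[OF meas] e by (intro P.product_integral_prod cis_integral) auto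
  also have "\<dots> = (if \<forall>k<n. m k = 0 then (2 * of_real pi) ^ n else 0)"
    unfolding cis_integral(2) by (auto simp: prod_zero_iff)
  finally show "(\<integral>t. (\<Prod>k<n. cis (real_of_int (m k) * t k)) \<partial>torus n) = (if \<forall>k<n. m k = 0 then (2 * of_real pi) ^ n else 0)" .
qed

text \<open>A character with a nonzero exponent integrates to 0, so of all edge sets in the
  expansion exactly those with degrees D survive.\<close>

lemma torus_char_prod:
  assumes z: "\<And>e. e \<in> vertex_pairs n \<Longrightarrow> 0 \<le> z e \<and> z e \<le> 1"
  shows "integrable (torus n) (char_prod n D z)"
    and "(\<integral>t. char_prod n D z t \<partial>torus n) = of_real ((2 * pi) ^ n *
      (\<Sum>E\<in>graphs_with_degrees n D. (\<Prod>e\<in>E. z e) * (\<Prod>e\<in>vertex_pairs n - E. 1 - z e)))"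
proof -
  let ?P = "vertex_pairs n"
  let ?c = "\<lambda>E. (\<Prod>e\<in>E. z e) * (\<Prod>e\<in>?P - E. 1 - z e)"
  let ?m = "\<lambda>E k. int (card {e \<in> E. k \<in> e}) - int (D k)"
  have cp: "char_prod n D z = (\<lambda>t. \<Sum>E\<in>Pow ?P. of_real (?c E) * (\<Prod>k<n. cis (real_of_int (?m E k) * t k)))"
    using char_prod_expand[of n z D] z by blast
  have i: "integrable (torus n) (\<lambda>t. complex_of_real (?c E) * (\<Prod>k<n. cis (real_of_int (?m E k) * t k)))" for E
    by (intro integrable_mult_right torus_monomial_integral)
  show "integrable (torus n) (char_prod n D z)"
    unfolding cp by (intro Bochner_Integration.integrable_sum i)
  have "(\<integral>t. char_prod n D z t \<partial>torus n) = (\<Sum>E\<in>Pow ?P. of_real (?c E) * (if \<forall>k<n. ?m E k = 0 then (2 * of_real pi) ^ n else 0))"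
    unfolding cp by (subst Bochner_Integration.integral_sum, rule i)
      (simp only: integral_mult_right_zero torus_monomial_integral(2))
  also have "\<dots> = (\<Sum>E\<in>graphs_with_degrees n D. of_real (?c E) * (2 * of_real pi) ^ n)"
    by (intro sum.mono_neutral_cong_right) (auto simp: graphs_with_degrees_def)
  finally show "(\<integral>t. char_prod n D z t \<partial>torus n) = of_real ((2 * pi) ^ n * (\<Sum>E\<in>graphs_with_degrees n D. ?c E))"
    by (simp add: sum_distrib_left mult.commute)
qed

lemma cis_add_int_pi: "even m \<Longrightarrow> cis (x + real_of_int m * pi) = cis x"
proof -
  assume "even m"
  then obtain l where "m = 2 * l" by blast
  then have "cis (x + real_of_int m * pi) = cis x * cis (2 * pi * real_of_int l)"
    by (simp add: cis_mult algebra_simps)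
  also have "cis (2 * pi * real_of_int l) = 1" by (rule cis_multiple_2pi) simp
  finally show ?thesis by simp
qed

text \<open>Every coordinate moves by \<pi> or - \<pi>. An edge sum therefore moves by an even
  multiple of \<pi>, and the final phase by \<pi> times an integer with the parity of the sum of D;
  the evenness of that sum is used here.\<close>

lemma char_prod_half_turns:
  assumes even_D: "even (\<Sum>k<n. D k)" and z: "\<And>e. e \<in> vertex_pairs n \<Longrightarrow> 0 \<le> z e \<and> z e \<le> 1"
  shows "char_prod n D z (half_turns n t) = char_prod n D z t"
proof -
  define s where "s k = (if t k \<le> 0 then 1 else -1 :: int)" for k
  have h: "half_turns n t k = t k + real_of_int (s k) * pi" if "k < n" for k
    using that by (simp add: half_turns_def half_turn_def s_def)
  have "bern (z e) (sum (half_turns n t) e) = bern (z e) (sum t e)" if e: "e \<in> vertex_pairs n" for e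
  proof -
    obtain j k where jk: "e = {j, k}" "j \<noteq> k" using vertex_pairsD[OF e] by (auto simp: card_2_iff)
    then have "j < n" "k < n" using vertex_pairsD[OF e] by auto
    then have "sum (half_turns n t) e = sum t e + real_of_int (s j + s k) * pi"
      using jk h by (simp add: algebra_simps)
    moreover have "even (s j + s k)" by (simp add: s_def)
    ultimately have "cis (sum (half_turns n t) e) = cis (sum t e)" using cis_add_int_pi by metis
    moreover have "bern (z e) x = 1 - of_real (z e) + of_real (z e) * cis x" for x
      using bern_def[of "z e"] z[OF e] by simp
    ultimately show ?thesis by simp
  qed
  moreover have "cis (- (\<Sum>k<n. real (D k) * half_turns n t k)) = cis (- (\<Sum>k<n. real (D k) * t k))"
  proof -
    have "(\<Sum>k<n. real (D k) * half_turns n t k) = (\<Sum>k<n. real (D k) * t k) + real_of_int (\<Sum>k<n. int (D k) * s k) * pi"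
      unfolding of_int_sum sum_distrib_right sum.distrib[symmetric] by (intro sum.cong refl) (simp add: h algebra_simps)
    then have "- (\<Sum>k<n. real (D k) * half_turns n t k) = - (\<Sum>k<n. real (D k) * t k) + real_of_int (- (\<Sum>k<n. int (D k) * s k)) * pi"
      by simp
    moreover have "even (- (\<Sum>k<n. int (D k) * s k))"
    proof -
      have "even ((\<Sum>k<n. int (D k) * s k) - (\<Sum>k<n. int (D k)))"
        unfolding sum_subtractf[symmetric] by (rule dvd_sum) (auto simp: s_def)
      moreover have "even (\<Sum>k<n. int (D k))" using even_D by (metis even_of_nat of_nat_sum)
      ultimately show ?thesis by simp
    qed
    ultimately show ?thesis using cis_add_int_pi by metis
  qed
  ultimately show ?thesis unfolding char_prod_def by (metis (no_types, lifting) prod.cong)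
qed

context graph_weights
begin

lemma z01: "e \<in> vertex_pairs n \<Longrightarrow> 0 \<le> z e \<and> z e \<le> 1" using z by simp

lemma norm_char_prod_le: "cmod (char_prod n D z t) \<le> damp t"
proof -
  have "cmod (char_prod n D z t) = (\<Prod>e\<in>vertex_pairs n. cmod (bern (z e) (sum t e)))"
    by (simp add: char_prod_def norm_mult prod_norm)
  also have "\<dots> \<le> (\<Prod>e\<in>vertex_pairs n. exp (- (w e) * (1 - cos (sum t e))))"
    unfolding w_def using z by (intro prod_mono conjI norm_ge_zero norm_bern_le) auto
  also have "\<dots> = damp t" by (simp add: damp_def exp_sum[symmetric] sum_negf)
  finally show ?thesis .
qed

lemma char_prod_measurable [measurable]: "char_prod n D z \<in> borel_measurable L"
  using borel_measurable_integrable[OF torus_char_prod(1)[OF z01]] by simp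

lemma cube_indicator: "t \<in> space L \<Longrightarrow> (\<Prod>k<n. indicator {-pi..pi} (t k)) = (indicator cube t :: real)"
proof -
  assume t: "t \<in> space L"
  show ?thesis
  proof (cases "t \<in> cube")
    case True
    then have "(\<Prod>k<n. indicator {-pi..pi} (t k) :: real) = 1"
      by (intro prod.neutral) (auto simp: cube_def abs_le_iff)
    then show ?thesis using True by simp
  next
    case False
    then obtain k where "k < n" "t k \<notin> {-pi..pi}" using t by (auto simp: cube_def abs_le_iff)
    then have "(\<Prod>k<n. indicator {-pi..pi} (t k) :: real) = 0"
      by (intro prod_zero bexI[of _ k]) auto
    then show ?thesis using False by simp
  qed
qed

text \<open>Turning all coordinates by \<pi> changes the sign of the cosine sum, so the part where
  it is negative contributes as much as the part where it is positive. The set where it vanishes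
  stays with the first integral, which is why the two domains are stated separately.\<close>

lemma count_integral:
  assumes "even (\<Sum>k<n. D k)"
  shows "of_real ((2 * pi) ^ n * (\<Sum>E\<in>graphs_with_degrees n D. (\<Prod>e\<in>E. z e) * (\<Prod>e\<in>vertex_pairs n - E. 1 - z e)))
    = (\<integral>t. indicator {t \<in> cube. 0 \<le> (\<Sum>j<n. cos (t j))} t *\<^sub>R char_prod n D z t \<partial>L)
      + (\<integral>t. indicator {t \<in> cube. 0 < (\<Sum>j<n. cos (t j))} t *\<^sub>R char_prod n D z t \<partial>L)"
proof -
  let ?f = "char_prod n D z" and ?A = "\<lambda>t. \<Sum>j<n. cos (t j)"
  have i: "integrable (torus n) ?f" by (rule torus_char_prod(1)[OF z01])
  have ms: "{t \<in> space L. 0 \<le> ?A t} \<in> sets L" "{t \<in> space L. ?A t < 0} \<in> sets L" "{t \<in> space L. 0 < ?A t} \<in> sets L"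
    by measurable
  have sp: "space (torus n) = space L" by (simp add: torus_def)
  have int: "integrable (torus n) (\<lambda>t. indicator S t *\<^sub>R ?f t)" if "S \<in> sets L" for S
    using integrable_mult_indicator[OF _ i] that by simp
  have tr: "(\<integral>t. indicator {t \<in> space L. P t} t *\<^sub>R ?f t \<partial>torus n) = (\<integral>t. indicator {t \<in> cube. P t} t *\<^sub>R ?f t \<partial>L)"
    if m: "{t \<in> space L. P t} \<in> sets L" for P
  proof -
    have "(\<integral>t. indicator {t \<in> space L. P t} t *\<^sub>R ?f t \<partial>torus n)
        = (\<integral>t. (\<Prod>k<n. indicator {-pi..pi} (t k)) *\<^sub>R (indicator {t \<in> space L. P t} t *\<^sub>R ?f t) \<partial>L)"
      using m by (intro integral_torus(1)) auto
    also have "\<dots> = (\<integral>t. indicator {t \<in> cube. P t} t *\<^sub>R ?f t \<partial>L)"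
      by (intro Bochner_Integration.integral_cong refl, subst cube_indicator) (auto simp: indicator_def cube_def)
    finally show ?thesis .
  qed
  have "(\<integral>t. ?f t \<partial>torus n) = (\<integral>t. indicator {t \<in> space L. 0 \<le> ?A t} t *\<^sub>R ?f t + indicator {t \<in> space L. ?A t < 0} t *\<^sub>R ?f t \<partial>torus n)"
    by (intro Bochner_Integration.integral_cong refl) (auto simp: indicator_def sp)
  also have "\<dots> = (\<integral>t. indicator {t \<in> space L. 0 \<le> ?A t} t *\<^sub>R ?f t \<partial>torus n) + (\<integral>t. indicator {t \<in> space L. ?A t < 0} t *\<^sub>R ?f t \<partial>torus n)"
    by (rule Bochner_Integration.integral_add) (intro int ms)+
  also have "(\<integral>t. indicator {t \<in> space L. ?A t < 0} t *\<^sub>R ?f t \<partial>torus n)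
      = (\<integral>t. indicator {t \<in> space L. ?A t < 0} t *\<^sub>R ?f t \<partial>distr (torus n) L (half_turns n))"
    by (simp add: distr_torus_half_turns)
  also have "\<dots> = (\<integral>t. indicator {t \<in> space L. ?A t < 0} (half_turns n t) *\<^sub>R ?f (half_turns n t) \<partial>torus n)"
    using ms by (intro integral_distr) auto
  also have "\<dots> = (\<integral>t. indicator {t \<in> space L. 0 < ?A t} t *\<^sub>R ?f t \<partial>torus n)"
  proof (intro Bochner_Integration.integral_cong refl)
    fix t assume t: "t \<in> space (torus n)"
    have "?A (half_turns n t) = - ?A t"
      unfolding sum_negf[symmetric] by (intro sum.cong refl) (auto simp: half_turns_def half_turn_def cos_diff)
    moreover have "half_turns n t \<in> space L" using t measurable_space[OF half_turns_measurable] sp by auto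
    ultimately show "indicator {t \<in> space L. ?A t < 0} (half_turns n t) *\<^sub>R ?f (half_turns n t) = indicator {t \<in> space L. 0 < ?A t} t *\<^sub>R ?f t"
      using t sp char_prod_half_turns[OF assms z01] by (auto simp: indicator_def)
  qed
  finally show ?thesis
    unfolding tr[OF ms(1)] tr[OF ms(3)] using torus_char_prod(2)[of n z D, OF z01] by simp
qed

end

section \<open>The Gaussian approximation near the origin\<close>

locale large_graph_weights = graph_weights +
  fixes D :: "nat \<Rightarrow> nat"
  assumes n8: "8 \<le> n" and deg: "\<And>k. k < n \<Longrightarrow> (\<Sum>j\<in>{..<n} - {k}. z {j, k}) = real (D k)"
begin

section \<open>Edge sums as linear forms of a standard Gaussian vector\<close>

definition edge_vec :: "nat set \<Rightarrow> nat \<Rightarrow> real" where "edge_vec e k = (\<Sum>j\<in>e. chol j k)"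

lemma lin_form_edge_vec: "e \<in> vertex_pairs n \<Longrightarrow> lin_form {..<n} (edge_vec e) y = sum (lin_map n chol y) e"
proof -
  assume e: "e \<in> vertex_pairs n"
  have "lin_form {..<n} (edge_vec e) y = (\<Sum>j\<in>e. \<Sum>k<n. chol j k * y k)"
    unfolding lin_form_def edge_vec_def sum_distrib_right by (rule sum.swap)
  also have "\<dots> = sum (lin_map n chol y) e"
    using vertex_pairsD[OF e] by (intro sum.cong refl) (auto simp: lin_map_def)
  finally show ?thesis .
qed

lemma lin_map_norm: "(\<Sum>j<n. (lin_map n chol y j)\<^sup>2) \<le> 2 / (w0 * real n) * (\<Sum>k<n. (y k)\<^sup>2)"
proof -
  define T where "T = (\<Sum>j<n. (lin_map n chol y j)\<^sup>2)"
  have T0: "T \<ge> 0" unfolding T_def by (intro sum_nonneg) auto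
  have "w0 * (real n / 2) * T \<le> w0 * (real n - 2) * T"
    using w0 n8 T0 by (intro mult_right_mono mult_left_mono) auto
  also have "\<dots> \<le> (\<Sum>k<n. (y k)\<^sup>2)"
    using quad_form_hess_lower[of "lin_map n chol y"] unfolding chol_quad T_def .
  finally show ?thesis unfolding T_def[symmetric] using w0 n8 by (simp add: field_simps)
qed

definition sd :: real where "sd = 2 / sqrt (w0 * real n)"

lemma sd_pos: "0 < sd" unfolding sd_def using w0 n8 by simp
lemma sd_square: "sd\<^sup>2 = 4 / (w0 * real n)" unfolding sd_def using w0 n8 by (simp add: power_divide)

lemma le_if_square_le: "S \<ge> 0 \<Longrightarrow> c \<ge> 0 \<Longrightarrow> S\<^sup>2 \<le> c * S \<Longrightarrow> S \<le> (c::real)"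
  by (cases "S = 0") (simp_all add: power2_eq_square)

text \<open>Duality: the matrix applied to its own row j has j-th entry S, the squared norm of that
  row. Hence S^2 \<le> c S, with c the bound for the squared operator norm.\<close>

lemma row_norm:
  assumes j: "j < n" shows "(\<Sum>k<n. (chol j k)\<^sup>2) \<le> sd\<^sup>2"
proof -
  define S where "S = (\<Sum>k<n. (chol j k)\<^sup>2)"
  have S0: "S \<ge> 0" unfolding S_def by (intro sum_nonneg) auto
  have "lin_map n chol (chol j) j = S" using j by (simp add: lin_map_def S_def power2_eq_square)
  then have "S\<^sup>2 \<le> (\<Sum>i<n. (lin_map n chol (chol j) i)\<^sup>2)"
    using member_le_sum[of j "{..<n}" "\<lambda>i. (lin_map n chol (chol j) i)\<^sup>2"] j by simp
  also have "\<dots> \<le> 2 / (w0 * real n) * S" using lin_map_norm[of "chol j"] unfolding S_def .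
  finally have "S \<le> 2 / (w0 * real n)" using S0 w0 by (intro le_if_square_le[OF S0]) auto
  also have "\<dots> \<le> sd\<^sup>2" unfolding sd_square using w0 n8 by (simp add: field_simps)
  finally show ?thesis unfolding S_def .
qed

text \<open>The same duality for the sum of two rows; the factor 2 comes from the square of a sum of
  two entries and is the reason for the 4 in \<open>sd_square\<close>.\<close>

lemma edge_norm:
  assumes e: "e \<in> vertex_pairs n" shows "(\<Sum>k<n. (edge_vec e k)\<^sup>2) \<le> sd\<^sup>2"
proof -
  define S where "S = (\<Sum>k<n. (edge_vec e k)\<^sup>2)"
  let ?t = "lin_map n chol (edge_vec e)"
  have S0: "S \<ge> 0" unfolding S_def by (intro sum_nonneg) auto
  have "S = lin_form {..<n} (edge_vec e) (edge_vec e)" by (simp add: S_def lin_form_def power2_eq_square)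
  then have "S = sum ?t e" by (simp add: lin_form_edge_vec[OF e])
  then have "S\<^sup>2 \<le> 2 * (\<Sum>j\<in>e. (?t j)\<^sup>2)" using sum_edge_square_le[OF e] by simp
  also have "\<dots> \<le> 2 * (\<Sum>j<n. (?t j)\<^sup>2)"
    using vertex_pairsD[OF e] by (intro mult_left_mono sum_mono2) auto
  also have "\<dots> \<le> 2 * (2 / (w0 * real n) * S)" using lin_map_norm[of "edge_vec e"] unfolding S_def by (intro mult_left_mono) auto
  also have "\<dots> = sd\<^sup>2 * S" unfolding sd_square by simp
  finally show ?thesis unfolding S_def[symmetric] by (intro le_if_square_le[OF S0]) auto
qed

text \<open>In these coordinates the w-weighted sum of the squared edge sums equals the squared
  length of v, so w \<ge> w0 gives the Bessel constant 1 / w0.\<close>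

sublocale fr: gaussian_frame "{..<n}" "vertex_pairs n" edge_vec sd "1 / w0" "(real n)\<^sup>2"
proof
  show "1 \<le> 1 / w0" using w0 w0_small by simp
  show "(\<Sum>e\<in>vertex_pairs n. (lin_form {..<n} (edge_vec e) v)\<^sup>2) \<le> 1 / w0 * (\<Sum>k<n. (v k)\<^sup>2)" for v
  proof -
    have "w0 * (\<Sum>e\<in>vertex_pairs n. (lin_form {..<n} (edge_vec e) v)\<^sup>2) = (\<Sum>e\<in>vertex_pairs n. w0 * (sum (lin_map n chol v) e)\<^sup>2)"
      by (simp add: lin_form_edge_vec sum_distrib_left)
    also have "\<dots> \<le> quad_form n hess (lin_map n chol v)"
      unfolding quad_form_hess by (intro sum_mono mult_right_mono w_bounds) auto
    finally show ?thesis unfolding chol_quad using w0 by (simp add: field_simps)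
  qed
qed (use sd_pos card_vertex_pairs edge_norm in auto)

abbreviation M :: "(nat \<Rightarrow> real) \<Rightarrow> nat \<Rightarrow> real" where "M \<equiv> lin_map n chol"
abbreviation G :: "(nat \<Rightarrow> real) measure" where "G \<equiv> std_gauss {..<n}"

lemma integral_exp_q: "(LINT s|L. exp (- q_form n z s)) = gauss_const"
  using gauss_const_pos nn_integral_exp_q by (subst integral_eq_nn_integral) auto

lemma M_measurable [measurable]: "M \<in> measurable G L"
  using lin_map_measurable[of n chol] by (simp cong: measurable_cong_sets)

lemma gaussian_eq: "gaussian n z = distr G L M"
proof (rule measure_eqI)
  fix A assume "A \<in> sets (gaussian n z)"
  then have [measurable]: "A \<in> sets L" by (simp add: gaussian_def Let_def)
  have "emeasure (gaussian n z) A = (\<integral>\<^sup>+t. ennreal (exp (- q_form n z t) / gauss_const) * indicator A t \<partial>L)"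
    unfolding gaussian_def Let_def integral_exp_q by (rule emeasure_density) measurable
  also have "\<dots> = (\<integral>\<^sup>+t. ennreal (1 / gauss_const) * (indicator A t * ennreal (exp (- q_form n z t))) \<partial>L)"
    using gauss_const_pos by (intro nn_integral_cong) (simp add: ennreal_mult'[symmetric] indicator_def)
  also have "\<dots> = ennreal (1 / gauss_const) * (ennreal gauss_const * (\<integral>\<^sup>+y. indicator A (M y) \<partial>G))"
    by (subst nn_integral_cmult, simp, subst chol_nn_integral) auto
  also have "\<dots> = (\<integral>\<^sup>+y. indicator A (M y) \<partial>G)"
    using gauss_const_pos by (simp add: mult.assoc[symmetric] ennreal_mult'[symmetric])
  also have "\<dots> = (\<integral>\<^sup>+t. indicator A t \<partial>distr G L M)"
    by (rule nn_integral_distr[OF M_measurable, symmetric]) simp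
  also have "\<dots> = emeasure (distr G L M) A" by simp
  finally show "emeasure (gaussian n z) A = emeasure (distr G L M) A" .
qed (simp add: gaussian_def Let_def)

lemma integral_gaussian:
  fixes F :: "(nat \<Rightarrow> real) \<Rightarrow> 'b :: {banach, second_countable_topology}"
  assumes "F \<in> borel_measurable L"
  shows "(\<integral>t. F t \<partial>gaussian n z) = (\<integral>y. F (M y) \<partial>G)"
  unfolding gaussian_eq using assms by (intro integral_distr) auto

lemma chol_integral:
  fixes F :: "(nat \<Rightarrow> real) \<Rightarrow> complex"
  assumes [measurable]: "F \<in> borel_measurable L"
  shows "(\<integral>t. exp (- q_form n z t) *\<^sub>R F t \<partial>L) = gauss_const *\<^sub>R (\<integral>y. F (M y) \<partial>G)"
proof -
  have "(\<integral>y. F (M y) \<partial>G) = (\<integral>t. (exp (- q_form n z t) / gauss_const) *\<^sub>R F t \<partial>L)"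
    unfolding integral_gaussian[OF assms, symmetric] unfolding gaussian_def Let_def integral_exp_q
    using gauss_const_pos by (intro integral_density) auto
  also have "\<dots> = (\<integral>t. (1 / gauss_const) *\<^sub>R (exp (- q_form n z t) *\<^sub>R F t) \<partial>L)" by simp
  also have "\<dots> = (1 / gauss_const) *\<^sub>R (\<integral>t. exp (- q_form n z t) *\<^sub>R F t \<partial>L)" by (rule integral_scaleR_right)
  finally show ?thesis using gauss_const_pos by simp
qed

definition acoef :: "nat set \<Rightarrow> real" where "acoef e = w e * (2 * z e - 1)"
text \<open>The factor 1/24 of h is included here, whereas the 1/6 of f belongs to
  \<open>cubic\<close>.\<close>

definition bcoef :: "nat set \<Rightarrow> real" where "bcoef e = w e * (6 * (z e)\<^sup>2 - 6 * z e + 1) / 24"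

lemma acoef_le: "e \<in> vertex_pairs n \<Longrightarrow> \<bar>acoef e\<bar> \<le> 1"
  unfolding acoef_def abs_mult using w_bounds[of e] z[of e] by (intro mult_le_one) auto

lemma bcoef_le: "e \<in> vertex_pairs n \<Longrightarrow> \<bar>bcoef e\<bar> \<le> 1"
proof -
  assume e: "e \<in> vertex_pairs n"
  have "6 * (z e)\<^sup>2 - 6 * z e + 1 = 1 - 6 * w e" by (simp add: w_def power2_eq_square algebra_simps)
  then have "\<bar>6 * (z e)\<^sup>2 - 6 * z e + 1\<bar> \<le> 1" using w_bounds[OF e] by auto
  then have "\<bar>w e\<bar> * \<bar>6 * (z e)\<^sup>2 - 6 * z e + 1\<bar> \<le> 1" using w_bounds[OF e] by (intro mult_le_one) auto
  then show ?thesis unfolding bcoef_def by (simp add: abs_mult)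
qed

abbreviation cub :: "(nat \<Rightarrow> real) \<Rightarrow> real" where "cub \<equiv> fr.cubic acoef"
definition quart :: "(nat \<Rightarrow> real) \<Rightarrow> real" where
  "quart y = (\<Sum>e\<in>vertex_pairs n. bcoef e * lin_form {..<n} (edge_vec e) y ^ 4)"

lemma f_form_M: "f_form n z (M y) = cub y"
proof -
  have "(\<Sum>e\<in>vertex_pairs n. z e * (1 - z e) * (2 * z e - 1) * sum (M y) e ^ 3)
      = (\<Sum>e\<in>vertex_pairs n. acoef e * lin_form {..<n} (edge_vec e) y ^ 3)"
    by (intro sum.cong refl) (simp add: lin_form_edge_vec acoef_def w_def)
  then show ?thesis unfolding f_form_def by (simp only: fr.cubic_def[OF acoef_le])
qed

lemma h_form_M: "h_form n z (M y) = quart y"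
  unfolding h_form_def quart_def bcoef_def w_def sum_distrib_left
  by (intro sum.cong refl) (simp add: lin_form_edge_vec)

lemma form_measurable: "f_form n z \<in> borel_measurable L" "h_form n z \<in> borel_measurable L"
  unfolding f_form_def [abs_def] h_form_def [abs_def]
  by (intro borel_measurable_times borel_measurable_const borel_measurable_sum borel_measurable_power edge_sum_measurable; assumption)+

lemma mu_eq: "mu n z = fr.cubic_var acoef"
  by (simp only: mu_def fr.cubic_var_def[OF acoef_le] f_form_M
      integral_gaussian[OF borel_measurable_power[OF form_measurable(1)]])

lemma nu_eq: "nu n z = (\<integral>y. quart y \<partial>G)"
  by (simp only: nu_def h_form_M integral_gaussian[OF form_measurable(2)])

text \<open>N s^4 is independent of n. This turns the bounds for \<open>mu\<close> and
  \<open>nu\<close> into constants: 100 * 16 = 1600 and 96 * 16 = 1536.\<close>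

lemma sd4: "(real n)\<^sup>2 * sd ^ 4 = 16 / w0\<^sup>2"
proof -
  have "sd ^ 4 = (sd\<^sup>2)\<^sup>2" by simp
  also have "\<dots> = 16 / (w0\<^sup>2 * (real n)\<^sup>2)" unfolding sd_square by (simp add: power_divide power_mult_distrib)
  finally show ?thesis using n8 by simp
qed

lemma mu_bounds: "0 \<le> mu n z" "mu n z \<le> 1600 / w0 ^ 3"
proof -
  show "0 \<le> mu n z" unfolding mu_def by simp
  have "mu n z \<le> 100 * (1 / w0) * (real n)\<^sup>2 * sd ^ 4"
    unfolding mu_eq by (rule fr.cubic_var_le[OF acoef_le])
  also have "\<dots> = 100 * (1 / w0) * (16 / w0\<^sup>2)" unfolding sd4[symmetric] by simp
  finally show "mu n z \<le> 1600 / w0 ^ 3" by (simp add: power2_eq_square power3_eq_cube)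
qed

lemma nu_bound: "\<bar>nu n z\<bar> \<le> 1536 / w0\<^sup>2"
  and nu_approx: "\<rho> > 0 \<Longrightarrow> \<bar>nu n z - (\<integral>y. fr.quartic bcoef \<rho> y \<partial>G)\<bar> \<le> 2880 * (real n)\<^sup>2 * sd ^ 6 / \<rho>\<^sup>2"
proof -
  have "\<bar>nu n z\<bar> \<le> 96 * (real n)\<^sup>2 * sd ^ 4"
    unfolding nu_eq quart_def [abs_def] using fr.quartic_mean(1)[of bcoef 1] bcoef_le by simp
  then show "\<bar>nu n z\<bar> \<le> 1536 / w0\<^sup>2" using sd4 by (simp add: mult.assoc)
  show "\<rho> > 0 \<Longrightarrow> \<bar>nu n z - (\<integral>y. fr.quartic bcoef \<rho> y \<partial>G)\<bar> \<le> 2880 * (real n)\<^sup>2 * sd ^ 6 / \<rho>\<^sup>2"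
    using fr.quartic_mean(2)[of bcoef \<rho>] bcoef_le unfolding nu_eq quart_def [abs_def] by simp
qed

section \<open>Expansion of the integrand inside the box\<close>

lemma box_edge_bound:
  assumes "t \<in> box r" "e \<in> vertex_pairs n" shows "\<bar>sum t e\<bar> \<le> 2 * r"
proof -
  obtain j k where jk: "e = {j, k}" "j \<noteq> k" using vertex_pairsD[OF assms(2)] by (auto simp: card_2_iff)
  then have "\<bar>t j\<bar> \<le> r" "\<bar>t k\<bar> \<le> r" using assms vertex_pairsD[OF assms(2)] by (auto simp: box_def)
  then show ?thesis using jk by auto
qed

lemma box_complement: "r > 0 \<Longrightarrow> measure G {y \<in> space G. M y \<notin> box r} \<le> real n * (4 * exp (- r / sd))"
proof -
  assume r: "r > 0"
  interpret P: prob_space G by (rule prob_space_std_gauss)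
  have row: "M y j = lin_form {..<n} (chol j) y" if "j < n" for y j using that by (simp add: lin_map_def lin_form_def)
  have [measurable]: "lin_form {..<n} m \<in> borel_measurable L" for m by (intro subexp_measurable subexp_lin_form) auto
  have ms: "{y \<in> space G. r < \<bar>lin_form {..<n} (chol j) y\<bar>} \<in> sets G" for j by measurable
  have sub: "{y \<in> space G. M y \<notin> box r} = (\<Union>j<n. {y \<in> space G. r < \<bar>lin_form {..<n} (chol j) y\<bar>})"
    using measurable_space[OF M_measurable] by (auto simp: box_def row not_le)
  have "measure G {y \<in> space G. M y \<notin> box r} \<le> (\<Sum>j<n. measure G {y \<in> space G. r < \<bar>lin_form {..<n} (chol j) y\<bar>})"
    unfolding sub using ms by (intro P.finite_measure_subadditive_finite) auto
  also have "\<dots> \<le> (\<Sum>j<n. 4 * exp (- r / sd))"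
    using row_norm sd_pos by (intro sum_mono lin_form_tail) auto
  finally show ?thesis by simp
qed

text \<open>The expansions of the single edges are multiplied; R collects their fifth order errors,
  and the quadratic, cubic and quartic terms sum to q, f and h.\<close>

lemma char_prod_box:
  assumes t: "t \<in> box r" and r: "0 \<le> r" "2 * r \<le> 1"
  obtains R where "char_prod n D z t = exp (- q_form n z t) *\<^sub>R (R * cis (f_form n z t) * exp (h_form n z t))"
    and "cmod (R - 1) \<le> exp ((real n)\<^sup>2 * (3000 * (2 * r) ^ 5)) - 1"
proof -
  let ?P = "vertex_pairs n"
  define x where "x e = sum t e" for e
  have x: "\<bar>x e\<bar> \<le> 2 * r" if "e \<in> ?P" for e unfolding x_def by (rule box_edge_bound[OF t that])
  define g where "g e = - \<i> * of_real (z e * x e) + of_real (w e * (x e)\<^sup>2 / 2) - \<i> * of_real (acoef e * x e ^ 3 / 6)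
    - of_real (w e * (6 * (z e)\<^sup>2 - 6 * z e + 1) * x e ^ 4 / 24)" for e
  define \<rho> where "\<rho> e = bern (z e) (x e) * exp (g e) - 1" for e
  have rb: "cmod (\<rho> e) \<le> 3000 * (2 * r) ^ 5" if e: "e \<in> ?P" for e
  proof -
    have "\<bar>x e\<bar> \<le> 1" using x[OF e] r by linarith
    then have "cmod (\<rho> e) \<le> 3000 * \<bar>x e\<bar> ^ 5"
      unfolding \<rho>_def g_def w_def acoef_def using bern_expansion[of "z e" "x e"] z[OF e] by simp
    also have "\<dots> \<le> 3000 * (2 * r) ^ 5" using x[OF e] by (intro mult_left_mono power_mono) auto
    finally show ?thesis .
  qed
  define R where "R = (\<Prod>e\<in>?P. 1 + \<rho> e)"
  have "cmod (R - 1) \<le> exp (\<Sum>e\<in>?P. cmod (\<rho> e)) - 1" unfolding R_def by (rule norm_prod_minus_one_le)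
  also have "(\<Sum>e\<in>?P. cmod (\<rho> e)) \<le> real (card ?P) * (3000 * (2 * r) ^ 5)" by (rule sum_bounded_above[OF rb])
  also have "\<dots> \<le> (real n)\<^sup>2 * (3000 * (2 * r) ^ 5)" using r by (intro mult_right_mono card_vertex_pairs) auto
  finally have R1: "cmod (R - 1) \<le> exp ((real n)\<^sup>2 * (3000 * (2 * r) ^ 5)) - 1" by simp
  \<comment> \<open>The degree equations for z: the linear terms of all edges cancel the phase that
    contains D.\<close>
  have Dx: "(\<Sum>e\<in>?P. z e * x e) = (\<Sum>k<n. real (D k) * t k)"
  proof -
    have "(\<Sum>e\<in>?P. z e * x e) = (\<Sum>e\<in>?P. \<Sum>j\<in>e. z e * t j)" by (simp add: x_def sum_distrib_left)
    also have "\<dots> = (\<Sum>k<n. \<Sum>j\<in>{..<n} - {k}. z {j, k} * t k)"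
      unfolding sum_vertex_pairs by (simp add: insert_commute)
    also have "\<dots> = (\<Sum>k<n. real (D k) * t k)"
      by (intro sum.cong refl) (simp add: sum_distrib_right[symmetric] deg)
    finally show ?thesis .
  qed
  have sg: "(\<Sum>e\<in>?P. g e) = - \<i> * of_real (\<Sum>k<n. real (D k) * t k) + of_real (q_form n z t) - \<i> * of_real (f_form n z t) - of_real (h_form n z t)"
  proof -
    have "(\<Sum>e\<in>?P. g e) = - \<i> * of_real (\<Sum>e\<in>?P. z e * x e) + of_real (\<Sum>e\<in>?P. w e * (x e)\<^sup>2 / 2)
        - \<i> * of_real (\<Sum>e\<in>?P. acoef e * x e ^ 3 / 6) - of_real (\<Sum>e\<in>?P. w e * (6 * (z e)\<^sup>2 - 6 * z e + 1) * x e ^ 4 / 24)"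
      unfolding g_def sum_subtractf sum.distrib of_real_sum sum_distrib_left ..
    also have "(\<Sum>e\<in>?P. w e * (x e)\<^sup>2 / 2) = q_form n z t"
      unfolding q_form_eq quad_form_hess x_def by (simp add: sum_divide_distrib)
    also have "(\<Sum>e\<in>?P. acoef e * x e ^ 3 / 6) = f_form n z t"
      unfolding f_form_def acoef_def w_def x_def by (simp add: sum_distrib_left)
    also have "(\<Sum>e\<in>?P. w e * (6 * (z e)\<^sup>2 - 6 * z e + 1) * x e ^ 4 / 24) = h_form n z t"
      unfolding h_form_def w_def x_def by (simp add: sum_distrib_left)
    finally show ?thesis unfolding Dx .
  qed
  have "R = (\<Prod>e\<in>?P. bern (z e) (x e)) * exp (\<Sum>e\<in>?P. g e)"
    unfolding R_def \<rho>_def by (simp add: prod.distrib exp_sum)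
  also have "\<dots> = char_prod n D z t * exp (of_real (q_form n z t) - \<i> * of_real (f_form n z t) - of_real (h_form n z t))"
    unfolding sg char_prod_def x_def cis_conv_exp by (simp add: exp_add[symmetric] exp_diff[symmetric] mult.assoc algebra_simps)
  finally have "R * exp (- (of_real (q_form n z t) - \<i> * of_real (f_form n z t) - of_real (h_form n z t))) = char_prod n D z t"
    by (simp add: mult.assoc exp_add[symmetric])
  moreover have "exp (- (of_real (q_form n z t) - \<i> * of_real (f_form n z t) - of_real (h_form n z t)))
      = of_real (exp (- q_form n z t)) * (cis (f_form n z t) * of_real (exp (h_form n z t)))"
    unfolding cis_conv_exp exp_of_real[symmetric] exp_add[symmetric] by (simp add: algebra_simps)
  ultimately have "char_prod n D z t = exp (- q_form n z t) *\<^sub>R (R * cis (f_form n z t) * exp (h_form n z t))"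
    by (simp add: scaleR_conv_of_real mult_ac)
  then show ?thesis using R1 by (rule that)
qed

end

section \<open>From the box to the Gaussian mean\<close>

lemma abs_exp_minus_one_le: "\<bar>exp x - 1\<bar> \<le> exp \<bar>x\<bar> - (1::real)"
proof (cases "x \<ge> 0")
  case False
  have "exp x \<le> 1" "2 \<le> exp x + exp (- x)" using False cosh_real_ge_1[of x] by (auto simp: cosh_def)
  then show ?thesis using False by simp
qed simp

lemma abs_exp_diff_le:
  assumes "\<bar>x - y\<bar> \<le> d" shows "\<bar>exp x - exp y\<bar> \<le> exp y * (exp d - (1::real))"
proof -
  have "\<bar>exp x - exp y\<bar> = exp y * \<bar>exp (x - y) - 1\<bar>"
    by (simp add: exp_diff abs_mult[symmetric, of "exp y", simplified] right_diff_distrib)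
  also have "\<dots> \<le> exp y * (exp d - 1)"
    using assms order_trans[OF abs_exp_minus_one_le[of "x - y"]] by (intro mult_left_mono) auto
  finally show ?thesis .
qed

context large_graph_weights
begin

lemma quartic_measurable: "fr.quartic bcoef \<rho> \<in> borel_measurable G"
  unfolding fr.quartic_def [abs_def] using subexp_measurable[OF fr.subexp_X] by measurable

lemma quartic_le: "\<bar>fr.quartic bcoef \<rho> y\<bar> \<le> (real n)\<^sup>2 * \<rho> ^ 4"
proof -
  have s1: "sin x ^ 4 \<le> 1" for x :: real using power_le_one[of "\<bar>sin x\<bar>" 4] by simp
  have "\<bar>fr.quartic bcoef \<rho> y\<bar> \<le> (\<Sum>e\<in>vertex_pairs n. \<rho> ^ 4)"
    unfolding fr.quartic_def
  proof (rule order_trans[OF sum_abs sum_mono])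
    fix e assume e: "e \<in> vertex_pairs n"
    have "\<bar>bcoef e\<bar> * (\<rho> ^ 4 * sin (lin_form {..<n} (edge_vec e) y / \<rho>) ^ 4) \<le> 1 * (\<rho> ^ 4 * 1)"
      using bcoef_le[OF e] s1 by (intro mult_mono mult_left_mono) auto
    then show "\<bar>bcoef e * (\<rho> ^ 4 * sin (lin_form {..<n} (edge_vec e) y / \<rho>) ^ 4)\<bar> \<le> \<rho> ^ 4"
      by (simp add: abs_mult power_abs)
  qed
  also have "\<dots> \<le> (real n)\<^sup>2 * \<rho> ^ 4" using card_vertex_pairs[of n] by (simp add: mult_right_mono)
  finally show ?thesis .
qed

text \<open>Bounds the change of the mean of h caused by the sine in \<open>quartic\<close>.\<close>

definition quartic_defect :: "real \<Rightarrow> real" where "quartic_defect \<rho> = 2880 * (real n)\<^sup>2 * sd ^ 6 / \<rho>\<^sup>2"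

lemma
  assumes r: "\<rho> > 0" and a: "0 < a" "a \<le> 1 / 10" "16 * (1 / w0) * (real n)\<^sup>2 * \<rho> ^ 6 \<le> a ^ 4"
  defines "\<eta> \<equiv> \<integral>y. fr.quartic bcoef \<rho> y \<partial>G"
  shows exp_quartic_concentration: "(\<integral>y. \<bar>exp (fr.quartic bcoef \<rho> y) - exp \<eta>\<bar> \<partial>G) \<le> 30 * a * exp \<eta>"
    and exp_quartic_integrable: "integrable G (\<lambda>y. exp (fr.quartic bcoef \<rho> y))"
    and exp_quartic_mean: "exp \<eta> \<le> exp (1536 / w0\<^sup>2 + quartic_defect \<rho>)"
proof -
  interpret P: prob_space G by (rule prob_space_std_gauss)
  show "(\<integral>y. \<bar>exp (fr.quartic bcoef \<rho> y) - exp \<eta>\<bar> \<partial>G) \<le> 30 * a * exp \<eta>"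
    unfolding \<eta>_def by (rule fr.quartic_concentration[OF bcoef_le r a])
  show "integrable G (\<lambda>y. exp (fr.quartic bcoef \<rho> y))"
    using quartic_measurable quartic_le
    by (intro P.integrable_const_bound[where B = "exp ((real n)\<^sup>2 * \<rho> ^ 4)"] AE_I2) (auto simp: abs_le_iff)
  show "exp \<eta> \<le> exp (1536 / w0\<^sup>2 + quartic_defect \<rho>)"
    using nu_bound nu_approx[OF r] unfolding \<eta>_def quartic_defect_def by simp
qed

lemma cis_cubic_mean:
  assumes v: "v > 0" "t > 0" "10 ^ 11 * (1 / w0) ^ 3 * (t * (real n)\<^sup>2 * sd ^ 4 + ((real n)\<^sup>2)\<^sup>2 * sd ^ 12 / t ^ 3) \<le> v\<^sup>2"
  shows "cmod ((\<integral>y. cis (cub y) \<partial>G) - of_real (exp (- mu n z / 2))) \<le> 2 * v"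
proof -
  interpret P: prob_space G by (rule prob_space_std_gauss)
  have mc [measurable]: "cub \<in> borel_measurable G"
    using subexp_measurable[OF fr.subexp_cubic[OF acoef_le]] by simp
  have V: "(\<integral>y. (fr.Gam acoef y)\<^sup>2 \<partial>G) - (fr.cubic_var acoef)\<^sup>2 \<le> v\<^sup>2"
    using fr.Gam_variance[of acoef, OF acoef_le v(2)] v(3) by simp
  have c: "\<bar>(\<integral>y. cos (cub y) \<partial>G) - exp (- mu n z / 2)\<bar> \<le> v"
    using fr.cubic_char_fun[of acoef, OF acoef_le v(1) V, of 0] unfolding mu_eq by simp
  \<comment> \<open>The phase - \<pi> / 2 turns the cosine into the sine, and its main term vanishes
    with cos (\<pi> / 2).\<close>
  have s: "\<bar>(\<integral>y. sin (cub y) \<partial>G)\<bar> \<le> v"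
    using fr.cubic_char_fun[of acoef, OF acoef_le v(1) V, of "- (pi / 2)"] by (simp add: cos_diff)
  have i: "integrable G (\<lambda>y. cis (cub y))"
    by (intro P.integrable_const_bound[where B = 1] AE_I2) (auto simp: cis_conv_exp)
  have "Re (\<integral>y. cis (cub y) \<partial>G) = (\<integral>y. cos (cub y) \<partial>G)" "Im (\<integral>y. cis (cub y) \<partial>G) = (\<integral>y. sin (cub y) \<partial>G)"
    by (simp_all only: integral_Re[OF i, symmetric] integral_Im[OF i, symmetric] cis.sel)
  then show ?thesis
    using cmod_le[of "(\<integral>y. cis (cub y) \<partial>G) - of_real (exp (- mu n z / 2))"] c s by simp
qed

text \<open>f and h are not independent. So exp h is first replaced by the constant exp \<eta> in
  mean, which costs nothing more against the unimodular factor; then the mean of exp (\<i> f) is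
  inserted, and finally \<eta> is replaced by \<nu>.\<close>

lemma cis_exp_mean:
  assumes r: "\<rho> > 0" and a: "0 < a" "a \<le> 1 / 10" "16 * (1 / w0) * (real n)\<^sup>2 * \<rho> ^ 6 \<le> a ^ 4"
    and v: "v > 0" "t > 0" "10 ^ 11 * (1 / w0) ^ 3 * (t * (real n)\<^sup>2 * sd ^ 4 + ((real n)\<^sup>2)\<^sup>2 * sd ^ 12 / t ^ 3) \<le> v\<^sup>2"
  defines "\<eta> \<equiv> \<integral>y. fr.quartic bcoef \<rho> y \<partial>G"
  shows "cmod ((\<integral>y. cis (cub y) * of_real (exp (fr.quartic bcoef \<rho> y)) \<partial>G) - of_real (exp (nu n z - mu n z / 2)))
    \<le> (30 * a + 2 * v) * exp \<eta> + exp (1536 / w0\<^sup>2) * (exp (quartic_defect \<rho>) - 1)"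
proof -
  interpret P: prob_space G by (rule prob_space_std_gauss)
  let ?h = "\<lambda>y. exp (fr.quartic bcoef \<rho> y)"
  have mc [measurable]: "cub \<in> borel_measurable G"
    using subexp_measurable[OF fr.subexp_cubic[OF acoef_le]] by simp
  note [measurable] = quartic_measurable[of \<rho>]
  note ih = exp_quartic_integrable[OF r a]
  have i1: "integrable G (\<lambda>y. cis (cub y))"
    by (intro P.integrable_const_bound[where B = 1] AE_I2) (auto simp: cis_conv_exp)
  have i2: "integrable G (\<lambda>y. cis (cub y) * of_real (?h y))"
    by (rule Bochner_Integration.integrable_bound[OF ih]) (auto simp: norm_mult cis_conv_exp intro!: AE_I2)
  have ia: "integrable G (\<lambda>y. ?h y - exp \<eta>)" using ih by simp
  define A where "A = (\<integral>y. cis (cub y) * of_real (?h y) \<partial>G)"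
  define B where "B = (\<integral>y. cis (cub y) \<partial>G)"
  have "A - exp \<eta> * B = (\<integral>y. cis (cub y) * of_real (?h y) - exp \<eta> * cis (cub y) \<partial>G)"
    unfolding A_def B_def by (subst Bochner_Integration.integral_diff[OF i2 integrable_mult_right[OF i1]]) simp
  also have "\<dots> = (\<integral>y. cis (cub y) * of_real (?h y - exp \<eta>) \<partial>G)"
    by (intro Bochner_Integration.integral_cong refl) (simp add: algebra_simps)
  also have "cmod \<dots> \<le> (\<integral>y. \<bar>?h y - exp \<eta>\<bar> \<partial>G)"
    by (rule order_trans[OF integral_norm_bound]) (simp add: norm_mult flip: of_real_diff)
  also have "\<dots> \<le> 30 * a * exp \<eta>" unfolding \<eta>_def by (rule exp_quartic_concentration[OF r a])
  finally have 1: "cmod (A - exp \<eta> * B) \<le> 30 * a * exp \<eta>" .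
  have "cmod (exp \<eta> * B - exp \<eta> * exp (- mu n z / 2)) = exp \<eta> * cmod (B - of_real (exp (- mu n z / 2)))"
    by (simp add: norm_mult flip: right_diff_distrib)
  also have "\<dots> \<le> exp \<eta> * (2 * v)" unfolding B_def by (intro mult_left_mono cis_cubic_mean[OF v]) auto
  finally have 2: "cmod (exp \<eta> * B - exp \<eta> * exp (- mu n z / 2)) \<le> exp \<eta> * (2 * v)" .
  have "cmod (of_real (exp \<eta> * exp (- mu n z / 2)) - of_real (exp (nu n z - mu n z / 2))) = \<bar>exp \<eta> - exp (nu n z)\<bar> * exp (- mu n z / 2)"
    unfolding of_real_diff[symmetric] norm_of_real
    by (simp add: exp_diff exp_minus abs_mult flip: left_diff_distrib divide_inverse diff_divide_distrib)
  also have "\<dots> \<le> (exp (1536 / w0\<^sup>2) * (exp (quartic_defect \<rho>) - 1)) * 1"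
  proof (intro mult_mono)
    have d0: "0 \<le> quartic_defect \<rho>" unfolding quartic_defect_def using sd_pos by simp
    have "\<bar>exp \<eta> - exp (nu n z)\<bar> \<le> exp (nu n z) * (exp (quartic_defect \<rho>) - 1)"
      using nu_approx[OF r] unfolding \<eta>_def quartic_defect_def by (intro abs_exp_diff_le) (simp add: abs_minus_commute)
    also have "\<dots> \<le> exp (1536 / w0\<^sup>2) * (exp (quartic_defect \<rho>) - 1)"
      using nu_bound d0 by (intro mult_right_mono) auto
    finally show "\<bar>exp \<eta> - exp (nu n z)\<bar> \<le> exp (1536 / w0\<^sup>2) * (exp (quartic_defect \<rho>) - 1)" .
    show "0 \<le> exp (1536 / w0\<^sup>2) * (exp (quartic_defect \<rho>) - 1)" using d0 by simp
  qed (use mu_bounds in auto)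
  finally have 3: "cmod (of_real (exp \<eta> * exp (- mu n z / 2)) - of_real (exp (nu n z - mu n z / 2)))
      \<le> exp (1536 / w0\<^sup>2) * (exp (quartic_defect \<rho>) - 1)" by simp
  have "cmod (A - of_real (exp (nu n z - mu n z / 2))) \<le> 30 * a * exp \<eta> + exp \<eta> * (2 * v) + exp (1536 / w0\<^sup>2) * (exp (quartic_defect \<rho>) - 1)"
    using norm_triangle_le[OF add_mono[OF norm_triangle_le[OF add_mono[OF 1 2]] 3]] by simp
  then show ?thesis unfolding A_def by (simp add: algebra_simps)
qed

text \<open>At most n^2 edges with edge sums up to 2 r: the first term is the fifth order remainder,
  the second the error of passing to the sine form of h.\<close>

definition box_error :: "real \<Rightarrow> real \<Rightarrow> real" where
  "box_error r \<rho> = (real n)\<^sup>2 * (3000 * (2 * r) ^ 5 + (2 * r) ^ 6 / \<rho>\<^sup>2)"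

lemma char_prod_box_approx:
  assumes y: "M y \<in> box r" and r: "0 \<le> r" "2 * r \<le> 1" and \<rho>: "\<rho> > 0"
  shows "cmod (exp (q_form n z (M y)) *\<^sub>R char_prod n D z (M y) - cis (cub y) * of_real (exp (fr.quartic bcoef \<rho> y)))
    \<le> (exp (box_error r \<rho>) - 1) * exp (fr.quartic bcoef \<rho> y)"
proof -
  obtain R where R: "char_prod n D z (M y) = exp (- q_form n z (M y)) *\<^sub>R (R * cis (f_form n z (M y)) * exp (h_form n z (M y)))"
    "cmod (R - 1) \<le> exp ((real n)\<^sup>2 * (3000 * (2 * r) ^ 5)) - 1"
    by (rule char_prod_box[OF y r])
  let ?h = "fr.quartic bcoef \<rho> y"
  define x where "x = quart y - ?h"
  define E1 where "E1 = (real n)\<^sup>2 * (3000 * (2 * r) ^ 5)"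
  define E2 where "E2 = (real n)\<^sup>2 * (2 * r) ^ 6 / \<rho>\<^sup>2"
  have "\<bar>x\<bar> \<le> (\<Sum>e\<in>vertex_pairs n. lin_form {..<n} (edge_vec e) y ^ 6) / \<rho>\<^sup>2"
    unfolding x_def quart_def by (rule fr.quartic_approx[OF bcoef_le \<rho>])
  also have "\<dots> \<le> E2"
    unfolding E2_def
  proof (intro divide_right_mono)
    have "lin_form {..<n} (edge_vec e) y ^ 6 \<le> (2 * r) ^ 6" if e: "e \<in> vertex_pairs n" for e
      using power_mono[OF box_edge_bound[OF y e] abs_ge_zero, of 6] by (simp add: lin_form_edge_vec[OF e])
    then have "(\<Sum>e\<in>vertex_pairs n. lin_form {..<n} (edge_vec e) y ^ 6) \<le> real (card (vertex_pairs n)) * (2 * r) ^ 6"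
      by (rule sum_bounded_above)
    also have "\<dots> \<le> (real n)\<^sup>2 * (2 * r) ^ 6" using r by (intro mult_right_mono card_vertex_pairs) auto
    finally show "(\<Sum>e\<in>vertex_pairs n. lin_form {..<n} (edge_vec e) y ^ 6) \<le> (real n)\<^sup>2 * (2 * r) ^ 6" .
  qed auto
  finally have x: "\<bar>x\<bar> \<le> E2" .
  have "exp (q_form n z (M y)) *\<^sub>R char_prod n D z (M y) = R * cis (cub y) * of_real (exp (quart y))"
    unfolding R(1) by (simp add: f_form_M h_form_M exp_minus exp_of_real)
  moreover have "exp (quart y) = exp x * exp ?h" unfolding x_def by (simp add: exp_diff)
  ultimately have "exp (q_form n z (M y)) *\<^sub>R char_prod n D z (M y) - cis (cub y) * of_real (exp ?h)
      = cis (cub y) * of_real (exp ?h) * ((R - 1) * of_real (exp x) + of_real (exp x - 1))"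
    by (simp add: algebra_simps)
  then have "cmod (exp (q_form n z (M y)) *\<^sub>R char_prod n D z (M y) - cis (cub y) * of_real (exp ?h))
      = exp ?h * cmod ((R - 1) * of_real (exp x) + of_real (exp x - 1))"
    by (simp add: norm_mult)
  also have "\<dots> \<le> exp ?h * ((exp E1 - 1) * exp E2 + (exp E2 - 1))"
  proof (intro mult_left_mono norm_triangle_le add_mono)
    show "cmod ((R - 1) * of_real (exp x)) \<le> (exp E1 - 1) * exp E2"
      unfolding norm_mult norm_of_real using R(2) x unfolding E1_def[symmetric] by (intro mult_mono) (use r in \<open>auto simp: E1_def\<close>)
    show "cmod (of_real (exp x - 1)) \<le> exp E2 - 1"
      unfolding norm_of_real using abs_exp_minus_one_le[of x] x by (smt (verit) exp_le_cancel_iff)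
  qed auto
  also have "(exp E1 - 1) * exp E2 + (exp E2 - 1) = exp (box_error r \<rho>) - 1"
  proof -
    have "box_error r \<rho> = E1 + E2" unfolding box_error_def E1_def E2_def by (simp add: algebra_simps)
    then show ?thesis by (simp add: exp_add algebra_simps)
  qed
  finally show ?thesis by (simp add: mult.commute)
qed

text \<open>Collects the box expansion, the concentration of exp h (used twice, hence 60), the
  probability of leaving the box, the characteristic function of f, and the difference between
  \<eta> and \<nu>.\<close>

definition window_error :: "real \<Rightarrow> real \<Rightarrow> real \<Rightarrow> real \<Rightarrow> real" where
  "window_error r \<rho> a v = ((exp (box_error r \<rho>) - 1) * (1 + 30 * a) + 60 * a + 4 * real n * exp (- r / sd) + 2 * v)
      * exp (1536 / w0\<^sup>2 + quartic_defect \<rho>) + exp (1536 / w0\<^sup>2) * (exp (quartic_defect \<rho>) - 1)"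

lemma box_integral:
  assumes r: "0 < r" "2 * r \<le> 1" and \<rho>: "\<rho> > 0"
    and a: "0 < a" "a \<le> 1 / 10" "16 * (1 / w0) * (real n)\<^sup>2 * \<rho> ^ 6 \<le> a ^ 4"
    and v: "v > 0" "t > 0" "10 ^ 11 * (1 / w0) ^ 3 * (t * (real n)\<^sup>2 * sd ^ 4 + ((real n)\<^sup>2)\<^sup>2 * sd ^ 12 / t ^ 3) \<le> v\<^sup>2"
  shows "cmod ((\<integral>t. indicator (box r) t *\<^sub>R char_prod n D z t \<partial>L) - of_real (gauss_const * exp (nu n z - mu n z / 2)))
    \<le> gauss_const * window_error r \<rho> a v"
proof -
  interpret P: prob_space G by (rule prob_space_std_gauss)
  define h where "h y = fr.quartic bcoef \<rho> y" for y
  define \<eta> where "\<eta> = (\<integral>y. h y \<partial>G)"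
  define \<psi> where "\<psi> y = cis (cub y) * of_real (exp (h y))" for y
  define F where "F t = indicator (box r) t *\<^sub>R (exp (q_form n z t) *\<^sub>R char_prod n D z t)" for t
  define S where "S = {y \<in> space G. M y \<notin> box r}"
  define E where "E = exp (box_error r \<rho>) - 1"
  define m where "m = exp (nu n z - mu n z / 2)"
  have E0: "0 \<le> E" unfolding E_def box_error_def using r by simp
  have mF [measurable]: "F \<in> borel_measurable L" unfolding F_def [abs_def] by measurable
  have mS [measurable]: "S \<in> sets G" unfolding S_def by measurable
  have SG: "S \<inter> space G = S" unfolding S_def by auto
  have mc [measurable]: "cub \<in> borel_measurable G" using subexp_measurable[OF fr.subexp_cubic[OF acoef_le]] by simp
  have mh [measurable]: "h \<in> borel_measurable G" unfolding h_def by (rule quartic_measurable)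
  note ih = exp_quartic_integrable[OF \<rho> a, folded h_def]
  note conc = exp_quartic_concentration[OF \<rho> a, folded h_def, folded \<eta>_def]
  have iS: "integrable G (\<lambda>y. indicator S y :: real)" by (rule P.integrable_const_bound[where B = 1]) (auto simp: indicator_def)
  have iabs: "integrable G (\<lambda>y. \<bar>exp (h y) - exp \<eta>\<bar>)" using ih by simp
  have i\<psi>: "integrable G \<psi>"
    by (rule Bochner_Integration.integrable_bound[OF ih]) (auto simp: \<psi>_def [abs_def] norm_mult cis_conv_exp intro!: AE_I2)
  \<comment> \<open>Inside the box the error is E exp h; outside, F vanishes and the error is exp h
    itself. Splitting exp h into exp \<eta> and the deviation from it bounds both cases at
    once.\<close>
  define b where "b y = E * exp \<eta> + (E + 1) * \<bar>exp (h y) - exp \<eta>\<bar> + exp \<eta> * indicator S y" for y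
  have ib: "integrable G b" unfolding b_def [abs_def]
    by (intro Bochner_Integration.integrable_add integrable_mult_right iabs iS) auto
  have pt: "cmod (F (M y) - \<psi> y) \<le> b y" if y: "y \<in> space G" for y
  proof (cases "M y \<in> box r")
    case True
    have "cmod (F (M y) - \<psi> y) \<le> E * exp (h y)"
      using char_prod_box_approx[OF True _ r(2) \<rho>] r True unfolding F_def \<psi>_def E_def h_def by simp
    also have "\<dots> \<le> E * (exp \<eta> + \<bar>exp (h y) - exp \<eta>\<bar>)" using E0 by (intro mult_left_mono) auto
    also have "\<dots> \<le> b y" unfolding b_def by (simp add: algebra_simps)
    finally show ?thesis .
  next
    case False
    then have "cmod (F (M y) - \<psi> y) = exp (h y)" "y \<in> S" using y unfolding F_def \<psi>_def S_def by (auto simp: norm_mult)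
    moreover have "0 \<le> E * \<bar>exp (h y) - exp \<eta>\<bar>" "0 \<le> E * exp \<eta>" using E0 by auto
    ultimately show ?thesis unfolding b_def by (simp add: algebra_simps)
  qed
  have iF: "integrable G (\<lambda>y. F (M y))"
  proof -
    have [measurable]: "\<psi> \<in> borel_measurable G" using i\<psi> by auto
    have "integrable G (\<lambda>y. F (M y) - \<psi> y)"
      by (rule Bochner_Integration.integrable_bound[OF ib]) (use pt in \<open>auto intro!: AE_I2 order_trans[OF _ abs_ge_self]\<close>)
    from Bochner_Integration.integrable_add[OF this i\<psi>] show ?thesis by simp
  qed
  have "cmod ((\<integral>y. F (M y) \<partial>G) - (\<integral>y. \<psi> y \<partial>G)) = cmod (\<integral>y. F (M y) - \<psi> y \<partial>G)"
    by (simp add: Bochner_Integration.integral_diff[OF iF i\<psi>])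
  also have "\<dots> \<le> (\<integral>y. b y \<partial>G)"
    by (rule order_trans[OF integral_norm_bound
          integral_mono[OF integrable_norm[OF Bochner_Integration.integrable_diff[OF iF i\<psi>]] ib pt]])
  also have "(\<integral>y. b y \<partial>G) = E * exp \<eta> + (E + 1) * (\<integral>y. \<bar>exp (h y) - exp \<eta>\<bar> \<partial>G) + exp \<eta> * measure G S"
    unfolding b_def using iabs iS SG by (simp add: P.prob_space)
  also have "\<dots> \<le> E * exp \<eta> + (E + 1) * (30 * a * exp \<eta>) + exp \<eta> * (real n * (4 * exp (- r / sd)))"
    using E0 conc box_complement[OF r(1)] unfolding S_def by (intro add_mono mult_left_mono) auto
  finally have 1: "cmod ((\<integral>y. F (M y) \<partial>G) - (\<integral>y. \<psi> y \<partial>G))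
      \<le> E * exp \<eta> + (E + 1) * (30 * a * exp \<eta>) + exp \<eta> * (real n * (4 * exp (- r / sd)))" .
  have 2: "cmod ((\<integral>y. \<psi> y \<partial>G) - of_real m) \<le> (30 * a + 2 * v) * exp \<eta> + exp (1536 / w0\<^sup>2) * (exp (quartic_defect \<rho>) - 1)"
    using cis_exp_mean[OF \<rho> a v] unfolding \<psi>_def m_def \<eta>_def h_def .
  have "cmod ((\<integral>y. F (M y) \<partial>G) - of_real m)
      \<le> (E * (1 + 30 * a) + 60 * a + 4 * real n * exp (- r / sd) + 2 * v) * exp \<eta> + exp (1536 / w0\<^sup>2) * (exp (quartic_defect \<rho>) - 1)"
    using norm_triangle_le[OF add_mono[OF 1 2]] by (simp add: algebra_simps)
  also have "\<dots> \<le> window_error r \<rho> a v"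
    unfolding window_error_def E_def[symmetric] using exp_quartic_mean[OF \<rho> a, folded h_def, folded \<eta>_def] E0 a v
    by (intro add_right_mono mult_left_mono add_nonneg_nonneg mult_nonneg_nonneg) auto
  finally have 3: "cmod ((\<integral>y. F (M y) \<partial>G) - of_real m) \<le> window_error r \<rho> a v" .
  have "(\<integral>t. indicator (box r) t *\<^sub>R char_prod n D z t \<partial>L) = (\<integral>t. exp (- q_form n z t) *\<^sub>R F t \<partial>L)"
    by (intro Bochner_Integration.integral_cong refl) (simp add: F_def exp_minus)
  also have "\<dots> = gauss_const *\<^sub>R (\<integral>y. F (M y) \<partial>G)" by (rule chol_integral[OF mF])
  finally have "(\<integral>t. indicator (box r) t *\<^sub>R char_prod n D z t \<partial>L) - of_real (gauss_const * m)
      = of_real gauss_const * ((\<integral>y. F (M y) \<partial>G) - of_real m)"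
    by (simp add: scaleR_conv_of_real right_diff_distrib)
  then show ?thesis using 3 gauss_const_pos unfolding m_def by (simp add: norm_mult mult_left_mono)
qed

text \<open>W is either of the two domains in \<open>count_integral\<close>. Both contain the box,
  so the same box integral and the same tail bound serve for both.\<close>

lemma window_integral:
  assumes W: "W \<in> sets L" "box r \<subseteq> W" "W \<subseteq> {t \<in> cube. 0 \<le> (\<Sum>j<n. cos (t j))}"
    and tail: "(\<integral>\<^sup>+t. ennreal (damp t) * indicator ({t \<in> cube. 0 \<le> (\<Sum>j<n. cos (t j))} - box r) t \<partial>L) \<le> ennreal (T * gauss_const)"
    and T: "0 \<le> T"
    and b: "cmod ((\<integral>t. indicator (box r) t *\<^sub>R char_prod n D z t \<partial>L) - of_real (gauss_const * m)) \<le> gauss_const * e"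
  shows "cmod ((\<integral>t. indicator W t *\<^sub>R char_prod n D z t \<partial>L) - of_real (gauss_const * m)) \<le> gauss_const * (T + e)"
proof -
  let ?f = "char_prod n D z"
  have [measurable]: "W \<in> sets L" by fact
  have T0: "0 \<le> T * gauss_const" using T gauss_const_pos by simp
  have "integrable (torus n) ?f" using torus_char_prod(1)[OF z01] .
  then have "integrable L (\<lambda>t. (\<Prod>k<n. indicator {-pi..pi} (t k)) *\<^sub>R ?f t)"
    using integral_torus(2)[OF char_prod_measurable] by simp
  then have ic: "integrable L (\<lambda>t. indicator cube t *\<^sub>R ?f t)"
    by (rule Bochner_Integration.integrable_cong[OF refl, THEN iffD1, rotated]) (simp add: cube_indicator)
  have i: "integrable L (\<lambda>t. indicator A t *\<^sub>R ?f t)" if "A \<in> sets L" "A \<subseteq> cube" for A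
    using ic that by (intro Bochner_Integration.integrable_bound[OF ic]) (auto simp: indicator_def intro!: AE_I2)
  have WD: "W - box r \<in> sets L" "W \<subseteq> cube" using W by auto
  have "(\<integral>t. indicator W t *\<^sub>R ?f t \<partial>L) = (\<integral>t. indicator (box r) t *\<^sub>R ?f t + indicator (W - box r) t *\<^sub>R ?f t \<partial>L)"
    using W(2) by (intro Bochner_Integration.integral_cong refl) (auto simp: indicator_def)
  also have "\<dots> = (\<integral>t. indicator (box r) t *\<^sub>R ?f t \<partial>L) + (\<integral>t. indicator (W - box r) t *\<^sub>R ?f t \<partial>L)"
    using W WD by (intro Bochner_Integration.integral_add i) auto
  finally have eq: "(\<integral>t. indicator W t *\<^sub>R ?f t \<partial>L) - of_real (gauss_const * m)
    = ((\<integral>t. indicator (box r) t *\<^sub>R ?f t \<partial>L) - of_real (gauss_const * m)) + (\<integral>t. indicator (W - box r) t *\<^sub>R ?f t \<partial>L)" by simp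
  have "ennreal (cmod (\<integral>t. indicator (W - box r) t *\<^sub>R ?f t \<partial>L)) \<le> (\<integral>\<^sup>+t. ennreal (cmod (indicator (W - box r) t *\<^sub>R ?f t)) \<partial>L)"
    using WD by (intro integral_norm_bound_ennreal i) auto
  also have "\<dots> \<le> (\<integral>\<^sup>+t. ennreal (damp t) * indicator ({t \<in> cube. 0 \<le> (\<Sum>j<n. cos (t j))} - box r) t \<partial>L)"
    using W norm_char_prod_le by (intro nn_integral_mono) (auto simp: indicator_def intro!: ennreal_leI)
  also have "\<dots> \<le> ennreal (T * gauss_const)" by (rule tail)
  finally have "cmod (\<integral>t. indicator (W - box r) t *\<^sub>R ?f t \<partial>L) \<le> T * gauss_const" using T0 by simp
  then show ?thesis unfolding eq using b by (intro norm_triangle_le) (simp add: algebra_simps)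
qed

end

section \<open>The determinant\<close>

context graph_weights
begin

text \<open>Inserting the degree equation for D j turns the diagonal entry into the sum of the edge
  variances at j.\<close>

lemma Q_mat_index:
  assumes deg: "\<And>k. k < n \<Longrightarrow> (\<Sum>j\<in>{..<n} - {k}. z {j, k}) = real (D k)"
    and "i < n" "j < n"
  shows "Q_mat n D z $$ (i, j) = hess i j"
proof (cases "i = j")
  case True
  have "real (D j) - (\<Sum>i\<in>{..<n} - {j}. (z {j, i})\<^sup>2) = (\<Sum>i\<in>{..<n} - {j}. z {j, i} - (z {j, i})\<^sup>2)"
    unfolding deg[OF \<open>j < n\<close>, symmetric] by (simp add: sum_subtractf insert_commute)
  also have "\<dots> = (\<Sum>i\<in>{..<n} - {j}. w {j, i})"
    by (intro sum.cong refl) (simp add: w_def power2_eq_square algebra_simps)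
  finally show ?thesis using assms(2,3) True by (simp add: Q_mat_def hess_def)
next
  case False
  then show ?thesis using assms(2,3) by (simp add: Q_mat_def hess_def w_def)
qed

lemma positive_definite_Q_mat:
  assumes deg: "\<And>k. k < n \<Longrightarrow> (\<Sum>j\<in>{..<n} - {k}. z {j, k}) = real (D k)"
  shows "positive_definite (Q_mat n D z)"
proof -
  let ?Q = "Q_mat n D z"
  have c: "?Q \<in> carrier_mat n n" by (simp add: Q_mat_def)
  have "transpose_mat ?Q = ?Q"
    by (rule eq_matI) (use c in \<open>auto simp: Q_mat_index[OF deg] hess_sym\<close>)
  moreover have "0 < scalar_prod v (?Q *\<^sub>v v)" if v: "v \<in> carrier_vec n" "v \<noteq> 0\<^sub>v n" for v
  proof -
    have "scalar_prod v (?Q *\<^sub>v v) = (\<Sum>i<n. v $ i * (\<Sum>j<n. ?Q $$ (i, j) * v $ j))"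
      using c v by (simp add: scalar_prod_def lessThan_atLeast0)
    also have "\<dots> = (\<Sum>i<n. \<Sum>j<n. hess i j * v $ i * v $ j)"
      by (simp add: Q_mat_index[OF deg] sum_distrib_left mult_ac)
    also have "\<dots> = quad_form n hess (\<lambda>i. v $ i)" by (simp add: quad_form_def)
    also have "\<dots> > 0" using v by (intro quad_form_hess_pos) (auto simp: vec_eq_iff)
    finally show ?thesis .
  qed
  ultimately show ?thesis using c by (auto simp: positive_definite_def)
qed

text \<open>Polarisation of \<open>chol_quad\<close>: the unit vectors give the diagonal, the sum of
  two of them the off-diagonal entries.\<close>

lemma chol_orthogonal:
  assumes "k < n" "l < n"
  shows "(\<Sum>i<n. \<Sum>j<n. hess i j * chol i k * chol j l) = (if k = l then 1 else 0)"
proof -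
  define B where "B s t = (\<Sum>i<n. \<Sum>j<n. hess i j * s i * t j)" for s t :: "nat \<Rightarrow> real"
  have col: "lin_map n chol (\<lambda>i. if i = k then 1 else 0) i = chol i k" if "k < n" "i < n" for k i
    using that by (simp add: lin_map_def if_distrib cong: if_cong)
  have unit: "B (\<lambda>i. chol i k) (\<lambda>i. chol i k) = 1" if "k < n" for k
  proof -
    have "(\<Sum>i<n. (if i = k then 1 else 0)\<^sup>2) = (\<Sum>i<n. if i = k then 1 else 0 :: real)" by (intro sum.cong) auto
    then have "quad_form n hess (lin_map n chol (\<lambda>i. if i = k then 1 else 0)) = 1"
      using that unfolding chol_quad by simp
    then show ?thesis
      using quad_form_cong[of n "lin_map n chol (\<lambda>i. if i = k then 1 else 0)" "\<lambda>i. chol i k" hess] col[OF that]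
      by (simp add: B_def quad_form_def)
  qed
  show ?thesis
  proof (cases "k = l")
    case True
    then show ?thesis using unit[OF assms(1)] by (simp add: B_def)
  next
    case False
    let ?y = "\<lambda>i. (if i = k then 1 else 0) + (if i = l then 1 else 0) :: real"
    have "lin_map n chol ?y i = chol i k + chol i l" if "i < n" for i
    proof -
      have "(\<Sum>j<n. chol i j * ?y j) = (\<Sum>j<n. (if j = k then chol i j else 0) + (if j = l then chol i j else 0))"
        by (intro sum.cong) auto
      then show ?thesis using that assms by (simp add: lin_map_def sum.distrib)
    qed
    then have "quad_form n hess (lin_map n chol ?y) = B (\<lambda>i. chol i k + chol i l) (\<lambda>i. chol i k + chol i l)"
      unfolding B_def quad_form_def[symmetric] by (rule quad_form_cong)
    moreover have "(\<Sum>i<n. (?y i)\<^sup>2) = (\<Sum>i<n. (if i = k then 1 else 0) + (if i = l then 1 else 0))"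
      using False by (intro sum.cong) auto
    then have "(\<Sum>i<n. (?y i)\<^sup>2) = 2" using assms by (simp add: sum.distrib)
    moreover have "B (\<lambda>i. chol i k + chol i l) (\<lambda>i. chol i k + chol i l)
        = B (\<lambda>i. chol i k) (\<lambda>i. chol i k) + B (\<lambda>i. chol i k) (\<lambda>i. chol i l)
          + (B (\<lambda>i. chol i l) (\<lambda>i. chol i k) + B (\<lambda>i. chol i l) (\<lambda>i. chol i l))"
      unfolding B_def sum.distrib[symmetric] by (intro sum.cong refl) (simp add: algebra_simps)
    moreover have "B (\<lambda>i. chol i l) (\<lambda>i. chol i k) = B (\<lambda>i. chol i k) (\<lambda>i. chol i l)"
      unfolding B_def by (subst sum.swap) (intro sum.cong refl, subst hess_sym, simp add: mult_ac)
    ultimately show ?thesis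
      using False unit[OF assms(1)] unit[OF assms(2)] chol_quad[of ?y] by (simp add: B_def)
  qed
qed

text \<open>With A the matrix of \<open>chol\<close>, the product of its transpose,
  \<open>Q_mat\<close> and A is the identity, and A is triangular; so the product of its diagonal is
  1 / sqrt (det Q).\<close>

lemma gauss_const_det:
  assumes deg: "\<And>k. k < n \<Longrightarrow> (\<Sum>j\<in>{..<n} - {k}. z {j, k}) = real (D k)"
  shows "gauss_const = (2 * pi) powr (real n / 2) / sqrt (Determinant.det (Q_mat n D z))"
proof -
  let ?Q = "Q_mat n D z"
  define A where "A = Matrix.mat n n (\<lambda>(i, j). chol i j)"
  define p where "p = (\<Prod>j<n. chol j j)"
  have p: "p > 0" unfolding p_def using chol_pos by (intro prod_pos) auto
  have c: "?Q \<in> carrier_mat n n" "A \<in> carrier_mat n n" "transpose_mat A \<in> carrier_mat n n"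
    by (simp_all add: Q_mat_def A_def)
  have "transpose_mat A * (?Q * A) = 1\<^sub>m n"
  proof (rule eq_matI)
    fix k l assume "k < dim_row (1\<^sub>m n)" "l < dim_col (1\<^sub>m n)"
    then have kl: "k < n" "l < n" by simp_all
    have "(transpose_mat A * (?Q * A)) $$ (k, l) = (\<Sum>i<n. chol i k * (\<Sum>j<n. ?Q $$ (i, j) * chol j l))"
      using kl c by (simp add: scalar_prod_def lessThan_atLeast0 A_def)
    also have "\<dots> = (\<Sum>i<n. \<Sum>j<n. hess i j * chol i k * chol j l)"
      by (simp add: Q_mat_index[OF deg] sum_distrib_left mult_ac)
    also have "\<dots> = (1\<^sub>m n :: real mat) $$ (k, l)" using kl by (simp add: chol_orthogonal)
    finally show "(transpose_mat A * (?Q * A)) $$ (k, l) = 1\<^sub>m n $$ (k, l)" .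
  qed (use c in auto)
  then have "Determinant.det (transpose_mat A) * (Determinant.det ?Q * Determinant.det A) = 1"
    using det_mult[OF c(3) mult_carrier_mat[OF c(1,2)]] det_mult[OF c(1,2)] by simp
  moreover have "Determinant.det A = p"
  proof -
    have "Determinant.det A = prod_list (diag_mat A)"
      by (rule det_lower_triangular[OF _ c(2)]) (simp add: A_def chol_lower)
    also have "\<dots> = p" by (simp add: prod_list_diag_prod A_def p_def lessThan_atLeast0)
    finally show ?thesis .
  qed
  ultimately have "Determinant.det ?Q * p\<^sup>2 = 1"
    by (simp add: det_transpose[OF c(2)] power2_eq_square mult_ac)
  then have "Determinant.det ?Q = (1 / p)\<^sup>2" using p by (simp add: power_divide field_simps)
  then have "sqrt (Determinant.det ?Q) = 1 / p" using p by (simp add: real_sqrt_divide)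
  moreover have "sqrt (2 * pi) ^ n = (2 * pi) powr (real n / 2)"
    by (simp add: powr_half_sqrt[symmetric] powr_powr flip: powr_realpow)
  ultimately show ?thesis unfolding gauss_const_def p_def[symmetric] by simp
qed

end

section \<open>Relative error\<close>

context large_graph_weights
begin

lemma box_subset_positive:
  assumes "0 < r" "r \<le> 1" shows "box r \<subseteq> {t \<in> cube. 0 < (\<Sum>j<n. cos (t j))}"
proof
  fix t assume t: "t \<in> box r"
  have small: "\<bar>t j\<bar> \<le> 1" if "j < n" for j using t that assms by (force simp: box_def)
  have "0 < cos (t j)" if "j < n" for j
  proof (rule cos_gt_zero_pi)
    show "- (pi / 2) < t j" "t j < pi / 2" using small[OF that] pi_gt3 by auto
  qed
  then have "0 < (\<Sum>j<n. cos (t j))" using n8 by (intro sum_pos) (auto simp: lessThan_empty_iff)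
  moreover have "t \<in> cube" using t small pi_gt3 by (force simp: box_def cube_def)
  ultimately show "t \<in> {t \<in> cube. 0 < (\<Sum>j<n. cos (t j))}" by simp
qed

text \<open>The error is first bounded relative to the formula, by \<epsilon> / 2. As \<epsilon>
  \<le> 1, the formula is then at most twice the count, which gives \<epsilon> relative to the
  count.\<close>

lemma formula_error:
  assumes even: "even (\<Sum>k<n. D k)"
    and wt: "\<And>E. E \<in> graphs_with_degrees n D \<Longrightarrow> (\<Prod>e\<in>E. z e) * (\<Prod>e\<in>vertex_pairs n - E. 1 - z e) = exp (- entropy_fun n z)"
    and r: "0 < r" "2 * r \<le> 1" and tail: "(\<integral>\<^sup>+t. ennreal (damp t) * indicator ({t \<in> cube. 0 \<le> (\<Sum>j<n. cos (t j))} - box r) t \<partial>L) \<le> ennreal (T * gauss_const)"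
    and T: "0 \<le> T"
    and b: "cmod ((\<integral>t. indicator (box r) t *\<^sub>R char_prod n D z t \<partial>L) - of_real (gauss_const * exp (nu n z - mu n z / 2))) \<le> gauss_const * e"
    and small: "(T + e) * exp (1536 / w0\<^sup>2 + 800 / w0 ^ 3) \<le> \<epsilon> / 2" and \<epsilon>: "\<epsilon> \<le> 1"
  shows "approximates_within \<epsilon> (asymptotic_formula n D z) (real (card (graphs_with_degrees n D)))"
proof -
  define C where "C = real (card (graphs_with_degrees n D))"
  define Fm where "Fm = asymptotic_formula n D z"
  define m where "m = exp (nu n z - mu n z / 2)"
  define h where "h = exp (entropy_fun n z)"
  let ?A = "\<lambda>t. \<Sum>j<n. cos (t j)"
  define I1 where "I1 = (\<integral>t. indicator {t \<in> cube. 0 \<le> ?A t} t *\<^sub>R char_prod n D z t \<partial>L)"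
  define I2 where "I2 = (\<integral>t. indicator {t \<in> cube. 0 < ?A t} t *\<^sub>R char_prod n D z t \<partial>L)"
  have pos: "box r \<subseteq> {t \<in> cube. 0 < ?A t}" using r by (intro box_subset_positive) auto
  have [measurable]: "?A \<in> borel_measurable L" by measurable
  have 1: "cmod (I1 - of_real (gauss_const * m)) \<le> gauss_const * (T + e)"
    unfolding I1_def m_def by (rule window_integral[OF _ _ _ tail T b]) (use pos in \<open>auto intro!: cube_Collect_sets\<close>)
  have 2: "cmod (I2 - of_real (gauss_const * m)) \<le> gauss_const * (T + e)"
    unfolding I2_def m_def by (rule window_integral[OF _ pos _ tail T b]) (auto intro!: cube_Collect_sets)
  have "(\<Sum>E\<in>graphs_with_degrees n D. (\<Prod>e\<in>E. z e) * (\<Prod>e\<in>vertex_pairs n - E. 1 - z e)) = C / h"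
    by (simp add: wt C_def h_def exp_minus divide_inverse)
  then have "of_real ((2 * pi) ^ n * (C / h)) = I1 + I2"
    using count_integral[OF even] unfolding I1_def I2_def by simp
  then have "cmod (of_real ((2 * pi) ^ n * (C / h) - 2 * (gauss_const * m)))
      = cmod ((I1 - of_real (gauss_const * m)) + (I2 - of_real (gauss_const * m)))"
    by (simp add: algebra_simps)
  also have "\<dots> \<le> 2 * (gauss_const * (T + e))" by (rule norm_triangle_le) (use 1 2 in linarith)
  finally have 3: "\<bar>(2 * pi) ^ n * (C / h) - 2 * (gauss_const * m)\<bar> \<le> 2 * (gauss_const * (T + e))"
    unfolding norm_of_real .
  have Fm: "Fm = h / (2 * pi) ^ n * (2 * (gauss_const * m))"
  proof -
    define p where "p = (2 * pi) powr (real n / 2)"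
    define s where "s = sqrt (Determinant.det (Q_mat n D z))"
    have p: "(2 * pi) ^ n = p * p" "p > 0" unfolding p_def by (simp_all add: powr_add[symmetric] powr_realpow)
    have g: "gauss_const = p / s" unfolding p_def s_def by (rule gauss_const_det[OF deg])
    have "Fm = 2 * h / (p * s) * m"
      unfolding Fm_def asymptotic_formula_def h_def m_def p_def s_def by simp
    also have "\<dots> = h / (p * p) * (2 * (p / s * m))" using p(2) by simp
    finally show ?thesis unfolding p(1) g .
  qed
  have hp: "h > 0" "(2 * pi) ^ n > 0" "m > 0" by (simp_all add: h_def m_def)
  have F0: "Fm > 0" unfolding Fm using hp gauss_const_pos by simp
  have "\<bar>C - Fm\<bar> = h / (2 * pi) ^ n * \<bar>(2 * pi) ^ n * (C / h) - 2 * (gauss_const * m)\<bar>"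
  proof -
    have "C - Fm = h / (2 * pi) ^ n * ((2 * pi) ^ n * (C / h) - 2 * (gauss_const * m))"
      unfolding Fm using hp by (simp add: field_simps)
    then show ?thesis using hp by (simp only: abs_mult) simp
  qed
  also have "\<dots> \<le> h / (2 * pi) ^ n * (2 * (gauss_const * (T + e)))"
    using 3 hp by (intro mult_left_mono) auto
  also have "\<dots> = Fm * ((T + e) / m)" unfolding Fm using hp by simp
  also have "\<dots> \<le> Fm * (\<epsilon> / 2)"
  proof (intro mult_left_mono)
    have "0 \<le> gauss_const * (T + e)" using order_trans[OF norm_ge_zero 1] .
    then have Te: "0 \<le> T + e" using gauss_const_pos by (simp add: zero_le_mult_iff)
    \<comment> \<open>The main term m is bounded below in terms of w0 alone, with 800 = 1600 / 2
      from \<mu> / 2. This makes the additive error T + e a relative one.\<close>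
    have "1 / m = exp (- (nu n z - mu n z / 2))" unfolding m_def exp_minus by (rule inverse_eq_divide[symmetric])
    also have "\<dots> \<le> exp (1536 / w0\<^sup>2 + 800 / w0 ^ 3)" using nu_bound mu_bounds(2) by simp
    finally have "(T + e) * (1 / m) \<le> (T + e) * exp (1536 / w0\<^sup>2 + 800 / w0 ^ 3)" using Te by (rule mult_left_mono)
    then have "(T + e) * (1 / m) \<le> \<epsilon> / 2" using small by (rule order_trans)
    then show "(T + e) / m \<le> \<epsilon> / 2" unfolding times_divide_eq_right mult_1_right .
  qed (use F0 in simp)
  finally have 4: "\<bar>C - Fm\<bar> \<le> Fm * (\<epsilon> / 2)" .
  have "0 \<le> Fm * (\<epsilon> / 2)" using order_trans[OF abs_ge_zero 4] .
  then have e0: "0 \<le> \<epsilon>" using F0 by (simp add: zero_le_mult_iff)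
  have "Fm * (\<epsilon> / 2) \<le> Fm * (1 / 2)" using \<epsilon> F0 by (intro mult_left_mono) auto
  then have "Fm / 2 \<le> C" using 4 by linarith
  then have "Fm * (\<epsilon> / 2) \<le> \<epsilon> * C" using mult_left_mono[of "Fm / 2" C \<epsilon>] e0 by (simp add: mult_ac)
  then have "\<bar>Fm - C\<bar> \<le> \<epsilon> * \<bar>C\<bar>" using 4 F0 \<open>Fm / 2 \<le> C\<close> by (simp add: abs_minus_commute)
  then show ?thesis unfolding approximates_within_def Fm_def C_def .
qed

end

text \<open>The radius of the box is \<open>x powr (- 12/25)\<close>; any exponent slightly above \<open>- 1/2\<close> makes the escape
  probability exponentially small while \<open>x\<^sup>2\<close> times its fifth power still tends to zero.\<close>

lemma
  fixes c B K :: real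
  assumes c: "c > 0"
  shows ev_tail: "\<forall>\<^sub>F x in at_top. (exp (- x) + 3 * x * (pi * sqrt x * exp (K + 1 - c * x * (x powr (-12/25))\<^sup>2 / 32))
      * exp (x * (x powr (-49/100))\<^sup>2)) * B \<le> x powr (-1/20)"
    and ev_escape: "\<forall>\<^sub>F x in at_top. x * (pi * sqrt x * exp (K + 1 + 1 - c * x * (x powr (-49/100))\<^sup>2 / 32)) \<le> 1 / 2"
    and ev_box: "\<forall>\<^sub>F x in at_top. (exp (x\<^sup>2 * (3000 * (2 * x powr (-12/25)) ^ 5 + (2 * x powr (-12/25)) ^ 6 / (x powr (-2/5))\<^sup>2)) - 1)
      * (1 + 30 * x powr (-1/20)) * exp (B + 2880 * x\<^sup>2 * (2 / sqrt (c * x)) ^ 6 / (x powr (-2/5))\<^sup>2) * K \<le> x powr (-1/30)"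
    and ev_mean: "\<forall>\<^sub>F x in at_top. (60 * x powr (-1/20) + 4 * x * exp (- (x powr (-12/25)) / (2 / sqrt (c * x))) + 2 * x powr (-1/20))
      * exp (B + 2880 * x\<^sup>2 * (2 / sqrt (c * x)) ^ 6 / (x powr (-2/5))\<^sup>2) * K \<le> x powr (-1/30)"
    and ev_defect: "\<forall>\<^sub>F x in at_top. exp B * (exp (2880 * x\<^sup>2 * (2 / sqrt (c * x)) ^ 6 / (x powr (-2/5))\<^sup>2) - 1) * K \<le> x powr (-1/30)"
    and ev_variance: "\<forall>\<^sub>F x in at_top. 10 ^ 11 * (1 / c) ^ 3 * (x powr (-1/2) * x\<^sup>2 * (2 / sqrt (c * x)) ^ 4
      + (x\<^sup>2)\<^sup>2 * (2 / sqrt (c * x)) ^ 12 / (x powr (-1/2)) ^ 3) \<le> (x powr (-1/20))\<^sup>2"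
    and ev_quartic: "\<forall>\<^sub>F x in at_top. 16 * (1 / c) * x\<^sup>2 * (x powr (-2/5)) ^ 6 \<le> (x powr (-1/20)) ^ 4"
    and ev_simple: "\<forall>\<^sub>F x :: real in at_top. 8 \<le> x \<and> K + 2 \<le> x \<and> x powr (-49/100) \<le> 1 \<and> 2 * x powr (-12/25) \<le> 1
      \<and> x powr (-1/20) \<le> 1 / 10 \<and> x powr (-1/40) \<le> 1 \<and> x powr (-1/20) + 3 * x powr (-1/30) \<le> x powr (-1/40) / 2"
proof -
  show "\<forall>\<^sub>F x :: real in at_top. 8 \<le> x \<and> K + 2 \<le> x \<and> x powr (-49/100) \<le> 1 \<and> 2 * x powr (-12/25) \<le> 1
      \<and> x powr (-1/20) \<le> 1 / 10 \<and> x powr (-1/40) \<le> 1 \<and> x powr (-1/20) + 3 * x powr (-1/30) \<le> x powr (-1/40) / 2"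
    by (intro eventually_conj; real_asymp)
qed (use c in real_asymp)+

section \<open>Choice of the parameters\<close>

lemma weight_ge:
  fixes \<delta> :: real
  assumes "\<delta> \<le> x" "x \<le> 1 - \<delta>" shows "\<delta> * (1 - \<delta>) \<le> x * (1 - x)"
proof -
  have "0 \<le> (x - \<delta>) * (1 - \<delta> - x)" using assms by (intro mult_nonneg_nonneg) auto
  then show ?thesis by (simp add: algebra_simps)
qed

lemma uniform_approximation:
  fixes \<delta> :: real
  assumes \<delta>: "0 < \<delta>" "\<delta> < 1 / 2"
  obtains n0 :: nat where "1 \<le> n0"
    "\<And>n D z. n0 \<le> n \<Longrightarrow> is_max_entropy_matrix n D z \<Longrightarrow> (\<And>e. e \<in> vertex_pairs n \<Longrightarrow> \<delta> \<le> z e \<and> z e \<le> 1 - \<delta>)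
      \<Longrightarrow> even (\<Sum>k<n. D k)
      \<Longrightarrow> approximates_within (real n powr (-1/40)) (asymptotic_formula n D z) (real (card (graphs_with_degrees n D)))"
proof -
  define c where "c = \<delta> * (1 - \<delta>)"
  define k0 where "k0 = 8 / c * (1 + ln (4 / sqrt c))"
  define B where "B = 1536 / c\<^sup>2"
  define B' where "B' = exp (B + 800 / c ^ 3)"
  have c: "c > 0" unfolding c_def using \<delta> by simp
  define approximation where "approximation n D z \<longleftrightarrow>
    approximates_within (real n powr (-1/40)) (asymptotic_formula n D z) (real (card (graphs_with_degrees n D)))" for n D z
  \<comment> \<open>A real variable x stands for n so that the asymptotic estimates of real
    functions apply; n, D and z are quantified inside, which yields one threshold for all of
    them.\<close>
  have "\<forall>\<^sub>F x in at_top. \<forall>n D z. x = real n \<longrightarrow> is_max_entropy_matrix n D z \<longrightarrow>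
      (\<forall>e\<in>vertex_pairs n. \<delta> \<le> z e \<and> z e \<le> 1 - \<delta>) \<longrightarrow> even (\<Sum>k<n. D k) \<longrightarrow> approximation n D z"
    using ev_tail[OF c, of k0 B'] ev_escape[OF c, of k0] ev_box[OF c, of B B'] ev_mean[OF c, of B B']
      ev_defect[OF c, of B B'] ev_variance[OF c] ev_quartic[OF c] ev_simple[OF c, of k0]
  proof eventually_elim
    case (elim x)
    show ?case
    proof (intro allI impI)
      fix n D z
      assume xn: "x = real n" and max: "is_max_entropy_matrix n D z"
        and zd: "\<forall>e\<in>vertex_pairs n. \<delta> \<le> z e \<and> z e \<le> 1 - \<delta>" and even: "even (\<Sum>k<n. D k)"
      have zb: "\<delta> \<le> z e \<and> z e \<le> 1 - \<delta>" if "e \<in> vertex_pairs n" for e using zd that by blast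
      \<comment> \<open>\<open>t\<close> balances the two terms in the variance of
        \<open>Gam\<close>, both then of order n^(-1/2). \<open>\<rho>\<close> has to lie below
        n^(-1/3) for the concentration of h and above n^(-11/25) for the box error with radius
        \<open>r2\<close>. The escape exponent n r2^2 = n^(1/25) beats the loss n r1^2 = n^(1/50).
        \<open>a\<close> serves also as v; the weaker powers -1/30 and -1/40 absorb the
        constants.\<close>
      define r1 where "r1 = real n powr (-49/100)"
      define r2 where "r2 = real n powr (-12/25)"
      define \<rho> where "\<rho> = real n powr (-2/5)"
      define a where "a = real n powr (-1/20)"
      define t where "t = real n powr (-1/2)"
      define \<epsilon> where "\<epsilon> = real n powr (-1/40)"
      note E = elim[unfolded xn, folded r1_def r2_def \<rho>_def a_def t_def \<epsilon>_def]
      have n8: "8 \<le> n" using E by simp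
      have deg: "(\<Sum>j\<in>{..<n} - {k}. z {j, k}) = real (D k)" if "k < n" for k
        using max that by (simp add: is_max_entropy_matrix_def degree_polytope_def)
      interpret large_graph_weights n z c D
      proof
        show "c \<le> z e * (1 - z e)" if "e \<in> vertex_pairs n" for e
          unfolding c_def using zb[OF that] by (intro weight_ge) auto
        show "0 \<le> z e" "z e \<le> 1" if "e \<in> vertex_pairs n" for e using zb[OF that] \<delta> by auto
      qed (use n8 c deg in auto)
      have pos: "0 < r1" "0 < r2" "0 < \<rho>" "0 < a" "0 < t"
        unfolding r1_def r2_def \<rho>_def a_def t_def using n8 by simp_all
      have K: "K0 = k0" unfolding K0_def k0_def ..
      define T where "T = exp (- real n) + 3 * real n * escape K0 r2 * exp (real n * r1\<^sup>2)"
      have "approximates_within \<epsilon> (asymptotic_formula n D z) (real (card (graphs_with_degrees n D)))"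
      proof (rule formula_error[OF even graph_weight[OF max \<delta>(1) zb]])
        show "(\<integral>\<^sup>+t. ennreal (damp t) * indicator ({t \<in> cube. 0 \<le> (\<Sum>j<n. cos (t j))} - box r2) t \<partial>L) \<le> ennreal (T * gauss_const)"
          unfolding T_def by (rule tail_bound) (use E pos n8 in \<open>auto simp: K escape_def\<close>)
        show "cmod ((\<integral>t. indicator (box r2) t *\<^sub>R char_prod n D z t \<partial>L) - of_real (gauss_const * exp (nu n z - mu n z / 2)))
            \<le> gauss_const * window_error r2 \<rho> a a"
          by (rule box_integral[where t = t]) (use E pos in \<open>auto simp: sd_def\<close>)
        show "0 \<le> T" unfolding T_def using escape_nonneg by simp
        show "(T + window_error r2 \<rho> a a) * exp (1536 / c\<^sup>2 + 800 / c ^ 3) \<le> \<epsilon> / 2"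
        proof -
          let ?e = "exp (box_error r2 \<rho>) - 1" and ?X = "exp (B + quartic_defect \<rho>)"
          have 1: "T * B' \<le> a" using E by (simp add: T_def escape_def K)
          have 2: "?e * (1 + 30 * a) * ?X * B' \<le> real n powr (-1/30)" using E by (simp add: box_error_def quartic_defect_def sd_def)
          have 3: "(60 * a + 4 * real n * exp (- r2 / sd) + 2 * a) * ?X * B' \<le> real n powr (-1/30)" using E by (simp add: quartic_defect_def sd_def)
          have 4: "exp B * (exp (quartic_defect \<rho>) - 1) * B' \<le> real n powr (-1/30)" using E by (simp add: quartic_defect_def sd_def)
          have "(T + window_error r2 \<rho> a a) * B' = T * B' + ?e * (1 + 30 * a) * ?X * B'
              + (60 * a + 4 * real n * exp (- r2 / sd) + 2 * a) * ?X * B' + exp B * (exp (quartic_defect \<rho>) - 1) * B'"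
            unfolding window_error_def B_def[symmetric] by (simp only: distrib_right add.assoc)
          also have "\<dots> \<le> a + 3 * real n powr (-1/30)" using 1 2 3 4 by linarith
          also have "\<dots> \<le> \<epsilon> / 2" using E by simp
          finally show ?thesis unfolding B'_def B_def .
        qed
      qed (use E pos in auto)
      then show "approximation n D z" unfolding approximation_def \<epsilon>_def .
    qed
  qed
  then obtain x0 where x0: "\<And>n D z. x0 \<le> real n \<Longrightarrow> is_max_entropy_matrix n D z \<Longrightarrow>
      (\<forall>e\<in>vertex_pairs n. \<delta> \<le> z e \<and> z e \<le> 1 - \<delta>) \<Longrightarrow> even (\<Sum>k<n. D k) \<Longrightarrow> approximation n D z"
    unfolding eventually_at_top_linorder by blast
  show thesis
  proof (rule that[of "max 1 (nat \<lceil>x0\<rceil>)"])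
    fix n D z
    assume "max 1 (nat \<lceil>x0\<rceil>) \<le> n" "is_max_entropy_matrix n D z"
      "\<And>e. e \<in> vertex_pairs n \<Longrightarrow> \<delta> \<le> z e \<and> z e \<le> 1 - \<delta>" "even (\<Sum>k<n. D k)"
    moreover from this(1) have "x0 \<le> real n" by linarith
    ultimately show "approximates_within (real n powr (-1/40)) (asymptotic_formula n D z) (real (card (graphs_with_degrees n D)))"
      using x0 unfolding approximation_def by blast
  qed auto
qed

text \<open>A single vertex has no edges and hence degree 0; two vertices have one edge, whose
  coordinate would equal a degree of at least 1.\<close>

lemma tame_sequence_length:
  assumes n: "1 \<le> n" and d: "\<And>k. k < n \<Longrightarrow> 0 < D k" and z: "z \<in> degree_polytope n D"
    and lt: "\<And>e. e \<in> vertex_pairs n \<Longrightarrow> z e < 1"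
  shows "3 \<le> n"
proof (rule ccontr)
  assume "\<not> 3 \<le> n"
  then consider "n = 1" | "n = 2" using n by linarith
  then show False
  proof cases
    case 1
    then have "{..<n} - {0} = {}" "0 < n" by auto
    moreover have "real (D 0) = (\<Sum>j\<in>{..<n} - {0}. z {j, 0})" using z \<open>0 < n\<close> by (simp add: degree_polytope_def)
    ultimately have "real (D 0) = 0" by (simp only: sum.empty)
    then show False using d[of 0] 1 by simp
  next
    case 2
    then have "{..<n} - {0} = {1}" "0 < n" by auto
    moreover have "real (D 0) = (\<Sum>j\<in>{..<n} - {0}. z {j, 0})" using z \<open>0 < n\<close> by (simp add: degree_polytope_def)
    ultimately have "z {1, 0} = real (D 0)" by simp
    moreover have "z {1, 0} < 1" using 2 by (intro lt doubleton_in_vertex_pairs) auto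
    ultimately show False using d[of 0] 2 by simp
  qed
qed

theorem theorem1p4:
  fixes \<delta> :: real
  assumes "0 < \<delta>" and "\<delta> < 1/2"
  shows "\<exists>\<gamma>>0.
    (\<forall>n\<ge>1. \<forall>D z. (\<forall>k<n. 0 < D k) \<and> tame \<delta> n D \<and> even (\<Sum>k<n. D k) \<and>
        is_max_entropy_matrix n D z \<longrightarrow>
      positive_definite (Q_mat n D z) \<and>
      (\<forall>\<epsilon>::real. 0 < \<epsilon> \<and> \<epsilon> \<le> 1/2 \<and> (1 / \<epsilon>) powr \<gamma> \<le> real n \<longrightarrow>
        approximates_within \<epsilon> (asymptotic_formula n D z) (real (card (graphs_with_degrees n D))))) \<and>
    (\<forall>\<epsilon>::real. 0 < \<epsilon> \<longrightarrow>
      (\<exists>N. \<forall>n\<ge>N. \<forall>D z. (\<forall>k<n. 0 < D k) \<and> tame \<delta> n D \<and> even (\<Sum>k<n. D k) \<and>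
        is_max_entropy_matrix n D z \<longrightarrow>
        approximates_within \<epsilon> (asymptotic_formula n D z) (real (card (graphs_with_degrees n D)))))"
proof -
  obtain n0 :: nat where n0: "1 \<le> n0" and approx:
    "\<And>n D z. n0 \<le> n \<Longrightarrow> is_max_entropy_matrix n D z \<Longrightarrow> (\<And>e. e \<in> vertex_pairs n \<Longrightarrow> \<delta> \<le> z e \<and> z e \<le> 1 - \<delta>)
      \<Longrightarrow> even (\<Sum>k<n. D k)
      \<Longrightarrow> approximates_within (real n powr (-1/40)) (asymptotic_formula n D z) (real (card (graphs_with_degrees n D)))"
    using uniform_approximation[OF assms] by blast
  have within: "approximates_within \<epsilon> (asymptotic_formula n D z) (real (card (graphs_with_degrees n D)))"
    if "n0 \<le> n" "tame \<delta> n D" "even (\<Sum>k<n. D k)" "is_max_entropy_matrix n D z" "0 < \<epsilon>" "(1 / \<epsilon>) powr 40 \<le> real n"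
    for n D z and \<epsilon> :: real
  proof -
    have "((1 / \<epsilon>) powr 40) powr (1/40) \<le> real n powr (1/40)" using that by (intro powr_mono2) auto
    then have "1 / \<epsilon> \<le> real n powr (1/40)" using that by (simp only: powr_powr) simp
    then have "real n powr (-1/40) \<le> \<epsilon>" using that n0 by (simp add: powr_minus field_simps)
    moreover have "approximates_within (real n powr (-1/40)) (asymptotic_formula n D z) (real (card (graphs_with_degrees n D)))"
      using that by (intro approx) (auto simp: tame_def)
    ultimately show ?thesis unfolding approximates_within_def by (meson order_trans mult_right_mono abs_ge_zero)
  qed
  \<comment> \<open>40 inverts the error n^(-1/40). As 1 / \<epsilon> \<ge> 2, the logarithm forces
    n \<ge> n0.\<close>
  define \<gamma> where "\<gamma> = max 40 (log 2 (real n0))"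
  show ?thesis
  proof (intro exI[of _ \<gamma>] conjI allI impI, goal_cases)
    case 1
    then show ?case by (simp add: \<gamma>_def)
  next
    case (2 n D z)
    have z: "\<delta> \<le> z e \<and> z e \<le> 1 - \<delta>" if "e \<in> vertex_pairs n" for e using 2 that by (simp add: tame_def)
    have zp: "z \<in> degree_polytope n D" using 2 by (simp add: is_max_entropy_matrix_def)
    have n3: "3 \<le> n" by (rule tame_sequence_length[OF _ _ zp]) (use 2 z assms in force)+
    interpret graph_weights n z "\<delta> * (1 - \<delta>)"
    proof
      show "\<delta> * (1 - \<delta>) \<le> z e * (1 - z e)" if "e \<in> vertex_pairs n" for e
        using z[OF that] by (intro weight_ge) auto
      show "0 \<le> z e" "z e \<le> 1" if "e \<in> vertex_pairs n" for e using z[OF that] assms by auto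
    qed (use n3 assms in auto)
    show ?case by (rule positive_definite_Q_mat) (use zp in \<open>simp add: degree_polytope_def\<close>)
  next
    case (3 n D z \<epsilon>)
    have e: "1 \<le> 1 / \<epsilon>" "2 \<le> 1 / \<epsilon>" using 3 by (simp_all add: field_simps)
    have "real n0 = 2 powr (log 2 (real n0))" using n0 by simp
    also have "\<dots> \<le> 2 powr \<gamma>" by (simp add: \<gamma>_def)
    also have "\<dots> \<le> (1 / \<epsilon>) powr \<gamma>" using e by (intro powr_mono2) (auto simp: \<gamma>_def)
    also have "\<dots> \<le> real n" using 3 by simp
    finally have "n0 \<le> n" by simp
    moreover have "(1 / \<epsilon>) powr 40 \<le> (1 / \<epsilon>) powr \<gamma>" using e by (intro powr_mono) (auto simp: \<gamma>_def)
    ultimately show ?case using 3 by (intro within) auto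
  next
    case (4 \<epsilon>)
    \<comment> \<open>\<epsilon> may exceed 1/2 here, so \<open>n0\<close> enters the threshold
      explicitly.\<close>
    have "approximates_within \<epsilon> (asymptotic_formula n D z) (real (card (graphs_with_degrees n D)))"
      if "max n0 (nat \<lceil>(1 / \<epsilon>) powr 40\<rceil>) \<le> n" "tame \<delta> n D" "even (\<Sum>k<n. D k)" "is_max_entropy_matrix n D z" for n D z
      using that 4 by (intro within) linarith+
    then show ?case by blast
  qed
qed

end
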